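(* Let $SU(d)$, $d\ge2$, be endowed with its bi-invariant metric and let $H$ be a discrete subgroup of $SU(d)$. Then any two homotopic closed geodesics $\gamma_0,\gamma_1\in\mathcal{C}^1(\mathbb{S}^1,SU(d)/H)$ that are minimising in their homotopy class are synharmonic.
   Context: $SU(d)/H=\{gH : g\in SU(d)\}$ is endowed with the unique Riemannian structure making the canonical projection $SU(d)\to SU(d)/H$ a Riemannian submersion (here a local isometry). The bi-invariant metric on $SU(d)$ is given on $\mathfrak{su}(d)$ by a positive multiple of $\operatorname{tr}(X^*Y)$. Write $\mathcal{N}=SU(d)/H$ (a compact connected Riemannian manifold, viewed as isometrically embedded in a Euclidean space $\mathbb{R}^\nu$). For a map $\gamma:\mathbb{S}^1\to\mathcal{N}$, $\lambda(\gamma)$ is the infimum of the lengths $\int_{\mathbb{S}^1}|\tilde\gamma'|$ over $\tilde\gamma\in\mathcal{C}^1(\mathbb{S}^1,\mathcal{N})$ (freely) homotopic to $\gamma$. A closed geodesic (with constant speed) is minimising in its homotopy class if its length equals $\lambda(\gamma)$. Synharmony: for $\gamma,\beta\in W^{1/2,2}(\mathbb{S}^1,\mathcal{N})$, $d_{\mathrm{synh}}(\gamma,\beta)$ is the infimum of $\int_{\mathbb{S}^1\times[0,T]}\bigl(\frac{|Du|^2}{2}-\frac{\lambda(\gamma)^2}{8\pi^2}\bigr)$ over $T\in(0,+\infty)$ and $u\in W^{1,2}(\mathbb{S}^1\times[0,T],\mathcal{N})$ with traces $\gamma$ on $\mathbb{S}^1\times\{0\}$ and $\beta$ on $\mathbb{S}^1\times\{T\}$.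 Two maps $\gamma,\beta$ are synharmonic if $d_{\mathrm{synh}}(\gamma,\beta)=0$. *)

theory Defs
  imports "HOL-Analysis.Analysis" "HOL-Algebra.Left_Coset"
begin

section \<open>The group \<open>SU(d)\<close> and its bi-invariant metric\<close>

definition conj_transpose :: "complex^'m^'n \<Rightarrow> complex^'n^'m" where
  "conj_transpose A = map_matrix cnj (transpose A)"

definition SU :: "(complex^'d^'d) monoid" where
  "SU = \<lparr>carrier = {A. conj_transpose A ** A = mat 1 \<and> det A = 1}, mult = (**), one = mat 1\<rparr>"

definition su :: "(complex^'d^'d) set" where
  "su = {X. conj_transpose X = - X \<and> trace X = 0}"

text \<open>For \<open>X, Y \<in> su\<close> the trace below is already real. The left-invariant (hence, the form being
  \<open>Ad\<close>-invariant, bi-invariant) metric determined by it is \<open>\<langle>gX, gY\<rangle>\<^sub>g = su_inner c X Y\<close>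
  on \<open>T\<^sub>g SU(d) = {gX | X. X \<in> su}\<close>.\<close>

definition su_inner :: "real \<Rightarrow> complex^'d^'d \<Rightarrow> complex^'d^'d \<Rightarrow> real" where
  "su_inner c X Y = c * Re (trace (conj_transpose X ** Y))"


section \<open>Isometric embeddings of \<open>SU(d)/H\<close>\<close>

text \<open>\<open>Ck_on k F U\<close>: \<open>F\<close> is of class \<open>C\<^sup>k\<close> on the open set \<open>U\<close>.\<close>

fun Ck_on :: "nat \<Rightarrow> ('a::euclidean_space \<Rightarrow> 'b::real_normed_vector) \<Rightarrow> 'a set \<Rightarrow> bool" where
  "Ck_on 0 F U \<longleftrightarrow> continuous_on U F"
| "Ck_on (Suc k) F U \<longleftrightarrow> F differentiable_on U \<and>
     (\<forall>v. Ck_on k (\<lambda>x. frechet_derivative F (at x) v) U)"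

definition smooth_on :: "('a::euclidean_space \<Rightarrow> 'b::real_normed_vector) \<Rightarrow> 'a set \<Rightarrow> bool" where
  "smooth_on F U \<longleftrightarrow> (\<forall>k. Ck_on k F U)"

text \<open>Let \<open>\<pi> g = gH\<close>. As \<open>H\<close> is discrete, \<open>\<pi>\<close> is a covering and the metric of \<open>SU(d)/H\<close> is the
  one for which \<open>\<pi>\<close> is a local isometry. So \<open>\<iota>\<close> is a smooth isometric immersion of \<open>SU(d)/H\<close> iff
  \<open>\<iota> \<circ> \<pi>\<close> is one of \<open>SU(d)\<close>; and a smooth map on the closed submanifold \<open>SU(d)\<close> of the space of
  matrices is the restriction of a smooth map \<open>F\<close> defined on a neighbourhood. An injective
  immersion of a compact manifold is an embedding.\<close>

definition isometric_embedding ::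
  "real \<Rightarrow> (complex^'d^'d) set \<Rightarrow> ((complex^'d^'d) set \<Rightarrow> 'v::euclidean_space) \<Rightarrow> bool" where
  "isometric_embedding c H \<iota> \<longleftrightarrow>
     inj_on \<iota> (lcosets\<^bsub>SU\<^esub> H) \<and>
     (\<exists>U F. open U \<and> carrier SU \<subseteq> U \<and> smooth_on F U \<and>
        (\<forall>g\<in>carrier SU. F g = \<iota> (g <#\<^bsub>SU\<^esub> H)) \<and>
        (\<forall>g\<in>carrier SU. \<forall>X\<in>su. \<forall>Y\<in>su.
           frechet_derivative F (at g) (g ** X) \<bullet> frechet_derivative F (at g) (g ** Y)
             = su_inner c X Y))"


section \<open>Loops in an embedded manifold\<close>

text \<open>Throughout, \<open>N\<close> is a compact submanifold of a Euclidean space, and \<open>S\<^sup>1\<close> is the unit circle of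
  \<open>complex\<close>, of length \<open>2\<pi>\<close>; derivatives on it are with respect to the angle.\<close>

definition C1_loop :: "'v::euclidean_space set \<Rightarrow> (complex \<Rightarrow> 'v) \<Rightarrow> bool" where
  "C1_loop N \<gamma> \<longleftrightarrow> \<gamma> ` sphere 0 1 \<subseteq> N \<and> (\<lambda>\<theta>. \<gamma> (cis \<theta>)) C1_differentiable_on UNIV"

definition loop_deriv :: "(complex \<Rightarrow> 'v::euclidean_space) \<Rightarrow> real \<Rightarrow> 'v" where
  "loop_deriv \<gamma> \<theta> = vector_derivative (\<lambda>\<theta>. \<gamma> (cis \<theta>)) (at \<theta>)"

definition loop_length :: "(complex \<Rightarrow> 'v::euclidean_space) \<Rightarrow> real" where
  "loop_length \<gamma> = integral {0..2*pi} (\<lambda>\<theta>. norm (loop_deriv \<gamma> \<theta>))"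

abbreviation homotopic_maps ::
  "'v::euclidean_space set \<Rightarrow> (complex \<Rightarrow> 'v) \<Rightarrow> (complex \<Rightarrow> 'v) \<Rightarrow> bool" where
  "homotopic_maps N \<equiv> homotopic_with_canon (\<lambda>_. True) (sphere 0 1) N"

definition min_length :: "'v::euclidean_space set \<Rightarrow> (complex \<Rightarrow> 'v) \<Rightarrow> real" where
  "min_length N \<gamma> = (INF \<gamma>'\<in>{\<gamma>'. C1_loop N \<gamma>' \<and> homotopic_maps N \<gamma> \<gamma>'}. loop_length \<gamma>')"

definition tangent_space :: "'v::euclidean_space set \<Rightarrow> 'v \<Rightarrow> 'v set" where
  "tangent_space N p =
     {v. \<exists>\<sigma>. (\<forall>t::real. \<sigma> t \<in> N) \<and> \<sigma> 0 = p \<and> (\<sigma> has_vector_derivative v) (at 0)}"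

text \<open>The Levi-Civita covariant derivative of \<open>\<gamma>'\<close> along \<open>\<gamma>\<close> is the tangential part of \<open>\<gamma>''\<close>, so the
  geodesic equation says that \<open>\<gamma>''\<close> is normal to \<open>N\<close>. It forces the speed to be constant. Constant
  loops are not excluded.\<close>

definition closed_geodesic :: "'v::euclidean_space set \<Rightarrow> (complex \<Rightarrow> 'v) \<Rightarrow> bool" where
  "closed_geodesic N \<gamma> \<longleftrightarrow> C1_loop N \<gamma> \<and>
     (\<forall>\<theta>. \<exists>a. (loop_deriv \<gamma> has_vector_derivative a) (at \<theta>) \<and>
            (\<forall>v\<in>tangent_space N (\<gamma> (cis \<theta>)). a \<bullet> v = 0))"

definition minimising_geodesic :: "'v::euclidean_space set \<Rightarrow> (complex \<Rightarrow> 'v) \<Rightarrow> bool" where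
  "minimising_geodesic N \<gamma> \<longleftrightarrow> closed_geodesic N \<gamma> \<and> loop_length \<gamma> = min_length N \<gamma>"


section \<open>Sobolev maps on the cylinder \<open>S\<^sup>1 \<times> [0,T]\<close>\<close>

text \<open>Functions on the cylinder are handled in the coordinates \<open>(\<theta>, t)\<close>, over the fundamental domain
  \<open>cyl T\<close>; smooth functions on it are \<open>2\<pi>\<close>-periodic in \<open>\<theta>\<close>.\<close>

abbreviation cyl :: "real \<Rightarrow> (real \<times> real) set" where
  "cyl T \<equiv> {0..2*pi} \<times> {0..T}"

definition L2_on :: "'a::euclidean_space set \<Rightarrow> ('a \<Rightarrow> 'v::euclidean_space) \<Rightarrow> bool" where
  "L2_on D f \<longleftrightarrow> f \<in> borel_measurable (lebesgue_on D) \<and>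
     integrable (lebesgue_on D) (\<lambda>z. (norm (f z))\<^sup>2)"

definition C1_periodic :: "(real \<times> real \<Rightarrow> 'v::euclidean_space) \<Rightarrow> bool" where
  "C1_periodic w \<longleftrightarrow> Ck_on 1 w UNIV \<and> (\<forall>\<theta> t. w (\<theta> + 2*pi, t) = w (\<theta>, t))"

definition cyl_test :: "real \<Rightarrow> (real \<times> real \<Rightarrow> real) \<Rightarrow> bool" where
  "cyl_test T \<phi> \<longleftrightarrow> C1_periodic \<phi> \<and>
     (\<exists>a b. 0 < a \<and> b < T \<and> (\<forall>\<theta> t. t \<notin> {a..b} \<longrightarrow> \<phi> (\<theta>, t) = 0))"

definition weak_deriv ::
  "real \<Rightarrow> real \<times> real \<Rightarrow> (real \<times> real \<Rightarrow> 'v::euclidean_space) \<Rightarrow> (real \<times> real \<Rightarrow> 'v) \<Rightarrow> bool" where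
  "weak_deriv T e f g \<longleftrightarrow> (\<forall>\<phi>. cyl_test T \<phi> \<longrightarrow>
     (LINT z|lebesgue_on (cyl T). frechet_derivative \<phi> (at z) e *\<^sub>R f z)
       = - (LINT z|lebesgue_on (cyl T). \<phi> z *\<^sub>R g z))"

text \<open>\<open>f \<in> W\<^sup>1\<^sup>,\<^sup>2\<close> with weak partial derivatives \<open>A = \<partial>\<^sub>\<theta> f\<close> and \<open>B = \<partial>\<^sub>t f\<close>.\<close>

definition sobolev_cyl ::
  "real \<Rightarrow> (real \<times> real \<Rightarrow> 'v::euclidean_space) \<Rightarrow> (real \<times> real \<Rightarrow> 'v) \<Rightarrow> (real \<times> real \<Rightarrow> 'v) \<Rightarrow> bool"
  where
  "sobolev_cyl T f A B \<longleftrightarrow> L2_on (cyl T) f \<and> L2_on (cyl T) A \<and> L2_on (cyl T) B \<and>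
     weak_deriv T (1,0) f A \<and> weak_deriv T (0,1) f B"

text \<open>The trace operator is the continuous extension to \<open>W\<^sup>1\<^sup>,\<^sup>2\<close> of the restriction of functions that
  are \<open>C\<^sup>1\<close> up to the boundary: \<open>\<gamma>\<close> and \<open>\<beta>\<close> are the traces at \<open>t = 0\<close> and \<open>t = T\<close> if they are the
  \<open>L\<^sup>2\<close> limits of the restrictions of \<open>C\<^sup>1\<close> functions converging to \<open>f\<close> in \<open>W\<^sup>1\<^sup>,\<^sup>2\<close>.\<close>

definition has_traces ::
  "real \<Rightarrow> (real \<times> real \<Rightarrow> 'v::euclidean_space) \<Rightarrow> (real \<times> real \<Rightarrow> 'v) \<Rightarrow> (real \<times> real \<Rightarrow> 'v) \<Rightarrow>
     (complex \<Rightarrow> 'v) \<Rightarrow> (complex \<Rightarrow> 'v) \<Rightarrow> bool" where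
  "has_traces T f A B \<gamma> \<beta> \<longleftrightarrow>
     L2_on {0..2*pi} (\<lambda>\<theta>. \<gamma> (cis \<theta>)) \<and> L2_on {0..2*pi} (\<lambda>\<theta>. \<beta> (cis \<theta>)) \<and>
     (\<exists>w. (\<forall>n::nat. C1_periodic (w n)) \<and>
       (\<lambda>n. LINT z|lebesgue_on (cyl T).
          (norm (w n z - f z))\<^sup>2 + (norm (frechet_derivative (w n) (at z) (1,0) - A z))\<^sup>2
            + (norm (frechet_derivative (w n) (at z) (0,1) - B z))\<^sup>2) \<longlonglongrightarrow> 0 \<and>
       (\<lambda>n. LINT \<theta>|lebesgue_on {0..2*pi}. (norm (w n (\<theta>, 0) - \<gamma> (cis \<theta>)))\<^sup>2) \<longlonglongrightarrow> 0 \<and>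
       (\<lambda>n. LINT \<theta>|lebesgue_on {0..2*pi}. (norm (w n (\<theta>, T) - \<beta> (cis \<theta>)))\<^sup>2) \<longlonglongrightarrow> 0)"


section \<open>Synharmony\<close>

definition synh_competitor ::
  "'v::euclidean_space set \<Rightarrow> (complex \<Rightarrow> 'v) \<Rightarrow> (complex \<Rightarrow> 'v) \<Rightarrow> real \<Rightarrow>
     (complex \<times> real \<Rightarrow> 'v) \<Rightarrow> (real \<times> real \<Rightarrow> 'v) \<Rightarrow> (real \<times> real \<Rightarrow> 'v) \<Rightarrow> bool" where
  "synh_competitor N \<gamma> \<beta> T u A B \<longleftrightarrow> 0 < T \<and>
     (let f = (\<lambda>(\<theta>, t). u (cis \<theta>, t))
      in sobolev_cyl T f A B \<and> (AE z in lebesgue_on (cyl T). f z \<in> N) \<and>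
         has_traces T f A B \<gamma> \<beta>)"

text \<open>The infimum is taken in the extended reals, so it is \<open>\<infinity>\<close> when there is no competitor. In
  particular no membership of \<open>\<gamma>\<close> and \<open>\<beta>\<close> in \<open>W\<^sup>1\<^sup>/\<^sup>2\<^sup>,\<^sup>2\<close> has to be imposed: it is implied by being
  a trace.\<close>

definition d_synh ::
  "'v::euclidean_space set \<Rightarrow> (complex \<Rightarrow> 'v) \<Rightarrow> (complex \<Rightarrow> 'v) \<Rightarrow> ereal" where
  "d_synh N \<gamma> \<beta> = (INF (T, u, A, B) \<in> {(T, u, A, B). synh_competitor N \<gamma> \<beta> T u A B}.
     ereal (LINT z|lebesgue_on (cyl T).
       ((norm (A z))\<^sup>2 + (norm (B z))\<^sup>2) / 2 - (min_length N \<gamma>)\<^sup>2 / (8 * pi\<^sup>2)))"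

definition synharmonic ::
  "'v::euclidean_space set \<Rightarrow> (complex \<Rightarrow> 'v) \<Rightarrow> (complex \<Rightarrow> 'v) \<Rightarrow> bool" where
  "synharmonic N \<gamma> \<beta> \<longleftrightarrow> d_synh N \<gamma> \<beta> = 0"

end

theory Submission
  imports Defs
begin

text \<open>
  \<^bold>\<open>Upper bound.\<close> Minimising closed geodesics lift to \<open>g\<^sub>0 exp (tX)\<close> and \<open>g\<^sub>1 exp (tY)\<close> in \<open>SU(d)\<close>; being
  homotopic, they can be lifted with the same deck transformation \<open>h = exp (2\<pi>X) = exp (2\<pi>Y)\<close>, and
  \<open>X\<close>, \<open>Y\<close> have the same norm. As no logarithm of the same homotopy class is shorter than \<open>X\<close>, the
  eigenvalues of \<open>X / i\<close> spread by at most 1. This forces \<open>Y\<close> to be conjugate to \<open>X\<close> by the end of a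
  one-parameter group centralising \<open>h\<close>, so the two geodesics are joined by a path of closed
  geodesics of the same speed. Running through that path in time \<open>T\<close> costs an excess energy of order \<open>1 / T\<close>.

  \<^bold>\<open>Lower bound.\<close> Every competitor has Dirichlet energy at least \<open>T \<lambda>\<^sup>2 / (4\<pi>)\<close>. It is approximated in
  \<open>W\<^sup>1\<^sup>,\<^sup>2\<close> by \<open>C\<^sup>1\<close> maps which are \<open>L\<^sup>2\<close>-close to \<open>N\<close>. A slice of bounded energy that is \<open>L\<^sup>2\<close>-close to
  \<open>N\<close> is uniformly close to a geodesic polygon in \<open>N\<close>; a chain of good slices, one per short time window,
  shows that this polygon is homotopic to \<open>\<gamma>\<close>, so the slice has angular energy at least about
  \<open>\<lambda>\<^sup>2 / (2\<pi>)\<close>.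
\<close>

section \<open>Matrices\<close>

text \<open>The manifold \<open>N\<close> enters only through the map \<open>F\<close>, the
  projection followed by the embedding, so the geometry is done with matrices: unitary invariance of
  the Frobenius norm makes estimates uniform, and lifting turns each loop into a curve whose ends
  differ by an element of \<open>H\<close>. The spread bound rests on SU(d) being simply connected:
  moving one eigenvalue of X/i up by 1 and another down by 1 multiplies the curve by a
  null-homotopic loop, which keeps the homotopy class and so cannot shorten a minimising geodesic.
  The one-parameter group joining the two logarithms is the principal logarithm of a conjugating
  matrix; being canonical, it inherits the commutation with h, so every intermediate curve closes up
  through the same h. The obstacle in the lower bound is that W^{1,2} does not embed into the
  continuous functions in dimension two: neither a competitor nor its approximations need be
  continuous maps into \<open>N\<close>. The homotopy class is therefore read off on one-dimensional
  slices, where energy controls the supremum norm, and geodesic polygons take the place of a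
  nearest-point projection.\<close>

lemma conj_transpose_nth [simp]: "conj_transpose A $ i $ j = cnj (A $ j $ i)"
  by (simp add: conj_transpose_def map_matrix_def transpose_def)

lemma conj_transpose_mult: "conj_transpose (A ** B) = conj_transpose B ** conj_transpose A"
  by (simp add: vec_eq_iff matrix_matrix_mult_def mult.commute)

lemma conj_transpose_simps [simp]:
  "conj_transpose (conj_transpose A) = A"
  "conj_transpose (mat 1) = mat 1"
  "conj_transpose 0 = 0"
  by (auto simp: vec_eq_iff mat_def)

lemma linear_conj_transpose: "linear conj_transpose"
  by (rule linearI) (auto simp: vec_eq_iff)

lemmas conj_transpose_add = linear_add [OF linear_conj_transpose]
lemmas conj_transpose_scaleR = linear_scale [OF linear_conj_transpose]

lemma continuous_on_conj_transpose [continuous_intros]: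
  fixes f :: "'a::topological_space \<Rightarrow> complex^'m^'n"
  shows "continuous_on S f \<Longrightarrow> continuous_on S (\<lambda>x. conj_transpose (f x))"
  using bounded_linear.continuous_on linear_conj_transpose linear_conv_bounded_linear by blast

lemma scaleR_matrix_mult:
  fixes A :: "complex^'m^'n" and B :: "complex^'p^'m"
  shows "(r *\<^sub>R A) ** B = r *\<^sub>R (A ** B)" "A ** (r *\<^sub>R B) = r *\<^sub>R (A ** B)"
  by (simp_all add: vec_eq_iff matrix_matrix_mult_def scaleR_sum_right)

lemma bounded_bilinear_matrix_mult:
  "bounded_bilinear (\<lambda>(A::complex^'m^'n) (B::complex^'p^'m). A ** B)"
  unfolding bilinear_conv_bounded_bilinear [symmetric] bilinear_def
  by (auto intro!: linearI simp: scaleR_matrix_mult matrix_add_ldistrib vec_eq_iff matrix_matrix_mult_def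
      sum.distrib algebra_simps scaleR_sum_right)

lemmas continuous_on_matrix_mult [continuous_intros] =
  bounded_bilinear.continuous_on [OF bounded_bilinear_matrix_mult]
lemmas has_vector_derivative_matrix_mult [derivative_intros] =
  bounded_bilinear.has_vector_derivative [OF bounded_bilinear_matrix_mult]
lemmas matrix_mult_minus_left = bounded_bilinear.minus_left [OF bounded_bilinear_matrix_mult]
lemmas matrix_mult_minus_right = bounded_bilinear.minus_right [OF bounded_bilinear_matrix_mult]
lemmas matrix_mult_diff_left = bounded_bilinear.diff_left [OF bounded_bilinear_matrix_mult]
lemmas matrix_mult_diff_right = bounded_bilinear.diff_right [OF bounded_bilinear_matrix_mult]

text \<open>Because the Euclidean inner product of matrices is the real trace form,
  \<open>su_inner c\<close> is \<open>c\<close> times it, and ordinary norms measure the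
  bi-invariant metric.\<close>

lemma frobenius_inner:
  fixes A B :: "complex^'d^'d"
  shows "A \<bullet> B = Re (trace (conj_transpose A ** B))"
  by (simp add: trace_def matrix_matrix_mult_def inner_vec_def inner_complex_def,
      subst sum.swap, simp add: mult.commute)

lemma su_inner_eq: "su_inner c X Y = c * (X \<bullet> Y)"
  by (simp add: su_inner_def frobenius_inner)

definition unitary :: "complex^'d^'d \<Rightarrow> bool" where
  "unitary V \<longleftrightarrow> conj_transpose V ** V = mat 1"

lemma unitaryD: "unitary V \<Longrightarrow> conj_transpose V ** V = mat 1" "unitary V \<Longrightarrow> V ** conj_transpose V = mat 1"
  using matrix_left_right_inverse unfolding unitary_def by auto

lemma unitary_cancel:
  assumes "unitary V"
  shows "conj_transpose V ** (V ** A) = A" "V ** (conj_transpose V ** A) = A"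
    "A ** V ** conj_transpose V = A" "A ** conj_transpose V ** V = A"
proof -
  show "conj_transpose V ** (V ** A) = A" "V ** (conj_transpose V ** A) = A"
    by (simp_all add: matrix_mul_assoc unitaryD[OF assms])
  show "A ** V ** conj_transpose V = A" "A ** conj_transpose V ** V = A"
    by (simp_all add: matrix_mul_assoc [symmetric] unitaryD[OF assms])
qed

lemma unitary_mat_1 [simp]: "unitary (mat 1)"
  by (simp add: unitary_def)

lemma unitary_mult: "unitary A \<Longrightarrow> unitary B \<Longrightarrow> unitary (A ** B)"
  by (simp add: unitary_def[of "A ** B"] conj_transpose_mult unitary_cancel unitaryD matrix_mul_assoc [symmetric])

lemma unitary_conj_transpose: "unitary A \<Longrightarrow> unitary (conj_transpose A)"
  by (simp add: unitaryD unitary_def)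

lemma inner_unitary_left:
  assumes "unitary U" shows "(U ** A) \<bullet> (U ** B) = A \<bullet> (B::complex^'d^'d)"
proof -
  have "conj_transpose (U ** A) ** (U ** B) = conj_transpose A ** B"
    by (simp add: conj_transpose_mult unitary_cancel[OF assms] matrix_mul_assoc [symmetric])
  then show ?thesis by (simp add: frobenius_inner)
qed

lemma inner_conj_transpose: "conj_transpose A \<bullet> conj_transpose B = A \<bullet> (B::complex^'d^'d)"
  by (simp add: inner_vec_def inner_complex_def, subst sum.swap, simp)

lemma inner_unitary_right:
  assumes "unitary U" shows "(A ** U) \<bullet> (B ** U) = A \<bullet> (B::complex^'d^'d)"
proof -
  have "(A ** U) \<bullet> (B ** U) = (conj_transpose U ** conj_transpose A) \<bullet> (conj_transpose U ** conj_transpose B)"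
    by (simp add: conj_transpose_mult[symmetric] inner_conj_transpose)
  also have "\<dots> = A \<bullet> B"
    using assms by (simp add: inner_unitary_left unitary_conj_transpose inner_conj_transpose)
  finally show ?thesis .
qed

lemma norm_unitary [simp]:
  assumes "unitary U" shows "norm (U ** A) = norm A" "norm (A ** U) = norm (A::complex^'d^'d)"
  using assms by (simp_all add: norm_eq_sqrt_inner inner_unitary_left inner_unitary_right)

lemma norm_unitary_mat:
  assumes "unitary (U::complex^'d^'d)" shows "norm U = norm (mat 1 :: complex^'d^'d)"
  using norm_unitary(1)[OF assms, of "mat 1"] by simp

section \<open>The spectral theorem for normal matrices\<close>

text \<open>For small s of the sign of a the linear side would win. This is the vanishing of a first
  variation, used for the Rayleigh quotient and again for the energy of a loop.\<close>

lemma eq_0_if_linear_le_square: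
  fixes a C :: real
  assumes "\<And>s. 2 * s * a \<le> s\<^sup>2 * C"
  shows "a = 0"
proof (rule ccontr)
  assume "a \<noteq> 0"
  \<comment> \<open>With this step a = s (|C| + 1), so both sides are multiples of s^2 and the
    hypothesis reads 2 (|C| + 1) <= C.\<close>
  define s where "s = a / (\<bar>C\<bar> + 1)"
  have s: "s\<^sup>2 > 0" "a = s * (\<bar>C\<bar> + 1)"
    using \<open>a \<noteq> 0\<close> by (auto simp: s_def)
  from assms[of s] have "s\<^sup>2 * (2 * (\<bar>C\<bar> + 1)) \<le> s\<^sup>2 * C"
    by (subst (asm) s(2)) (simp add: power2_eq_square mult_ac)
  then have "2 * (\<bar>C\<bar> + 1) \<le> C"
    using s(1) by (simp add: mult_le_cancel_left_pos)
  then show False by simp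
qed

text \<open>The Rayleigh quotient attains its maximum l on the unit sphere of S. Moving the
  maximiser x in the direction of the residual z = f x - l x changes y . f y - l |y|^2 to first
  order by twice the squared norm of z, which must therefore vanish.\<close>

lemma selfadjoint_has_eigenvector:
  fixes f :: "'a::euclidean_space \<Rightarrow> 'a"
  assumes lin: "linear f" and sa: "\<And>x y. f x \<bullet> y = x \<bullet> f y"
    and S: "subspace S" "f ` S \<subseteq> S" "\<exists>x\<in>S. x \<noteq> 0"
  shows "\<exists>x\<in>S. norm x = 1 \<and> (\<exists>l::real. f x = l *\<^sub>R x)"
proof -
  let ?K = "S \<inter> sphere 0 1"
  have "compact ?K"
    by (simp add: S(1) closed_Int_compact closed_subspace)
  moreover obtain x0 where "x0 \<in> S" "x0 \<noteq> 0" using S by blast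
  then have "(1 / norm x0) *\<^sub>R x0 \<in> ?K"
    using S(1) by (auto simp: subspace_scale)
  then have "?K \<noteq> {}" by blast
  moreover have "continuous_on ?K (\<lambda>x. x \<bullet> f x)"
    using lin by (intro continuous_intros bounded_linear.continuous_on[OF _ continuous_on_id])
      (simp add: linear_conv_bounded_linear)
  ultimately obtain x where "x \<in> ?K" and max': "\<forall>y\<in>?K. y \<bullet> f y \<le> x \<bullet> f x"
    using continuous_attains_sup[of ?K "\<lambda>x. x \<bullet> f x"] by blast
  then have x: "x \<in> S" "norm x = 1" by auto
  have max: "y \<bullet> f y \<le> x \<bullet> f x" if "y \<in> S" "norm y = 1" for y
    using max' that by auto
  define l where "l = x \<bullet> f x"
  have le: "y \<bullet> f y \<le> l * (y \<bullet> y)" if "y \<in> S" for y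
  proof (cases "y = 0")
    case False
    have "((1/norm y) *\<^sub>R y) \<bullet> f ((1/norm y) *\<^sub>R y) \<le> l"
      unfolding l_def using that False S(1) by (intro max) (auto simp: subspace_scale)
    then have "(1/norm y)\<^sup>2 * (y \<bullet> f y) \<le> l"
      by (simp add: linear_scale[OF lin] power2_eq_square)
    then show ?thesis
      using False by (simp add: field_simps dot_square_norm)
  qed (simp add: linear_0[OF lin])
  define z where "z = f x - l *\<^sub>R x"
  have zS: "z \<in> S" unfolding z_def using S x by (auto intro!: subspace_diff subspace_scale)
  have zx: "z \<bullet> f x = x \<bullet> f z" by (simp add: inner_commute[of z] sa)
  have "2 * s * (z \<bullet> z) \<le> s\<^sup>2 * (l * (z \<bullet> z) - z \<bullet> f z)" for s :: real
  proof -
    have "x + s *\<^sub>R z \<in> S" using S x zS by (auto intro!: subspace_add subspace_scale)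
    from le[OF this] have "(x + s *\<^sub>R z) \<bullet> (f x + s *\<^sub>R f z) \<le> l * ((x + s *\<^sub>R z) \<bullet> (x + s *\<^sub>R z))"
      by (simp add: linear_add[OF lin] linear_scale[OF lin])
    then have "x \<bullet> f x + 2 * s * (z \<bullet> f x) + s\<^sup>2 * (z \<bullet> f z)
        \<le> l * (x \<bullet> x) + 2 * s * l * (z \<bullet> x) + s\<^sup>2 * l * (z \<bullet> z)"
      by (simp add: inner_add_left inner_add_right zx[symmetric] power2_eq_square algebra_simps inner_commute)
    moreover have "l * (x \<bullet> x) = x \<bullet> f x" using x by (simp add: l_def dot_square_norm)
    moreover have "z \<bullet> f x - l * (z \<bullet> x) = z \<bullet> z"
      unfolding z_def by (simp add: inner_diff_right inner_diff_left)
    then have "z \<bullet> f x = l * (z \<bullet> x) + z \<bullet> z" by simp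
    ultimately show ?thesis by (simp add: algebra_simps)
  qed
  then have "z \<bullet> z = 0" by (rule eq_0_if_linear_le_square)
  then have "f x = l *\<^sub>R x" by (simp add: z_def)
  then show ?thesis using x by blast
qed

text \<open>The Hermitian form, conjugate-linear in the first argument. The preceding eigenvector
  theorem sees only its real part; the complex form expresses orthogonality over the complex
  numbers.\<close>

definition cinner :: "complex^'n \<Rightarrow> complex^'n \<Rightarrow> complex" where
  "cinner x y = (\<Sum>i\<in>UNIV. cnj (x $ i) * y $ i)"

lemma Re_cinner: "x \<bullet> y = Re (cinner x y)"
  by (simp add: cinner_def inner_vec_def inner_complex_def)

lemma cinner_adjoint: "cinner (conj_transpose A *v x) y = cinner x (A *v y)"
  by (simp add: cinner_def matrix_vector_mult_def sum_distrib_left sum_distrib_right, subst sum.swap,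
      simp add: mult_ac)

lemma cinner_commute: "cinner x y = cnj (cinner y x)"
  by (simp add: cinner_def mult.commute)

lemma cinner_simps [simp]:
  "cinner x (c *s y) = c * cinner x y" "cinner (c *s x) y = cnj c * cinner x y"
  "cinner x (y + z) = cinner x y + cinner x z" "cinner x (y - z) = cinner x y - cinner x z"
  "cinner x 0 = 0" "cinner x (r *\<^sub>R y) = r *\<^sub>R cinner x y"
  by (simp_all add: cinner_def sum_distrib_left sum.distrib sum_subtractf algebra_simps scaleR_sum_right)

lemma cinner_self: "cinner x x = of_real ((norm x)\<^sup>2)"
proof -
  have "cinner x x \<in> \<real>"
    by (metis Reals_cnj_iff cinner_commute)
  then have "cinner x x = of_real (Re (cinner x x))" by (simp add: of_real_Re)
  then show ?thesis by (simp add: Re_cinner[symmetric] dot_square_norm)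
qed

lemma scaleR_eq_smult: "r *\<^sub>R (x::complex^'n) = complex_of_real r *s x"
  by (simp add: vec_eq_iff complex_eq_iff)

lemma matrix_vector_smult: "A *v (c *s x) = c *s (A *v (x::complex^'n))"
  by (simp add: vec_eq_iff matrix_vector_mult_def sum_distrib_left mult_ac)

text \<open>The self-adjoint and skew-adjoint parts of a normal matrix commute, so the eigenspace of the first
  is invariant under the second.\<close>

lemma normal_has_eigenvector:
  fixes A :: "complex^'d^'d"
  assumes normal: "A ** conj_transpose A = conj_transpose A ** A"
    and S: "subspace S" "\<exists>x\<in>S. x \<noteq> 0" "\<And>x c. x \<in> S \<Longrightarrow> c *s x \<in> S"
    and inv: "\<And>x. x \<in> S \<Longrightarrow> A *v x \<in> S" "\<And>x. x \<in> S \<Longrightarrow> conj_transpose A *v x \<in> S"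
  shows "\<exists>x\<in>S. norm x = 1 \<and> (\<exists>c. A *v x = c *s x \<and> conj_transpose A *v x = cnj c *s x)"
proof -
  \<comment> \<open>\<open>A\<close> equals \<open>B + i C\<close> with \<open>B\<close> and
    \<open>C\<close> Hermitian. On a common eigenvector the real eigenvalues l of \<open>B\<close>
    and m of \<open>C\<close> combine to the eigenvalue l + i m of \<open>A\<close>.\<close>
  define B where "B = (\<lambda>x. (1/2::complex) *s (A *v x + conj_transpose A *v x))"
  define C where "C = (\<lambda>x. (-\<i>/2) *s (A *v x - conj_transpose A *v x))"
  have linB: "linear B" and linC: "linear C"
    by (rule linearI; simp add: B_def C_def vec.scale_right_distrib vec.scale_right_diff_distrib
          matrix_vector_right_distrib scaleR_eq_smult matrix_vector_smult; simp add: vec_eq_iff algebra_simps)+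
  have AA: "cinner (A *v x) y = cinner x (conj_transpose A *v y)" for x y
    using cinner_adjoint[of "conj_transpose A" x y] by simp
  have cl: "cinner (u + v) y = cinner u y + cinner v y" "cinner (u - v) y = cinner u y - cinner v y" for u v y
    by (simp_all add: cinner_def sum.distrib sum_subtractf algebra_simps)
  have "cinner (B x) y = cinner x (B y)" for x y
    by (simp add: B_def cl cinner_adjoint AA)
  then have saB: "B x \<bullet> y = x \<bullet> B y" for x y
    by (simp add: Re_cinner)
  have "cinner (C x) y = cinner x (C y)" for x y
    by (simp add: C_def cl cinner_adjoint AA algebra_simps)
  then have saC: "C x \<bullet> y = x \<bullet> C y" for x y
    by (simp add: Re_cinner)
  have com: "A *v (conj_transpose A *v x) = conj_transpose A *v (A *v x)" for x
    using normal by (simp add: matrix_vector_mul_assoc)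
  have BC: "B (C x) = C (B x)" for x
    by (simp add: B_def C_def matrix_vector_smult matrix_vector_right_distrib
          matrix_vector_mult_diff_distrib com vec.scale_right_distrib vec.scale_right_diff_distrib)
  have BS: "B ` S \<subseteq> S" and CS: "C ` S \<subseteq> S"
    using S inv by (auto simp: B_def C_def intro!: S(3) subspace_add subspace_diff)
  obtain x0 l where x0: "x0 \<in> S" "norm x0 = 1" "B x0 = l *\<^sub>R x0"
    using selfadjoint_has_eigenvector[OF linB saB S(1) BS S(2)] by blast
  define S' where "S' = {x \<in> S. B x = l *\<^sub>R x}"
  have "subspace S'"
    using S(1) by (auto simp: S'_def subspace_def linear_0[OF linB] linear_add[OF linB] linear_scale[OF linB]
        scaleR_add_right)
  moreover have "C ` S' \<subseteq> S'"
    using CS by (auto simp: S'_def BC linear_scale[OF linC])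
  moreover have "\<exists>x\<in>S'. x \<noteq> 0" using x0 by (auto simp: S'_def intro!: bexI[of _ x0])
  ultimately obtain x m where x: "x \<in> S'" "norm x = 1" "C x = m *\<^sub>R x"
    using selfadjoint_has_eigenvector[OF linC saC] by blast
  have Bx: "B x = l *\<^sub>R x" using x by (simp add: S'_def)
  define c where "c = Complex l m"
  have "A *v x = B x + \<i> *s C x" "conj_transpose A *v x = B x - \<i> *s C x"
    by (simp_all add: B_def C_def vec_eq_iff field_simps)
  then have "A *v x = c *s x" "conj_transpose A *v x = cnj c *s x"
    unfolding Bx x(3) by (simp_all add: scaleR_eq_smult vec_eq_iff c_def complex_eq_iff algebra_simps)
  then show ?thesis using x by (auto simp: S'_def)
qed

text \<open>Eigenvectors are collected one index at a time: the Hermitian complement of those found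
  so far is invariant under \<open>A\<close> and its adjoint, and so contains another common
  eigenvector.\<close>

lemma normal_orthonormal_eigenvectors:
  fixes A :: "complex^'d^'d" and I :: "'d set"
  assumes normal: "A ** conj_transpose A = conj_transpose A ** A"
  shows "\<exists>e f. (\<forall>i\<in>I. A *v e i = f i *s e i \<and> conj_transpose A *v e i = cnj (f i) *s e i) \<and>
    (\<forall>i\<in>I. \<forall>j\<in>I. cinner (e i) (e j) = (if i = j then 1 else 0))"
proof -
  have "finite I" by simp
  then show ?thesis
  proof (induction I rule: finite_induct)
    case empty then show ?case by simp
  next
    case (insert k I)
    then obtain e f where e: "\<And>i. i \<in> I \<Longrightarrow> A *v e i = f i *s e i"
        "\<And>i. i \<in> I \<Longrightarrow> conj_transpose A *v e i = cnj (f i) *s e i"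
      and on: "\<And>i j. i \<in> I \<Longrightarrow> j \<in> I \<Longrightarrow> cinner (e i) (e j) = (if i = j then 1 else 0)"
      by blast
    define S where "S = {x. \<forall>i\<in>I. cinner (e i) x = 0}"
    \<comment> \<open>Including the multiples by i turns real orthogonality to this set into
      Hermitian orthogonality to all \<open>e i\<close>. Its real dimension is at most twice the
      number of vectors found, so a further vector exists while some index is left.\<close>
    let ?T = "e ` I \<union> (\<lambda>i. \<i> *s e i) ` I"
    have "card I < CARD('d)"
      using insert by (metis finite psubset_card_mono psubsetI subset_UNIV UNIV_I)
    moreover have "dim ?T \<le> 2 * card I"
    proof -
      have "dim ?T \<le> card ?T" by (intro dim_le_card') (simp add: insert)
      also have "\<dots> \<le> card (e ` I) + card ((\<lambda>i. \<i> *s e i) ` I)" by (rule card_Un_le)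
      also have "\<dots> \<le> 2 * card I"
        using card_image_le[OF \<open>finite I\<close>, of e] card_image_le[OF \<open>finite I\<close>, of "\<lambda>i. \<i> *s e i"] by simp
      finally show ?thesis .
    qed
    ultimately have "dim ?T < DIM(complex^'d)" by (simp add: DIM_cart)
    then obtain x where x: "x \<noteq> 0" "\<And>y. y \<in> span ?T \<Longrightarrow> orthogonal x y"
      using orthogonal_to_subspace_exists by blast
    have "cinner (e i) x = 0" if "i \<in> I" for i
    proof -
      have "e i \<bullet> x = 0" "(\<i> *s e i) \<bullet> x = 0"
        using that x(2)[OF span_base, of "e i"] x(2)[OF span_base, of "\<i> *s e i"]
        by (auto simp: orthogonal_def inner_commute)
      then show ?thesis by (auto simp: Re_cinner complex_eq_iff)
    qed
    then have "\<exists>x\<in>S. x \<noteq> 0" using x(1) by (auto simp: S_def)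
    moreover have "subspace S" by (auto simp: S_def subspace_def)
    moreover have "A *v x \<in> S" "conj_transpose A *v x \<in> S" if "x \<in> S" for x
      using that e by (auto simp: S_def cinner_adjoint[symmetric] cinner_adjoint[of "conj_transpose A", simplified, symmetric])
    moreover have "c *s x \<in> S" if "x \<in> S" for x c using that by (auto simp: S_def)
    ultimately obtain v c where v: "v \<in> S" "norm v = 1" "A *v v = c *s v" "conj_transpose A *v v = cnj c *s v"
      using normal_has_eigenvector[OF normal, of S] by blast
    have "cinner v v = 1" using v by (simp add: cinner_self)
    moreover have "cinner v (e i) = 0" "cinner (e i) v = 0" if "i \<in> I" for i
      using v(1) that cinner_commute[of v "e i"] by (auto simp: S_def)
    ultimately show ?case
      using insert(2) v e on
      by (intro exI[of _ "e(k := v)"] exI[of _ "f(k := c)"]) auto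
  qed
qed

definition cdiag :: "('d \<Rightarrow> complex) \<Rightarrow> complex^'d^'d" where
  "cdiag f = (\<chi> i j. if i = j then f i else 0)"

lemma matrix_mult_cdiag: "(A ** cdiag f) $ i $ j = A $ i $ j * f j"
  "(cdiag f ** A) $ i $ j = f i * A $ i $ j"
  by (simp_all add: matrix_matrix_mult_def cdiag_def if_distrib if_distribR cong: if_cong)

lemma cdiag_simps:
  "conj_transpose (cdiag f) = cdiag (\<lambda>i. cnj (f i))"
  "cdiag f ** cdiag g = cdiag (\<lambda>i. f i * g i)"
  "cdiag (\<lambda>i. 1) = mat 1"
  "det (cdiag f) = (\<Prod>i\<in>UNIV. f i)"
  "trace (cdiag f) = (\<Sum>i\<in>UNIV. f i)"
  "r *\<^sub>R cdiag f = cdiag (\<lambda>i. r *\<^sub>R f i)"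
  "cdiag f - cdiag g = cdiag (\<lambda>i. f i - g i)"
  "cdiag f + cdiag g = cdiag (\<lambda>i. f i + g i)"
  by (auto simp: vec_eq_iff cdiag_def mat_def matrix_mult_cdiag[unfolded cdiag_def] det_diagonal trace_def)

lemma cdiag_eq_iff [simp]: "cdiag f = cdiag g \<longleftrightarrow> f = g"
  by (auto simp: vec_eq_iff cdiag_def fun_eq_iff)

lemma norm_cdiag: "(norm (cdiag f))\<^sup>2 = (\<Sum>i\<in>UNIV. (norm (f i))\<^sup>2)"
proof -
  have "(norm (cdiag f))\<^sup>2 = (\<Sum>i\<in>UNIV. \<Sum>j\<in>UNIV. if i = j then (norm (f i))\<^sup>2 else 0)"
    unfolding power2_norm_eq_inner inner_vec_def
    by (intro sum.cong refl) (auto simp: cdiag_def dot_square_norm)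
  then show ?thesis by simp
qed

theorem normal_diagonalisable:
  fixes A :: "complex^'d^'d"
  assumes normal: "A ** conj_transpose A = conj_transpose A ** A"
  shows "\<exists>V f. unitary V \<and> A = V ** cdiag f ** conj_transpose V"
proof -
  from normal_orthonormal_eigenvectors[OF normal, of UNIV] obtain e f where
    ef: "(\<forall>i\<in>(UNIV::'d set). A *v e i = f i *s e i \<and> conj_transpose A *v e i = cnj (f i) *s e i) \<and>
      (\<forall>i\<in>UNIV. \<forall>j\<in>UNIV. cinner (e i) (e j) = (if i = j then 1 else 0))"
    by (elim exE)
  then have e: "A *v e i = f i *s e i" and on: "cinner (e i) (e j) = (if i = j then 1 else 0)" for i j
    by simp_all
  define V where "V = (\<chi> a j. e j $ a)"
  have "unitary V"
    using on by (simp add: unitary_def V_def vec_eq_iff matrix_matrix_mult_def mat_def cinner_def)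
  moreover have "A ** V = V ** cdiag f"
  proof -
    have "(A ** V) $ a $ j = (V ** cdiag f) $ a $ j" for a j
      using arg_cong[OF e[of j], of "\<lambda>v. v $ a"]
      unfolding matrix_mult_cdiag by (simp add: V_def matrix_matrix_mult_def matrix_vector_mult_def mult.commute)
    then show ?thesis unfolding vec_eq_iff by blast
  qed
  ultimately have "V ** cdiag f ** conj_transpose V = A"
    using unitary_cancel(3)[OF \<open>unitary V\<close>, of A] by simp
  then show ?thesis using \<open>unitary V\<close> by blast
qed

section \<open>One-parameter groups in \<open>SU(d)\<close>\<close>

text \<open>Exhibits a diagonal matrix as a sum of linear images of its entries, so that derivatives
  and continuity can be checked entry by entry.\<close>

lemma cdiag_eq_sum: "cdiag f = (\<Sum>j\<in>UNIV. cdiag (\<lambda>k. if k = j then f j else 0))"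
  by (auto simp: vec_eq_iff cdiag_def sum_component)

lemma bounded_linear_cdiag_single:
  "bounded_linear (\<lambda>z. cdiag (\<lambda>k::'d::finite. if k = j then z else 0))"
  unfolding linear_conv_bounded_linear [symmetric]
  by (rule linearI) (auto simp: vec_eq_iff cdiag_def)

lemma has_vector_derivative_cdiag:
  assumes "\<And>j. ((\<lambda>t. f t j) has_vector_derivative f' j) (at t)"
  shows "((\<lambda>t. cdiag (f t)) has_vector_derivative cdiag f') (at t)"
  by (subst cdiag_eq_sum[abs_def], subst (2) cdiag_eq_sum)
    (intro has_vector_derivative_sum bounded_linear.has_vector_derivative[OF bounded_linear_cdiag_single] assms)

lemma continuous_on_cdiag [continuous_intros]:
  assumes "\<And>j. continuous_on S (\<lambda>t. f t j)"
  shows "continuous_on S (\<lambda>t. cdiag (f t))"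
  by (subst cdiag_eq_sum[abs_def])
    (intro continuous_on_sum bounded_linear.continuous_on[OF bounded_linear_cdiag_single] assms)

text \<open>The one-parameter group exp(tX) with X = \<open>gen V x\<close>, kept in diagonalised
  form: the eigenvalues stay visible, so that integral shifts and permutations become operations on
  \<open>x\<close>.\<close>

definition opg :: "complex^'d^'d \<Rightarrow> ('d \<Rightarrow> real) \<Rightarrow> real \<Rightarrow> complex^'d^'d" where
  "opg V x t = V ** cdiag (\<lambda>j. cis (t * x j)) ** conj_transpose V"

definition gen :: "complex^'d^'d \<Rightarrow> ('d \<Rightarrow> real) \<Rightarrow> complex^'d^'d" where
  "gen V x = V ** cdiag (\<lambda>j. \<i> * of_real (x j)) ** conj_transpose V"

lemma conjugate_mult:
  assumes "unitary V"
  shows "(V ** A ** conj_transpose V) ** (V ** B ** conj_transpose V) = V ** (A ** B) ** conj_transpose V"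
  by (simp add: matrix_mul_assoc [symmetric] unitary_cancel[OF assms])

lemma opg_add: "unitary V \<Longrightarrow> opg V x (s + t) = opg V x s ** opg V x t"
  by (simp add: opg_def conjugate_mult cdiag_simps cis_mult distrib_right)

lemma opg_0: "unitary V \<Longrightarrow> opg V x 0 = mat 1"
  by (simp add: opg_def cdiag_simps unitaryD)

lemma conj_transpose_opg: "conj_transpose (opg V x t) = opg V x (- t)"
  by (simp add: opg_def conj_transpose_mult cdiag_simps cis_cnj matrix_mul_assoc)

lemma unitary_opg: "unitary V \<Longrightarrow> unitary (opg V x t)"
  by (simp add: unitary_def[of "opg V x t"] conj_transpose_opg opg_add[symmetric] opg_0)

lemma opg_cancel:
  assumes "unitary V"
  shows "opg V x t ** opg V x (- t) = mat 1" "opg V x (- t) ** opg V x t = mat 1"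
  by (simp_all add: opg_add[OF assms, symmetric] opg_0[OF assms])

lemma cis_sum: "cis (sum f A) = (\<Prod>i\<in>A. cis (f i))"
  by (induction A rule: infinite_finite_induct) (simp_all add: cis_mult [symmetric])

lemma det_opg: "unitary V \<Longrightarrow> det (opg V x t) = cis (t * sum x UNIV)"
proof -
  assume V: "unitary V"
  have "det V * det (conj_transpose V) = 1"
    using unitaryD(2)[OF V] by (metis det_I det_mul)
  then show ?thesis
    by (simp add: opg_def det_mul cdiag_simps sum_distrib_left cis_sum mult_ac)
qed

lemma opg_gen_commute: "unitary V \<Longrightarrow> opg V x t ** gen V x = gen V x ** opg V x t"
  by (simp add: opg_def gen_def conjugate_mult cdiag_simps mult.commute)

lemma has_vector_derivative_opg:
  assumes "unitary V"
  shows "(opg V x has_vector_derivative gen V x ** opg V x t) (at t)"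
proof -
  have "((\<lambda>t. cdiag (\<lambda>j. cis (t * x j))) has_vector_derivative cdiag (\<lambda>j. \<i> * of_real (x j) * cis (t * x j))) (at t)"
  proof (rule has_vector_derivative_cdiag)
    fix j
    show "((\<lambda>t. cis (t * x j)) has_vector_derivative \<i> * of_real (x j) * cis (t * x j)) (at t)"
      unfolding cis_conv_exp
      by (rule has_vector_derivative_eq_rhs, (rule derivative_eq_intros refl has_vector_derivative_real_field | simp)+)
  qed
  moreover have "bounded_linear (\<lambda>A. V ** A ** conj_transpose V)"
    by (rule bounded_linear_compose[OF bounded_bilinear.bounded_linear_left bounded_bilinear.bounded_linear_right];
        rule bounded_bilinear_matrix_mult)
  ultimately have "((\<lambda>t. V ** cdiag (\<lambda>j. cis (t * x j)) ** conj_transpose V) has_vector_derivative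
     V ** cdiag (\<lambda>j. \<i> * of_real (x j) * cis (t * x j)) ** conj_transpose V) (at t)"
    by (rule bounded_linear.has_vector_derivative[rotated])
  then show ?thesis
    by (simp add: opg_def[abs_def] gen_def conjugate_mult[OF assms] cdiag_simps)
qed

lemma continuous_on_opg [continuous_intros]:
  "continuous_on S f \<Longrightarrow> continuous_on S (\<lambda>s. opg V x (f s))"
  unfolding opg_def by (intro continuous_intros)

lemma norm_gen: "unitary V \<Longrightarrow> (norm (gen V x))\<^sup>2 = (\<Sum>j\<in>UNIV. (x j)\<^sup>2)"
  by (simp add: gen_def unitary_conj_transpose norm_cdiag norm_mult)

lemma conj_transpose_gen: "conj_transpose (gen V x) = - gen V x"
proof -
  have "conj_transpose (gen V x) = V ** (cdiag (\<lambda>j. 0) - cdiag (\<lambda>j. \<i> * of_real (x j))) ** conj_transpose V"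
    by (simp add: gen_def conj_transpose_mult cdiag_simps matrix_mul_assoc)
  also have "cdiag (\<lambda>j. 0) = 0" by (simp add: vec_eq_iff cdiag_def)
  finally show ?thesis by (simp add: gen_def matrix_mult_minus_left matrix_mult_minus_right)
qed

lemma trace_gen: "unitary V \<Longrightarrow> trace (gen V x) = \<i> * of_real (sum x UNIV)"
  by (subst gen_def, subst trace_mul_sym)
    (simp add: matrix_mul_assoc unitaryD cdiag_simps sum_distrib_left)

lemma gen_in_su: "unitary V \<Longrightarrow> gen V x \<in> su \<longleftrightarrow> sum x UNIV = 0"
  by (simp add: su_def conj_transpose_gen trace_gen del: of_real_sum)

lemma skew_eq_gen:
  assumes "conj_transpose X = - X"
  shows "\<exists>V x. unitary V \<and> X = gen V x"
proof -
  obtain V f where V: "unitary V" and X: "X = V ** cdiag f ** conj_transpose V"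
    using normal_diagonalisable[of X] assms by (auto simp: matrix_mult_minus_left matrix_mult_minus_right)
  have f: "cdiag f = conj_transpose V ** X ** V"
    unfolding X by (simp add: matrix_mul_assoc [symmetric] unitary_cancel[OF V] unitaryD[OF V])
  have "conj_transpose (cdiag f) = - cdiag f"
    unfolding f by (simp add: conj_transpose_mult assms matrix_mult_minus_left matrix_mult_minus_right matrix_mul_assoc)
  then have "cnj (f j) = - f j" for j
    by (auto simp: vec_eq_iff cdiag_def dest!: spec[of _ j])
  then have "f j = \<i> * of_real (Im (f j))" for j
    by (simp add: complex_eq_iff)
  then have "X = gen V (\<lambda>j. Im (f j))" unfolding gen_def X by metis
  then show ?thesis using V by blast
qed

lemma su_eq_gen:
  assumes "X \<in> su" shows "\<exists>V x. unitary V \<and> sum x UNIV = 0 \<and> X = gen V x"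
  using assms skew_eq_gen[of X] gen_in_su by (fastforce simp: su_def)

text \<open>The eigenvalues have modulus one and \<open>Arg\<close> takes their logarithms. The
  half-open interval makes this logarithm principal, hence determined by the matrix; later it
  inherits whatever commutes with the matrix.\<close>

lemma unitary_log:
  assumes "unitary U"
  shows "\<exists>V x. unitary V \<and> (\<forall>j. - pi < x j \<and> x j \<le> pi) \<and> U = opg V x 1"
proof -
  obtain V f where V: "unitary V" and U: "U = V ** cdiag f ** conj_transpose V"
    using normal_diagonalisable[of U] unitaryD[OF assms] by auto
  have f: "cdiag f = conj_transpose V ** U ** V"
    unfolding U by (simp add: matrix_mul_assoc [symmetric] unitary_cancel[OF V] unitaryD[OF V])
  have "unitary (cdiag f)"
    unfolding f by (intro unitary_mult unitary_conj_transpose V assms)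
  then have "cnj (f j) * f j = 1" for j
    by (auto simp: unitary_def cdiag_simps fun_eq_iff simp flip: cdiag_simps(3))
  then have "complex_of_real ((norm (f j))\<^sup>2) = 1" for j
    by (simp add: complex_norm_square mult.commute del: of_real_power)
  then have norm: "norm (f j) = 1" for j
    by (metis of_real_eq_1_iff power2_eq_1_iff norm_ge_zero not_one_le_zero neg_0_le_iff_le)
  have "f j \<noteq> 0" for j using norm[of j] by auto
  then have "cis (Arg (f j)) = f j" for j
    by (simp add: cis_Arg sgn_div_norm norm)
  then have "(\<lambda>j. cis (1 * Arg (f j))) = f" by simp
  then have "U = opg V (\<lambda>j. Arg (f j)) 1" unfolding opg_def U by simp
  moreover have "- pi < Arg (f j) \<and> Arg (f j) \<le> pi" for j by (rule Arg_bounded)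
  ultimately show ?thesis using V by (intro exI[of _ V] exI[of _ "\<lambda>j. Arg (f j)"]) auto
qed

lemma carrier_SU: "U \<in> carrier SU \<longleftrightarrow> unitary U \<and> det U = 1"
  by (simp add: SU_def unitary_def)

lemma SU_simps [simp]: "mult SU = (**)" "one SU = mat 1"
  by (simp_all add: SU_def)

lemma SU_mult: "A \<in> carrier SU \<Longrightarrow> B \<in> carrier SU \<Longrightarrow> A ** B \<in> carrier SU"
  by (simp add: carrier_SU unitary_mult det_mul)

lemma det_conj_transpose: "det (conj_transpose A) = cnj (det (A :: complex^'d^'d))"
proof -
  have "det (map_matrix cnj B) = cnj (det B)" for B :: "complex^'d^'d"
    by (simp add: det_def map_matrix_def)
  then show ?thesis by (simp add: conj_transpose_def det_transpose)
qed

lemma SU_conj_transpose: "A \<in> carrier SU \<Longrightarrow> conj_transpose A \<in> carrier SU"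
  by (simp add: carrier_SU unitary_conj_transpose det_conj_transpose)

lemma opg_SU: "unitary V \<Longrightarrow> sum x UNIV = 0 \<Longrightarrow> opg V x t \<in> carrier SU"
  by (simp add: carrier_SU unitary_opg det_opg)

lemma conjugate_SU:
  assumes "A \<in> carrier SU" "unitary K" shows "K ** A ** conj_transpose K \<in> carrier SU"
proof -
  have "det K * det (conj_transpose K) = 1"
    using unitaryD(2)[OF assms(2)] by (metis det_I det_mul)
  then show ?thesis
    using assms by (simp add: carrier_SU unitary_mult unitary_conj_transpose det_mul)
qed

lemma cis_eq_1_imp: "cis a = 1 \<Longrightarrow> \<exists>n::int. a = 2 * pi * n"
  using cos_one_2pi_int[of a] by (auto simp: complex_eq_iff mult_ac)

lemma SU_log:
  assumes "U \<in> carrier SU"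
  shows "\<exists>V x. unitary V \<and> sum x UNIV = 0 \<and> U = opg V x 1"
proof -
  obtain V x where V: "unitary V" and U: "U = opg V x 1"
    using unitary_log assms by (meson carrier_SU)
  have "cis (sum x UNIV) = 1" using assms det_opg[OF V, of x 1] by (simp add: U carrier_SU)
  then obtain n :: int where n: "sum x UNIV = 2 * pi * n" using cis_eq_1_imp by blast
  obtain k :: 'a where True by simp
  \<comment> \<open>The principal angles may sum to a nonzero multiple of 2 pi. One arbitrary
    eigenvalue absorbs it, which restores trace zero without changing the exponential.\<close>
  define y where "y = (\<lambda>j. x j - (if j = k then 2 * pi * n else 0))"
  have "sum y UNIV = 0" by (simp add: y_def sum_subtractf n)
  moreover have "cis (y j) = cis (x j)" for j
    by (simp add: y_def cis_divide [symmetric])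
  then have "U = opg V y 1" by (simp add: U opg_def)
  ultimately show ?thesis using V by blast
qed

section \<open>Size and uniqueness of logarithms\<close>

lemma norm_cis_taylor: "norm (cis a - 1 - \<i> * of_real a) \<le> a\<^sup>2"
proof -
  have "norm (exp (\<i> * of_real a) - (\<Sum>i\<le>1. (\<i> * of_real a) ^ i / fact i))
      \<le> exp \<bar>Re (\<i> * of_real a)\<bar> * norm (\<i> * of_real a) ^ Suc 1 / fact 1"
    by (rule Taylor_exp)
  then show ?thesis by (simp add: cis_conv_exp norm_mult power2_eq_square algebra_simps)
qed

lemma norm_cis_minus_1: "norm (cis a - 1) \<le> \<bar>a\<bar>"
  using dist_exp_i_1[of a] abs_sin_x_le_abs_x[of "a/2"] by (simp add: cis_conv_exp dist_norm)

lemma norm_opg_minus_1: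
  assumes "unitary V"
  shows "norm (opg V x t - mat 1) \<le> \<bar>t\<bar> * norm (gen V x)"
proof -
  have "mat 1 = V ** cdiag (\<lambda>j. 1) ** conj_transpose V"
    using assms by (simp add: cdiag_simps unitaryD)
  then have "opg V x t - mat 1 = V ** cdiag (\<lambda>j. cis (t * x j) - 1) ** conj_transpose V"
    by (simp add: opg_def cdiag_simps(7) [symmetric] matrix_mult_diff_left matrix_mult_diff_right)
  then have "(norm (opg V x t - mat 1))\<^sup>2 = (\<Sum>j\<in>UNIV. (norm (cis (t * x j) - 1))\<^sup>2)"
    using assms by (simp add: norm_cdiag unitary_conj_transpose)
  also have "\<dots> \<le> (\<Sum>j\<in>UNIV. t\<^sup>2 * (x j)\<^sup>2)"
  proof (rule sum_mono)
    fix j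
    have "(norm (cis (t * x j) - 1))\<^sup>2 \<le> \<bar>t * x j\<bar>\<^sup>2" by (intro power_mono norm_cis_minus_1) simp
    then show "(norm (cis (t * x j) - 1))\<^sup>2 \<le> t\<^sup>2 * (x j)\<^sup>2" by (simp add: power_mult_distrib)
  qed
  also have "\<dots> = (\<bar>t\<bar> * norm (gen V x))\<^sup>2"
    by (simp add: power_mult_distrib norm_gen[OF assms] sum_distrib_left)
  finally show ?thesis by (rule power2_le_imp_le) simp
qed

text \<open>Functional calculus: a unitary change of basis between two diagonalisations of the same matrix
  only mixes equal eigenvalues.\<close>

lemma diagonalisation_intertwine:
  assumes "unitary V" "unitary W" "V ** cdiag f ** conj_transpose V = W ** cdiag g ** conj_transpose W"
    and "\<And>j k. f j = g k \<Longrightarrow> f' j = g' k"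
  shows "V ** cdiag f' ** conj_transpose V = W ** cdiag g' ** conj_transpose W"
proof -
  let ?M = "conj_transpose W ** V"
  have "?M ** cdiag f = conj_transpose W ** (V ** cdiag f ** conj_transpose V) ** V"
    by (simp add: matrix_mul_assoc [symmetric] unitary_cancel[OF assms(1)] unitaryD[OF assms(1)])
  also have "\<dots> = cdiag g ** ?M"
    unfolding assms(3) by (simp add: matrix_mul_assoc unitary_cancel[OF assms(2)] unitaryD[OF assms(2)])
  finally have "?M $ j $ k * f k = g j * ?M $ j $ k" for j k
    by (metis matrix_mult_cdiag)
  then have "?M $ j $ k * f' k = g' j * ?M $ j $ k" for j k
    using assms(4)[of k j] by (metis mult.commute mult_cancel_left)
  then have "?M ** cdiag f' = cdiag g' ** ?M"
    by (simp add: vec_eq_iff matrix_mult_cdiag)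
  then have "W ** (?M ** cdiag f') ** conj_transpose V = W ** (cdiag g' ** ?M) ** conj_transpose V" by simp
  then show ?thesis
    by (simp add: matrix_mul_assoc [symmetric] unitary_cancel[OF assms(1)] unitaryD[OF assms(1)]
        unitary_cancel[OF assms(2)])
qed

text \<open>Angles in the open interval (-pi, pi) can be recovered from their exponentials, so both
  groups are the same function of the common matrix.\<close>

lemma opg_unique:
  assumes "unitary V" "unitary W" "opg V x 1 = opg W y 1"
    and "\<And>j. \<bar>x j\<bar> < pi" "\<And>j. \<bar>y j\<bar> < pi"
  shows "opg V x s = opg W y s"
  unfolding opg_def
proof (rule diagonalisation_intertwine[OF assms(1,2)])
  show "V ** cdiag (\<lambda>j. cis (1 * x j)) ** conj_transpose V = W ** cdiag (\<lambda>j. cis (1 * y j)) ** conj_transpose W"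
    using assms(3) by (simp add: opg_def)
next
  fix j k assume "cis (1 * x j) = cis (1 * y k)"
  then have "cis (x j - y k) = 1" by (simp add: cis_divide [symmetric])
  then obtain n :: int where n: "x j - y k = 2 * pi * n" using cis_eq_1_imp by blast
  have "\<bar>x j - y k\<bar> < 2 * pi" using assms(4)[of j] assms(5)[of k] by linarith
  then have "2 * pi * \<bar>real_of_int n\<bar> < 2 * pi * 1" by (simp add: n abs_mult)
  then have "n = 0" by (subst (asm) mult_less_cancel_left_pos) auto
  then show "cis (s * x j) = cis (s * y k)" using n by simp
qed

lemma opg_conjugate:
  "K ** opg V x t ** conj_transpose K = opg (K ** V) x t"
  by (simp add: opg_def conj_transpose_mult matrix_mul_assoc)

text \<open>The exponential is invertible near the identity with a quadratic error. Everything is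
  diagonal in one basis, so the estimates reduce to scalar ones for \<open>cis\<close>.\<close>

lemma SU_log_near:
  "\<exists>r>0. \<forall>U\<in>carrier SU. norm (U - mat 1 :: complex^'d^'d) < r \<longrightarrow>
    (\<exists>V x. unitary V \<and> sum x UNIV = 0 \<and> U = opg V x 1 \<and> norm (gen V x) \<le> 2 * norm (U - mat 1) \<and>
       norm (U - mat 1 - gen V x) \<le> (norm (gen V x))\<^sup>2)"
proof -
  \<comment> \<open>The first entry keeps every angle at most 1/2, where \<open>cis a - 1\<close> is
    comparable to a. The second keeps the sum of the angles at most 2 in absolute value, so this
    multiple of 2 pi is zero and the principal logarithm lies in \<open>su\<close>.\<close>
  define r where "r = min (1 - cos (1/2)) (1 / real CARD('d))"
  have "cos (1/2::real) < cos 0"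
    by (rule cos_monotone_0_pi) (use pi_gt3 in auto)
  then have "r > 0" by (simp add: r_def)
  moreover have "\<exists>V x. unitary V \<and> sum x UNIV = 0 \<and> U = opg V x 1 \<and> norm (gen V x) \<le> 2 * norm (U - mat 1) \<and>
       norm (U - mat 1 - gen V x) \<le> (norm (gen V x))\<^sup>2"
    if U: "U \<in> carrier SU" "norm (U - mat 1) < r" for U :: "complex^'d^'d"
  proof -
    obtain V x where V: "unitary V" and xpi: "\<And>j. - pi < x j \<and> x j \<le> pi" and Ux: "U = opg V x 1"
      using unitary_log U by (metis carrier_SU)
    have "mat 1 = V ** cdiag (\<lambda>j. 1) ** conj_transpose V"
      using V by (simp add: cdiag_simps unitaryD)
    then have U1: "U - mat 1 = V ** cdiag (\<lambda>j. cis (x j) - 1) ** conj_transpose V"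
      by (simp add: Ux opg_def cdiag_simps(7) [symmetric] matrix_mult_diff_left matrix_mult_diff_right)
    then have U2: "U - mat 1 - gen V x = V ** cdiag (\<lambda>j. cis (x j) - 1 - \<i> * of_real (x j)) ** conj_transpose V"
      by (simp add: gen_def cdiag_simps(7) [symmetric] matrix_mult_diff_left matrix_mult_diff_right)
    have n1: "(norm (U - mat 1))\<^sup>2 = (\<Sum>j\<in>UNIV. (norm (cis (x j) - 1))\<^sup>2)"
      using V by (simp add: U1 norm_cdiag unitary_conj_transpose)
    have n2: "(norm (U - mat 1 - gen V x))\<^sup>2 = (\<Sum>j\<in>UNIV. (norm (cis (x j) - 1 - \<i> * of_real (x j)))\<^sup>2)"
      using V by (simp add: U2 norm_cdiag unitary_conj_transpose)
    have lt: "norm (cis (x j) - 1) < r" for j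
    proof -
      have "(norm (cis (x j) - 1))\<^sup>2 \<le> (norm (U - mat 1))\<^sup>2"
        unfolding n1 by (rule member_le_sum) auto
      then show ?thesis using U(2) by (meson norm_ge_zero order_le_less_trans power2_le_imp_le)
    qed
    have small: "\<bar>x j\<bar> \<le> 1/2" for j
    proof (rule ccontr)
      assume "\<not> ?thesis"
      then have "cos \<bar>x j\<bar> < cos (1/2)" using xpi[of j] by (intro cos_monotone_0_pi) auto
      then have "1 - cos (1/2) < 1 - cos (x j)" by simp
      also have "\<dots> \<le> norm (cis (x j) - 1)"
        using complex_Re_le_cmod[of "1 - cis (x j)"] by (simp add: norm_minus_commute)
      finally show False using lt[of j] by (simp add: r_def)
    qed
    have lower: "\<bar>x j\<bar> \<le> 2 * norm (cis (x j) - 1)" for j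
    proof -
      have "\<bar>x j\<bar> = norm (\<i> * of_real (x j))" by (simp add: norm_mult)
      also have "\<dots> \<le> norm (cis (x j) - 1) + norm (cis (x j) - 1 - \<i> * of_real (x j))"
        by (metis norm_triangle_sub norm_minus_commute)
      also have "\<dots> \<le> norm (cis (x j) - 1) + (x j)\<^sup>2" using norm_cis_taylor by simp
      also have "(x j)\<^sup>2 \<le> \<bar>x j\<bar> * (1/2)"
        using mult_left_mono[OF small[of j], of "\<bar>x j\<bar>"] by (simp add: power2_eq_square abs_mult_self_eq)
      finally show ?thesis by simp
    qed
    have "(norm (gen V x))\<^sup>2 \<le> (\<Sum>j\<in>UNIV. (2 * norm (cis (x j) - 1))\<^sup>2)"
      unfolding norm_gen[OF V]
    proof (rule sum_mono)
      fix j show "(x j)\<^sup>2 \<le> (2 * norm (cis (x j) - 1))\<^sup>2"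
        using lower[of j] by (metis abs_ge_zero power2_abs power_mono)
    qed
    also have "\<dots> = (2 * norm (U - mat 1))\<^sup>2"
      by (simp add: power_mult_distrib n1 sum_distrib_left)
    finally have "norm (gen V x) \<le> 2 * norm (U - mat 1)"
      by (rule power2_le_imp_le) simp
    moreover have "norm (U - mat 1 - gen V x) \<le> (norm (gen V x))\<^sup>2"
    proof -
      have "(norm (U - mat 1 - gen V x))\<^sup>2 \<le> (\<Sum>j\<in>UNIV. (x j)\<^sup>2 * (\<Sum>j\<in>UNIV. (x j)\<^sup>2))"
        unfolding n2
      proof (rule sum_mono)
        fix j
        have "(norm (cis (x j) - 1 - \<i> * of_real (x j)))\<^sup>2 \<le> ((x j)\<^sup>2)\<^sup>2"
          by (intro power_mono norm_cis_taylor) simp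
        also have "\<dots> \<le> (x j)\<^sup>2 * (\<Sum>j\<in>UNIV. (x j)\<^sup>2)"
          unfolding power2_eq_square[of "(x j)\<^sup>2"] by (intro mult_left_mono member_le_sum) auto
        finally show "(norm (cis (x j) - 1 - \<i> * of_real (x j)))\<^sup>2 \<le> (x j)\<^sup>2 * (\<Sum>j\<in>UNIV. (x j)\<^sup>2)" .
      qed
      also have "\<dots> = ((norm (gen V x))\<^sup>2)\<^sup>2"
        unfolding norm_gen[OF V] sum_distrib_right[symmetric] by (simp add: power2_eq_square)
      finally show ?thesis by (rule power2_le_imp_le) simp
    qed
    moreover have "sum x UNIV = 0"
    proof -
      have "cis (sum x UNIV) = 1" using U(1) det_opg[OF V, of x 1] by (simp add: Ux carrier_SU)
      then obtain n :: int where n: "sum x UNIV = 2 * pi * n" using cis_eq_1_imp by blast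
      have "\<bar>x j\<bar> \<le> 2 * r" for j using lower[of j] lt[of j] by linarith
      then have "\<bar>sum x UNIV\<bar> \<le> (\<Sum>j\<in>(UNIV::'d set). 2 * r)"
        by (intro order_trans[OF sum_abs] sum_mono)
      also have "\<dots> \<le> 2" by (simp add: r_def min_def field_simps)
      finally have "pi * \<bar>real_of_int n\<bar> \<le> 1" by (simp add: n abs_mult)
      moreover have "pi * 1 \<le> pi * \<bar>real_of_int n\<bar>" if "n \<noteq> 0"
        using that by (intro mult_left_mono) auto
      ultimately have "n = 0" using pi_gt3 by fastforce
      then show ?thesis using n by simp
    qed
    ultimately show ?thesis using V Ux by blast
  qed
  ultimately show ?thesis by blast
qed

section \<open>The quotient \<open>SU(d)/H\<close>\<close>

lemma continuous_on_det: "continuous_on S (det :: complex^'d^'d \<Rightarrow> complex)"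
  unfolding det_def by (intro continuous_intros)

lemma compact_unitary: "compact {V :: complex^'d^'d. unitary V}"
proof -
  have "closed {V :: complex^'d^'d. unitary V}"
    unfolding unitary_def by (intro closed_Collect_eq continuous_intros)
  moreover have "bounded {V :: complex^'d^'d. unitary V}"
    by (rule boundedI) (auto dest: norm_unitary_mat)
  ultimately show ?thesis by (simp add: compact_eq_bounded_closed)
qed

lemma compact_SU: "compact (carrier (SU :: (complex^'d^'d) monoid))"
proof -
  have "carrier SU = {V. unitary V} \<inter> {V :: complex^'d^'d. det V = 1}"
    by (auto simp: carrier_SU)
  moreover have "closed {V :: complex^'d^'d. det V = 1}"
    by (intro closed_Collect_eq continuous_on_det continuous_intros)
  ultimately show ?thesis by (metis compact_Int_closed compact_unitary)
qed

lemma trace_scaleR: "trace (r *\<^sub>R (A :: complex^'d^'d)) = r *\<^sub>R trace A"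
  by (simp add: trace_def scaleR_sum_right)

lemma subspace_su: "subspace (su :: (complex^'d^'d) set)"
  unfolding subspace_def su_def
  by (auto simp: conj_transpose_add conj_transpose_scaleR trace_add trace_scaleR trace_0 [simplified])

text \<open>A continuous surjection from a compact set acts as a quotient map: the graph of f is the
  compact image of \<open>K\<close> under (P, Q), and a closed graph over a compact range gives
  continuity. This brings homotopies down from redundant parametrisations.\<close>

lemma factor_through_compact:
  fixes P :: "'a::topological_space \<Rightarrow> 'b::euclidean_space" and Q :: "'a \<Rightarrow> 'c::euclidean_space"
  assumes "compact K" "continuous_on K P" "continuous_on K Q"
    and "\<And>k k'. k \<in> K \<Longrightarrow> k' \<in> K \<Longrightarrow> P k = P k' \<Longrightarrow> Q k = Q k'"
  shows "\<exists>f. continuous_on (P ` K) f \<and> (\<forall>k\<in>K. f (P k) = Q k)"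
proof -
  define f where "f y = Q (SOME k. k \<in> K \<and> P k = y)" for y
  have f: "f (P k) = Q k" if "k \<in> K" for k
  proof -
    have "\<exists>k'. k' \<in> K \<and> P k' = P k" using that by blast
    from someI_ex[OF this] show ?thesis unfolding f_def using assms(4)[OF _ that] by simp
  qed
  have "compact (Q ` K)" by (rule compact_continuous_image[OF assms(3,1)])
  moreover have "f \<in> P ` K \<rightarrow> Q ` K" by (rule funcsetI) (auto simp: f)
  moreover have "closed ((\<lambda>x. (x, f x)) ` P ` K)"
  proof -
    have eq: "(\<lambda>x. (x, f x)) ` P ` K = (\<lambda>k. (P k, Q k)) ` K"
      unfolding image_image by (rule image_cong) (simp_all add: f)
    have "compact ((\<lambda>k. (P k, Q k)) ` K)"
      by (rule compact_continuous_image[OF continuous_on_Pair[OF assms(2,3)] assms(1)])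
    then show ?thesis unfolding eq by (rule compact_imp_closed)
  qed
  ultimately have "continuous_on (P ` K) f" by (rule continuous_from_closed_graph)
  with f show ?thesis by (intro exI[of _ f] conjI ballI)
qed

text \<open>\<open>F\<close> is the projection to the quotient followed by the embedding, extended
  to an open set so that Frechet derivatives make sense at group elements; isometry is available on
  the tangent vectors \<open>g ** X\<close>. Points of \<open>N\<close> are handled through lifts,
  any two of which differ by right multiplication with an element of \<open>H\<close>.\<close>

locale SU_quotient =
  fixes c :: real and H :: "(complex^'d^'d) set" and N :: "'v::euclidean_space set"
    and F :: "complex^'d^'d \<Rightarrow> 'v" and U :: "(complex^'d^'d) set"
  assumes c: "c > 0"
    and H_SU: "H \<subseteq> carrier SU"
    and H_mult: "\<And>h k. h \<in> H \<Longrightarrow> k \<in> H \<Longrightarrow> h ** k \<in> H"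
    and H_inv: "\<And>h. h \<in> H \<Longrightarrow> conj_transpose h \<in> H"
    and H_one: "mat 1 \<in> H"
    and H_discrete: "\<exists>r>0. \<forall>h\<in>H. h \<noteq> mat 1 \<longrightarrow> r \<le> norm (h - mat 1)"
    and N: "N = F ` carrier SU"
    and F_eq_iff: "\<And>g g'. g \<in> carrier SU \<Longrightarrow> g' \<in> carrier SU \<Longrightarrow> F g = F g' \<longleftrightarrow> (\<exists>h\<in>H. g' = g ** h)"
    and U: "open U" "carrier SU \<subseteq> U"
    and F_diff: "F differentiable_on U"
    and F_C1: "\<And>v. continuous_on U (\<lambda>x. frechet_derivative F (at x) v)"
    and F_isometry: "\<And>g X Y. g \<in> carrier SU \<Longrightarrow> X \<in> su \<Longrightarrow> Y \<in> su \<Longrightarrow>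
      frechet_derivative F (at g) (g ** X) \<bullet> frechet_derivative F (at g) (g ** Y) = c * (X \<bullet> Y)"
begin

abbreviation "G \<equiv> carrier (SU :: (complex^'d^'d) monoid)"
abbreviation "DF g \<equiv> frechet_derivative F (at g)"

lemma F_has_derivative: "g \<in> G \<Longrightarrow> (F has_derivative DF g) (at g)"
  using F_diff U by (metis at_within_open differentiable_on_def frechet_derivative_works subsetD)

lemma bounded_linear_DF: "g \<in> G \<Longrightarrow> bounded_linear (DF g)"
  using F_has_derivative has_derivative_bounded_linear by blast

lemma continuous_on_F: "continuous_on G F"
  using F_diff U by (meson continuous_on_subset differentiable_imp_continuous_on)

text \<open>\<open>F_C1\<close> fixes the direction of differentiation. Expanding a varying
  direction in \<open>Basis\<close> and using linearity gives joint continuity.\<close>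

lemma continuous_on_DF:
  fixes S :: "'x::topological_space set"
  assumes "continuous_on S f" "continuous_on S A" "f ` S \<subseteq> G"
  shows "continuous_on S (\<lambda>x. DF (f x) (A x))"
proof -
  have "DF (f x) (A x) = (\<Sum>b\<in>Basis. (A x \<bullet> b) *\<^sub>R DF (f x) b)" if "x \<in> S" for x
  proof -
    interpret bounded_linear "DF (f x)" using assms(3) that bounded_linear_DF by blast
    have "DF (f x) (A x) = DF (f x) (\<Sum>b\<in>Basis. (A x \<bullet> b) *\<^sub>R b)" by (simp add: euclidean_representation)
    then show ?thesis by (simp only: sum scaleR)
  qed
  moreover have "continuous_on S (\<lambda>x. \<Sum>b\<in>Basis. (A x \<bullet> b) *\<^sub>R DF (f x) b)"
    using assms U by (intro continuous_intros continuous_on_compose2[OF F_C1]) auto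
  ultimately show ?thesis by (simp cong: continuous_on_cong_simp)
qed

lemma continuous_on_F_compose:
  "continuous_on S f \<Longrightarrow> f ` S \<subseteq> G \<Longrightarrow> continuous_on S (\<lambda>x. F (f x))"
  by (rule continuous_on_compose2[OF continuous_on_F])

lemma norm_DF: "g \<in> G \<Longrightarrow> X \<in> su \<Longrightarrow> norm (DF g (g ** X)) = sqrt c * norm X"
  using F_isometry[of g X X] c by (simp add: norm_eq_sqrt_inner real_sqrt_mult)

lemma F_curve:
  assumes "m t \<in> G" "(m has_vector_derivative m') (at t within S)"
  shows "((\<lambda>t. F (m t)) has_vector_derivative DF (m t) m') (at t within S)"
  using vector_derivative_diff_chain_within[of m m' t S F "DF (m t)"] assms
    F_has_derivative[OF assms(1)] by (simp add: o_def has_derivative_at_withinI)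

lemma F_right_H: "g \<in> G \<Longrightarrow> h \<in> H \<Longrightarrow> F (g ** h) = F g"
  using F_eq_iff[of g "g ** h"] H_SU SU_mult by (metis subsetD)

lemma unitary_G: "g \<in> G \<Longrightarrow> unitary g"
  by (simp add: carrier_SU)

lemma unitary_H: "h \<in> H \<Longrightarrow> unitary h"
  using H_SU unitary_G by blast

section \<open>Nearby points of the quotient and short geodesics\<close>

lemma compact_N: "compact N"
  unfolding N by (intro compact_continuous_image continuous_on_F compact_SU)

text \<open>The pairs (g, g') with g at distance at least \<epsilon> from every point of g'H form a
  compact set on which F g and F g' differ, hence differ by a positive minimum. Closeness below that
  minimum yields close lifts.\<close>

lemma near_lifts:
  assumes "\<epsilon> > 0"
  shows "\<exists>\<rho>>0. \<forall>p\<in>N. \<forall>q\<in>N. norm (p - q) < \<rho> \<longrightarrow> (\<exists>g\<in>G. \<exists>g'\<in>G. p = F g \<and> q = F g' \<and> norm (g - g') < \<epsilon>)"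
proof -
  define K where "K = (G \<times> G) \<inter> (\<Inter>h\<in>H. {x. \<epsilon> \<le> norm (fst x - snd x ** h)})"
  have "compact K" unfolding K_def
    by (intro compact_Int_closed compact_Times compact_SU closed_INT ballI closed_Collect_le continuous_intros)
  have cont: "continuous_on K (\<lambda>x. norm (F (fst x) - F (snd x)))"
    by (intro continuous_intros continuous_on_F_compose) (auto simp: K_def)
  have pos: "norm (F (fst x) - F (snd x)) > 0" if x: "x \<in> K" for x
  proof (rule ccontr)
    assume "\<not> ?thesis"
    then have "F (snd x) = F (fst x)" by simp
    then obtain h where "h \<in> H" "fst x = snd x ** h"
      using F_eq_iff[of "snd x" "fst x"] x by (auto simp: K_def)
    then show False using x assms by (auto simp: K_def)
  qed
  obtain \<rho> where \<rho>: "\<rho> > 0" "\<And>x. x \<in> K \<Longrightarrow> \<rho> \<le> norm (F (fst x) - F (snd x))"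
  proof (cases "K = {}")
    case True then show ?thesis using that[of 1] by simp
  next
    case False
    then obtain x where "x \<in> K" "\<forall>y\<in>K. norm (F (fst x) - F (snd x)) \<le> norm (F (fst y) - F (snd y))"
      using continuous_attains_inf[OF \<open>compact K\<close> False cont] by blast
    then show ?thesis using that pos by blast
  qed
  have "\<exists>g\<in>G. \<exists>g'\<in>G. p = F g \<and> q = F g' \<and> norm (g - g') < \<epsilon>"
    if pq: "p \<in> N" "q \<in> N" "norm (p - q) < \<rho>" for p q
  proof -
    obtain g g' where g: "g \<in> G" "g' \<in> G" "p = F g" "q = F g'" using pq N by auto
    have "(g, g') \<notin> K" using \<rho>(2)[of "(g, g')"] pq g by auto
    then obtain h where h: "h \<in> H" "norm (g - g' ** h) < \<epsilon>" using g by (auto simp: K_def not_le)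
    have "g' ** h \<in> G" "F (g' ** h) = q" using h g H_SU SU_mult F_right_H by auto
    then show ?thesis using g h by metis
  qed
  then show ?thesis using \<rho>(1) by blast
qed

text \<open>The threshold is the same for all base points because (g, Y) ->
  \<open>DF g (g ** Y)\<close> is uniformly continuous on the product of the group with the unit
  ball. The remainder is estimated along the curve s -> g exp(sX).\<close>

lemma F_first_order:
  assumes "\<epsilon> > 0"
  shows "\<exists>r>0. \<forall>g\<in>G. \<forall>V x. unitary V \<and> sum x UNIV = 0 \<and> norm (gen V x) < r \<longrightarrow>
    norm (F (g ** opg V x 1) - F g - DF g (g ** gen V x)) \<le> \<epsilon> * norm (gen V x)"
proof -
  let ?D = "\<lambda>x. DF (fst x) (fst x ** snd x)"
  have "continuous_on (G \<times> cball 0 1) ?D"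
    by (rule continuous_on_DF) (auto intro!: continuous_intros)
  then have "uniformly_continuous_on (G \<times> cball 0 1) ?D"
    by (rule compact_uniformly_continuous) (intro compact_Times compact_SU compact_cball)
  from this[unfolded uniformly_continuous_on_def, rule_format, OF assms] obtain r where r: "r > 0" and
    ucD: "\<And>a b. a \<in> G \<times> cball 0 1 \<Longrightarrow> b \<in> G \<times> cball 0 1 \<Longrightarrow> dist b a < r \<Longrightarrow> dist (?D b) (?D a) < \<epsilon>"
    by blast
  have uc: "norm (DF g' (g' ** Y) - DF g (g ** Y)) < \<epsilon>"
    if "g \<in> G" "g' \<in> G" "norm Y \<le> 1" "norm (g' - g) < r" for g g' Y
    using ucD[of "(g, Y)" "(g', Y)"] that by (auto simp: dist_norm norm_Pair)
  have "norm (F (g ** opg V x 1) - F g - DF g (g ** gen V x)) \<le> \<epsilon> * norm (gen V x)"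
    if g: "g \<in> G" and V: "unitary V" "sum x UNIV = 0" and small: "norm (gen V x) < r" for g V x
  proof (cases "gen V x = 0")
    case True
    have "opg V x 1 = mat 1" using norm_opg_minus_1[OF V(1), of x 1] True by simp
    then show ?thesis
      using True by (simp add: linear_0[OF bounded_linear.linear[OF bounded_linear_DF[OF g]]]
          bounded_bilinear.zero_right[OF bounded_bilinear_matrix_mult])
  next
    case False
    let ?X = "gen V x" let ?m = "\<lambda>s. g ** opg V x s"
    have mG: "?m s \<in> G" for s using g V by (simp add: SU_mult opg_SU)
    have der: "((\<lambda>s. F (?m s)) has_vector_derivative DF (?m s) (?m s ** ?X)) (at s within {0..1})" for s
    proof -
      have "(?m has_vector_derivative ?m s ** ?X) (at s)"
        using bounded_linear.has_vector_derivative[OF bounded_bilinear.bounded_linear_right[OF bounded_bilinear_matrix_mult]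
            has_vector_derivative_opg[OF V(1)], of g]
        by (simp add: opg_gen_commute[OF V(1), symmetric] matrix_mul_assoc)
      then show ?thesis by (rule F_curve[OF mG has_vector_derivative_at_within])
    qed
    have "norm (F (?m 1) - F (?m 0) - (1 - 0) *\<^sub>R DF (?m 0) (?m 0 ** ?X)) \<le> norm (1 - 0 :: real) * (\<epsilon> * norm ?X)"
    proof (rule vector_differentiable_bound_linearization[where S = "{0..1}" and a = 0 and b = 1 and ?x0.0 = 0
          and f = "\<lambda>s. F (?m s)" and f' = "\<lambda>s. DF (?m s) (?m s ** ?X)" and B = "\<epsilon> * norm ?X"])
      show "((\<lambda>s. F (?m s)) has_vector_derivative DF (?m s) (?m s ** ?X)) (at s within {0..1})" for s
        by (rule der)
    next
      fix s :: real assume s: "s \<in> {0..1}"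
      \<comment> \<open>Uniform continuity is available on the unit ball of directions; normalising
        makes the error proportional to the norm of \<open>gen V x\<close>.\<close>
      define Y where "Y = (1 / norm ?X) *\<^sub>R ?X"
      have XY: "?X = norm ?X *\<^sub>R Y" and Y1: "norm Y \<le> 1" using False by (simp_all add: Y_def)
      have DX: "DF h (h ** ?X) = norm ?X *\<^sub>R DF h (h ** Y)" if "h \<in> G" for h
        by (subst XY) (simp add: scaleR_matrix_mult linear_scale[OF bounded_linear.linear[OF bounded_linear_DF[OF that]]])
      have "norm (?m s - ?m 0) = norm (g ** (opg V x s - mat 1))"
        by (simp add: opg_0[OF V(1)] matrix_mult_diff_right)
      also have "\<dots> = norm (opg V x s - mat 1)" using unitary_G[OF g] by simp
      also have "\<dots> \<le> \<bar>s\<bar> * norm ?X" by (rule norm_opg_minus_1[OF V(1)])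
      also have "\<dots> \<le> norm ?X" using s by (simp add: mult_left_le_one_le)
      finally have "norm (?m s - ?m 0) < r" using small by simp
      then have "norm (DF (?m s) (?m s ** Y) - DF (?m 0) (?m 0 ** Y)) \<le> \<epsilon>"
        using uc[OF mG mG Y1] less_imp_le by blast
      then have "norm ?X * norm (DF (?m s) (?m s ** Y) - DF (?m 0) (?m 0 ** Y)) \<le> norm ?X * \<epsilon>"
        by (rule mult_left_mono) simp
      then show "norm (DF (?m s) (?m s ** ?X) - DF (?m 0) (?m 0 ** ?X)) \<le> \<epsilon> * norm ?X"
        unfolding DX[OF mG] scaleR_diff_right [symmetric] by (simp add: mult.commute)
    qed (auto simp: closed_segment_eq_real_ivl)
    then show ?thesis by (simp add: opg_0[OF V(1)])
  qed
  then show ?thesis using r by blast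
qed

text \<open>Left translation is an isometry, so the logarithm near the identity serves near every
  point.\<close>

lemma SU_log_near_two:
  "\<exists>r>0. \<forall>g\<in>G. \<forall>g'\<in>G. norm (g - g') < r \<longrightarrow>
    (\<exists>V x. unitary V \<and> sum x UNIV = 0 \<and> g' = g ** opg V x 1 \<and> norm (gen V x) \<le> 2 * norm (g - g'))"
proof -
  obtain r where r: "r > 0" "\<And>u. u \<in> G \<Longrightarrow> norm (u - mat 1) < r \<Longrightarrow>
    \<exists>V x. unitary V \<and> sum x UNIV = 0 \<and> u = opg V x 1 \<and> norm (gen V x) \<le> 2 * norm (u - mat 1)"
    using SU_log_near by metis
  have "\<exists>V x. unitary V \<and> sum x UNIV = 0 \<and> g' = g ** opg V x 1 \<and> norm (gen V x) \<le> 2 * norm (g - g')"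
    if g: "g \<in> G" "g' \<in> G" "norm (g - g') < r" for g g'
  proof -
    let ?u = "conj_transpose g ** g'"
    have ug: "unitary g" using g by (simp add: unitary_G)
    have "?u \<in> G" using g by (simp add: SU_mult SU_conj_transpose)
    moreover have "norm (?u - mat 1) = norm (g - g')"
    proof -
      have "norm (?u - mat 1) = norm (g ** (?u - mat 1))" using ug by simp
      also have "\<dots> = norm (g' - g)" by (simp add: matrix_mult_diff_right unitary_cancel[OF ug])
      finally show ?thesis by (simp add: norm_minus_commute)
    qed
    moreover have "g' = g ** ?u" by (simp add: unitary_cancel[OF ug])
    ultimately show ?thesis using r(2)[of ?u] g(3) by metis
  qed
  then show ?thesis using r(1) by blast
qed

text \<open>Arc and chord agree to first order, since \<open>DF\<close> multiplies lengths by
  \<open>sqrt c\<close> with a uniformly small remainder. Euclidean distances between vertices thus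
  bound lengths of polygons in \<open>N\<close>.\<close>

lemma short_geodesics:
  assumes "\<eta> > 0"
  shows "\<exists>\<rho>>0. \<forall>p\<in>N. \<forall>q\<in>N. norm (p - q) < \<rho> \<longrightarrow>
    (\<exists>g V x. g \<in> G \<and> unitary V \<and> sum x UNIV = 0 \<and> p = F g \<and> q = F (g ** opg V x 1) \<and>
       sqrt c * norm (gen V x) \<le> (1 + \<eta>) * norm (p - q))"
proof -
  \<comment> \<open>Chosen so that (sqrt c - \<epsilon>)(1 + \<eta>) = sqrt c: absorbing the
    first-order error costs exactly the factor 1 + \<eta>.\<close>
  define \<epsilon> where "\<epsilon> = sqrt c * \<eta> / (1 + \<eta>)"
  have "\<epsilon> > 0" using assms c by (simp add: \<epsilon>_def)
  then obtain r where r: "r > 0" and first: "\<And>g V x. g \<in> G \<Longrightarrow> unitary V \<Longrightarrow> sum x UNIV = 0 \<Longrightarrow> norm (gen V x) < r \<Longrightarrow>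
    norm (F (g ** opg V x 1) - F g - DF g (g ** gen V x)) \<le> \<epsilon> * norm (gen V x)"
    using F_first_order by metis
  obtain r' where r': "r' > 0" and log: "\<And>g g'. g \<in> G \<Longrightarrow> g' \<in> G \<Longrightarrow> norm (g - g') < r' \<Longrightarrow>
    \<exists>V x. unitary V \<and> sum x UNIV = 0 \<and> g' = g ** opg V x 1 \<and> norm (gen V x) \<le> 2 * norm (g - g')"
    using SU_log_near_two by metis
  have "min r' (r / 2) > 0" using r r' by simp
  from near_lifts[OF this] obtain \<rho> where "\<rho> > 0" and \<rho>: "\<And>p q. p \<in> N \<Longrightarrow> q \<in> N \<Longrightarrow> norm (p - q) < \<rho> \<Longrightarrow>
    \<exists>g\<in>G. \<exists>g'\<in>G. p = F g \<and> q = F g' \<and> norm (g - g') < min r' (r / 2)" by metis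
  have "\<exists>g V x. g \<in> G \<and> unitary V \<and> sum x UNIV = 0 \<and> p = F g \<and> q = F (g ** opg V x 1) \<and>
       sqrt c * norm (gen V x) \<le> (1 + \<eta>) * norm (p - q)"
    if pq: "p \<in> N" "q \<in> N" "norm (p - q) < \<rho>" for p q
  proof -
    obtain g g' where g: "g \<in> G" "g' \<in> G" "p = F g" "q = F g'" and gg: "norm (g - g') < min r' (r/2)"
      using \<rho>[OF pq] by blast
    obtain V x where V: "unitary V" "sum x UNIV = 0" and g': "g' = g ** opg V x 1"
      and le: "norm (gen V x) \<le> 2 * norm (g - g')"
      using log[OF g(1,2)] gg by auto
    have "norm (gen V x) < r" using le gg by simp
    from first[OF g(1) V this] have "norm (q - p - DF g (g ** gen V x)) \<le> \<epsilon> * norm (gen V x)"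
      by (simp add: g g')
    moreover have "norm (DF g (g ** gen V x)) = sqrt c * norm (gen V x)"
      using V by (intro norm_DF g) (simp add: gen_in_su)
    moreover have "norm (DF g (g ** gen V x)) \<le> norm (q - p) + norm (q - p - DF g (g ** gen V x))"
      by (metis norm_triangle_sub norm_minus_commute)
    ultimately have "sqrt c * norm (gen V x) \<le> norm (p - q) + \<epsilon> * norm (gen V x)"
      by (simp add: norm_minus_commute)
    then have "(1 + \<eta>) * (sqrt c * norm (gen V x)) \<le> (1 + \<eta>) * (norm (p - q) + \<epsilon> * norm (gen V x))"
      using assms by (intro mult_left_mono) auto
    also have "\<dots> = (1 + \<eta>) * norm (p - q) + \<eta> * (sqrt c * norm (gen V x))"
      using assms by (simp add: \<epsilon>_def field_simps)
    finally show ?thesis using g V g' by (auto simp: algebra_simps)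
  qed
  then show ?thesis using \<open>\<rho> > 0\<close> by blast
qed

section \<open>The covering of the quotient by SU(d)\<close>

lemma H_discrete_two:
  "\<exists>r>0. \<forall>g\<in>G. \<forall>h\<in>H. \<forall>k\<in>H. norm (g ** h - g ** k) < r \<longrightarrow> h = k"
proof -
  obtain r where r: "r > 0" "\<And>h. h \<in> H \<Longrightarrow> h \<noteq> mat 1 \<Longrightarrow> r \<le> norm (h - mat 1)"
    using H_discrete by blast
  have "h = k" if "g \<in> G" "h \<in> H" "k \<in> H" "norm (g ** h - g ** k) < r" for g h k
  proof -
    have uh: "unitary h" "unitary g" using that unitary_H unitary_G by auto
    \<comment> \<open>Unitary factors preserve the norm, so the gap around the identity reappears
      with the same size in every coset.\<close>
    have "norm (conj_transpose h ** k - mat 1) = norm (g ** (h ** (conj_transpose h ** k - mat 1)))"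
      using uh by simp
    also have "\<dots> = norm (g ** h - g ** k)"
      by (simp add: matrix_mult_diff_right unitary_cancel[OF uh(1)] norm_minus_commute)
    finally have "conj_transpose h ** k = mat 1" using r(2)[of "conj_transpose h ** k"] that H_mult H_inv by fastforce
    then have "h ** (conj_transpose h ** k) = h" by simp
    then show ?thesis by (simp add: unitary_cancel[OF uh(1)])
  qed
  then show ?thesis using r(1) by blast
qed

text \<open>\<open>R\<close> is the complement of the union of all translates of \<open>W\<close> by
  \<open>H\<close>. Its image is compact, hence closed, and is exactly what the image of
  \<open>W\<close> misses.\<close>

lemma openin_F_image:
  assumes "openin (top_of_set G) W" shows "openin (top_of_set N) (F ` W)"
proof -
  have W: "W \<subseteq> G" using assms openin_imp_subset by blast
  have "openin (top_of_set G) ((\<lambda>g. g ** conj_transpose h) -` W \<inter> G)" if "h \<in> H" for h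
  proof -
    have "continuous_on G (\<lambda>g. g ** conj_transpose h)" by (intro continuous_intros)
    moreover have "(\<lambda>g. g ** conj_transpose h) \<in> G \<rightarrow> G" using H_inv[OF that] H_SU SU_mult by auto
    ultimately show ?thesis using assms by (metis continuous_openin_preimage Int_commute)
  qed
  then have op: "openin (top_of_set G) (\<Union>h\<in>H. (\<lambda>g. g ** conj_transpose h) -` W \<inter> G)" by blast
  define R where "R = G - (\<Union>h\<in>H. (\<lambda>g. g ** conj_transpose h) -` W \<inter> G)"
  have "closedin (top_of_set G) R" unfolding R_def using op by (simp add: closedin_diff)
  then have "compact R" using compact_SU closedin_compact by blast
  then have "closed (F ` R)"
    by (intro compact_imp_closed compact_continuous_image continuous_on_subset[OF continuous_on_F]) (auto simp: R_def)
  moreover have "F ` W = N - F ` R"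
  proof (intro equalityI subsetI)
    fix y assume "y \<in> F ` W"
    then obtain w where w: "w \<in> W" "y = F w" by blast
    have "y \<notin> F ` R"
    proof
      assume "y \<in> F ` R"
      then obtain g where g: "g \<in> R" "F g = F w" using w by auto
      then obtain h where h: "h \<in> H" "g = w ** h" using F_eq_iff[of w g] w W by (auto simp: R_def)
      then have "g ** conj_transpose h = w" using unitary_H unitary_cancel by metis
      then show False using g h w by (auto simp: R_def)
    qed
    then show "y \<in> N - F ` R" using w W N by auto
  next
    fix y assume y: "y \<in> N - F ` R"
    then obtain g where g: "g \<in> G" "y = F g" using N by auto
    then have "g \<notin> R" using y by blast
    then obtain h where "h \<in> H" "g ** conj_transpose h \<in> W" using g by (auto simp: R_def)
    then show "y \<in> F ` W" using g H_inv F_right_H by (metis image_eqI)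
  qed
  moreover have "F ` R \<subseteq> N" by (auto simp: R_def N)
  ultimately show ?thesis by (metis closed_subset openin_diff openin_subtopology_self)
qed

text \<open>The sheets over a small neighbourhood are balls around the points g h, permuted
  isometrically by right multiplication with \<open>H\<close>.\<close>

theorem covering_space_F: "covering_space G F N"
proof
  show "continuous_on G F" by (rule continuous_on_F)
  show "F ` G = N" by (simp add: N)
  fix y assume "y \<in> N"
  then obtain g where g: "g \<in> G" "y = F g" using N by auto
  obtain r where r: "r > 0" "\<And>g h k. g \<in> G \<Longrightarrow> h \<in> H \<Longrightarrow> k \<in> H \<Longrightarrow> norm (g ** h - g ** k) < r \<Longrightarrow> h = k"
    using H_discrete_two by metis
  \<comment> \<open>Points of a sheet lie within r/4 of its centre, so a comparison through two of
    them costs less than r/2. This stays below the gap r and gives both the disjointness of the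
    sheets and the injectivity of \<open>F\<close> on each.\<close>
  define W where "W h = ball (g ** h) (r/4) \<inter> G" for h
  have opW: "openin (top_of_set G) (W h)" for h
    unfolding W_def by (simp add: openin_open_Int Int_commute)
  have Wmult: "a ** k \<in> W (h ** k)" if "a \<in> W h" "k \<in> H" for a h k
  proof -
    have "norm (g ** (h ** k) - a ** k) = norm ((g ** h - a) ** k)"
      by (simp add: matrix_mult_diff_left matrix_mul_assoc)
    also have "\<dots> = norm (g ** h - a)" using unitary_H that by simp
    finally show ?thesis using that H_SU SU_mult by (auto simp: W_def dist_norm)
  qed
  define T where "T = F ` W (mat 1)"
  have image: "F ` W h = T" if "h \<in> H" for h
  proof (intro equalityI subsetI)
    fix y assume "y \<in> F ` W h"
    then obtain a where a: "a \<in> W h" "y = F a" by auto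
    have "h ** conj_transpose h = mat 1" using that unitary_H unitaryD by blast
    then have "a ** conj_transpose h \<in> W (mat 1)"
      using Wmult[OF a(1) H_inv[OF that]] by simp
    moreover have "F (a ** conj_transpose h) = y"
      using a F_right_H[OF _ H_inv[OF that]] by (auto simp: W_def)
    ultimately
    show "y \<in> T" unfolding T_def by blast
  next
    fix y assume "y \<in> T"
    then obtain a where a: "a \<in> W (mat 1)" "y = F a" by (auto simp: T_def)
    then have "a ** h \<in> W h" "F (a ** h) = y"
      using Wmult[of a "mat 1" h] that F_right_H by (auto simp: W_def)
    then show "y \<in> F ` W h" by blast
  qed
  have close: "norm (g ** h - a) < r / 4" if "a \<in> W h" for a h
    using that by (simp add: W_def dist_norm)
  show "\<exists>T. y \<in> T \<and> openin (top_of_set N) T \<and> (\<exists>v. \<Union>v = G \<inter> F -` T \<and>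
      (\<forall>u\<in>v. openin (top_of_set G) u) \<and> pairwise disjnt v \<and> (\<forall>u\<in>v. \<exists>q. homeomorphism u T F q))"
  proof (intro exI conjI)
    show "y \<in> T" using g r(1) by (auto simp: T_def W_def)
    show "openin (top_of_set N) T" unfolding T_def by (rule openin_F_image[OF opW])
    show "\<Union>(W ` H) = G \<inter> F -` T"
    proof (intro equalityI subsetI)
      fix a assume "a \<in> \<Union>(W ` H)"
      then obtain h where h: "h \<in> H" "a \<in> W h" by blast
      then show "a \<in> G \<inter> F -` T" using image[OF h(1)] by (auto simp: W_def)
    next
      fix a assume a: "a \<in> G \<inter> F -` T"
      then obtain b where b: "b \<in> W (mat 1)" "F b = F a" by (auto simp: T_def)
      then obtain h where "h \<in> H" "a = b ** h" using F_eq_iff[of b a] a by (auto simp: W_def)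
      then show "a \<in> \<Union>(W ` H)" using Wmult[OF b(1), of h] by auto
    qed
    show "\<forall>u\<in>W ` H. openin (top_of_set G) u" using opW by blast
    show "pairwise disjnt (W ` H)"
    proof (rule pairwiseI)
      fix A B assume "A \<in> W ` H" "B \<in> W ` H" "A \<noteq> B"
      then obtain h k where hk: "h \<in> H" "k \<in> H" "A = W h" "B = W k" "h \<noteq> k" by auto
      have False if "a \<in> W h" "a \<in> W k" for a
      proof -
        have "norm (g ** h - g ** k) \<le> norm (g ** h - a) + norm (g ** k - a)"
          using norm_triangle_ineq4[of "g ** h - a" "g ** k - a"] by simp
        then have "norm (g ** h - g ** k) < r" using close[OF that(1)] close[OF that(2)] r(1) by linarith
        then show False using r(2)[OF g(1)] hk by blast
      qed
      then show "disjnt A B" using hk by (auto simp: disjnt_def)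
    qed
    show "\<forall>u\<in>W ` H. \<exists>q. homeomorphism u T F q"
    proof
      fix u assume "u \<in> W ` H"
      then obtain h where h: "h \<in> H" "u = W h" by auto
      show "\<exists>q. homeomorphism u T F q"
      proof (rule homeomorphism_injective_open_map[of u F T])
        have uG: "u \<subseteq> G" using h by (auto simp: W_def)
        show "continuous_on u F" by (rule continuous_on_subset[OF continuous_on_F uG])
        show "F ` u = T" using image h by simp
        show "inj_on F u"
        proof (rule inj_onI)
          fix a b assume ab: "a \<in> u" "b \<in> u" "F a = F b"
          then have "a \<in> G" "b \<in> G" using h by (auto simp: W_def)
          then obtain k where k: "k \<in> H" "b = a ** k" using F_eq_iff ab by blast
          have "norm (a ** mat 1 - a ** k) \<le> norm (g ** h - a) + norm (g ** h - b)"
            using norm_triangle_ineq4[of "g ** h - b" "g ** h - a"] k(2) by simp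
          then have "norm (a ** mat 1 - a ** k) < r" using close[of a h] close[of b h] ab h r(1) by simp
          then have "k = mat 1" using r(2)[OF \<open>a \<in> G\<close> H_one k(1)] by simp
          then show "a = b" using k(2) by simp
        qed
        show "openin (top_of_set T) (F ` V)" if "openin (top_of_set u) V" for V
        proof -
          have "openin (top_of_set G) u" using opW h by simp
          then have "openin (top_of_set G) V" by (rule openin_trans[OF that])
          then have "openin (top_of_set N) (F ` V)" by (rule openin_F_image)
          moreover have "F ` V \<subseteq> T"
            using openin_imp_subset[OF that] image[OF h(1)] h(2) by blast
          moreover have "T \<subseteq> N" by (auto simp: T_def N W_def)
          ultimately show ?thesis by (rule openin_subset_trans)
        qed
      qed blast
    qed
  qed
qed

end

section \<open>Loops and homotopies\<close>

lemma cis_eq_imp: "cis a = cis b \<Longrightarrow> \<exists>n::int. a = b + 2 * pi * n"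
  using cis_eq_1_imp[of "a - b"] by (auto simp: cis_divide [symmetric] algebra_simps)

lemma periodic_add_int:
  assumes "\<And>t. f (t + 2*pi) = f t"
  shows "f (t + 2 * pi * of_int n) = f t"
proof -
  have nat: "f (t + 2 * pi * real k) = f t" for t and k :: nat
  proof (induction k)
    case (Suc k)
    have "t + 2 * pi * real (Suc k) = (t + 2 * pi * real k) + 2 * pi" by (simp add: algebra_simps)
    then show ?case by (simp only: assms Suc)
  qed simp
  show ?thesis
  proof (cases "n \<ge> 0")
    case True then show ?thesis using nat[of t "nat n"] by simp
  next
    case False then show ?thesis using nat[of "t + 2 * pi * of_int n" "nat (- n)"] by simp
  qed
qed

lemma periodic_cis:
  assumes "\<And>t. f (t + 2*pi) = f t" "cis a = cis b"
  shows "f a = f b"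
  using cis_eq_imp[OF assms(2)] periodic_add_int[of f, OF assms(1)] by blast

lemma cis_Arg2pi: "z \<in> sphere 0 1 \<Longrightarrow> cis (Arg2pi z) = z"
  using complex_norm_eq_1_exp by (simp add: cis_conv_exp)

lemma periodic_Arg2pi_cis:
  assumes "\<And>t. f (t + 2*pi) = f t"
  shows "f (Arg2pi (cis t)) = f t"
  by (rule periodic_cis[of f, OF assms]) (simp add: cis_Arg2pi)

lemma homotopic_mapsI:
  assumes "continuous_on ({0..1::real} \<times> sphere 0 1) h" "h ` ({0..1} \<times> sphere 0 1) \<subseteq> N"
    and "\<And>z. z \<in> sphere 0 1 \<Longrightarrow> h (0, z) = \<alpha> z" "\<And>z. z \<in> sphere 0 1 \<Longrightarrow> h (1, z) = \<beta> z"
  shows "homotopic_maps N \<alpha> \<beta>"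
proof -
  have "prod_topology (top_of_set {0..1::real}) (top_of_set (sphere (0::complex) 1)) = top_of_set ({0..1} \<times> sphere 0 1)"
    by (rule prod_topology_subtopology_eu)
  then have "continuous_map (prod_topology (top_of_set {0..1}) (top_of_set (sphere 0 1))) (top_of_set N) h"
    using assms(1,2) by (simp only: continuous_map_in_subtopology continuous_map_iff_continuous topspace_euclidean_subtopology)
       (auto simp: image_subset_iff_funcset)
  then have "\<exists>h. continuous_map (prod_topology (top_of_set {0..1::real}) (top_of_set (sphere 0 1))) (top_of_set N) h \<and>
     (\<forall>x\<in>topspace (top_of_set (sphere 0 1)). h (0, x) = \<alpha> x) \<and>
     (\<forall>x\<in>topspace (top_of_set (sphere 0 1)). h (1, x) = \<beta> x) \<and> (\<forall>t\<in>{0..1::real}. True)"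
    using assms(3,4) by (intro exI[of _ h]) simp
  then show ?thesis by (intro homotopic_with[THEN iffD2]) simp_all
qed

text \<open>A homotopy that is periodic in the angle descends to the circle because the angle map is
  a quotient map on the compact rectangle. Homotopies can then be written with real angles.\<close>

lemma homotopic_maps_periodic:
  fixes N :: "'v::euclidean_space set" and f :: "real \<times> real \<Rightarrow> 'v"
  assumes "continuous_on ({0..1} \<times> UNIV) f" "\<And>s t. s \<in> {0..1} \<Longrightarrow> f (s, t) \<in> N"
    and per: "\<And>s t. s \<in> {0..1} \<Longrightarrow> f (s, t + 2*pi) = f (s, t)"
    and "\<And>t. \<alpha> (cis t) = f (0, t)" "\<And>t. \<beta> (cis t) = f (1, t)"
  shows "homotopic_maps N \<alpha> \<beta>"
proof -
  let ?K = "{0..1::real} \<times> {0..2*pi}" and ?P = "\<lambda>x::real \<times> real. (fst x, cis (snd x))"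
  have "\<exists>h. continuous_on (?P ` ?K) h \<and> (\<forall>k\<in>?K. h (?P k) = f k)"
  proof (rule factor_through_compact)
    show "compact ?K" by (intro compact_Times compact_Icc)
    show "continuous_on ?K ?P" by (intro continuous_intros)
    show "continuous_on ?K f" by (rule continuous_on_subset[OF assms(1)]) auto
    fix k k' assume k: "k \<in> ?K" "k' \<in> ?K" "?P k = ?P k'"
    have "f (fst k, snd k) = f (fst k, snd k')"
      by (rule periodic_cis[of "\<lambda>t. f (fst k, t)"]) (use k per in auto)
    then show "f k = f k'" using k by simp
  qed
  then obtain h where h: "continuous_on (?P ` ?K) h" "\<And>k. k \<in> ?K \<Longrightarrow> h (?P k) = f k" by blast
  have Pz: "(s, z) = ?P (s, Arg2pi z)" "(s, Arg2pi z) \<in> ?K" if "s \<in> {0..1}" "z \<in> sphere 0 1" for s z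
    using that Arg2pi[of z] by (auto simp: cis_Arg2pi less_imp_le)
  have sub: "{0..1} \<times> sphere 0 1 \<subseteq> ?P ` ?K"
  proof
    fix y :: "real \<times> complex" assume "y \<in> {0..1} \<times> sphere 0 1"
    then obtain s z where y: "y = (s, z)" "s \<in> {0..1}" "z \<in> sphere 0 1" by blast
    show "y \<in> ?P ` ?K" unfolding y(1) by (rule image_eqI[where x = "(s, Arg2pi z)"]) (use Pz[OF y(2,3)] in auto)
  qed
  have hz: "h (s, z) = f (s, Arg2pi z)" if "s \<in> {0..1}" "z \<in> sphere 0 1" for s z
    using h(2)[OF Pz(2)[OF that]] Pz(1)[OF that] by simp
  show ?thesis
  proof (rule homotopic_mapsI)
    show "continuous_on ({0..1} \<times> sphere 0 1) h" by (rule continuous_on_subset[OF h(1) sub])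
    show "h ` ({0..1} \<times> sphere 0 1) \<subseteq> N" using hz assms(2) by auto
    fix z :: complex assume z: "z \<in> sphere 0 1"
    show "h (0, z) = \<alpha> z" "h (1, z) = \<beta> z"
      using hz[OF _ z] assms(4,5)[of "Arg2pi z"] cis_Arg2pi[OF z] by auto
  qed
qed

section \<open>Homotopy of uniformly close loops\<close>

lemma continuous_on_opg_joint:
  assumes "continuous_on S V" "\<And>j. continuous_on S (\<lambda>z. x z j)" "continuous_on S t"
  shows "continuous_on S (\<lambda>z. opg (V z) (x z) (t z))"
  unfolding opg_def
  by (intro continuous_on_matrix_mult continuous_on_cdiag continuous_on_conj_transpose
      continuous_on_cis continuous_on_mult assms)

lemma norm_gen_le:
  assumes "unitary V" "\<And>j. \<bar>x j\<bar> \<le> b"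
  shows "norm (gen (V :: complex^'d^'d) x) \<le> real CARD('d) * b"
proof (rule power2_le_imp_le)
  obtain k :: 'd where True by simp
  have b: "0 \<le> b" using assms(2)[of k] by linarith
  have "(norm (gen V x))\<^sup>2 \<le> (\<Sum>j\<in>(UNIV::'d set). b\<^sup>2)"
    unfolding norm_gen[OF assms(1)] using assms(2) b by (intro sum_mono) (metis abs_ge_zero power2_abs power_mono)
  also have "\<dots> = real CARD('d) * b\<^sup>2 * 1" by simp
  also have "\<dots> \<le> real CARD('d) * b\<^sup>2 * real CARD('d)"
    by (intro mult_left_mono) (simp_all add: Suc_leI)
  also have "\<dots> = (real CARD('d) * b)\<^sup>2" by (simp add: power2_eq_square)
  finally show "(norm (gen V x))\<^sup>2 \<le> (real CARD('d) * b)\<^sup>2" .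
  show "0 \<le> real CARD('d) * b" using b by simp
qed

lemma le_norm_gen: "unitary V \<Longrightarrow> \<bar>x j\<bar> \<le> norm (gen V x)"
proof (rule power2_le_imp_le)
  assume V: "unitary V"
  have "\<bar>x j\<bar>\<^sup>2 \<le> (\<Sum>j\<in>UNIV. (x j)\<^sup>2)" using member_le_sum[of j UNIV "\<lambda>j. (x j)\<^sup>2"] by simp
  then show "\<bar>x j\<bar>\<^sup>2 \<le> (norm (gen V x))\<^sup>2" by (simp add: norm_gen[OF V])
qed simp

context SU_quotient
begin

lemma F_eqE:
  assumes "F g = F g'" "g \<in> G" "g' \<in> G"
  obtains h where "h \<in> H" "g' = g ** h"
  using assms F_eq_iff by blast

text \<open>The homotopy runs along the short geodesics \<open>s \<mapsto> F (g exp (sX))\<close> from \<open>\<alpha> z = F g\<close> to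
  \<open>\<beta> z = F (g exp X)\<close>, which depend continuously on their end points.\<close>

lemma close_loops_homotopic:
  "\<exists>\<delta>>0. \<forall>\<alpha> \<beta>. continuous_on (sphere 0 1) \<alpha> \<and> continuous_on (sphere 0 1) \<beta> \<and> \<alpha> ` sphere 0 1 \<subseteq> N \<and>
    \<beta> ` sphere 0 1 \<subseteq> N \<and> (\<forall>z\<in>sphere 0 1. norm (\<alpha> z - \<beta> z) < \<delta>) \<longrightarrow> homotopic_maps N \<alpha> \<beta>"
proof -
  obtain r where r: "r > 0" "\<And>g h k. g \<in> G \<Longrightarrow> h \<in> H \<Longrightarrow> k \<in> H \<Longrightarrow> norm (g ** h - g ** k) < r \<Longrightarrow> h = k"
    using H_discrete_two by metis
  \<comment> \<open>Below pi, so that logarithms within this bound are unique. Also d times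
    \<open>b\<close> is at most r/4, so two such geodesics together displace by less than the gap r
    between elements of a coset.\<close>
  define b where "b = min 1 (r / (4 * real CARD('d)))"
  have b: "b > 0" "b < pi" using r(1) pi_gt3 by (auto simp: b_def)
  have db: "2 * (real CARD('d) * b) < r"
  proof -
    have "2 * (real CARD('d) * b) \<le> 2 * (real CARD('d) * (r / (4 * real CARD('d))))"
      by (intro mult_left_mono) (auto simp: b_def)
    then show ?thesis using r(1) by simp
  qed
  \<comment> \<open>Eigenvalue vectors live in a Euclidean space, so that the data describing short
    geodesics form a compact set.\<close>
  define B where "B = {x :: real^'d. (\<forall>j. \<bar>x $ j\<bar> \<le> b) \<and> (\<Sum>j\<in>UNIV. x $ j) = 0}"
  define K where "K = {0..1::real} \<times> G \<times> {V :: complex^'d^'d. unitary V} \<times> B"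
  \<comment> \<open>\<open>P\<close> records what is visible in \<open>N\<close>, namely the time
    and both end points; \<open>Q\<close> is the point reached. That \<open>Q\<close> factors
    through \<open>P\<close> is the uniqueness of the short geodesic with given ends.\<close>
  define P where "P = (\<lambda>(s::real, g, V, x::real^'d). (s, F g, F (g ** opg V (\<lambda>j. x $ j) 1)))"
  define Q where "Q = (\<lambda>(s::real, g, V, x::real^'d). F (g ** opg V (\<lambda>j. x $ j) s))"
  have opgG: "opg V (\<lambda>j. x $ j) s \<in> G" if "unitary V" "x \<in> B" for V x s
    using that by (intro opg_SU) (auto simp: B_def)
  have "closed B"
  proof -
    have "B = (\<Inter>j. {x. \<bar>x $ j\<bar> \<le> b}) \<inter> {x. (\<Sum>j\<in>UNIV. x $ j) = 0}" by (auto simp: B_def)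
    moreover have "closed {x::real^'d. \<bar>x $ j\<bar> \<le> b}" for j by (intro closed_Collect_le continuous_intros)
    moreover have "closed {x::real^'d. (\<Sum>j\<in>UNIV. x $ j) = 0}" by (intro closed_Collect_eq continuous_intros)
    ultimately show ?thesis by (auto intro!: closed_INT)
  qed
  moreover have "bounded B"
  proof (rule boundedI)
    fix x assume "x \<in> B"
    then have "(\<Sum>j\<in>UNIV. \<bar>x $ j\<bar>) \<le> (\<Sum>j\<in>(UNIV::'d set). b)" by (intro sum_mono) (auto simp: B_def)
    then show "norm x \<le> (\<Sum>j\<in>(UNIV::'d set). b)" using norm_le_l1_cart[of x] by linarith
  qed
  ultimately have "compact B" by (simp add: compact_eq_bounded_closed)
  then have cK: "compact K" unfolding K_def by (intro compact_Times compact_Icc compact_SU compact_unitary)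
  have contQ: "continuous_on K (\<lambda>k. F (fst (snd k) ** opg (fst (snd (snd k))) (\<lambda>j. snd (snd (snd k)) $ j) (t k)))"
    if "continuous_on K t" for t
  proof (rule continuous_on_F_compose)
    show "continuous_on K (\<lambda>k. fst (snd k) ** opg (fst (snd (snd k))) (\<lambda>j. snd (snd (snd k)) $ j) (t k))"
      by (intro continuous_on_matrix_mult continuous_on_opg_joint continuous_intros that)
    show "(\<lambda>k. fst (snd k) ** opg (fst (snd (snd k))) (\<lambda>j. snd (snd (snd k)) $ j) (t k)) ` K \<subseteq> G"
      by (auto simp: K_def intro!: SU_mult opgG)
  qed
  have "continuous_on K (\<lambda>k. F (fst (snd k)))"
    by (intro continuous_on_F_compose continuous_intros) (auto simp: K_def)
  then have cP: "continuous_on K P" unfolding P_def case_prod_unfold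
    by (intro continuous_on_Pair contQ continuous_on_const continuous_on_fst continuous_on_id)
  have cQ: "continuous_on K Q" unfolding Q_def case_prod_unfold by (intro contQ continuous_on_fst continuous_on_id)
  have PQ: "Q k = Q k'" if "k \<in> K" "k' \<in> K" "P k = P k'" for k k'
  proof -
    obtain s g V x where k: "k = (s, g, V, x)" by (metis prod_cases4)
    obtain s' g' V' x' where k': "k' = (s', g', V', x')" by (metis prod_cases4)
    define e where "e = opg V (\<lambda>j. x $ j)"
    define e' where "e' = opg V' (\<lambda>j. x' $ j)"
    have V: "unitary V" "x \<in> B" "unitary V'" "x' \<in> B" and g: "g \<in> G" "g' \<in> G"
      using that by (auto simp: k k' K_def)
    have eG: "e t \<in> G" "e' t \<in> G" for t using V opgG by (auto simp: e_def e'_def)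
    have s: "s = s'" and Fg: "F g = F g'" "F (g ** e 1) = F (g' ** e' 1)"
      using that by (auto simp: k k' P_def e_def e'_def)
    \<comment> \<open>The two lifts differ by \<open>h\<close> at the start and by \<open>h'\<close>
      at the end. Both geodesics are short, so these elements agree by discreteness; uniqueness of
      small logarithms then matches the geodesics at every time.\<close>
    obtain h where h: "h \<in> H" "g' = g ** h" using F_eqE[OF Fg(1) g] .
    obtain h' where h': "h' \<in> H" "g' ** e' 1 = g ** e 1 ** h'"
      using F_eqE[OF Fg(2)] g eG SU_mult by metis
    have uh: "unitary h" "unitary h'" "unitary g" "unitary g'" using h h' g unitary_H unitary_G by auto
    have "norm (e 1 - mat 1) \<le> real CARD('d) * b" "norm (e' 1 - mat 1) \<le> real CARD('d) * b"
      using norm_opg_minus_1[OF V(1), of "\<lambda>j. x $ j" 1] norm_opg_minus_1[OF V(3), of "\<lambda>j. x' $ j" 1]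
        norm_gen_le[OF V(1), of "\<lambda>j. x $ j" b] norm_gen_le[OF V(3), of "\<lambda>j. x' $ j" b] V(2,4)
      by (auto simp: e_def e'_def B_def)
    moreover have "norm (g ** e 1 ** h' - g ** h') = norm (e 1 - mat 1)"
    proof -
      have "g ** e 1 ** h' - g ** h' = g ** (e 1 - mat 1) ** h'"
        by (simp add: matrix_mult_diff_left matrix_mult_diff_right)
      then show ?thesis using uh by simp
    qed
    moreover have "norm (g ** h ** e' 1 - g ** h) = norm (e' 1 - mat 1)"
    proof -
      have "g ** h ** e' 1 - g ** h = g ** h ** (e' 1 - mat 1)"
        by (simp add: matrix_mult_diff_right)
      then show ?thesis using uh by (simp add: unitary_mult)
    qed
    moreover have "norm (g ** h - g ** h') \<le> norm (g ** e 1 ** h' - g ** h') + norm (g ** h ** e' 1 - g ** h)"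
      using norm_triangle_ineq4[of "g ** e 1 ** h' - g ** h'" "g ** h ** e' 1 - g ** h"] h h' by simp
    ultimately have "norm (g ** h - g ** h') < r" using db by linarith
    then have hh: "h' = h" using r(2) g h h' by metis
    have "e' 1 = conj_transpose g' ** (g' ** e' 1)" by (simp add: unitary_cancel[OF uh(4)])
    also have "\<dots> = conj_transpose h ** e 1 ** h"
      unfolding h'(2) unfolding h(2) hh
      by (simp add: conj_transpose_mult matrix_mul_assoc [symmetric] unitary_cancel[OF uh(3)])
    also have "\<dots> = opg (conj_transpose h ** V) (\<lambda>j. x $ j) 1"
      using opg_conjugate[of "conj_transpose h" V "\<lambda>j. x $ j" 1] by (simp add: e_def)
    finally have e1: "e' 1 = opg (conj_transpose h ** V) (\<lambda>j. x $ j) 1" .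
    have xb: "\<bar>x $ j\<bar> < pi" for j
      using V(2) b(2) order_le_less_trans[of "\<bar>x $ j\<bar>" b pi] by (simp add: B_def)
    have xb': "\<bar>x' $ j\<bar> < pi" for j
      using V(4) b(2) order_le_less_trans[of "\<bar>x' $ j\<bar>" b pi] by (simp add: B_def)
    have "e' t = opg (conj_transpose h ** V) (\<lambda>j. x $ j) t" for t
      unfolding e'_def
      by (rule opg_unique[OF V(3) unitary_mult[OF unitary_conj_transpose[OF uh(1)] V(1)] e1[unfolded e'_def] xb' xb])
    then have "e' t = conj_transpose h ** e t ** h" for t
      using opg_conjugate[of "conj_transpose h" V "\<lambda>j. x $ j" t] by (simp add: e_def)
    then have "g' ** e' s = g ** e s ** h"
      by (simp add: h(2) matrix_mul_assoc [symmetric] unitary_cancel[OF uh(1)])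
    then have "F (g' ** e' s) = F (g ** e s)"
      using F_right_H[OF SU_mult[OF g(1) eG(1)] h(1)] by metis
    then show ?thesis using s by (simp add: k k' Q_def e_def e'_def)
  qed
  from factor_through_compact[OF cK cP cQ PQ]
  obtain \<Gamma> where \<Gamma>c: "continuous_on (P ` K) \<Gamma> \<and> (\<forall>k\<in>K. \<Gamma> (P k) = Q k)" by (rule exE)
  have \<Gamma>: "continuous_on (P ` K) \<Gamma>" "\<And>k. k \<in> K \<Longrightarrow> \<Gamma> (P k) = Q k"
    by (rule conjunct1[OF \<Gamma>c], rule bspec[OF conjunct2[OF \<Gamma>c]])
  obtain r' where r': "r' > 0" and log: "\<And>g g'. g \<in> G \<Longrightarrow> g' \<in> G \<Longrightarrow> norm (g - g') < r' \<Longrightarrow>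
    \<exists>V x. unitary V \<and> sum x UNIV = 0 \<and> g' = g ** opg V x 1 \<and> norm (gen V x) \<le> 2 * norm (g - g')"
    using SU_log_near_two by metis
  \<comment> \<open>Half of \<open>b\<close>, since the logarithm may be twice as long as the
    chord.\<close>
  have "min r' (b / 2) > 0" using r' b by simp
  from near_lifts[OF this] obtain \<delta> where \<delta>: "\<delta> > 0" "\<And>p q. p \<in> N \<Longrightarrow> q \<in> N \<Longrightarrow> norm (p - q) < \<delta> \<Longrightarrow>
    \<exists>g\<in>G. \<exists>g'\<in>G. p = F g \<and> q = F g' \<and> norm (g - g') < min r' (b / 2)" by metis
  have geod: "\<exists>g V x. g \<in> G \<and> unitary V \<and> x \<in> B \<and> p = F g \<and> q = F (g ** opg V (\<lambda>j. x $ j) 1)"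
    if pq: "p \<in> N" "q \<in> N" "norm (p - q) < \<delta>" for p q
  proof -
    obtain g g' where g: "g \<in> G" "g' \<in> G" "p = F g" "q = F g'" and gg: "norm (g - g') < min r' (b/2)"
      using \<delta>(2)[OF pq] by blast
    obtain V x where V: "unitary V" "sum x UNIV = 0" and g': "g' = g ** opg V x 1"
      and le: "norm (gen V x) \<le> 2 * norm (g - g')"
      using log[OF g(1,2)] gg by auto
    have "\<bar>x j\<bar> \<le> b" for j using le_norm_gen[OF V(1), of x j] le gg by simp
    then have "(\<chi> j. x j) \<in> B" using V by (simp add: B_def)
    moreover have "q = F (g ** opg V (\<lambda>j. (\<chi> j. x j) $ j) 1)" using g g' by simp
    ultimately show ?thesis using g V by blast
  qed
  have hom: "homotopic_maps N \<alpha> \<beta>"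
    if \<alpha>: "continuous_on (sphere 0 1) \<alpha>" "\<alpha> ` sphere 0 1 \<subseteq> N"
      and \<beta>: "continuous_on (sphere 0 1) \<beta>" "\<beta> ` sphere 0 1 \<subseteq> N"
      and close: "\<And>z. z \<in> sphere 0 1 \<Longrightarrow> norm (\<alpha> z - \<beta> z) < \<delta>" for \<alpha> \<beta> :: "complex \<Rightarrow> 'v"
  proof -
    have ex: "\<exists>g V x. (s, g, V, x) \<in> K \<and> P (s, g, V, x) = (s, \<alpha> z, \<beta> z) \<and> F g = \<alpha> z \<and> F (g ** opg V (\<lambda>j. x $ j) 1) = \<beta> z"
      if "s \<in> {0..1}" "z \<in> sphere 0 1" for s z
    proof -
      have "\<alpha> z \<in> N" "\<beta> z \<in> N" using \<alpha> \<beta> that by auto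
      from geod[OF this close[OF that(2)]] obtain g V x where
        "g \<in> G" "unitary V" "x \<in> B" "\<alpha> z = F g" "\<beta> z = F (g ** opg V (\<lambda>j. x $ j) 1)" by blast
      then show ?thesis using that by (intro exI[of _ g] exI[of _ V] exI[of _ x]) (simp add: K_def P_def)
    qed
    have \<Gamma>eq: "\<exists>g V x. g \<in> G \<and> unitary V \<and> x \<in> B \<and> \<Gamma> (s, \<alpha> z, \<beta> z) = F (g ** opg V (\<lambda>j. x $ j) s) \<and>
        F g = \<alpha> z \<and> F (g ** opg V (\<lambda>j. x $ j) 1) = \<beta> z"
      if sz: "s \<in> {0..1}" "z \<in> sphere 0 1" for s z
    proof -
      obtain g V x where k: "(s, g, V, x) \<in> K" "P (s, g, V, x) = (s, \<alpha> z, \<beta> z)" "F g = \<alpha> z"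
        "F (g ** opg V (\<lambda>j. x $ j) 1) = \<beta> z" using ex[OF sz] by blast
      have "\<Gamma> (s, \<alpha> z, \<beta> z) = F (g ** opg V (\<lambda>j. x $ j) s)"
        using \<Gamma>(2)[OF k(1)] k(2) by (simp add: Q_def)
      then show ?thesis using k by (auto simp: K_def)
    qed
    show ?thesis
    proof (rule homotopic_mapsI)
      show "continuous_on ({0..1} \<times> sphere 0 1) (\<lambda>y. \<Gamma> (fst y, \<alpha> (snd y), \<beta> (snd y)))"
      proof (rule continuous_on_compose2[OF \<Gamma>(1)])
        show "continuous_on ({0..1} \<times> sphere 0 1) (\<lambda>y. (fst y, \<alpha> (snd y), \<beta> (snd y)))"
          by (intro continuous_on_Pair continuous_on_fst continuous_on_id
              continuous_on_compose2[OF \<alpha>(1)] continuous_on_compose2[OF \<beta>(1)] continuous_on_snd) auto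
        show "(\<lambda>y. (fst y, \<alpha> (snd y), \<beta> (snd y))) ` ({0..1} \<times> sphere 0 1) \<subseteq> P ` K"
        proof (rule image_subsetI)
          fix y assume "y \<in> {0..1::real} \<times> sphere (0::complex) 1"
          then obtain g V x where "(fst y, g, V, x) \<in> K" "P (fst y, g, V, x) = (fst y, \<alpha> (snd y), \<beta> (snd y))"
            using ex[of "fst y" "snd y"] by auto
          then show "(fst y, \<alpha> (snd y), \<beta> (snd y)) \<in> P ` K" by (metis image_eqI)
        qed
      qed
      show "(\<lambda>y. \<Gamma> (fst y, \<alpha> (snd y), \<beta> (snd y))) ` ({0..1} \<times> sphere 0 1) \<subseteq> N"
      proof (rule image_subsetI)
        fix y assume "y \<in> {0..1::real} \<times> sphere (0::complex) 1"
        then obtain g V x where "g \<in> G" "unitary V" "x \<in> B"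
          "\<Gamma> (fst y, \<alpha> (snd y), \<beta> (snd y)) = F (g ** opg V (\<lambda>j. x $ j) (fst y))"
          using \<Gamma>eq[of "fst y" "snd y"] by auto
        moreover from this have "g ** opg V (\<lambda>j. x $ j) (fst y) \<in> G" by (intro SU_mult opgG)
        ultimately show "\<Gamma> (fst y, \<alpha> (snd y), \<beta> (snd y)) \<in> N" unfolding N by simp
      qed
      fix z :: complex assume z: "z \<in> sphere 0 1"
      obtain g V x where 0: "unitary V" "\<Gamma> (0, \<alpha> z, \<beta> z) = F (g ** opg V (\<lambda>j. x $ j) 0)" "F g = \<alpha> z"
        using \<Gamma>eq[of 0 z] z by auto
      then show "\<Gamma> (fst (0::real, z), \<alpha> (snd (0::real, z)), \<beta> (snd (0::real, z))) = \<alpha> z"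
        by (simp add: opg_0[OF 0(1)])
      obtain g V x where 1: "\<Gamma> (1, \<alpha> z, \<beta> z) = F (g ** opg V (\<lambda>j. x $ j) 1)" "F (g ** opg V (\<lambda>j. x $ j) 1) = \<beta> z"
        using \<Gamma>eq[of 1 z] z by auto
      show "\<Gamma> (fst (1::real, z), \<alpha> (snd (1::real, z)), \<beta> (snd (1::real, z))) = \<beta> z"
        using 1(1) unfolding 1(2) by simp
    qed
  qed
  have fin: "homotopic_maps N \<alpha> \<beta>"
    if *: "continuous_on (sphere 0 1) \<alpha> \<and> continuous_on (sphere 0 1) \<beta> \<and> \<alpha> ` sphere 0 1 \<subseteq> N \<and>
      \<beta> ` sphere 0 1 \<subseteq> N \<and> (\<forall>z\<in>sphere 0 1. norm (\<alpha> z - \<beta> z) < \<delta>)" for \<alpha> \<beta> :: "complex \<Rightarrow> 'v"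
  proof (rule hom)
    show "norm (\<alpha> z - \<beta> z) < \<delta>" if "z \<in> sphere 0 1" for z using * that by simp
  qed (use * in simp_all)
  show ?thesis
    by (rule exI[of _ \<delta>], rule conjI[OF \<delta>(1)], rule allI, rule allI, rule impI, rule fin)
qed

section \<open>Lifting through the covering\<close>

lemma lift_convex:
  fixes \<Phi> :: "'x::euclidean_space \<Rightarrow> 'v"
  assumes "convex S" "S \<noteq> {}" "continuous_on S \<Phi>" "\<And>x. x \<in> S \<Longrightarrow> \<Phi> x \<in> N"
  shows "\<exists>k. continuous_on S k \<and> (\<forall>x\<in>S. k x \<in> G \<and> F (k x) = \<Phi> x)"
proof -
  obtain z where z: "z \<in> S" using assms(2) by blast
  then have "\<Phi> z \<in> F ` G" using assms(4)[of z] by (simp add: N)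
  then obtain a where a: "a \<in> G" "\<Phi> z = F a" by blast
  have "\<Phi> \<in> S \<rightarrow> N" by (rule funcsetI) (rule assms(4))
  obtain k where k: "continuous_on S k" "k \<in> S \<rightarrow> G" "\<And>y. y \<in> S \<Longrightarrow> F (k y) = \<Phi> y"
    by (rule covering_space_lift_strong[OF covering_space_F a(1) z convex_imp_simply_connected[OF assms(1)]
        convex_imp_locally_path_connected[OF assms(1)] assms(3) \<open>\<Phi> \<in> S \<rightarrow> N\<close> a(2)], rule that)
  then show ?thesis by (intro exI[of _ k] conjI ballI k(1,3)) auto
qed

text \<open>The quotient of the two lifts takes values in the discrete set \<open>H\<close>; being
  continuous on a connected set, it cannot move.\<close>

lemma lifts_differ_by_constant:
  fixes a b :: "'x::topological_space \<Rightarrow> complex^'d^'d"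
  assumes "connected S" "S \<noteq> {}" "continuous_on S a" "continuous_on S b"
    and "\<And>x. x \<in> S \<Longrightarrow> a x \<in> G \<and> b x \<in> G \<and> F (a x) = F (b x)"
  shows "\<exists>h\<in>H. \<forall>x\<in>S. b x = a x ** h"
proof -
  let ?f = "\<lambda>x. conj_transpose (a x) ** b x"
  have fH: "?f x \<in> H" and fb: "b x = a x ** ?f x" if xS: "x \<in> S" for x
  proof -
    obtain h where "h \<in> H" "b x = a x ** h" using F_eqE[of "a x" "b x"] assms(5)[OF xS] by blast
    moreover have "unitary (a x)" using assms(5)[OF xS] unitary_G by blast
    ultimately show "?f x \<in> H" "b x = a x ** ?f x" by (simp_all add: unitary_cancel)
  qed
  obtain r where r: "r > 0" "\<And>g h k. g \<in> G \<Longrightarrow> h \<in> H \<Longrightarrow> k \<in> H \<Longrightarrow> norm (g ** h - g ** k) < r \<Longrightarrow> h = k"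
    using H_discrete_two by metis
  have "?f constant_on S"
  proof -
    obtain x where x: "x \<in> S" using assms(2) by blast
    have "continuous_on S ?f" using assms(3,4) by (intro continuous_intros)
    then have conn: "connected (?f ` S)" using assms(1) by (rule connected_continuous_image)
    have "mat 1 \<in> G" using H_one H_SU by blast
    have eqf: "?f y = ?f x" if y: "y \<in> S" "dist (?f x) (?f y) < r" for y
    proof -
      have "norm (mat 1 ** ?f y - mat 1 ** ?f x) < r"
        using y(2) by (simp add: dist_norm norm_minus_commute)
      then show ?thesis using r(2)[OF \<open>mat 1 \<in> G\<close>] fH x y(1) by blast
    qed
    have "?f ` S \<inter> ball (?f x) r \<subseteq> {?f x}"
    proof
      fix w assume "w \<in> ?f ` S \<inter> ball (?f x) r"
      then obtain y where "y \<in> S" "w = ?f y" "dist (?f x) w < r" by auto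
      then show "w \<in> {?f x}" using eqf[of y] by simp
    qed
    moreover have "?f x \<in> ?f ` S \<inter> ball (?f x) r" using x r(1) by simp
    ultimately have eq: "?f ` S \<inter> ball (?f x) r = {?f x}" by blast
    have "openin (top_of_set (?f ` S)) (?f ` S \<inter> ball (?f x) r)" by (rule openin_open_Int[OF open_ball])
    then have "openin (top_of_set (?f ` S)) {?f x}" unfolding eq .
    moreover have "closedin (top_of_set (?f ` S)) {?f x}"
      using x by (intro closed_subset) auto
    ultimately have "?f ` S = {?f x}" using conn unfolding connected_clopen by blast
    then show ?thesis unfolding constant_on_def by blast
  qed
  then obtain h where h: "\<And>x. x \<in> S \<Longrightarrow> ?f x = h" by (auto simp: constant_on_def)
  obtain x where "x \<in> S" using assms(2) by blast
  then have "h \<in> H" using fH[of x] h[of x] by simp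
  moreover have "b x = a x ** h" if "x \<in> S" for x using fb[OF that] unfolding h[OF that] .
  ultimately show ?thesis by blast
qed

end

section \<open>Minimising geodesics\<close>

lemma ex_primitive:
  fixes f :: "real \<Rightarrow> 'a::euclidean_space"
  assumes "continuous_on UNIV f"
  shows "\<exists>\<phi>. \<phi> 0 = 0 \<and> (\<forall>x. (\<phi> has_vector_derivative f x) (at x))"
proof -
  let ?\<phi> = "\<lambda>u. LBINT y=ereal 0..ereal u. f y"
  have "(?\<phi> has_vector_derivative f x) (at x)" for x
  proof -
  let ?a = "- \<bar>x\<bar> - 1" and ?b = "\<bar>x\<bar> + 1"
  have "(?\<phi> has_vector_derivative f x) (at x within {?a..?b})"
  proof (rule interval_integral_FTC2)
    show "continuous_on {?a..?b} f" by (rule continuous_on_subset[OF assms subset_UNIV])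
  qed (use abs_ge_zero[of x] abs_ge_self[of x] abs_ge_minus_self[of x] in linarith)+
  moreover have "x \<in> interior {?a..?b}"
    unfolding interior_atLeastAtMost_real greaterThanLessThan_iff
    using abs_ge_self[of x] abs_ge_minus_self[of x] by linarith
  ultimately show ?thesis by (simp only: at_within_interior)
  qed
  moreover have "?\<phi> 0 = 0" by (rule interval_integral_endpoints_same)
  ultimately show ?thesis by (intro exI[of _ ?\<phi>]) simp
qed

lemma has_vector_derivative_shift_arg:
  assumes "(f has_vector_derivative D) (at (x + a))"
  shows "((\<lambda>t. f (t + a)) has_vector_derivative D) (at x)"
proof -
  have "((\<lambda>t. t + a) has_vector_derivative 1) (at x)" by (auto intro!: derivative_eq_intros)
  from vector_diff_chain_at[OF this assms] have "((f \<circ> (\<lambda>t. t + a)) has_vector_derivative 1 *\<^sub>R D) (at x)" .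
  then show ?thesis by (simp add: o_def)
qed

lemma has_vector_derivative_eventually:
  assumes "(f has_vector_derivative D) (at x)" "e > 0"
  shows "\<forall>\<^sub>F y in nhds x. norm (f y - f x - (y - x) *\<^sub>R D) \<le> e * \<bar>y - x\<bar>"
  using assms unfolding has_vector_derivative_def has_derivative_at_alt eventually_nhds_metric dist_norm real_norm_def by blast

lemma has_vector_derivativeI_eventually:
  assumes "\<And>e. e > 0 \<Longrightarrow> \<forall>\<^sub>F y in nhds x. norm (f y - f x - (y - x) *\<^sub>R D) \<le> e * \<bar>y - x\<bar>"
  shows "(f has_vector_derivative D) (at x)"
  unfolding has_vector_derivative_def has_derivative_at_alt real_norm_def
  using assms unfolding eventually_nhds_metric dist_norm real_norm_def
  by (auto intro: bounded_linear_scaleR_left)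

lemma has_derivative_eventually:
  assumes "(f has_derivative D) (at x)" "e > 0"
  shows "\<forall>\<^sub>F y in nhds x. norm (f y - f x - D (y - x)) \<le> e * norm (y - x)"
  using assms unfolding has_derivative_at_alt eventually_nhds_metric dist_norm by blast

lemma su_conjugate:
  assumes "X \<in> su" "unitary K" shows "K ** X ** conj_transpose K \<in> su"
proof -
  have "trace (K ** X ** conj_transpose K) = trace X"
    by (subst trace_mul_sym) (simp add: matrix_mul_assoc unitaryD[OF assms(2)])
  then show ?thesis using assms(1)
    by (simp add: su_def conj_transpose_mult matrix_mult_minus_left matrix_mult_minus_right matrix_mul_assoc)
qed

lemma loop_length_nonneg: "0 \<le> loop_length \<gamma>"
  unfolding loop_length_def
  by (cases "(\<lambda>t. norm (loop_deriv \<gamma> t)) integrable_on {0..2*pi}")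
    (simp_all add: integral_nonneg not_integrable_integral)

lemma min_length_le:
  assumes "C1_loop N \<gamma>'" "homotopic_maps N \<gamma> \<gamma>'"
  shows "min_length N \<gamma> \<le> loop_length \<gamma>'"
  unfolding min_length_def
  by (rule cINF_lower) (use assms in \<open>auto intro!: bdd_belowI2[where m = 0] loop_length_nonneg\<close>)

section \<open>Differentiability of lifted curves\<close>

context SU_quotient
begin

text \<open>Near \<theta> the lift moves by a small exponential exp(Y), and \<open>L Y\<close> is
  close to (t - \<theta>) v by differentiability downstairs. Since \<open>L\<close> multiplies
  lengths in \<open>su\<close> by sqrt c, this determines Y to first order.\<close>

lemma lift_has_derivative:
  fixes a :: "real \<Rightarrow> complex^'d^'d"
  assumes aG: "\<And>t. a t \<in> G" and cont: "isCont a \<theta>"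
    and der: "((\<lambda>t. F (a t)) has_vector_derivative v) (at \<theta>)"
  shows "\<exists>X\<in>su. (a has_vector_derivative a \<theta> ** X) (at \<theta>)"
proof -
  define L where "L M = DF (a \<theta>) (a \<theta> ** M)" for M
  have "bounded_linear L" unfolding L_def
    by (rule bounded_linear_compose[OF bounded_linear_DF[OF aG] bounded_bilinear.bounded_linear_right[OF bounded_bilinear_matrix_mult]])
  then interpret L: bounded_linear L .
  obtain K where K: "K > 0" "\<And>M. norm (L M) \<le> norm M * K" using L.pos_bounded by blast
  obtain B :: "(complex^'d^'d) set" where B: "B \<subseteq> su" "pairwise orthogonal B" "\<And>b. b \<in> B \<Longrightarrow> norm b = 1"
    "independent B" "span B = su"
    by (rule orthonormal_basis_subspace[OF subspace_su]) blast
  have finB: "finite B" using B(4) by (rule independent_imp_finite)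
  have L_inner: "L X \<bullet> L Y = c * (X \<bullet> Y)" if "X \<in> su" "Y \<in> su" for X Y
    unfolding L_def by (rule F_isometry[OF aG that])
  have L_norm: "norm (L X) = sqrt c * norm X" if "X \<in> su" for X
    unfolding L_def by (rule norm_DF[OF aG that])
  \<comment> \<open>The only possible candidate: the vectors \<open>L b\<close> are orthogonal of
    squared length \<open>c\<close>, and these are the coordinates of \<open>v\<close> along
    them.\<close>
  define X where "X = (\<Sum>b\<in>B. (v \<bullet> L b / c) *\<^sub>R b)"
  have "X \<in> su" unfolding X_def using B(1) by (intro subspace_sum[OF subspace_su] subspace_scale[OF subspace_su]) auto
  \<comment> \<open>\<open>C\<close> will bound the norm of Y divided by |t - \<theta>|;
    \<open>M\<close> collects everything that multiplies s in the final error.\<close>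
  define C where "C = 2 / sqrt c * (norm v + 1)"
  define n where "n = real (card B)"
  define M where "M = n * sqrt c / c * ((K + 2) * C + 1) + C"
  have sc: "sqrt c > 0" using c by simp
  have C0: "C > 0" unfolding C_def using sc by (intro mult_pos_pos divide_pos_pos add_nonneg_pos) auto
  have M0: "M > 0" unfolding M_def n_def using C0 K(1) c sc by (intro add_nonneg_pos mult_nonneg_nonneg divide_nonneg_pos) auto
  obtain r where r: "r > 0" and log: "\<And>u. u \<in> G \<Longrightarrow> norm (u - mat 1) < r \<Longrightarrow>
    \<exists>V x. unitary V \<and> sum x UNIV = 0 \<and> u = opg V x 1 \<and> norm (gen V x) \<le> 2 * norm (u - mat 1) \<and>
       norm (u - mat 1 - gen V x) \<le> (norm (gen V x))\<^sup>2"
    using SU_log_near by metis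
  have "(a has_vector_derivative a \<theta> ** X) (at \<theta>)"
  proof (rule has_vector_derivativeI_eventually)
    fix e :: real assume e: "e > 0"
    \<comment> \<open>The bound 1 makes the square of norm Y at most norm Y, the second bound lets
      an error be absorbed into half of sqrt c times norm Y, and the third brings the final error s
      M below e.\<close>
    define s where "s = min 1 (min (sqrt c / (2 * (K + 2))) (e / M))"
    have s: "s > 0" "s \<le> 1" using sc K(1) e M0 by (auto simp: s_def)
    have s2: "(K + 2) * s \<le> sqrt c / 2"
    proof -
      have "s \<le> sqrt c / (2 * (K + 2))" by (simp add: s_def)
      then have "s * (2 * (K + 2)) \<le> sqrt c" using K(1) by (simp add: pos_le_divide_eq)
      then show ?thesis by (simp add: algebra_simps)
    qed
    have s3: "s * M \<le> e"
    proof -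
      have "s * M \<le> e / M * M" using M0 by (intro mult_right_mono) (auto simp: s_def)
      then show ?thesis using M0 by simp
    qed
    have "\<forall>\<^sub>F t in nhds \<theta>. norm (F (a t) - F (a \<theta>) - (t - \<theta>) *\<^sub>R v) \<le> s * \<bar>t - \<theta>\<bar>"
      by (rule has_vector_derivative_eventually[OF der s(1)])
    moreover have "(a \<longlongrightarrow> a \<theta>) (nhds \<theta>)" using cont by (simp add: isCont_def tendsto_at_iff_tendsto_nhds)
    then have "\<forall>\<^sub>F t in nhds \<theta>. norm (F (a t) - F (a \<theta>) - DF (a \<theta>) (a t - a \<theta>)) \<le> s * norm (a t - a \<theta>)"
      by (rule eventually_compose_filterlim[OF has_derivative_eventually[OF F_has_derivative[OF aG] s(1)]])
    moreover have "\<forall>\<^sub>F t in nhds \<theta>. dist (a t) (a \<theta>) < min r (s / 2)"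
      using \<open>(a \<longlongrightarrow> a \<theta>) (nhds \<theta>)\<close> r s(1) by (intro tendstoD) auto
    ultimately show "\<forall>\<^sub>F t in nhds \<theta>. norm (a t - a \<theta> - (t - \<theta>) *\<^sub>R (a \<theta> ** X)) \<le> e * \<bar>t - \<theta>\<bar>"
    proof eventually_elim
      case (elim t)
      define \<Delta> where "\<Delta> = t - \<theta>"
      define k where "k = conj_transpose (a \<theta>) ** a t"
      have u\<theta>: "unitary (a \<theta>)" using aG unitary_G by blast
      have kG: "k \<in> G" unfolding k_def by (intro SU_mult SU_conj_transpose aG)
      have ak: "a t - a \<theta> = a \<theta> ** (k - mat 1)"
        by (simp add: k_def matrix_mult_diff_right unitary_cancel[OF u\<theta>])
      then have nk: "norm (a t - a \<theta>) = norm (k - mat 1)" using u\<theta> by simp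
      have k_small: "norm (k - mat 1) < r" "norm (k - mat 1) < s / 2" using elim(3) nk by (simp_all add: dist_norm)
      obtain V x where V: "unitary V" "sum x UNIV = 0" and Y1: "norm (gen V x) \<le> 2 * norm (k - mat 1)"
        and Y2: "norm (k - mat 1 - gen V x) \<le> (norm (gen V x))\<^sup>2"
        using log[OF kG k_small(1)] by blast
      define Y where "Y = gen V x"
      have Ysu: "Y \<in> su" using V by (simp add: Y_def gen_in_su)
      have Ys: "norm Y \<le> s" using Y1 k_small(2) by (simp add: Y_def)
      have Ysq: "(norm Y)\<^sup>2 \<le> s * norm Y"
        unfolding power2_eq_square by (rule mult_right_mono[OF Ys]) simp
      have "(norm Y)\<^sup>2 \<le> norm Y" using Ysq mult_right_mono[OF s(2), of "norm Y"] by simp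
      then have kY: "norm (k - mat 1) \<le> 2 * norm Y"
        using Y2 norm_triangle_sub[of "k - mat 1" Y] by (simp add: Y_def)
      have "norm (L Y - \<Delta> *\<^sub>R v) \<le> norm (L (k - mat 1 - Y)) + (s * norm (k - mat 1) + s * \<bar>\<Delta>\<bar>)"
      proof -
        have "L Y - \<Delta> *\<^sub>R v = (F (a t) - F (a \<theta>) - \<Delta> *\<^sub>R v) - (F (a t) - F (a \<theta>) - L (k - mat 1)) - L (k - mat 1 - Y)"
          by (simp add: L.diff)
        then have "norm (L Y - \<Delta> *\<^sub>R v) \<le> norm (F (a t) - F (a \<theta>) - \<Delta> *\<^sub>R v)
            + norm (F (a t) - F (a \<theta>) - L (k - mat 1)) + norm (L (k - mat 1 - Y))"
          by (simp only:) (rule order_trans[OF norm_triangle_ineq4 add_right_mono[OF norm_triangle_ineq4]])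
        moreover have "norm (F (a t) - F (a \<theta>) - L (k - mat 1)) \<le> s * norm (k - mat 1)"
          using elim(2) unfolding nk unfolding ak L_def .
        ultimately show ?thesis using elim(1) by (simp add: \<Delta>_def)
      qed
      also have "norm (L (k - mat 1 - Y)) \<le> s * norm Y * K"
      proof -
        have "norm (k - mat 1 - Y) \<le> s * norm Y" using Y2 Ysq by (simp add: Y_def)
        then show ?thesis using K order_trans[OF K(2)] by (simp add: mult_right_mono)
      qed
      also have "s * norm (k - mat 1) \<le> s * (2 * norm Y)" using kY s(1) by (intro mult_left_mono) auto
      finally have D1: "norm (L Y - \<Delta> *\<^sub>R v) \<le> (K + 2) * s * norm Y + s * \<bar>\<Delta>\<bar>"
        by (simp add: algebra_simps)
      have "sqrt c * norm Y \<le> norm (L Y - \<Delta> *\<^sub>R v) + norm (\<Delta> *\<^sub>R v)"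
        using norm_triangle_sub[of "L Y" "\<Delta> *\<^sub>R v"] by (simp add: L_norm[OF Ysu])
      also have "\<dots> \<le> (K + 2) * s * norm Y + s * \<bar>\<Delta>\<bar> + norm v * \<bar>\<Delta>\<bar>" using D1 by (simp add: mult.commute)
      also have "\<dots> \<le> sqrt c / 2 * norm Y + 1 * \<bar>\<Delta>\<bar> + norm v * \<bar>\<Delta>\<bar>"
        using s2 s(2) by (intro add_mono mult_right_mono order_refl) auto
      finally have "norm Y \<le> C * \<bar>\<Delta>\<bar>" using sc by (simp add: C_def field_simps)
      then have YC: "s * norm Y \<le> s * (C * \<bar>\<Delta>\<bar>)" using s(1) by (intro mult_left_mono) auto
      have D1': "norm (L Y - \<Delta> *\<^sub>R v) \<le> s * ((K + 2) * C + 1) * \<bar>\<Delta>\<bar>"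
        using D1 mult_left_mono[OF YC, of "K + 2"] K(1) by (simp add: algebra_simps)
      have "Y - \<Delta> *\<^sub>R X = (\<Sum>b\<in>B. ((L Y - \<Delta> *\<^sub>R v) \<bullet> L b / c) *\<^sub>R b)"
      proof -
        have "Y = (\<Sum>b\<in>B. (Y \<bullet> b) *\<^sub>R b)"
          using B(5) Ysu by (intro orthonormal_basis_expand[OF B(2,3) _ finB, symmetric]) auto
        also have "\<dots> = (\<Sum>b\<in>B. (L Y \<bullet> L b / c) *\<^sub>R b)"
          using B(1) c by (intro sum.cong refl) (auto simp: L_inner[OF Ysu])
        finally have "Y = (\<Sum>b\<in>B. (L Y \<bullet> L b / c) *\<^sub>R b)" .
        then show ?thesis unfolding X_def scaleR_sum_right
          by (simp add: inner_diff_left diff_divide_distrib scaleR_diff_left sum_subtractf)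
      qed
      then have "norm (Y - \<Delta> *\<^sub>R X) \<le> (\<Sum>b\<in>B. norm (((L Y - \<Delta> *\<^sub>R v) \<bullet> L b / c) *\<^sub>R b))"
        by (simp only: norm_sum)
      also have "\<dots> \<le> (\<Sum>b\<in>B. norm (L Y - \<Delta> *\<^sub>R v) * sqrt c / c)"
      proof (rule sum_mono)
        fix b assume b: "b \<in> B"
        have "\<bar>(L Y - \<Delta> *\<^sub>R v) \<bullet> L b\<bar> \<le> norm (L Y - \<Delta> *\<^sub>R v) * sqrt c"
          using Cauchy_Schwarz_ineq2[of "L Y - \<Delta> *\<^sub>R v" "L b"] L_norm[of b] B(1,3) b by auto
        then show "norm (((L Y - \<Delta> *\<^sub>R v) \<bullet> L b / c) *\<^sub>R b) \<le> norm (L Y - \<Delta> *\<^sub>R v) * sqrt c / c"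
          using c B(3)[OF b] by (simp add: divide_right_mono)
      qed
      also have "\<dots> = n * sqrt c / c * norm (L Y - \<Delta> *\<^sub>R v)" by (simp add: n_def)
      also have "\<dots> \<le> n * sqrt c / c * (s * ((K + 2) * C + 1) * \<bar>\<Delta>\<bar>)"
        using c by (intro mult_left_mono D1') (auto simp: n_def)
      finally have D2: "norm (Y - \<Delta> *\<^sub>R X) \<le> n * sqrt c / c * (s * ((K + 2) * C + 1) * \<bar>\<Delta>\<bar>)" .
      have "norm (a t - a \<theta> - \<Delta> *\<^sub>R (a \<theta> ** X)) = norm (a \<theta> ** (k - mat 1 - \<Delta> *\<^sub>R X))"
        unfolding ak by (simp add: matrix_mult_diff_right scaleR_matrix_mult)
      also have "\<dots> = norm (k - mat 1 - \<Delta> *\<^sub>R X)" using u\<theta> by simp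
      also have "\<dots> \<le> norm (k - mat 1 - Y) + norm (Y - \<Delta> *\<^sub>R X)"
        using norm_triangle_ineq[of "k - mat 1 - Y" "Y - \<Delta> *\<^sub>R X"] by (simp add: algebra_simps)
      also have "\<dots> \<le> s * (C * \<bar>\<Delta>\<bar>) + n * sqrt c / c * (s * ((K + 2) * C + 1) * \<bar>\<Delta>\<bar>)"
        using Y2 Ysq YC D2 by (simp add: Y_def)
      also have "\<dots> = s * M * \<bar>\<Delta>\<bar>" by (simp add: M_def algebra_simps)
      also have "\<dots> \<le> e * \<bar>\<Delta>\<bar>" by (rule mult_right_mono[OF s3]) simp
      finally show ?case by (simp add: \<Delta>_def)
    qed
  qed
  then show ?thesis using \<open>X \<in> su\<close> by blast
qed

text \<open>In an orthonormal basis of \<open>su\<close> the lifted velocity has the explicit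
  coordinates \<open>v t \<bullet> DF (a t) (a t ** b) / c\<close>, and its continuity is read off
  from this formula.\<close>

lemma lift_C1:
  fixes a :: "real \<Rightarrow> complex^'d^'d"
  assumes aG: "\<And>t. a t \<in> G" and cont: "continuous_on UNIV a"
    and C1: "(\<lambda>t. F (a t)) C1_differentiable_on UNIV"
  shows "\<exists>X. continuous_on UNIV X \<and> (\<forall>t. X t \<in> su \<and> (a has_vector_derivative a t ** X t) (at t))"
proof -
  obtain v where v: "\<And>t. ((\<lambda>t. F (a t)) has_vector_derivative v t) (at t)" and cv: "continuous_on UNIV v"
    using C1 unfolding C1_differentiable_on_def by auto
  have "\<forall>t. \<exists>X. X \<in> su \<and> (a has_vector_derivative a t ** X) (at t)"
    using lift_has_derivative[OF aG _ v] cont continuous_on_eq_continuous_at[OF open_UNIV] by blast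
  then obtain X where X: "\<And>t. X t \<in> su" "\<And>t. (a has_vector_derivative a t ** X t) (at t)" by metis
  obtain B :: "(complex^'d^'d) set" where B: "B \<subseteq> su" "pairwise orthogonal B" "\<And>b. b \<in> B \<Longrightarrow> norm b = 1"
    "independent B" "span B = su"
    by (rule orthonormal_basis_subspace[OF subspace_su]) blast
  have finB: "finite B" using B(4) by (rule independent_imp_finite)
  have vX: "v t = DF (a t) (a t ** X t)" for t
    using v F_curve[OF aG X(2)] vector_derivative_unique_at by blast
  have Xeq: "X t = (\<Sum>b\<in>B. (v t \<bullet> DF (a t) (a t ** b) / c) *\<^sub>R b)" for t
  proof -
    have "X t = (\<Sum>b\<in>B. (X t \<bullet> b) *\<^sub>R b)"
      using B(5) X(1) by (intro orthonormal_basis_expand[OF B(2,3) _ finB, symmetric]) auto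
    also have "\<dots> = (\<Sum>b\<in>B. (v t \<bullet> DF (a t) (a t ** b) / c) *\<^sub>R b)"
    proof (rule sum.cong[OF refl])
      fix b assume "b \<in> B"
      then have "v t \<bullet> DF (a t) (a t ** b) = c * (X t \<bullet> b)" unfolding vX using B(1) by (intro F_isometry aG X(1)) auto
      then show "(X t \<bullet> b) *\<^sub>R b = (v t \<bullet> DF (a t) (a t ** b) / c) *\<^sub>R b" using c by simp
    qed
    finally show ?thesis .
  qed
  have "continuous_on UNIV (\<lambda>t. \<Sum>b\<in>B. (v t \<bullet> DF (a t) (a t ** b) / c) *\<^sub>R b)"
    using aG c by (intro continuous_intros cv cont continuous_on_DF) auto
  then have "continuous_on UNIV X" unfolding Xeq[symmetric, abs_def] by (simp add: Xeq[symmetric])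
  then show ?thesis using X by blast
qed

lemma loop_of_curve:
  fixes m :: "real \<Rightarrow> complex^'d^'d"
  assumes mG: "\<And>t. m t \<in> G" and m: "\<And>t. (m has_vector_derivative m t ** X t) (at t)"
    and X: "\<And>t. X t \<in> su" "continuous_on UNIV X" and \<alpha>: "\<And>t. \<alpha> (cis t) = F (m t)"
  shows "C1_loop N \<alpha>" "loop_deriv \<alpha> t = DF (m t) (m t ** X t)"
    "loop_length \<alpha> = sqrt c * integral {0..2*pi} (\<lambda>t. norm (X t))"
proof -
  have der: "((\<lambda>t. \<alpha> (cis t)) has_vector_derivative DF (m t) (m t ** X t)) (at t)" for t
    unfolding \<alpha> by (rule F_curve[OF mG m])
  have cm: "continuous_on UNIV m"
    by (rule continuous_at_imp_continuous_on) (use m has_vector_derivative_continuous in blast)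
  have "continuous_on UNIV (\<lambda>t. DF (m t) (m t ** X t))"
    using mG by (intro continuous_on_DF continuous_intros cm X) auto
  then have "(\<lambda>t. \<alpha> (cis t)) C1_differentiable_on UNIV"
    unfolding C1_differentiable_on_def by (intro exI[of _ "\<lambda>t. DF (m t) (m t ** X t)"] conjI ballI der)
  moreover have "\<alpha> z \<in> N" if "z \<in> sphere 0 1" for z
    using \<alpha>[of "Arg2pi z"] mG N by (simp add: cis_Arg2pi[OF that])
  ultimately show "C1_loop N \<alpha>" by (auto simp: C1_loop_def)
  show ld: "loop_deriv \<alpha> t = DF (m t) (m t ** X t)" for t
    unfolding loop_deriv_def by (rule vector_derivative_at[OF der])
  show "loop_length \<alpha> = sqrt c * integral {0..2*pi} (\<lambda>t. norm (X t))"
    unfolding loop_length_def ld by (simp add: norm_DF[OF mG X(1)])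
qed

end

section \<open>First variation of minimising curves\<close>

context SU_quotient
begin

lemma curve_translate:
  assumes "continuous_on UNIV a" "\<And>t. a t \<in> G" "\<And>t. F (a (t + 2*pi)) = F (a t)"
  shows "\<exists>h\<in>H. \<forall>t. a (t + 2*pi) = a t ** h"
proof -
  have "continuous_on UNIV (\<lambda>t. a (t + 2*pi))"
    by (rule continuous_on_compose2[OF assms(1)]) (auto intro!: continuous_intros)
  from lifts_differ_by_constant[OF connected_UNIV _ assms(1) this] assms(2,3)
  show ?thesis by auto
qed

text \<open>The curves \<open>t \<mapsto> exp(s\<phi>(t)Z) a(t)\<close> cover loops homotopic to the geodesic covered by \<open>a\<close>. The squared
  speed is \<open>c |\<xi>(t) + s\<phi>'(t)Z|\<^sup>2\<close>, where \<open>\<xi> = a'a\<^sup>-\<^sup>1\<close>. Taking \<open>\<phi>' = \<langle>Z, \<xi>\<rangle> - const\<close>, the vanishing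
  of the first variation says that \<open>\<langle>Z, \<xi>\<rangle>\<close> is constant.\<close>

lemma minimising_curve_momentum:
  fixes a :: "real \<Rightarrow> complex^'d^'d"
  assumes aG: "\<And>t. a t \<in> G" and a\<gamma>: "\<And>t. F (a t) = \<gamma> (cis t)"
    and \<xi>: "\<And>t. \<xi> t \<in> su" "continuous_on UNIV \<xi>" "\<And>t. (a has_vector_derivative \<xi> t ** a t) (at t)"
    and h: "h \<in> H" "\<And>t. a (t + 2*pi) = a t ** h"
    and \<xi>per: "\<And>t. \<xi> (t + 2*pi) = \<xi> t"
    and \<rho>: "\<And>t. norm (\<xi> t) = \<rho>"
    and min: "min_length N \<gamma> = 2 * pi * (sqrt c * \<rho>)"
    and Z: "Z \<in> su"
  shows "Z \<bullet> \<xi> t = Z \<bullet> \<xi> 0"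
proof (cases "\<rho> = 0")
  case True
  then have "\<xi> t = 0" for t using \<rho>[of t] by simp
  then show ?thesis by simp
next
  case False
  have \<rho>0: "\<rho> > 0" using False \<rho>[of 0] norm_ge_zero[of "\<xi> 0"] by linarith
  obtain V z where V: "unitary V" "sum z UNIV = 0" and Zg: "Z = gen V z" using su_eq_gen[OF Z] by blast
  define \<psi> where "\<psi> t = Z \<bullet> \<xi> t" for t
  have c\<psi>: "continuous_on UNIV \<psi>" unfolding \<psi>_def by (intro continuous_intros \<xi>(2))
  have c\<psi>': "continuous_on S \<psi>" for S by (rule continuous_on_subset[OF c\<psi> subset_UNIV])
  \<comment> \<open>Subtracting the mean of \<psi> makes the primitive \<phi> periodic, so that the
    varied curve still closes up.\<close>
  define k where "k = integral {0..2*pi} \<psi> / (2 * pi)"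
  define p where "p t = \<psi> t - k" for t
  have cp: "continuous_on S p" for S unfolding p_def by (intro continuous_intros c\<psi>')
  have p_int: "integral {0..2*pi} p = 0"
  proof -
    have "integral {0..2*pi} p = integral {0..2*pi} \<psi> - integral {0..2*pi} (\<lambda>_. k)"
      unfolding p_def by (intro integral_diff integrable_continuous_interval c\<psi>' continuous_on_const)
    then show ?thesis by (simp add: k_def)
  qed
  have p_per: "p (t + 2*pi) = p t" for t by (simp add: p_def \<psi>_def \<xi>per)
  obtain \<phi> where \<phi>0: "\<phi> 0 = 0" and \<phi>: "\<And>t. (\<phi> has_vector_derivative p t) (at t)"
    using ex_primitive[OF cp] by blast
  have \<phi>_per: "\<phi> (t + 2*pi) = \<phi> t" for t
  proof -
    have "((\<lambda>t. \<phi> (t + 2*pi) - \<phi> t) has_vector_derivative 0) (at t within UNIV)" for t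
      using has_vector_derivative_diff[OF has_vector_derivative_shift_arg[OF \<phi>[of "t + 2*pi"]] \<phi>[of t]] by (simp add: p_per)
    then obtain C where C: "\<And>t. t \<in> UNIV \<Longrightarrow> \<phi> (t + 2*pi) - \<phi> t = C"
      using has_vector_derivative_zero_constant[OF convex_UNIV] by blast
    have "(p has_integral \<phi> (2*pi) - \<phi> 0) {0..2*pi}"
      by (rule fundamental_theorem_of_calculus) (simp_all add: has_vector_derivative_at_within \<phi>)
    then have "\<phi> (2*pi) = \<phi> 0" using p_int by (simp add: integral_unique)
    then show ?thesis using C[of 0] C[of t] by simp
  qed
  have c\<phi>: "continuous_on UNIV \<phi>"
    by (rule continuous_at_imp_continuous_on) (use \<phi> has_vector_derivative_continuous in blast)
  have ca: "continuous_on UNIV a"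
    by (rule continuous_at_imp_continuous_on) (use \<xi>(3) has_vector_derivative_continuous in blast)
  have ua: "unitary (a t)" for t by (rule unitary_G[OF aG])
  have const_int: "((\<lambda>t. \<rho>\<^sup>2) has_integral 2 * pi * \<rho>\<^sup>2) {0..2*pi}"
    using has_integral_const_real[of "\<rho>\<^sup>2" 0 "2*pi"] by simp
  have energy: "2 * pi * \<rho>\<^sup>2 \<le> integral {0..2*pi} (\<lambda>t. (norm (\<xi> t + (s * p t) *\<^sub>R Z))\<^sup>2)" for s :: real
  proof -
    define E where "E t = opg V z (s * \<phi> t)" for t
    define m where "m t = E t ** a t" for t
    have EG: "E t \<in> G" for t unfolding E_def by (rule opg_SU[OF V])
    have mG: "m t \<in> G" for t unfolding m_def by (rule SU_mult[OF EG aG])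
    define X where "X t = conj_transpose (a t) ** (\<xi> t + (s * p t) *\<^sub>R Z) ** a t" for t
    have Xsu: "X t \<in> su" for t
      using su_conjugate[OF subspace_add[OF subspace_su \<xi>(1)[of t] subspace_scale[OF subspace_su Z, of "s * p t"]]
          unitary_conj_transpose[OF ua[of t]]] by (simp add: X_def)
    have cX: "continuous_on UNIV X" unfolding X_def by (intro continuous_intros ca \<xi>(2) cp)
    have normX: "norm (X t) = norm (\<xi> t + (s * p t) *\<^sub>R Z)" for t
      unfolding X_def by (simp add: ua unitary_conj_transpose)
    have dm: "(m has_vector_derivative m t ** X t) (at t)" for t
    proof -
      have "((\<lambda>t. s * \<phi> t) has_vector_derivative s * p t) (at t)"
        using \<phi>[of t] by (auto intro!: derivative_eq_intros simp: has_real_derivative_iff_has_vector_derivative [symmetric])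
      from vector_diff_chain_at[OF this has_vector_derivative_opg[OF V(1)]]
      have dE: "(E has_vector_derivative (s * p t) *\<^sub>R (Z ** E t)) (at t)"
        by (simp add: o_def E_def[abs_def] Zg)
      have EZ: "E t ** Z = Z ** E t" unfolding E_def Zg by (rule opg_gen_commute[OF V(1)])
      have "m t ** X t = E t ** (a t ** conj_transpose (a t)) ** (\<xi> t + (s * p t) *\<^sub>R Z) ** a t"
        by (simp add: m_def X_def matrix_mul_assoc)
      also have "\<dots> = E t ** (\<xi> t ** a t) + (s * p t) *\<^sub>R (E t ** Z) ** a t"
        by (simp add: unitaryD[OF ua] matrix_add_ldistrib matrix_mul_assoc [symmetric] scaleR_matrix_mult
            bounded_bilinear.add_left[OF bounded_bilinear_matrix_mult])
      finally have "m t ** X t = E t ** (\<xi> t ** a t) + (s * p t) *\<^sub>R (Z ** E t) ** a t" unfolding EZ .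
      then show ?thesis
        unfolding m_def[abs_def] using has_vector_derivative_matrix_mult[OF dE \<xi>(3)[of t]] by simp
    qed
    have m_per: "F (E' (t + 2*pi) ** a (t + 2*pi)) = F (E' t ** a t)"
      if "E' = (\<lambda>t. opg V z (r * \<phi> t))" for t r E'
    proof -
      have "E' t ** a t \<in> G" unfolding that by (intro SU_mult opg_SU V aG)
      from F_right_H[OF this h(1)] show ?thesis by (simp add: that \<phi>_per h(2) matrix_mul_assoc)
    qed
    define \<alpha> where "\<alpha> w = F (m (Arg2pi w))" for w
    have \<alpha>: "\<alpha> (cis t) = F (m t)" for t
      unfolding \<alpha>_def by (rule periodic_Arg2pi_cis[of "\<lambda>t. F (m t)"]) (unfold m_def, rule m_per, simp add: E_def[abs_def])
    note loop = loop_of_curve[OF mG dm Xsu cX \<alpha>]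
    have "homotopic_maps N \<gamma> \<alpha>"
    proof (rule homotopic_maps_periodic[where f = "\<lambda>y. F (opg V z (fst y * s * \<phi> (snd y)) ** a (snd y))"])
      show "continuous_on ({0..1} \<times> UNIV) (\<lambda>y. F (opg V z (fst y * s * \<phi> (snd y)) ** a (snd y)))"
        by (intro continuous_on_F_compose continuous_intros continuous_on_compose2[OF c\<phi>] continuous_on_compose2[OF ca])
          (auto intro!: SU_mult opg_SU V aG)
      show "F (opg V z (fst (r, t) * s * \<phi> (snd (r, t))) ** a (snd (r, t))) \<in> N" for r t
        unfolding N by (intro imageI SU_mult opg_SU V aG)
      show "F (opg V z (fst (r, t + 2*pi) * s * \<phi> (snd (r, t + 2*pi))) ** a (snd (r, t + 2*pi)))
          = F (opg V z (fst (r, t) * s * \<phi> (snd (r, t))) ** a (snd (r, t)))" for r t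
        using m_per[OF refl, of "r * s" t] by simp
      show "\<gamma> (cis t) = F (opg V z (fst (0, t) * s * \<phi> (snd (0, t))) ** a (snd (0, t)))" for t
        by (simp add: opg_0[OF V(1)] a\<gamma>)
      show "\<alpha> (cis t) = F (opg V z (fst (1, t) * s * \<phi> (snd (1, t))) ** a (snd (1, t)))" for t
        by (simp add: \<alpha> m_def E_def)
    qed
    from min_length_le[OF loop(1) this] have "sqrt c * (2 * pi * \<rho>) \<le> sqrt c * integral {0..2*pi} (\<lambda>t. norm (X t))"
      unfolding min loop(3) by (simp add: mult_ac)
    then have "2 * pi * \<rho> \<le> integral {0..2*pi} (\<lambda>t. norm (X t))"
      using c by (simp add: mult_le_cancel_left_pos)
    \<comment> \<open>Length is traded for energy, which is quadratic in s. The arithmetic-geometric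
      mean inequality is an equality at speed \<rho>, that is at s = 0, so no first-order
      information is lost.\<close>
    also have "\<dots> \<le> integral {0..2*pi} (\<lambda>t. ((norm (X t))\<^sup>2 + \<rho>\<^sup>2) / (2 * \<rho>))"
    proof (rule integral_le)
      show "(\<lambda>t. norm (X t)) integrable_on {0..2*pi}"
        by (intro integrable_continuous_interval continuous_intros continuous_on_subset[OF cX subset_UNIV])
      show "(\<lambda>t. ((norm (X t))\<^sup>2 + \<rho>\<^sup>2) / (2 * \<rho>)) integrable_on {0..2*pi}"
        using \<rho>0 by (intro integrable_continuous_interval continuous_intros continuous_on_subset[OF cX subset_UNIV]) auto
      show "norm (X t) \<le> ((norm (X t))\<^sup>2 + \<rho>\<^sup>2) / (2 * \<rho>)" for t
        using \<rho>0 sum_squares_bound[of "norm (X t)" \<rho>] by (simp add: field_simps)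
    qed
    also have "\<dots> = (integral {0..2*pi} (\<lambda>t. (norm (X t))\<^sup>2) + 2 * pi * \<rho>\<^sup>2) / (2 * \<rho>)"
    proof -
      have "(\<lambda>t. (norm (X t))\<^sup>2) integrable_on {0..2*pi}"
        by (intro integrable_continuous_interval continuous_intros continuous_on_subset[OF cX subset_UNIV])
      then have "((\<lambda>t. ((norm (X t))\<^sup>2 + \<rho>\<^sup>2) / (2 * \<rho>)) has_integral
          (integral {0..2*pi} (\<lambda>t. (norm (X t))\<^sup>2) + 2 * pi * \<rho>\<^sup>2) / (2 * \<rho>)) {0..2*pi}"
        by (intro has_integral_divide has_integral_add integrable_integral const_int)
      then show ?thesis by (rule integral_unique)
    qed
    finally have "2 * pi * \<rho> * (2 * \<rho>) \<le> integral {0..2*pi} (\<lambda>t. (norm (X t))\<^sup>2) + 2 * pi * \<rho>\<^sup>2"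
      using \<rho>0 by (simp add: pos_le_divide_eq)
    then show ?thesis unfolding normX by (simp add: power2_eq_square)
  qed
  have expand: "(norm (\<xi> t + (s * p t) *\<^sub>R Z))\<^sup>2 = \<rho>\<^sup>2 + (2 * s) * (p t * \<psi> t) + (s\<^sup>2 * (norm Z)\<^sup>2) * (p t)\<^sup>2" for s t
  proof -
    have "(norm (\<xi> t + r *\<^sub>R Z))\<^sup>2 = \<xi> t \<bullet> \<xi> t + 2 * r * (Z \<bullet> \<xi> t) + r\<^sup>2 * (Z \<bullet> Z)" for r :: real
      unfolding power2_norm_eq_inner
      by (simp add: inner_add_left inner_add_right inner_commute power2_eq_square algebra_simps)
    moreover have "\<xi> t \<bullet> \<xi> t = \<rho>\<^sup>2" "Z \<bullet> Z = (norm Z)\<^sup>2" by (simp_all add: dot_square_norm \<rho>)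
    ultimately show ?thesis by (simp add: \<psi>_def power_mult_distrib mult_ac)
  qed
  have hI: "((\<lambda>t. p t * \<psi> t) has_integral integral {0..2*pi} (\<lambda>t. p t * \<psi> t)) {0..2*pi}"
    "((\<lambda>t. (p t)\<^sup>2) has_integral integral {0..2*pi} (\<lambda>t. (p t)\<^sup>2)) {0..2*pi}"
    by (intro integrable_integral integrable_continuous_interval continuous_intros cp c\<psi>')+
  define I1 where "I1 = integral {0..2*pi} (\<lambda>t. p t * \<psi> t)"
  define I2 where "I2 = integral {0..2*pi} (\<lambda>t. (p t)\<^sup>2)"
  have "integral {0..2*pi} (\<lambda>t. (norm (\<xi> t + (s * p t) *\<^sub>R Z))\<^sup>2) = 2 * pi * \<rho>\<^sup>2 + (2 * s) * I1 + (s\<^sup>2 * (norm Z)\<^sup>2) * I2" for s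
    unfolding expand I1_def I2_def
    by (intro integral_unique has_integral_add has_integral_mult_right const_int hI)
  then have ineq: "0 \<le> 2 * s * I1 + s\<^sup>2 * ((norm Z)\<^sup>2 * I2)" for s
    using energy[of s] by (simp add: mult_ac)
  \<comment> \<open>The inequality holds for s of both signs, so the linear coefficient vanishes. As
    \<open>p\<close> has mean zero, this coefficient equals the integral of the square of
    \<open>p\<close>.\<close>
  have "I1 = 0"
  proof (rule eq_0_if_linear_le_square)
    show "2 * s * I1 \<le> s\<^sup>2 * ((norm Z)\<^sup>2 * I2)" for s using ineq[of "-s"] by simp
  qed
  have "I2 = I1 - k * integral {0..2*pi} p"
  proof -
    have "(p t)\<^sup>2 = p t * \<psi> t - k * p t" for t by (simp add: p_def power2_eq_square algebra_simps)
    moreover have "((\<lambda>t. p t * \<psi> t - k * p t) has_integral I1 - k * integral {0..2*pi} p) {0..2*pi}"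
      unfolding I1_def
      by (intro has_integral_diff has_integral_mult_right hI(1) integrable_integral integrable_continuous_interval cp)
    ultimately show ?thesis unfolding I2_def by (simp add: integral_unique)
  qed
  then have "I2 = 0" using \<open>I1 = 0\<close> p_int by simp
  have "continuous_on {0..2*pi} (\<lambda>t. (p t)\<^sup>2)" by (intro continuous_intros cp)
  from integral_eq_0_iff[OF this] \<open>I2 = 0\<close> have p0: "p t = 0" if "t \<in> {0..2*pi}" for t
    using that by (simp add: I2_def)
  have "p t = p (Arg2pi (cis t))" by (rule periodic_Arg2pi_cis[of p, OF p_per, symmetric])
  also have "\<dots> = 0" using Arg2pi[of "cis t"] by (intro p0) auto
  finally have "p t = 0" .
  then show ?thesis using p0[of 0] by (simp add: p_def \<psi>_def)
qed

text \<open>The geodesic equation supplies constant speed: the velocity is itself tangent, hence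
  orthogonal to the acceleration. The momentum lemma for every Z in \<open>su\<close> then makes a'
  a^-1 constant, so \<open>a\<close> is a translate of a one-parameter group.\<close>

theorem minimising_geodesic_lift:
  fixes a :: "real \<Rightarrow> complex^'d^'d"
  assumes \<gamma>: "minimising_geodesic N \<gamma>" and a: "continuous_on UNIV a" "\<And>t. a t \<in> G" "\<And>t. F (a t) = \<gamma> (cis t)"
  shows "\<exists>V x. unitary V \<and> sum x UNIV = 0 \<and> (\<forall>t. a t = a 0 ** opg V x t) \<and>
    min_length N \<gamma> = 2 * pi * (sqrt c * norm (gen V x))"
proof -
  have C1: "C1_loop N \<gamma>" and len: "loop_length \<gamma> = min_length N \<gamma>"
    and geod: "\<And>t. \<exists>acc. (loop_deriv \<gamma> has_vector_derivative acc) (at t) \<and> (\<forall>v\<in>tangent_space N (\<gamma> (cis t)). acc \<bullet> v = 0)"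
    using \<gamma> by (auto simp: minimising_geodesic_def closed_geodesic_def)
  have "(\<lambda>t. F (a t)) C1_differentiable_on UNIV" using C1 by (simp add: C1_loop_def a(3))
  from lift_C1[OF a(2,1) this] obtain X where X: "continuous_on UNIV X" "\<And>t. X t \<in> su"
    "\<And>t. (a has_vector_derivative a t ** X t) (at t)" by blast
  note loop = loop_of_curve[OF a(2) X(3) X(2) X(1) a(3)[symmetric]]
  have ua: "unitary (a t)" for t by (rule unitary_G[OF a(2)])
  have periodic: "F (a (t + 2*pi)) = F (a t)" for t by (simp add: a(3) cis_mult [symmetric])
  obtain h where h: "h \<in> H" "\<And>t. a (t + 2*pi) = a t ** h" using curve_translate[OF a(1,2) periodic] by blast
  have uh: "unitary h" by (rule unitary_H[OF h(1)])
  \<comment> \<open>The velocity is brought to the identity by right translation. The deck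
    transformation multiplies \<open>a\<close> on the right, so this version is periodic, while a^-1
    a' is in general conjugated by \<open>h\<close>.\<close>
  define \<xi> where "\<xi> t = a t ** X t ** conj_transpose (a t)" for t
  have \<xi>: "\<xi> t \<in> su" "continuous_on UNIV \<xi>" "(a has_vector_derivative \<xi> t ** a t) (at t)" for t
  proof -
    show "\<xi> t \<in> su" unfolding \<xi>_def by (rule su_conjugate[OF X(2) ua])
    show "continuous_on UNIV \<xi>" unfolding \<xi>_def by (intro continuous_intros a(1) X(1))
    show "(a has_vector_derivative \<xi> t ** a t) (at t)" using X(3)[of t] by (simp add: \<xi>_def unitary_cancel[OF ua])
  qed
  have norm\<xi>: "norm (\<xi> t) = norm (X t)" for t unfolding \<xi>_def by (simp add: ua unitary_conj_transpose)
  have \<xi>per: "\<xi> (t + 2*pi) = \<xi> t" for t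
  proof -
    have "((\<lambda>t. a (t + 2*pi)) has_vector_derivative \<xi> (t + 2*pi) ** a (t + 2*pi)) (at t)"
      by (rule has_vector_derivative_shift_arg[OF \<xi>(3)])
    moreover have "((\<lambda>t. a t ** h) has_vector_derivative \<xi> t ** a t ** h) (at t)"
      by (rule bounded_linear.has_vector_derivative[OF bounded_bilinear.bounded_linear_left[OF bounded_bilinear_matrix_mult] \<xi>(3)])
    ultimately have "\<xi> (t + 2*pi) ** a (t + 2*pi) = \<xi> t ** a t ** h"
      unfolding h(2) by (rule vector_derivative_unique_at)
    then have "\<xi> (t + 2*pi) ** (a t ** h) = \<xi> t ** (a t ** h)" by (simp add: h(2) matrix_mul_assoc)
    then have "\<xi> (t + 2*pi) ** (a t ** h) ** conj_transpose (a t ** h) = \<xi> t ** (a t ** h) ** conj_transpose (a t ** h)" by simp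
    then show ?thesis by (simp only: unitary_cancel[OF unitary_mult[OF ua uh]])
  qed
  have speed: "norm (loop_deriv \<gamma> t) = sqrt c * norm (X t)" for t
    unfolding loop(2) by (rule norm_DF[OF a(2) X(2)])
  have tangent: "loop_deriv \<gamma> t \<in> tangent_space N (\<gamma> (cis t))" for t
    unfolding tangent_space_def mem_Collect_eq
  proof (intro exI[of _ "\<lambda>s. \<gamma> (cis (s + t))"] conjI allI)
    show "\<gamma> (cis (s + t)) \<in> N" for s using C1 by (auto simp: C1_loop_def)
    have "((\<lambda>t. \<gamma> (cis t)) has_vector_derivative loop_deriv \<gamma> t) (at (0 + t))"
      unfolding loop(2) a(3)[symmetric] add_0 by (rule F_curve[OF a(2) X(3)])
    then show "((\<lambda>s. \<gamma> (cis (s + t))) has_vector_derivative loop_deriv \<gamma> t) (at 0)"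
      by (rule has_vector_derivative_shift_arg)
  qed simp
  have "((\<lambda>t. loop_deriv \<gamma> t \<bullet> loop_deriv \<gamma> t) has_vector_derivative 0) (at t within UNIV)" for t
  proof -
    obtain acc where acc: "(loop_deriv \<gamma> has_vector_derivative acc) (at t)" "acc \<bullet> loop_deriv \<gamma> t = 0"
      using geod[of t] tangent[of t] by blast
    show ?thesis
      using bounded_bilinear.has_vector_derivative[OF bounded_bilinear_inner acc(1) acc(1)] acc(2)
      by (simp add: inner_commute)
  qed
  then obtain C where "\<And>t. t \<in> UNIV \<Longrightarrow> loop_deriv \<gamma> t \<bullet> loop_deriv \<gamma> t = C"
    using has_vector_derivative_zero_constant[OF convex_UNIV] by blast
  then have "norm (loop_deriv \<gamma> t) = norm (loop_deriv \<gamma> 0)" for t by (simp add: norm_eq_sqrt_inner)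
  then have normX: "norm (X t) = norm (X 0)" for t using c by (simp add: speed)
  have min: "min_length N \<gamma> = 2 * pi * (sqrt c * norm (X 0))"
  proof -
    have "integral {0..2*pi} (\<lambda>t. norm (X t)) = integral {0..2*pi} (\<lambda>t. norm (X 0))"
      by (rule integral_cong) (rule normX)
    then show ?thesis unfolding len[symmetric] loop(3) by simp
  qed
  have inner_const: "Z \<bullet> \<xi> t = Z \<bullet> \<xi> 0" if "Z \<in> su" for Z t
  proof (rule minimising_curve_momentum[where a = a and \<gamma> = \<gamma> and \<xi> = \<xi> and h = h and \<rho> = "norm (X 0)"])
    show "norm (\<xi> t) = norm (X 0)" for t using norm\<xi>[of t] normX[of t] by simp
  qed (rule a(2) a(3) \<xi> h \<xi>per min that)+
  have \<xi>_const: "\<xi> t = \<xi> 0" for t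
  proof -
    have "\<xi> t - \<xi> 0 \<in> su" by (intro subspace_diff[OF subspace_su] \<xi>(1))
    from inner_const[OF this, of t] have "(\<xi> t - \<xi> 0) \<bullet> (\<xi> t - \<xi> 0) = 0" by (simp add: inner_diff_right)
    then show ?thesis by simp
  qed
  obtain V x where V: "unitary V" "sum x UNIV = 0" and gen: "\<xi> 0 = gen V x" using su_eq_gen[OF \<xi>(1)] by blast
  \<comment> \<open>Uniqueness for the equation a' = \<xi> a with constant \<xi>: undoing the flow
    leaves a constant.\<close>
  have "((\<lambda>t. opg V x (- t) ** a t) has_vector_derivative 0) (at t within UNIV)" for t
  proof -
    have "((\<lambda>t. - t) has_vector_derivative - 1) (at t)" by (auto intro!: derivative_eq_intros)
    from vector_diff_chain_at[OF this has_vector_derivative_opg[OF V(1)]]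
    have "((\<lambda>t. opg V x (- t)) has_vector_derivative - (gen V x ** opg V x (- t))) (at t)" by (simp add: o_def)
    from has_vector_derivative_matrix_mult[OF this \<xi>(3)[of t]] show ?thesis
      unfolding \<xi>_const[of t] gen
      by (simp add: matrix_mult_minus_left matrix_mul_assoc opg_gen_commute[OF V(1)])
  qed
  then obtain D where D: "\<And>t. t \<in> UNIV \<Longrightarrow> opg V x (- t) ** a t = D"
    using has_vector_derivative_zero_constant[OF convex_UNIV] by blast
  have a0: "opg V x (- t) ** a t = a 0" for t using D[of t] D[of 0] by (simp add: opg_0[OF V(1)])
  have at: "a t = opg V x t ** a 0" for t
  proof -
    have "a t = opg V x t ** (opg V x (- t) ** a t)" by (simp add: matrix_mul_assoc opg_cancel[OF V(1)])
    then show ?thesis by (simp only: a0)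
  qed
  \<comment> \<open>Conjugating by \<open>a 0\<close> moves the group from the left of the base
    point to its right, the side on which \<open>H\<close> acts.\<close>
  let ?V = "conj_transpose (a 0) ** V"
  have "a 0 ** opg ?V x t = a t" for t
    unfolding at[of t] opg_conjugate[of "conj_transpose (a 0)" V x t, symmetric]
    by (simp add: matrix_mul_assoc [symmetric] unitary_cancel[OF ua])
  moreover have "unitary ?V" by (intro unitary_mult unitary_conj_transpose ua V)
  moreover have "norm (gen ?V x) = norm (X 0)"
  proof -
    have "norm (gen ?V x) = norm (gen V x)"
      by (rule power2_eq_imp_eq) (simp_all add: norm_gen[OF V(1)] norm_gen[OF \<open>unitary ?V\<close>])
    then show ?thesis using norm\<xi>[of 0] gen by simp
  qed
  ultimately show ?thesis using V(2) min by (intro exI[of _ ?V] exI[of _ x]) simp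
qed

end

section \<open>Minimal logarithms\<close>

text \<open>The half-open interval admits the eigenvalue -1, so this form of uniqueness applies to
  the principal logarithm of every unitary matrix.\<close>

lemma opg_eq_on_half_open:
  assumes "unitary V" "unitary W" "opg V x 1 = opg W y 1"
    and "\<And>j. - pi < x j \<and> x j \<le> pi" "\<And>j. - pi < y j \<and> y j \<le> pi"
  shows "opg V x s = opg W y s"
  unfolding opg_def
proof (rule diagonalisation_intertwine[OF assms(1,2)])
  show "V ** cdiag (\<lambda>j. cis (1 * x j)) ** conj_transpose V = W ** cdiag (\<lambda>j. cis (1 * y j)) ** conj_transpose W"
    using assms(3) by (simp add: opg_def)
next
  fix j k assume "cis (1 * x j) = cis (1 * y k)"
  then obtain n :: int where n: "x j = y k + 2 * pi * n" using cis_eq_imp[of "x j" "y k"] by auto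
  have "\<bar>x j - y k\<bar> < 2 * pi" using assms(4)[of j] assms(5)[of k] by linarith
  then have "2 * pi * \<bar>real_of_int n\<bar> < 2 * pi * 1" by (simp add: n abs_mult)
  then have "n = 0" by (subst (asm) mult_less_cancel_left_pos) auto
  then show "cis (s * x j) = cis (s * y k)" using n by simp
qed

section \<open>Permuting eigenvalues\<close>

definition permutation_matrix :: "('d \<Rightarrow> 'd) \<Rightarrow> complex^'d^'d" where
  "permutation_matrix p = (\<chi> a b. if b = p a then 1 else 0)"

lemma permutation_matrix_conjugate:
  fixes p :: "'d::finite \<Rightarrow> 'd"
  assumes "inj p"
  shows "permutation_matrix p ** cdiag f ** conj_transpose (permutation_matrix p) = cdiag (\<lambda>k. f (p k))"
proof -
  have "(permutation_matrix p ** cdiag f ** conj_transpose (permutation_matrix p)) $ a $ b = cdiag (\<lambda>k. f (p k)) $ a $ b" for a b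
  proof -
    have "(permutation_matrix p ** cdiag f ** conj_transpose (permutation_matrix p)) $ a $ b
      = (\<Sum>k\<in>UNIV. (permutation_matrix p ** cdiag f) $ a $ k * conj_transpose (permutation_matrix p) $ k $ b)"
      by (simp add: matrix_matrix_mult_def)
    also have "\<dots> = (\<Sum>k\<in>UNIV. if k = p a then f (p a) * (if p a = p b then 1 else 0) else 0)"
      unfolding matrix_mult_cdiag by (intro sum.cong refl) (auto simp: permutation_matrix_def)
    also have "\<dots> = cdiag (\<lambda>k. f (p k)) $ a $ b" using assms by (simp add: cdiag_def inj_eq)
    finally show ?thesis .
  qed
  then show ?thesis by (simp add: vec_eq_iff)
qed

lemma unitary_permutation_matrix:
  fixes p :: "'d::finite \<Rightarrow> 'd"
  assumes "inj p" shows "unitary (permutation_matrix p)"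
proof -
  have "permutation_matrix p ** conj_transpose (permutation_matrix p) = mat 1"
    using permutation_matrix_conjugate[OF assms, of "\<lambda>_. 1"] by (simp add: cdiag_simps)
  then show ?thesis unfolding unitary_def using matrix_left_right_inverse by blast
qed

lemma opg_permute:
  assumes "inj p"
  shows "opg V (\<lambda>k. x (p k)) t = opg (V ** permutation_matrix p) x t"
proof -
  have "opg V (\<lambda>k. x (p k)) t = V ** (permutation_matrix p ** cdiag (\<lambda>k. cis (t * x k)) ** conj_transpose (permutation_matrix p)) ** conj_transpose V"
    unfolding opg_def permutation_matrix_conjugate[OF assms] ..
  then show ?thesis by (simp add: opg_def conj_transpose_mult matrix_mul_assoc)
qed

text \<open>Both \<open>x\<close> and \<open>x + n\<close> have minimal norm in the coset, so each summand of
  \<open>|x + n|\<^sup>2 - |x|\<^sup>2 = \<Sum> n\<^sub>k (n\<^sub>k + 2 (x\<^sub>k - min x) - 1)\<close> vanishes.\<close>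

lemma minimal_shift_is_permutation:
  fixes x :: "'d::finite \<Rightarrow> real" and n :: "'d \<Rightarrow> int"
  assumes spread: "\<And>i j. x j - x i \<le> 1" and sum0: "(\<Sum>k\<in>UNIV. n k) = 0"
    and le: "(\<Sum>k\<in>UNIV. (x k + of_int (n k))\<^sup>2) \<le> (\<Sum>k\<in>UNIV. (x k)\<^sup>2)"
  shows "\<exists>p. bij p \<and> (\<forall>k. x k + of_int (n k) = x (p k))"
proof -
  define a where "a = Min (range x)"
  have a_le: "a \<le> x k" for k unfolding a_def by (rule Min_le) auto
  have "a \<in> range x" unfolding a_def by (rule Min_in) auto
  then have le_a: "x k \<le> a + 1" for k using spread by (auto simp: algebra_simps)
  \<comment> \<open>Since \<open>x k - a\<close> lies in [0, 1] and \<open>n k\<close> is an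
    integer, the two factors never have opposite signs. All summands are thus nonnegative while
    their total is not positive.\<close>
  define q where "q k = of_int (n k) * (of_int (n k) + 2 * (x k - a) - 1)" for k
  have q_nonneg: "0 \<le> q k" for k
  proof -
    consider "n k = 0" | "n k \<ge> 1" | "n k \<le> -1" by linarith
    then show ?thesis
    proof cases
      case 1 then show ?thesis by (simp add: q_def)
    next
      case 2 then show ?thesis unfolding q_def using a_le[of k] by (intro mult_nonneg_nonneg) auto
    next
      case 3
      then have "real_of_int (n k) \<le> -1" by linarith
      then show ?thesis unfolding q_def using le_a[of k] by (intro mult_nonpos_nonpos) auto
    qed
  qed
  have "(\<Sum>k\<in>UNIV. q k) = (\<Sum>k\<in>UNIV. (x k + of_int (n k))\<^sup>2 - (x k)\<^sup>2 - (2 * a + 1) * of_int (n k))"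
    by (intro sum.cong refl) (simp add: q_def power2_eq_square algebra_simps)
  also have "\<dots> = (\<Sum>k\<in>UNIV. (x k + of_int (n k))\<^sup>2) - (\<Sum>k\<in>UNIV. (x k)\<^sup>2) - (2 * a + 1) * of_int (\<Sum>k\<in>UNIV. n k)"
    by (simp add: sum_subtractf sum_distrib_left)
  finally have "(\<Sum>k\<in>UNIV. q k) \<le> 0" using le sum0 by simp
  then have "(\<Sum>k\<in>UNIV. q k) = 0" using q_nonneg by (meson antisym sum_nonneg)
  then have q0: "q k = 0" for k using sum_nonneg_eq_0_iff[of UNIV q] q_nonneg by simp
  \<comment> \<open>The equality cases: an entry at the bottom may rise by 1, an entry at the top
    may fall by 1, and every other entry stays.\<close>
  have cases: "n k = 0 \<or> (n k = 1 \<and> x k = a) \<or> (n k = -1 \<and> x k = a + 1)" for k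
  proof (cases "n k = 0")
    case False
    then have e: "real_of_int (n k) = 1 - 2 * x k + 2 * a" using q0[of k] by (simp add: q_def)
    then have "real_of_int (n k) \<le> 1" "real_of_int (n k) \<ge> -1" using a_le[of k] le_a[of k] by linarith+
    then have "n k \<le> 1" "n k \<ge> -1" by linarith+
    then have "n k = 1 \<or> n k = -1" using False by linarith
    then show ?thesis using e by (elim disjE) simp_all
  qed simp
  define P where "P = {k. n k = 1}"
  define M where "M = {k. n k = -1}"
  have nPM: "n k = (if k \<in> P then 1 else 0) - (if k \<in> M then 1 else 0)" for k
    using cases[of k] by (auto simp: P_def M_def)
  have card: "(\<Sum>k\<in>UNIV. if k \<in> Q then 1 else 0) = int (card Q)" for Q :: "'d set"
    by (simp add: sum.If_cases)
  have "(\<Sum>k\<in>UNIV. n k) = (\<Sum>k\<in>UNIV. (if k \<in> P then 1 else 0) - (if k \<in> M then 1 else 0))"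
    by (rule sum.cong[OF refl nPM])
  then have "(\<Sum>k\<in>UNIV. n k) = int (card P) - int (card M)"
    unfolding sum_subtractf card .
  then have "card P = card M" using sum0 by simp
  \<comment> \<open>As the shifts sum to zero, as many entries rise as fall; exchanging them in
    pairs realises the shift by an involution.\<close>
  then obtain f where f: "bij_betw f P M" using finite_same_card_bij[of P M] by auto
  define p where "p k = (if k \<in> P then f k else if k \<in> M then inv_into P f k else k)" for k
  have PM: "k \<notin> M" if "k \<in> P" for k using that by (auto simp: P_def M_def)
  have fP: "f k \<in> M" if "k \<in> P" for k using f that by (auto simp: bij_betw_def)
  have gM: "inv_into P f k \<in> P" "f (inv_into P f k) = k" if "k \<in> M" for k
    using f that bij_betw_imp_surj_on[OF f] by (auto intro: inv_into_into f_inv_into_f)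
  have "p (p k) = k" for k
    using PM fP gM f by (auto simp: p_def bij_betw_def dest: inv_into_f_f)
  then have "bij p" by (rule involuntory_imp_bij)
  moreover have "x k + of_int (n k) = x (p k)" for k
  proof -
    consider "k \<in> P" | "k \<in> M" | "k \<notin> P" "k \<notin> M" by blast
    then show ?thesis
    proof cases
      case 1
      then have "p k \<in> M" using fP by (simp add: p_def)
      then show ?thesis using 1 cases[of k] cases[of "p k"] by (auto simp: P_def M_def)
    next
      case 2
      then have "p k \<in> P" using gM PM by (auto simp: p_def)
      then show ?thesis using 2 cases[of k] cases[of "p k"] by (auto simp: P_def M_def)
    next
      case 3
      then have "n k = 0" using cases[of k] by (auto simp: P_def M_def)
      then show ?thesis using 3 by (simp add: p_def)
    qed
  qed
  ultimately show ?thesis by blast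
qed

text \<open>The unitary change of basis has nonzero entries only between equal eigenvalues. Its
  determinant is nonzero, so some product in the expansion over permutations is nonzero, and that
  permutation matches the eigenvalues with multiplicity.\<close>

lemma diagonalisation_permutation:
  fixes V W :: "complex^'d^'d"
  assumes V: "unitary V" and W: "unitary W" and eq: "V ** cdiag f ** conj_transpose V = W ** cdiag g ** conj_transpose W"
  shows "\<exists>p. bij p \<and> (\<forall>k. g k = f (p k))"
proof -
  let ?M = "conj_transpose W ** V"
  have "?M ** cdiag f = conj_transpose W ** (V ** cdiag f ** conj_transpose V) ** V"
    by (simp add: matrix_mul_assoc [symmetric] unitary_cancel[OF V] unitaryD[OF V])
  also have "\<dots> = cdiag g ** ?M"
    unfolding eq by (simp add: matrix_mul_assoc unitary_cancel[OF W] unitaryD[OF W])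
  finally have M: "?M $ j $ k * f k = g j * ?M $ j $ k" for j k
    by (metis matrix_mult_cdiag)
  have "unitary ?M" by (intro unitary_mult unitary_conj_transpose V W)
  then have "det ?M \<noteq> 0"
    using unitaryD(1)[of ?M] by (metis det_I det_mul mult_zero_right zero_neq_one)
  have "\<exists>p. p permutes (UNIV :: 'd set) \<and> of_int (sign p) * (\<Prod>i\<in>UNIV. ?M $ i $ p i) \<noteq> 0"
  proof (rule ccontr)
    assume *: "\<nexists>p. p permutes (UNIV :: 'd set) \<and> of_int (sign p) * (\<Prod>i\<in>UNIV. ?M $ i $ p i) \<noteq> 0"
    have "det ?M = 0" unfolding det_def by (rule sum.neutral) (use * in blast)
    then show False using \<open>det ?M \<noteq> 0\<close> by simp
  qed
  then obtain p where p: "p permutes (UNIV :: 'd set)" "of_int (sign p) * (\<Prod>i\<in>UNIV. ?M $ i $ p i) \<noteq> 0"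
    by blast
  then have "?M $ k $ p k \<noteq> 0" for k by simp
  then have "g k = f (p k)" for k using M[of k "p k"] by (simp add: mult.commute)
  moreover have "bij p" using p(1) by (rule permutes_bij)
  ultimately show ?thesis by blast
qed

section \<open>Logarithms of minimal length\<close>

context SU_quotient
begin

lemma has_vector_derivative_geodesic:
  assumes "unitary V"
  shows "((\<lambda>t. g ** opg V x t) has_vector_derivative (g ** opg V x t) ** gen V x) (at t)"
  using bounded_linear.has_vector_derivative[OF bounded_bilinear.bounded_linear_right[OF bounded_bilinear_matrix_mult]
      has_vector_derivative_opg[OF assms], of g]
  by (simp add: opg_gen_commute[OF assms, symmetric] matrix_mul_assoc)

text \<open>Multiplying by the loop \<open>diag(e\<^sup>i\<^sup>t, e\<^sup>-\<^sup>i\<^sup>t)\<close> in the coordinates \<open>i, j\<close> does not change the homotopy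
  class: this loop is the commutator of \<open>D = diag(e\<^sup>i\<^sup>t, 1)\<close> with a transposition, which is joined to the
  identity in the unitary group.\<close>

lemma minimal_logarithm_spread:
  assumes g: "g \<in> G" and V: "unitary V" "sum x UNIV = 0" and \<gamma>: "\<And>t. F (g ** opg V x t) = \<gamma> (cis t)"
    and h: "opg V x (2*pi) \<in> H" and min: "min_length N \<gamma> = 2 * pi * (sqrt c * norm (gen V x))"
  shows "x j - x i \<le> 1"
proof (cases "i = j")
  case False
  let ?I = "mat 1 :: complex^'d^'d"
  define e where "e k l = (if l = k then 1 else 0 :: real)" for k l :: 'd
  \<comment> \<open>The competitor raises eigenvalue i by 1 and lowers eigenvalue j by 1, which
    keeps the trace and the group element at time 2 pi.\<close>
  define x' where "x' k = x k + (e i k - e j k)" for k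
  define \<tau> where "\<tau> k = (if k = i then j else if k = j then i else k)" for k
  have \<tau>: "inj \<tau>" by (rule injI) (auto simp: \<tau>_def split: if_splits)
  have e\<tau>: "e i (\<tau> k) = e j k" for k using False by (auto simp: e_def \<tau>_def)
  have uI: "unitary ?I" by simp
  obtain W w where W: "unitary W" and Ww: "permutation_matrix \<tau> = opg W w 1"
    using unitary_log[OF unitary_permutation_matrix[OF \<tau>]] by blast
  \<comment> \<open>For each s this is a commutator, so its determinant is 1 although its factors
    are only unitary. It is the identity at s = 0; at s = 1 the transposition turns the second
    diagonal factor from i to j.\<close>
  define K where "K s t = opg ?I (e i) t ** opg W w s ** opg ?I (e i) (- t) ** opg W w (- s)" for s t
  have K0: "K 0 t = mat 1" for t
    unfolding K_def by (simp add: opg_0[OF W] opg_cancel[OF uI])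
  have K1: "K 1 t = opg ?I (e i) t ** opg ?I (e j) (- t)" for t
  proof -
    have "opg W w 1 ** opg ?I (e i) (- t) ** conj_transpose (opg W w 1) = opg ?I (\<lambda>k. e i (\<tau> k)) (- t)"
      unfolding opg_permute[OF \<tau>] using opg_conjugate[of "opg W w 1" ?I "e i" "- t"] by (simp add: Ww)
    then show ?thesis by (simp add: K_def e\<tau> conj_transpose_opg matrix_mul_assoc[symmetric])
  qed
  have KG: "K s t \<in> G" for s t
    unfolding K_def carrier_SU using W
    by (simp add: unitary_mult unitary_opg det_mul det_opg cis_mult)
  have opg_int: "opg ?I (e k) (t + 2*pi) = opg ?I (e k) t" for k t
  proof -
    have "cis ((t + 2*pi) * e k l) = cis (t * e k l)" for l by (auto simp: e_def cis_mult [symmetric])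
    then show ?thesis by (simp add: opg_def)
  qed
  have opg_int': "opg ?I (e k) (- t - 2*pi) = opg ?I (e k) (- t)" for k t
    using opg_int[of k "- t - 2*pi"] by simp
  have K_per: "K s (t + 2*pi) = K s t" for s t
    by (simp add: K_def opg_int opg_int')
  define m where "m s t = g ** (V ** (K s t ** opg ?I x t) ** conj_transpose V)" for s t
  have mG: "m s t \<in> G" for s t
    unfolding m_def by (intro SU_mult g conjugate_SU KG opg_SU uI V)
  have m0: "m 0 t = g ** opg V x t" for t
    using opg_conjugate[of V ?I x t] by (simp add: m_def K0)
  have m1: "m 1 t = g ** opg V x' t" for t
  proof -
    have "K 1 t ** opg ?I x t = opg ?I x' t"
      by (simp add: K1 opg_def cdiag_simps cis_mult x'_def algebra_simps)
    then show ?thesis using opg_conjugate[of V ?I x' t] by (simp add: m_def)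
  qed
  \<comment> \<open>\<open>K\<close> has period 2 pi because its diagonal factors have integral
    exponents, so all curves of the homotopy close up through the same element of
    \<open>H\<close>.\<close>
  have m_per: "m s (t + 2*pi) = m s t ** opg V x (2*pi)" for s t
  proof -
    have "m s t ** opg V x (2*pi) = g ** (V ** (K s t ** opg ?I x t) ** conj_transpose V ** (V ** opg ?I x (2*pi) ** conj_transpose V))"
      using opg_conjugate[of V ?I x "2*pi"] by (simp add: m_def matrix_mul_assoc)
    also have "\<dots> = g ** (V ** (K s t ** opg ?I x t ** opg ?I x (2*pi)) ** conj_transpose V)"
      unfolding conjugate_mult[OF V(1)] ..
    also have "\<dots> = m s (t + 2*pi)"
      by (simp add: m_def K_per opg_add[OF uI] matrix_mul_assoc)
    finally show ?thesis by simp
  qed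
  have F_per: "F (m s (t + 2*pi)) = F (m s t)" for s t
    unfolding m_per by (rule F_right_H[OF mG h])
  define \<alpha> where "\<alpha> z = F (m 1 (Arg2pi z))" for z
  have \<alpha>: "\<alpha> (cis t) = F (m 1 t)" for t
    unfolding \<alpha>_def by (rule periodic_Arg2pi_cis[of "\<lambda>t. F (m 1 t)", OF F_per])
  have "sum x' UNIV = 0" by (simp add: x'_def sum.distrib sum_subtractf V(2) e_def)
  then have su: "gen V x' \<in> su" by (simp add: gen_in_su[OF V(1)])
  have "C1_loop N \<alpha>" and len: "loop_length \<alpha> = sqrt c * integral {0..2*pi} (\<lambda>t. norm (gen V x'))"
  proof -
    have der: "(m 1 has_vector_derivative m 1 t ** gen V x') (at t)" for t
      unfolding m1[abs_def] by (rule has_vector_derivative_geodesic[OF V(1)])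
    show "C1_loop N \<alpha>" "loop_length \<alpha> = sqrt c * integral {0..2*pi} (\<lambda>t. norm (gen V x'))"
      by (rule loop_of_curve[OF mG der su continuous_on_const \<alpha>])+
  qed
  have "homotopic_maps N \<gamma> \<alpha>"
  proof (rule homotopic_maps_periodic[where f = "\<lambda>y. F (m (fst y) (snd y))"])
    show "continuous_on ({0..1} \<times> UNIV) (\<lambda>y. F (m (fst y) (snd y)))"
    proof (rule continuous_on_F_compose)
      show "continuous_on ({0..1} \<times> UNIV) (\<lambda>y. m (fst y) (snd y))"
        unfolding m_def K_def by (intro continuous_intros)
    qed (use mG in blast)
    show "F (m (fst (s, t)) (snd (s, t))) \<in> N" for s t unfolding N by (intro imageI mG)
    show "F (m (fst (s, t + 2*pi)) (snd (s, t + 2*pi))) = F (m (fst (s, t)) (snd (s, t)))" for s t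
      by (simp add: F_per)
  qed (simp_all add: \<alpha> m0 \<gamma>)
  from min_length_le[OF \<open>C1_loop N \<alpha>\<close> this] have "2 * pi * (sqrt c * norm (gen V x)) \<le> 2 * pi * (sqrt c * norm (gen V x'))"
    unfolding len min by (simp add: mult_ac)
  then have "norm (gen V x) \<le> norm (gen V x')" using c by simp
  then have "(norm (gen V x))\<^sup>2 \<le> (norm (gen V x'))\<^sup>2" by (intro power_mono) auto
  \<comment> \<open>The squared norms differ by 2 (x i - x j + 1), which minimality makes
    nonnegative.\<close>
  moreover have "(\<Sum>k\<in>UNIV. (x' k)\<^sup>2) = (\<Sum>k\<in>UNIV. (x k)\<^sup>2) + (2 * x i + 1) - (2 * x j - 1)"
  proof -
    have "(x' k)\<^sup>2 = (x k)\<^sup>2 + (if k = i then 2 * x i + 1 else 0) - (if k = j then 2 * x j - 1 else 0)" for k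
      using False by (auto simp: x'_def e_def power2_eq_square algebra_simps)
    then show ?thesis by (simp add: sum.distrib sum_subtractf)
  qed
  ultimately show ?thesis by (simp add: norm_gen[OF V(1)])
qed simp

text \<open>Equal values at 2 pi leave only a permutation and integral shifts of the eigenvalues,
  and equal norms with the spread bound turn the shifts into a permutation too. The resulting
  conjugating matrix k commutes with the common value h. So does its principal logarithm, since
  conjugating that by h gives another principal logarithm of k.\<close>

theorem minimal_logarithms_conjugate:
  fixes V W :: "complex^'d^'d"
  assumes V: "unitary V" "sum x UNIV = 0" and W: "unitary W" "sum y UNIV = 0"
    and eq: "opg V x (2*pi) = opg W y (2*pi)" and norm: "norm (gen V x) = norm (gen W y)"
    and spread: "\<And>i j. x j - x i \<le> 1"
  shows "\<exists>R \<kappa>. unitary R \<and> (\<forall>t. opg W y t = opg R \<kappa> 1 ** opg V x t ** opg R \<kappa> (- 1)) \<and>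
    (\<forall>s. opg R \<kappa> s ** opg V x (2*pi) = opg V x (2*pi) ** opg R \<kappa> s)"
proof -
  obtain p where p: "bij p" "\<And>k. cis (2*pi * y k) = cis (2*pi * x (p k))"
    using diagonalisation_permutation[OF V(1) W(1), of "\<lambda>k. cis (2*pi * x k)" "\<lambda>k. cis (2*pi * y k)"] eq
    by (auto simp: opg_def)
  have "\<exists>n::int. y k = x (p k) + of_int n" for k
    using cis_eq_imp[OF p(2)[of k]] by (auto simp flip: distrib_left)
  then obtain n :: "'d \<Rightarrow> int" where n: "\<And>k. y k = x (p k) + of_int (n k)" by metis
  have sum_p: "(\<Sum>k\<in>UNIV. f (p k)) = (\<Sum>k\<in>UNIV. f k)" for f :: "'d \<Rightarrow> real"
    using sum.reindex_bij_betw[OF p(1), of f] .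
  have "sum y UNIV = (\<Sum>k\<in>UNIV. x (p k)) + of_int (\<Sum>k\<in>UNIV. n k)" by (simp add: n sum.distrib)
  then have "real_of_int (\<Sum>k\<in>UNIV. n k) = 0" using V(2) W(2) sum_p[of x] by linarith
  then have n0: "(\<Sum>k\<in>UNIV. n k) = 0" by (simp only: of_int_eq_0_iff)
  have "(\<Sum>k\<in>UNIV. (y k)\<^sup>2) = (\<Sum>k\<in>UNIV. (x (p k))\<^sup>2)"
    using norm norm_gen[OF V(1), of x] norm_gen[OF W(1), of y] sum_p[of "\<lambda>k. (x k)\<^sup>2"] by simp
  then obtain q where q: "bij q" "\<And>k. x (p k) + of_int (n k) = x (p (q k))"
    using minimal_shift_is_permutation[of "\<lambda>k. x (p k)" n] spread n0 n by auto
  have pq: "inj (p \<circ> q)" using p(1) q(1) by (simp add: bij_is_inj inj_compose)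
  have y: "y = (\<lambda>k. x ((p \<circ> q) k))" using n q(2) by auto
  define W' where "W' = W ** permutation_matrix (p \<circ> q)"
  have W': "unitary W'" unfolding W'_def by (intro unitary_mult W unitary_permutation_matrix pq)
  have opgW: "opg W y t = opg W' x t" for t unfolding y W'_def by (rule opg_permute[OF pq])
  define k where "k = W' ** conj_transpose V"
  have uk: "unitary k" unfolding k_def by (intro unitary_mult unitary_conj_transpose V W')
  have kV: "k ** V = W'" by (simp add: k_def unitary_cancel[OF V(1)])
  obtain R \<kappa> where R: "unitary R" "\<And>j. - pi < \<kappa> j \<and> \<kappa> j \<le> pi" and k: "k = opg R \<kappa> 1"
    using unitary_log[OF uk] by blast
  let ?h = "opg V x (2*pi)"
  have uh: "unitary ?h" by (rule unitary_opg[OF V(1)])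
  have conj: "opg W y t = k ** opg V x t ** conj_transpose k" for t
    unfolding opgW opg_conjugate kV ..
  have "k ** ?h ** conj_transpose k = ?h" using conj[of "2*pi"] eq by simp
  then have "?h ** k = k ** ?h ** conj_transpose k ** k" by simp
  then have hk: "?h ** k = k ** ?h" unfolding unitary_cancel(4)[OF uk] .
  have "?h ** k ** conj_transpose ?h = k" unfolding hk by (rule unitary_cancel(3)[OF uh])
  then have "opg (?h ** R) \<kappa> 1 = opg R \<kappa> 1"
    unfolding k opg_conjugate .
  then have "opg (?h ** R) \<kappa> s = opg R \<kappa> s" for s
    by (rule opg_eq_on_half_open[OF unitary_mult[OF uh R(1)] R(1) _ R(2) R(2)])
  then have hR: "?h ** opg R \<kappa> s ** conj_transpose ?h = opg R \<kappa> s" for s unfolding opg_conjugate .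
  have "opg R \<kappa> s ** ?h = ?h ** opg R \<kappa> s" for s
    by (subst hR[of s, symmetric]) (rule unitary_cancel(4)[OF uh])
  moreover have "opg W y t = opg R \<kappa> 1 ** opg V x t ** opg R \<kappa> (- 1)" for t
    unfolding conj k conj_transpose_opg ..
  ultimately show ?thesis using R(1) by blast
qed

text \<open>The homotopy is lifted on the convex strip [0,1] x R. Translating the strip by 2 pi
  changes the lift by one constant element of \<open>H\<close>, which is how both boundary curves
  get the same h.\<close>

lemma homotopic_maps_lift:
  assumes "homotopic_maps N \<gamma>\<^sub>0 \<gamma>\<^sub>1"
  shows "\<exists>a0 a1 h. h \<in> H \<and> continuous_on UNIV a0 \<and> continuous_on UNIV a1 \<and>
    (\<forall>t. a0 t \<in> G \<and> a1 t \<in> G \<and> F (a0 t) = \<gamma>\<^sub>0 (cis t) \<and> F (a1 t) = \<gamma>\<^sub>1 (cis t) \<and>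
      a0 (t + 2*pi) = a0 t ** h \<and> a1 (t + 2*pi) = a1 t ** h)"
proof -
  obtain k where k: "continuous_map (prod_topology (top_of_set {0..1::real}) (top_of_set (sphere 0 1))) (top_of_set N) k"
    "\<And>z. k (0, z) = \<gamma>\<^sub>0 z" "\<And>z. k (1, z) = \<gamma>\<^sub>1 z"
    using assms unfolding homotopic_with_def by blast
  then have "continuous_on ({0..1} \<times> sphere 0 1) k \<and> (\<forall>y\<in>{0..1} \<times> sphere 0 1. k y \<in> N)"
    by (simp add: prod_topology_subtopology_eu continuous_map_in_subtopology Pi_iff)
  then have ck: "continuous_on ({0..1} \<times> sphere 0 1) k" and kN: "\<And>y. y \<in> {0..1} \<times> sphere 0 1 \<Longrightarrow> k y \<in> N"
    by blast+
  let ?S = "{0..1::real} \<times> (UNIV :: real set)"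
  have conv: "convex ?S" by (intro convex_Times convex_closed_interval convex_UNIV)
  have ne: "?S \<noteq> {}" by auto
  have "continuous_on ?S (\<lambda>y. k (fst y, cis (snd y)))"
    by (rule continuous_on_compose2[OF ck]) (auto intro!: continuous_intros)
  moreover have "k (fst y, cis (snd y)) \<in> N" if "y \<in> ?S" for y using that by (intro kN) auto
  ultimately obtain l where l: "continuous_on ?S l" "\<And>y. y \<in> ?S \<Longrightarrow> l y \<in> G \<and> F (l y) = k (fst y, cis (snd y))"
    using lift_convex[OF conv ne, of "\<lambda>y. k (fst y, cis (snd y))"] by blast
  have "continuous_on ?S (\<lambda>y. l (fst y, snd y + 2*pi))"
    by (rule continuous_on_compose2[OF l(1)]) (auto intro!: continuous_intros)
  moreover have "l y \<in> G \<and> l (fst y, snd y + 2*pi) \<in> G \<and> F (l y) = F (l (fst y, snd y + 2*pi))" if "y \<in> ?S" for y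
    using l(2)[OF that] l(2)[of "(fst y, snd y + 2*pi)"] that by (auto simp: cis_mult [symmetric])
  ultimately obtain h where h: "h \<in> H" "\<And>y. y \<in> ?S \<Longrightarrow> l (fst y, snd y + 2*pi) = l y ** h"
    using lifts_differ_by_constant[OF convex_connected[OF conv] ne l(1), of "\<lambda>y. l (fst y, snd y + 2*pi)"] by blast
  have "continuous_on UNIV (\<lambda>t. l (s, t))" if "s \<in> {0..1}" for s
    by (rule continuous_on_compose2[OF l(1)]) (use that in \<open>auto intro!: continuous_intros\<close>)
  then show ?thesis
    using h(1) h(2)[of "(0, _)"] h(2)[of "(1, _)"] l(2)[of "(0, _)"] l(2)[of "(1, _)"]
    by (intro exI[of _ "\<lambda>t. l (0, t)"] exI[of _ "\<lambda>t. l (1, t)"] exI[of _ h]) (simp add: k)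
qed

lemma min_length_homotopic:
  assumes "homotopic_maps N \<gamma>\<^sub>0 \<gamma>\<^sub>1" shows "min_length N \<gamma>\<^sub>0 = min_length N \<gamma>\<^sub>1"
proof -
  have "homotopic_maps N \<gamma>\<^sub>0 \<beta> \<longleftrightarrow> homotopic_maps N \<gamma>\<^sub>1 \<beta>" for \<beta>
  proof
    assume "homotopic_maps N \<gamma>\<^sub>0 \<beta>"
    then show "homotopic_maps N \<gamma>\<^sub>1 \<beta>" by (rule homotopic_with_trans[OF homotopic_with_symD[OF assms]])
  next
    assume "homotopic_maps N \<gamma>\<^sub>1 \<beta>"
    then show "homotopic_maps N \<gamma>\<^sub>0 \<beta>" by (rule homotopic_with_trans[OF assms])
  qed
  then show ?thesis by (simp add: min_length_def)
qed

end

section \<open>Polygons in the quotient\<close>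

text \<open>The cubic step 3y^2 - 2y^3 on [0, 1], extended by constants. Its derivative vanishes at
  both ends, so traversing each side of a broken geodesic at this pace gives a continuously
  differentiable loop of the same length.\<close>

definition ramp :: "real \<Rightarrow> real" where
  "ramp y = integral {0..max 0 (min 1 y)} (\<lambda>s. 6 * s * (1 - s))"

lemma ramp_props:
  "y \<le> 0 \<Longrightarrow> ramp y = 0" "y \<ge> 1 \<Longrightarrow> ramp y = 1"
  "\<exists>D. continuous_on UNIV D \<and> (\<forall>y. 0 \<le> D y \<and> (ramp has_vector_derivative D y) (at y)) \<and> (\<forall>y. y \<le> 0 \<or> 1 \<le> y \<longrightarrow> D y = 0)"
  "ramp y \<in> {0..1}"
proof -
  define D where "D y = (let s = max 0 (min 1 y) in 6 * s * (1 - s))" for y :: real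
  have D: "continuous_on UNIV D" unfolding D_def Let_def by (intro continuous_intros)
  have D0: "0 \<le> D y" for y unfolding D_def Let_def by (intro mult_nonneg_nonneg) auto
  have Dz: "y \<le> 0 \<or> 1 \<le> y \<Longrightarrow> D y = 0" for y by (auto simp: D_def)
  have int: "integral {0..s} (\<lambda>s. 6 * s * (1 - s)) = 3 * s\<^sup>2 - 2 * s ^ 3" if "0 \<le> s" for s :: real
  proof -
    have "((\<lambda>s. 6 * s * (1 - s)) has_integral (3 * s\<^sup>2 - 2 * s ^ 3) - (3 * 0\<^sup>2 - 2 * 0 ^ 3)) {0..s}"
      by (rule fundamental_theorem_of_calculus[OF that])
        (auto intro!: derivative_eq_intros simp: has_real_derivative_iff_has_vector_derivative [symmetric] power2_eq_square algebra_simps)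
    then show ?thesis by (simp add: integral_unique)
  qed
  have ramp: "ramp y = 3 * (max 0 (min 1 y))\<^sup>2 - 2 * (max 0 (min 1 y)) ^ 3" for y
    unfolding ramp_def by (rule int) simp
  show r0: "y \<le> 0 \<Longrightarrow> ramp y = 0" and r1: "y \<ge> 1 \<Longrightarrow> ramp y = 1" for y
    by (simp_all add: ramp max_def min_def)
  obtain f where f0: "f 0 = 0" and f: "\<And>y. (f has_vector_derivative D y) (at y)" using ex_primitive[OF D] by blast
  have rf: "ramp y = f y" for y
  proof -
    have seg: "f b - f a = integral {a..b} D" if "a \<le> b" for a b
      using fundamental_theorem_of_calculus[OF that, of f D] f has_vector_derivative_at_within by (metis integral_unique)
    have pos: "f y = integral {0..y} D" if "0 \<le> y" for y using seg[OF that] f0 by simp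
    have mid: "f y = ramp y" if "0 \<le> y" "y \<le> 1" for y
    proof -
      have "integral {0..y} D = integral {0..y} (\<lambda>s. 6 * s * (1 - s))"
        by (rule integral_cong) (use that in \<open>auto simp: D_def\<close>)
      then show ?thesis using pos[OF that(1)] int[OF that(1)] that by (simp add: ramp)
    qed
    consider "y < 0" | "0 \<le> y" "y \<le> 1" | "1 < y" by linarith
    then show ?thesis
    proof cases
      case 1
      have "integral {y..0} D = integral {y..0} (\<lambda>_. 0)" by (rule integral_cong) (auto simp: Dz)
      then show ?thesis using seg[of y 0] f0 1 r0[of y] by simp
    next
      case 2 then show ?thesis using mid by simp
    next
      case 3
      have "integral {1..y} D = integral {1..y} (\<lambda>_. 0)" by (rule integral_cong) (auto simp: Dz)
      then show ?thesis using seg[of 1 y] mid[of 1] 3 r1[of y] r1[of 1] by simp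
    qed
  qed
  have "ramp = f" using rf by (simp add: fun_eq_iff)
  then show "\<exists>D. continuous_on UNIV D \<and> (\<forall>y. 0 \<le> D y \<and> (ramp has_vector_derivative D y) (at y)) \<and> (\<forall>y. y \<le> 0 \<or> 1 \<le> y \<longrightarrow> D y = 0)"
    using D D0 Dz f by (intro exI[of _ D]) simp
  define s where "s = max 0 (min 1 y)"
  have s: "0 \<le> s" "s \<le> 1" by (auto simp: s_def)
  have "3 * s\<^sup>2 - 2 * s ^ 3 = s\<^sup>2 * (3 - 2 * s)" "1 - (3 * s\<^sup>2 - 2 * s ^ 3) = (1 - s)\<^sup>2 * (1 + 2 * s)"
    by (simp_all add: power2_eq_square power3_eq_cube algebra_simps)
  moreover have "0 \<le> s\<^sup>2 * (3 - 2 * s)" "0 \<le> (1 - s)\<^sup>2 * (1 + 2 * s)" using s by (auto intro!: mult_nonneg_nonneg)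
  ultimately have "0 \<le> 3 * s\<^sup>2 - 2 * s ^ 3" "3 * s\<^sup>2 - 2 * s ^ 3 \<le> 1" by linarith+
  then show "ramp y \<in> {0..1}" by (simp add: ramp s_def)
qed

text \<open>Near any angle, the loop is the sum of two shifted copies of the curve.\<close>

lemma loop_of_closed_curve:
  fixes b :: "real \<Rightarrow> 'v::euclidean_space"
  assumes b: "\<And>t. (b has_vector_derivative b' t) (at t)" "continuous_on UNIV b'"
    and const: "\<And>t. t \<le> 0 \<or> 2*pi \<le> t \<Longrightarrow> b t = q" and N: "\<And>t. t \<in> {0..2*pi} \<Longrightarrow> b t \<in> N"
    and \<alpha>: "\<And>z. \<alpha> z = b (Arg2pi z)"
  shows "C1_loop N \<alpha>" "loop_length \<alpha> = integral {0..2*pi} (\<lambda>t. norm (b' t))"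
    "\<And>t. t \<in> {0..2*pi} \<Longrightarrow> \<alpha> (cis t) = b t"
proof -
  have zero_before: "b' t = 0" if "t \<le> 0" for t
  proof -
    have "((\<lambda>_. q) has_vector_derivative b' t) (at t within {t - 1..t})"
      by (rule has_vector_derivative_transform[OF _ _ has_vector_derivative_at_within[OF b(1)]]) (use that const in auto)
    moreover have "((\<lambda>_. q) has_vector_derivative 0) (at t within {t - 1..t})" by (rule has_vector_derivative_const)
    ultimately show ?thesis using vector_derivative_unique_within_closed_interval[of "t - 1" t t "\<lambda>_. q"] by simp
  qed
  have zero_after: "b' t = 0" if "2*pi \<le> t" for t
  proof -
    have "((\<lambda>_. q) has_vector_derivative b' t) (at t within {t..t + 1})"
      by (rule has_vector_derivative_transform[OF _ _ has_vector_derivative_at_within[OF b(1)]]) (use that const in auto)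
    moreover have "((\<lambda>_. q) has_vector_derivative 0) (at t within {t..t + 1})" by (rule has_vector_derivative_const)
    ultimately show ?thesis using vector_derivative_unique_within_closed_interval[of t "t + 1" t "\<lambda>_. q"] by simp
  qed
  \<comment> \<open>On (-2 pi, 2 pi) one of the two copies rests at \<open>q\<close>, so subtracting
    \<open>q\<close> leaves the other. The seam at angle zero becomes an interior point of a
    differentiable function.\<close>
  define f where "f t = b t + b (t + 2*pi) - q" for t
  define f' where "f' t = b' t + b' (t + 2*pi)" for t
  have f: "(f has_vector_derivative f' t) (at t)" for t
    unfolding f_def f'_def using has_vector_derivative_diff_const
      has_vector_derivative_add[OF b(1)[of t] has_vector_derivative_shift_arg[OF b(1)[of "t + 2*pi"]]]
    by (auto intro!: derivative_eq_intros has_vector_derivative_add b(1) has_vector_derivative_shift_arg[OF b(1)])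
  have cf': "continuous_on UNIV f'" unfolding f'_def
    by (intro continuous_intros b(2) continuous_on_compose2[OF b(2)]) auto
  have ff: "\<alpha> (cis t) = f t" if "- 2*pi < t" "t < 2*pi" for t
  proof (cases "0 \<le> t")
    case True
    have "Arg2pi (cis t) = t" using that True by (intro Arg2pi_unique[of 1]) (simp_all add: cis_conv_exp)
    then show ?thesis using True const[of "t + 2*pi"] by (simp add: \<alpha> f_def)
  next
    case False
    have "exp (\<i> * complex_of_real (t + 2*pi)) = cis t"
      unfolding cis_conv_exp [symmetric] by (simp add: cis_mult [symmetric])
    then have "complex_of_real 1 * exp (\<i> * complex_of_real (t + 2*pi)) = cis t" by (simp only: of_real_1 mult_1)
    then have "Arg2pi (cis t) = t + 2*pi"
      by (rule Arg2pi_unique) (use that False in auto)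
    then show ?thesis using False const[of t] by (simp add: \<alpha> f_def)
  qed
  have near: "((\<lambda>t. \<alpha> (cis t)) has_vector_derivative f' t) (at t)" if "- 2*pi < t" "t < 2*pi" for t
    by (rule has_vector_derivative_transform_within_open[OF f[of t], of "{- 2*pi<..<2*pi}"]) (use that ff in auto)
  have shift: "((\<lambda>t. \<alpha> (cis t)) has_vector_derivative f' (t - 2 * pi * of_int n)) (at t)"
    if "- 2*pi < t - 2 * pi * of_int n" "t - 2 * pi * of_int n < 2*pi" for t and n :: int
  proof -
    have "((\<lambda>t. \<alpha> (cis (t + (- 2 * pi * of_int n)))) has_vector_derivative f' (t - 2 * pi * of_int n)) (at t)"
      by (rule has_vector_derivative_shift_arg) (use near[OF that] in simp)
    moreover have "cis (t + (- 2 * pi * of_int n)) = cis t" for t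
      using periodic_add_int[of cis t "- n"] by (simp add: cis_mult [symmetric])
    ultimately show ?thesis by simp
  qed
  define D where "D t = vector_derivative (\<lambda>t. \<alpha> (cis t)) (at t)" for t
  have ex_n: "\<exists>n::int. - 2*pi < t - 2 * pi * of_int n \<and> t - 2 * pi * of_int n < 2*pi" for t
  proof -
    define k where "k = \<lfloor>t / (2*pi)\<rfloor>"
    have k: "of_int k \<le> t / (2*pi)" "t / (2*pi) < of_int k + 1" unfolding k_def by linarith+
    have "of_int k * (2*pi) \<le> t" using mult_right_mono[OF k(1), of "2*pi"] by simp
    moreover have "t < (of_int k + 1) * (2*pi)" using mult_strict_right_mono[OF k(2), of "2*pi"] by simp
    ultimately show ?thesis using pi_gt_zero by (intro exI[of _ k]) (simp add: algebra_simps)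
  qed
  have D: "((\<lambda>t. \<alpha> (cis t)) has_vector_derivative D t) (at t)" for t
    using ex_n[of t] shift unfolding D_def by (metis vector_derivative_works differentiableI_vector)
  have "isCont D t" for t
  proof -
    obtain n :: int where n: "- 2*pi < t - 2 * pi * of_int n" "t - 2 * pi * of_int n < 2*pi" using ex_n by blast
    have eq: "D u = f' (u - 2 * pi * of_int n)" if "u \<in> {2 * pi * of_int n - 2*pi<..<2 * pi * of_int n + 2*pi}" for u
      unfolding D_def by (rule vector_derivative_at[OF shift]) (use that in auto)
    have "continuous_on {2 * pi * of_int n - 2*pi<..<2 * pi * of_int n + 2*pi} (\<lambda>u. f' (u - 2 * pi * of_int n))"
      by (rule continuous_on_compose2[OF cf']) (auto intro!: continuous_intros)
    then have "continuous_on {2 * pi * of_int n - 2*pi<..<2 * pi * of_int n + 2*pi} D"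
      by (rule continuous_on_eq) (simp add: eq)
    then show ?thesis using n by (subst (asm) continuous_on_eq_continuous_at) auto
  qed
  then have "continuous_on UNIV D" by (simp add: continuous_at_imp_continuous_on)
  then have "(\<lambda>t. \<alpha> (cis t)) C1_differentiable_on UNIV"
    unfolding C1_differentiable_on_def using D by (intro exI[of _ D]) simp
  moreover have "\<alpha> z \<in> N" for z unfolding \<alpha> using Arg2pi[of z] by (intro N) simp
  ultimately show "C1_loop N \<alpha>" by (auto simp: C1_loop_def)
  have "norm (loop_deriv \<alpha> t) = norm (b' t)" if "t \<in> {0..2*pi} - {2*pi}" for t
  proof -
    have "loop_deriv \<alpha> t = f' t" unfolding loop_deriv_def by (rule vector_derivative_at[OF near]) (use that in auto)
    also have "\<dots> = b' t" using zero_after[of "t + 2*pi"] that by (simp add: f'_def)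
    finally show ?thesis by simp
  qed
  then show "loop_length \<alpha> = integral {0..2*pi} (\<lambda>t. norm (b' t))"
    unfolding loop_length_def by (intro integral_spike[of "{2*pi}"]) auto
  show "\<alpha> (cis t) = b t" if "t \<in> {0..2*pi}" for t
  proof (cases "t = 2*pi")
    case True
    moreover have "Arg2pi 1 = 0" by (simp add: Arg2pi_eq_0)
    ultimately show ?thesis using const[of 0] const[of "2*pi"] by (simp add: \<alpha>)
  next
    case False
    then show ?thesis using that ff[of t] const[of "t + 2*pi"] by (simp add: f_def)
  qed
qed

lemma ex_subinterval:
  fixes s t :: real and n :: nat
  assumes s: "s > 0" "s * real n = b" and n: "n > 0" and t: "t \<in> {0..b}"
  shows "\<exists>k<n. t \<in> {s * real k..s * real (Suc k)}"
proof (cases "t = b")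
  case True
  \<comment> \<open>The right end point belongs to the last interval; the floor used in the other
    case would give the index n.\<close>
  have "s * real (n - 1) \<le> s * real n" using s(1) by (intro mult_left_mono) auto
  then have 1: "s * real (n - 1) \<le> t" unfolding True s(2) .
  have "Suc (n - 1) = n" using n by simp
  then have 2: "t \<le> s * real (Suc (n - 1))" unfolding True s(2)[symmetric] by simp
  show ?thesis by (intro exI[of _ "n - 1"] conjI) (use n in simp, use 1 2 in \<open>simp only: atLeastAtMost_iff simp_thms\<close>)
next
  case False
  let ?k = "nat \<lfloor>t / s\<rfloor>"
  have ts: "0 \<le> t / s" using t s(1) by simp
  then have k: "real ?k \<le> t / s" "t / s < real (Suc ?k)" by linarith+
  have kt: "s * ?k \<le> t" "t < s * Suc ?k"
    using mult_left_mono[OF k(1), of s] mult_strict_left_mono[OF k(2), of s] s(1) by simp_all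
  have "s * ?k < s * n" using kt(1) t False s(2) by auto
  then have "?k < n" using s(1) by simp
  then show ?thesis using kt by (intro exI[of _ ?k]) auto
qed

context SU_quotient
begin

text \<open>The sides are added as displacements instead of being pasted. Each is constant before
  and after its own arc, so the sum telescopes to the polygon, and differentiability and the length
  bound follow termwise.\<close>

lemma polygon_loop:
  fixes q :: "nat \<Rightarrow> 'v" and n :: nat
  assumes n: "n > 0" and closed: "q n = q 0" and r: "r \<ge> 0"
    and seg: "\<And>j. j < n \<Longrightarrow> \<exists>g V x. g \<in> G \<and> unitary V \<and> sum x UNIV = 0 \<and> q j = F g \<and> q (Suc j) = F (g ** opg V x 1) \<and>
      sqrt c * norm (gen V x) \<le> L j" and L: "\<And>j. j < n \<Longrightarrow> L j \<le> r"
  shows "\<exists>\<beta>. C1_loop N \<beta> \<and> loop_length \<beta> \<le> (\<Sum>j<n. L j) \<and>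
    (\<forall>j<n. \<forall>t\<in>{2*pi/n * j..2*pi/n * Suc j}. norm (\<beta> (cis t) - q j) \<le> r)"
proof -
  define s where "s = 2 * pi / n"
  have s: "s > 0" "s * n = 2 * pi" using n by (simp_all add: s_def)
  obtain D where D: "continuous_on UNIV D" "\<And>y. 0 \<le> D y" "\<And>y. (ramp has_vector_derivative D y) (at y)"
    using ramp_props(3) by blast
  define Q where "Q j y \<longleftrightarrow> fst y \<in> G \<and> unitary (fst (snd y)) \<and> sum (snd (snd y)) UNIV = 0 \<and> q j = F (fst y) \<and>
      q (Suc j) = F (fst y ** opg (fst (snd y)) (snd (snd y)) 1) \<and> sqrt c * norm (gen (fst (snd y)) (snd (snd y))) \<le> L j"
    for j y
  have "\<exists>y. j < n \<longrightarrow> Q j y" for j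
  proof (cases "j < n")
    case True
    then obtain g V x where "g \<in> G \<and> unitary V \<and> sum x UNIV = 0 \<and> q j = F g \<and> q (Suc j) = F (g ** opg V x 1) \<and>
      sqrt c * norm (gen V x) \<le> L j" using seg by blast
    then have "Q j (g, V, x)" by (simp add: Q_def)
    then show ?thesis by blast
  qed simp
  from choice[OF allI[OF this]] obtain y where y: "\<forall>j. j < n \<longrightarrow> Q j (y j)" by (rule exE)
  define g V x where "g j = fst (y j)" and "V j = fst (snd (y j))" and "x j = snd (snd (y j))" for j
  have gV: "g j \<in> G" "unitary (V j)" "sum (x j) UNIV = 0" "q j = F (g j)" "q (Suc j) = F (g j ** opg (V j) (x j) 1)"
    "sqrt c * norm (gen (V j) (x j)) \<le> L j" if "j < n" for j
    using y[rule_format, OF that] by (simp_all add: Q_def g_def V_def x_def)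
  define m where "m j y = g j ** opg (V j) (x j) y" for j y
  define C where "C j y = F (m j y)" for j y
  define C' where "C' j y = DF (m j y) (m j y ** gen (V j) (x j))" for j y
  have mG: "m j y \<in> G" if "j < n" for j y unfolding m_def by (intro SU_mult opg_SU gV that)
  have C: "(C j has_vector_derivative C' j y) (at y)" if "j < n" for j y
    unfolding C_def[abs_def] C'_def by (rule F_curve[OF mG[OF that]])
      (unfold m_def[abs_def], rule has_vector_derivative_geodesic[OF gV(2)[OF that]])
  have nC': "norm (C' j y) \<le> L j" if "j < n" for j y
    unfolding C'_def using norm_DF[OF mG[OF that]] gV(6)[OF that] gen_in_su[OF gV(2)[OF that]] gV(3)[OF that] by simp
  have cC': "continuous_on UNIV (C' j)" if "j < n" for j
    unfolding C'_def[abs_def] m_def using mG[OF that] by (intro continuous_on_DF continuous_intros) (auto simp: m_def)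
  have C0: "C j 0 = q j" and C1: "C j 1 = q (Suc j)" if "j < n" for j
    using gV that by (simp_all add: C_def m_def opg_0)
  have C_near: "norm (C j y - q j) \<le> r" if "j < n" "y \<in> {0..1}" for j y
  proof -
    have "norm (C j y - C j 0) \<le> L j * norm (y - 0)"
    proof (rule differentiable_bound[of "{0..1}" "C j" "\<lambda>t h. h *\<^sub>R C' j t"])
      show "(C j has_derivative (\<lambda>h. h *\<^sub>R C' j t)) (at t within {0..1})" for t
        using C[OF that(1), of t] by (simp add: has_vector_derivative_def has_derivative_at_withinI)
      show "onorm (\<lambda>h. h *\<^sub>R C' j t) \<le> L j" for t
      proof (rule onorm_le)
        fix h :: real
        show "norm (h *\<^sub>R C' j t) \<le> L j * norm h"
          using mult_right_mono[OF nC'[OF that(1), of t], of "norm h"] by (simp add: mult.commute)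
      qed
    qed (use that in auto)
    also have "\<dots> \<le> r * 1" using that L[OF that(1)] r by (intro mult_mono) auto
    finally show ?thesis by (simp add: C0[OF that(1)])
  qed
  define P where "P j t = C j (ramp (t / s - real j))" for j t
  define P' where "P' j t = (D (t / s - real j) / s) *\<^sub>R C' j (ramp (t / s - real j))" for j t
  have cramp: "continuous_on UNIV ramp"
    by (rule continuous_at_imp_continuous_on) (use D(3) has_vector_derivative_continuous in blast)
  have dramp: "((\<lambda>t. ramp (t / s - real j)) has_vector_derivative D (t / s - real j) / s) (at t)" for j t
  proof -
    have "((\<lambda>t. t / s - real j) has_vector_derivative 1 / s) (at t)"
      using s(1) by (auto intro!: derivative_eq_intros simp: has_real_derivative_iff_has_vector_derivative [symmetric])
    from vector_diff_chain_at[OF this D(3)] show ?thesis by (simp add: o_def)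
  qed
  have P: "(P j has_vector_derivative P' j t) (at t)" if "j < n" for j t
    using vector_diff_chain_at[OF dramp C[OF that]] by (simp add: o_def P_def[abs_def] P'_def)
  have cP': "continuous_on UNIV (P' j)" if "j < n" for j
    unfolding P'_def[abs_def] using s(1)
    by (intro continuous_intros continuous_on_compose2[OF D(1)] continuous_on_compose2[OF cC'[OF that]]
        continuous_on_compose2[OF cramp]) auto
  define b where "b t = q 0 + (\<Sum>j<n. P j t - q j)" for t
  define b' where "b' t = (\<Sum>j<n. P' j t)" for t
  have b: "(b has_vector_derivative b' t) (at t)" for t
  proof -
    have "((\<lambda>t. \<Sum>j<n. P j t - q j) has_vector_derivative (\<Sum>j<n. P' j t - 0)) (at t)"
      by (intro has_vector_derivative_sum has_vector_derivative_diff has_vector_derivative_const P) auto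
    from has_vector_derivative_add[OF has_vector_derivative_const[of "q 0"] this] show ?thesis
      unfolding b_def[abs_def] b'_def by simp
  qed
  have cb': "continuous_on UNIV b'" unfolding b'_def by (intro continuous_on_sum cP') auto
  have P_before: "P j t = q j" if "j < n" "t \<le> s * j" for j t
  proof -
    have "t / s \<le> real j" using that s(1) by (simp add: pos_divide_le_eq mult.commute)
    then show ?thesis using ramp_props(1)[of "t / s - real j"] by (simp add: P_def C0[OF that(1)])
  qed
  have P_after: "P j t = q (Suc j)" if "j < n" "s * Suc j \<le> t" for j t
  proof -
    have "real (Suc j) \<le> t / s" using that s(1) by (simp add: pos_le_divide_eq mult.commute)
    then show ?thesis using ramp_props(2)[of "t / s - real j"] by (simp add: P_def C1[OF that(1)])
  qed
  have b_seg: "b t = P k t" if k: "k < n" "t \<in> {s * k..s * Suc k}" for k t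
  proof -
    have "(\<Sum>j<n. P j t - q j) = (\<Sum>j<Suc k. P j t - q j)"
    proof (rule sum.mono_neutral_right)
      show "\<forall>j\<in>{..<n} - {..<Suc k}. P j t - q j = 0"
      proof
        fix j assume j: "j \<in> {..<n} - {..<Suc k}"
        then have "s * Suc k \<le> s * j" using s(1) by (intro mult_left_mono) auto
        then show "P j t - q j = 0" using P_before[of j t] j k by auto
      qed
    qed (use k in auto)
    also have "\<dots> = (\<Sum>j<k. q (Suc j) - q j) + (P k t - q k)"
    proof -
      have "P j t = q (Suc j)" if "j < k" for j
      proof -
        have "s * Suc j \<le> s * k" using that s(1) by (intro mult_left_mono) auto
        then show ?thesis using P_after[of j t] that k by auto
      qed
      then show ?thesis by simp
    qed
    also have "\<dots> = P k t - q 0" by (simp add: sum_lessThan_telescope)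
    finally show ?thesis by (simp add: b_def)
  qed
  have const: "b t = q 0" if "t \<le> 0 \<or> 2*pi \<le> t" for t
    using that
  proof
    assume t: "t \<le> 0"
    have "t \<le> s * j" for j :: nat using t s(1) by (meson mult_nonneg_nonneg of_nat_0_le_iff order_trans less_imp_le)
    then show ?thesis by (simp add: b_def P_before)
  next
    assume t: "2*pi \<le> t"
    have "P j t = q (Suc j)" if "j < n" for j
    proof -
      have "s * Suc j \<le> s * n" using that s(1) by (intro mult_left_mono) auto
      then show ?thesis using P_after[OF that] t s(2) by simp
    qed
    then have "(\<Sum>j<n. P j t - q j) = (\<Sum>j<n. q (Suc j) - q j)" by (intro sum.cong) auto
    then show ?thesis by (simp add: b_def sum_lessThan_telescope closed)
  qed
  have ex_seg: "\<exists>k<n. t \<in> {s * k..s * Suc k}" if "t \<in> {0..2*pi}" for t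
    by (rule ex_subinterval[OF s n that])
  have bN: "b t \<in> N" if t02: "t \<in> {0..2*pi}" for t
  proof -
    obtain k where k: "k < n" "t \<in> {s * k..s * Suc k}" using ex_seg[OF t02] by blast
    show ?thesis unfolding b_seg[OF k] P_def C_def N by (intro imageI mG k)
  qed
  define \<beta> where "\<beta> z = b (Arg2pi z)" for z
  note loop = loop_of_closed_curve[OF b cb' const bN \<beta>_def]
  have "loop_length \<beta> \<le> (\<Sum>j<n. L j)"
  proof -
    \<comment> \<open>The pace along one side integrates to the total progress 1 of
      \<open>ramp\<close>, so each side contributes exactly its own bound.\<close>
    have hI: "((\<lambda>t. D (t / s - real j) / s * L j) has_integral L j) {0..2*pi}" if "j < n" for j
    proof -
      have "((\<lambda>t. D (t / s - real j) / s) has_integral ramp (2*pi / s - real j) - ramp (0 / s - real j)) {0..2*pi}"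
        by (rule fundamental_theorem_of_calculus) (simp_all add: has_vector_derivative_at_within dramp)
      moreover have "2*pi / s = n" using s n by (simp add: s_def)
      moreover have "real n - real j \<ge> 1" using that by simp
      ultimately have "((\<lambda>t. D (t / s - real j) / s) has_integral 1) {0..2*pi}"
        by (simp add: ramp_props(1,2))
      from has_integral_mult_left[OF this, of "L j"] show ?thesis by simp
    qed
    have "integral {0..2*pi} (\<lambda>t. norm (b' t)) \<le> (\<Sum>j<n. L j)"
    proof (rule has_integral_le[OF integrable_integral])
      show "(\<lambda>t. norm (b' t)) integrable_on {0..2*pi}"
        by (intro integrable_continuous_interval continuous_on_norm continuous_on_subset[OF cb']) simp
      show "((\<lambda>t. \<Sum>j<n. D (t / s - real j) / s * L j) has_integral (\<Sum>j<n. L j)) {0..2*pi}"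
        by (intro has_integral_sum hI) auto
      fix t
      have "norm (b' t) \<le> (\<Sum>j<n. norm (P' j t))" unfolding b'_def by (rule norm_sum)
      also have "\<dots> \<le> (\<Sum>j<n. D (t / s - real j) / s * L j)"
        unfolding P'_def using D(2) s(1) nC' by (intro sum_mono) (auto intro!: divide_right_mono mult_left_mono)
      finally show "norm (b' t) \<le> (\<Sum>j<n. D (t / s - real j) / s * L j)" .
    qed
    then show ?thesis using loop(2) by simp
  qed
  moreover have "norm (\<beta> (cis t) - q j) \<le> r" if j: "j < n" "t \<in> {2*pi/n * j..2*pi/n * Suc j}" for j t
  proof -
    have js: "t \<in> {s * j..s * Suc j}" using j by (simp add: s_def)
    have "s * Suc j \<le> s * n" using j s(1) by (intro mult_left_mono) auto
    moreover have "0 \<le> s * j" using s(1) by simp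
    ultimately have "t \<in> {0..2*pi}" using js s(2) by auto
    then have "\<beta> (cis t) = P j t" using loop(3) b_seg[OF j(1) js] by simp
    then show ?thesis unfolding P_def using C_near[OF j(1)] ramp_props(4) by simp
  qed
  ultimately show ?thesis by (intro exI[of _ \<beta>] conjI loop(1) allI impI ballI)
qed

end

section \<open>Upper bound for the synharmonic distance\<close>

lemma cyl_eq_cbox: "cyl T = cbox (0, 0) (2*pi, T)"
  by (simp add: cbox_Pair_eq)

lemma LINT_cyl:
  fixes f :: "real \<times> real \<Rightarrow> 'a::euclidean_space"
  assumes "continuous_on UNIV f"
  shows "integrable (lebesgue_on (cyl T)) f" "(LINT z|lebesgue_on (cyl T). f z) = integral (cyl T) f"
proof -
  have "continuous_on (cbox (0, 0) (2*pi, T)) f" by (rule continuous_on_subset[OF assms subset_UNIV])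
  then show int: "integrable (lebesgue_on (cyl T)) f" unfolding cyl_eq_cbox by (rule continuous_imp_integrable)
  show "(LINT z|lebesgue_on (cyl T). f z) = integral (cyl T) f"
    by (rule lebesgue_integral_eq_integral[OF int]) (simp add: cyl_eq_cbox)
qed

lemma L2_on_continuous:
  fixes f :: "'a::euclidean_space \<Rightarrow> 'v::euclidean_space"
  assumes "continuous_on UNIV f" shows "L2_on (cbox a b) f"
proof -
  have c: "continuous_on (cbox a b) f" by (rule continuous_on_subset[OF assms subset_UNIV])
  have "integrable (lebesgue_on (cbox a b)) f" by (rule continuous_imp_integrable[OF c])
  moreover have "integrable (lebesgue_on (cbox a b)) (\<lambda>z. (norm (f z))\<^sup>2)"
    by (rule continuous_imp_integrable) (intro continuous_intros c)
  ultimately show ?thesis unfolding L2_on_def by (simp add: borel_measurable_integrable)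
qed

lemma C1_periodicI:
  assumes D: "\<And>z. (w has_derivative D z) (at z)" and c: "\<And>v. continuous_on UNIV (\<lambda>z. D z v)"
    and per: "\<And>\<theta> t. w (\<theta> + 2*pi, t) = w (\<theta>, t)"
  shows "C1_periodic w" "frechet_derivative w (at z) = D z"
proof -
  have fd: "frechet_derivative w (at z) = D z" for z using frechet_derivative_at[OF D] by simp
  have "w differentiable_on UNIV" using D by (auto simp: differentiable_on_def differentiable_def)
  then show "C1_periodic w" using c per by (simp add: C1_periodic_def fd)
  show "frechet_derivative w (at z) = D z" by (rule fd)
qed

lemma C1_periodicD:
  assumes "C1_periodic w"
  shows "(w has_derivative frechet_derivative w (at z)) (at z)"
    "continuous_on UNIV (\<lambda>z. frechet_derivative w (at z) v)"
    "w (\<theta> + 2*pi, t) = w (\<theta>, t)" "continuous_on UNIV w"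
    "((\<lambda>\<theta>. w (\<theta>, t)) has_vector_derivative frechet_derivative w (at (\<theta>, t)) (1, 0)) (at \<theta>)"
    "((\<lambda>t. w (\<theta>, t)) has_vector_derivative frechet_derivative w (at (\<theta>, t)) (0, 1)) (at t)"
proof -
  have diff: "w differentiable_on UNIV" and per: "\<And>\<theta> t. w (\<theta> + 2*pi, t) = w (\<theta>, t)"
    using assms by (auto simp: C1_periodic_def)
  show D: "(w has_derivative frechet_derivative w (at z)) (at z)" for z
    using bspec[OF diff[unfolded differentiable_on_def] UNIV_I, of z] unfolding frechet_derivative_works .
  show "continuous_on UNIV (\<lambda>z. frechet_derivative w (at z) v)"
    using assms by (simp add: C1_periodic_def del: split_paired_All)
  show "w (\<theta> + 2*pi, t) = w (\<theta>, t)" by (rule per)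
  show "continuous_on UNIV w" by (rule differentiable_imp_continuous_on[OF diff])
  have "((\<lambda>\<theta>. (\<theta>, t)) has_vector_derivative (1, 0)) (at \<theta>)"
    by (auto intro!: has_vector_derivative_Pair derivative_eq_intros)
  then show "((\<lambda>\<theta>. w (\<theta>, t)) has_vector_derivative frechet_derivative w (at (\<theta>, t)) (1, 0)) (at \<theta>)"
    using vector_derivative_diff_chain_within[of "\<lambda>\<theta>. (\<theta>, t)" "(1, 0)" \<theta> UNIV w, OF _ has_derivative_at_withinI[OF D]]
    by (simp add: o_def)
  have "((\<lambda>t. (\<theta>, t)) has_vector_derivative (0, 1)) (at t)"
    by (auto intro!: has_vector_derivative_Pair derivative_eq_intros)
  then show "((\<lambda>t. w (\<theta>, t)) has_vector_derivative frechet_derivative w (at (\<theta>, t)) (0, 1)) (at t)"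
    using vector_derivative_diff_chain_within[of "\<lambda>t. (\<theta>, t)" "(0, 1)" t UNIV w, OF _ has_derivative_at_withinI[OF D]]
    by (simp add: o_def)
qed

lemma integral_cyl:
  fixes f :: "real \<times> real \<Rightarrow> 'a::euclidean_space"
  assumes "continuous_on UNIV f"
  shows "integral (cyl T) f = integral {0..2*pi} (\<lambda>\<theta>. integral {0..T} (\<lambda>t. f (\<theta>, t)))"
    "integral (cyl T) f = integral {0..T} (\<lambda>t. integral {0..2*pi} (\<lambda>\<theta>. f (\<theta>, t)))"
proof -
  have c: "continuous_on (cbox (0, 0) (2*pi, T)) f" by (rule continuous_on_subset[OF assms subset_UNIV])
  show 1: "integral (cyl T) f = integral {0..2*pi} (\<lambda>\<theta>. integral {0..T} (\<lambda>t. f (\<theta>, t)))"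
    using integral_prod_continuous[OF c] by (simp add: cyl_eq_cbox)
  show "integral (cyl T) f = integral {0..T} (\<lambda>t. integral {0..2*pi} (\<lambda>\<theta>. f (\<theta>, t)))"
    unfolding 1 using integral_swap_continuous[of 0 0 "2*pi" T "\<lambda>\<theta> t. f (\<theta>, t)"] c by (simp add: case_prod_unfold)
qed

lemma integral_cyl_derivative_eq_0:
  fixes w :: "real \<times> real \<Rightarrow> 'a::euclidean_space"
  assumes w: "C1_periodic w" and T: "0 < T"
  shows "integral (cyl T) (\<lambda>z. frechet_derivative w (at z) (1, 0)) = 0"
    and "(\<And>\<theta>. w (\<theta>, 0) = 0 \<and> w (\<theta>, T) = 0) \<Longrightarrow> integral (cyl T) (\<lambda>z. frechet_derivative w (at z) (0, 1)) = 0"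
proof -
  note W = C1_periodicD[OF w]
  have "integral {0..2*pi} (\<lambda>\<theta>. frechet_derivative w (at (\<theta>, t)) (1, 0)) = 0" for t
  proof -
    have "((\<lambda>\<theta>. frechet_derivative w (at (\<theta>, t)) (1, 0)) has_integral w (2*pi, t) - w (0, t)) {0..2*pi}"
      by (rule fundamental_theorem_of_calculus) (simp_all add: has_vector_derivative_at_within W(5))
    then show ?thesis using W(3)[of 0 t] by (simp add: integral_unique)
  qed
  then show "integral (cyl T) (\<lambda>z. frechet_derivative w (at z) (1, 0)) = 0"
    unfolding integral_cyl(2)[OF W(2)] by simp
  assume 0: "\<And>\<theta>. w (\<theta>, 0) = 0 \<and> w (\<theta>, T) = 0"
  have "integral {0..T} (\<lambda>t. frechet_derivative w (at (\<theta>, t)) (0, 1)) = 0" for \<theta>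
  proof -
    have "((\<lambda>t. frechet_derivative w (at (\<theta>, t)) (0, 1)) has_integral w (\<theta>, T) - w (\<theta>, 0)) {0..T}"
      by (rule fundamental_theorem_of_calculus) (use T in \<open>simp_all add: has_vector_derivative_at_within W(6)\<close>)
    then show ?thesis using 0[of \<theta>] by (simp add: integral_unique)
  qed
  then show "integral (cyl T) (\<lambda>z. frechet_derivative w (at z) (0, 1)) = 0"
    unfolding integral_cyl(1)[OF W(2)] by simp
qed

text \<open>Integration by parts: the derivative of the product with a test function integrates to
  zero, by periodicity in the angle and by vanishing near both ends in t.\<close>

lemma weak_deriv_classical:
  fixes f :: "real \<times> real \<Rightarrow> 'v::euclidean_space"
  assumes f: "C1_periodic f" and T: "0 < T" and e: "e = (1, 0) \<or> e = (0, 1)"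
  shows "weak_deriv T e f (\<lambda>z. frechet_derivative f (at z) e)"
  unfolding weak_deriv_def
proof (intro allI impI)
  fix \<phi> assume "cyl_test T \<phi>"
  then obtain a b where \<phi>: "C1_periodic \<phi>" and ab: "0 < a" "b < T" "\<And>\<theta> t. t \<notin> {a..b} \<Longrightarrow> \<phi> (\<theta>, t) = 0"
    unfolding cyl_test_def by blast
  note F = C1_periodicD[OF f] and P = C1_periodicD[OF \<phi>]
  let ?D = "\<lambda>z h. \<phi> z *\<^sub>R frechet_derivative f (at z) h + frechet_derivative \<phi> (at z) h *\<^sub>R f z"
  have D: "((\<lambda>z. \<phi> z *\<^sub>R f z) has_derivative ?D z) (at z)" for z
    by (rule has_derivative_scaleR[OF P(1) F(1)])
  have cD: "continuous_on UNIV (\<lambda>z. \<phi> z *\<^sub>R frechet_derivative f (at z) v)"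
    "continuous_on UNIV (\<lambda>z. frechet_derivative \<phi> (at z) v *\<^sub>R f z)" for v
    by (intro continuous_intros P(2,4) F(2,4))+
  have w: "C1_periodic (\<lambda>z. \<phi> z *\<^sub>R f z)" and fd: "frechet_derivative (\<lambda>z. \<phi> z *\<^sub>R f z) (at z) = ?D z" for z
    by (rule C1_periodicI[OF D continuous_on_add[OF cD]]; simp add: P(3) F(3))+
  have "\<phi> (\<theta>, 0) *\<^sub>R f (\<theta>, 0) = 0 \<and> \<phi> (\<theta>, T) *\<^sub>R f (\<theta>, T) = 0" for \<theta>
    using ab by simp
  then have "integral (cyl T) (\<lambda>z. frechet_derivative (\<lambda>z. \<phi> z *\<^sub>R f z) (at z) e) = 0"
    using integral_cyl_derivative_eq_0[OF w T] e by blast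
  then have "integral (cyl T) (\<lambda>z. \<phi> z *\<^sub>R frechet_derivative f (at z) e + frechet_derivative \<phi> (at z) e *\<^sub>R f z) = 0"
    unfolding fd .
  then have "(LINT z|lebesgue_on (cyl T). \<phi> z *\<^sub>R frechet_derivative f (at z) e + frechet_derivative \<phi> (at z) e *\<^sub>R f z) = 0"
    by (simp only: LINT_cyl(2)[OF continuous_on_add[OF cD]])
  then have "(LINT z|lebesgue_on (cyl T). \<phi> z *\<^sub>R frechet_derivative f (at z) e)
    + (LINT z|lebesgue_on (cyl T). frechet_derivative \<phi> (at z) e *\<^sub>R f z) = 0"
    by (simp only: Bochner_Integration.integral_add[OF LINT_cyl(1)[OF cD(1)] LINT_cyl(1)[OF cD(2)]])
  then show "(LINT z|lebesgue_on (cyl T). frechet_derivative \<phi> (at z) e *\<^sub>R f z)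
    = - (LINT z|lebesgue_on (cyl T). \<phi> z *\<^sub>R frechet_derivative f (at z) e)"
    by (simp only: add_eq_0_iff)
qed

lemma d_synh_le_classical:
  fixes W :: "real \<times> real \<Rightarrow> 'v::euclidean_space"
  assumes W: "C1_periodic W" and T: "0 < T" and WN: "\<And>z. W z \<in> N"
    and \<gamma>: "\<And>\<theta>. \<gamma> (cis \<theta>) = W (\<theta>, 0)" and \<beta>: "\<And>\<theta>. \<beta> (cis \<theta>) = W (\<theta>, T)"
  shows "d_synh N \<gamma> \<beta> \<le> ereal (LINT z|lebesgue_on (cyl T).
    ((norm (frechet_derivative W (at z) (1, 0)))\<^sup>2 + (norm (frechet_derivative W (at z) (0, 1)))\<^sup>2) / 2
      - (min_length N \<gamma>)\<^sup>2 / (8 * pi\<^sup>2))"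
proof -
  let ?A = "\<lambda>z. frechet_derivative W (at z) (1, 0)" and ?B = "\<lambda>z. frechet_derivative W (at z) (0, 1)"
  note D = C1_periodicD[OF W]
  define u where "u y = W (Arg2pi (fst y), snd y)" for y
  have u: "u (cis \<theta>, t) = W (\<theta>, t)" for \<theta> t
    unfolding u_def using periodic_Arg2pi_cis[of "\<lambda>\<theta>. W (\<theta>, t)", OF D(3)] by simp
  have f: "(\<lambda>(\<theta>, t). u (cis \<theta>, t)) = W" by (simp add: u fun_eq_iff)
  have cW: "continuous_on UNIV (\<lambda>\<theta>. W (\<theta>, t))" for t
    by (rule continuous_on_compose2[OF D(4)]) (auto intro!: continuous_intros)
  have L2: "L2_on {0..2*pi} (\<lambda>\<theta>. W (\<theta>, t))" for t
    using L2_on_continuous[OF cW, of 0 "2*pi"] by simp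
  have "sobolev_cyl T W ?A ?B"
    unfolding sobolev_cyl_def cyl_eq_cbox
    by (intro conjI L2_on_continuous D(2,4) weak_deriv_classical[OF W T]) simp_all
  \<comment> \<open>A map that is \<open>C1\<close> up to the boundary is its own approximating
    sequence.\<close>
  moreover have "has_traces T W ?A ?B \<gamma> \<beta>"
    unfolding has_traces_def \<gamma> \<beta>
    by (intro conjI L2 exI[of _ "\<lambda>_. W"] allI W) simp_all
  ultimately have "synh_competitor N \<gamma> \<beta> T u ?A ?B"
    unfolding synh_competitor_def Let_def f using T WN by simp
  then show ?thesis
    unfolding d_synh_def by (intro INF_lower2[of "(T, u, ?A, ?B)"]) auto
qed

section \<open>A path of closed geodesics and its cost\<close>

context SU_quotient
begin

text \<open>The velocity of a curve in the group is automatically \<open>a\<close> times an element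
  of \<open>su\<close>, so the isometry applies without computing that element.\<close>

lemma norm_DF_curve:
  fixes a :: "real \<Rightarrow> complex^'d^'d"
  assumes aG: "\<And>t. a t \<in> G" and a: "(a has_vector_derivative a') (at \<theta>)"
  shows "norm (DF (a \<theta>) a') = sqrt c * norm a'"
proof -
  have "isCont a \<theta>" using a has_vector_derivative_continuous by blast
  from lift_has_derivative[OF aG this F_curve[OF aG a]] obtain X where
    X: "X \<in> su" "(a has_vector_derivative a \<theta> ** X) (at \<theta>)" by blast
  then have "a' = a \<theta> ** X" using a vector_derivative_unique_at by blast
  then show ?thesis using norm_DF[OF aG X(1)] unitary_G[OF aG] by simp
qed

lemma has_derivative_opg_compose:
  assumes "unitary V" "bounded_linear l"
  shows "((\<lambda>z. opg V x (l z)) has_derivative (\<lambda>h. l h *\<^sub>R (gen V x ** opg V x (l z)))) (at z)"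
proof -
  have "(l has_derivative l) (at z)" by (rule bounded_linear_imp_has_derivative[OF assms(2)])
  from has_derivative_compose[OF this has_vector_derivative_opg[OF assms(1), unfolded has_vector_derivative_def]]
  show ?thesis .
qed

text \<open>The interpolation is A(t) a0(0) B(t) E(\<theta>) B(t)^-1, where A moves the base point
  and B conjugates the one-parameter group E through matrices commuting with h. For fixed t it
  covers a closed geodesic of the original speed. The t-derivative is of order 1/T, and its square
  integrated over time T is again of order 1/T.\<close>

theorem d_synh_le_0:
  assumes "minimising_geodesic N \<gamma>\<^sub>0" "minimising_geodesic N \<gamma>\<^sub>1" and hom: "homotopic_maps N \<gamma>\<^sub>0 \<gamma>\<^sub>1"
  shows "d_synh N \<gamma>\<^sub>0 \<gamma>\<^sub>1 \<le> 0"
proof -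
  from homotopic_maps_lift[OF hom] obtain a0 a1 h where h: "h \<in> H"
    and ca: "continuous_on UNIV a0" "continuous_on UNIV a1"
    and aG: "\<And>t. a0 t \<in> G" "\<And>t. a1 t \<in> G"
    and Fa: "\<And>t. F (a0 t) = \<gamma>\<^sub>0 (cis t)" "\<And>t. F (a1 t) = \<gamma>\<^sub>1 (cis t)"
    and ah: "\<And>t. a0 (t + 2*pi) = a0 t ** h" "\<And>t. a1 (t + 2*pi) = a1 t ** h" by blast
  obtain V x where V: "unitary V" "sum x UNIV = 0" and a0: "\<And>t. a0 t = a0 0 ** opg V x t"
    and l0: "min_length N \<gamma>\<^sub>0 = 2 * pi * (sqrt c * norm (gen V x))"
    using minimising_geodesic_lift[OF assms(1) ca(1) aG(1) Fa(1)] by blast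
  obtain W y where W: "unitary W" "sum y UNIV = 0" and a1: "\<And>t. a1 t = a1 0 ** opg W y t"
    and l1: "min_length N \<gamma>\<^sub>1 = 2 * pi * (sqrt c * norm (gen W y))"
    using minimising_geodesic_lift[OF assms(2) ca(2) aG(2) Fa(2)] by blast
  have h0: "opg V x (2*pi) = h"
  proof -
    have "a0 0 ** opg V x (2*pi) = a0 0 ** h" using a0[of "2*pi"] ah(1)[of 0] by simp
    then have "conj_transpose (a0 0) ** (a0 0 ** opg V x (2*pi)) = conj_transpose (a0 0) ** (a0 0 ** h)" by simp
    then show ?thesis by (simp only: unitary_cancel[OF unitary_G[OF aG(1)]])
  qed
  have h1: "opg W y (2*pi) = h"
  proof -
    have "a1 0 ** opg W y (2*pi) = a1 0 ** h" using a1[of "2*pi"] ah(2)[of 0] by simp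
    then have "conj_transpose (a1 0) ** (a1 0 ** opg W y (2*pi)) = conj_transpose (a1 0) ** (a1 0 ** h)" by simp
    then show ?thesis by (simp only: unitary_cancel[OF unitary_G[OF aG(2)]])
  qed
  have norm_eq: "norm (gen V x) = norm (gen W y)"
    using min_length_homotopic[OF hom] c by (simp add: l0 l1)
  have spread: "x j - x i \<le> 1" for i j
    by (rule minimal_logarithm_spread[OF aG(1)[of 0] V, where \<gamma> = \<gamma>\<^sub>0])
      (simp_all add: a0[symmetric] Fa(1) h0 h l0)
  obtain R \<kappa> where R: "unitary R" and RW: "\<And>t. opg W y t = opg R \<kappa> 1 ** opg V x t ** opg R \<kappa> (- 1)"
    and Rh: "\<And>s. opg R \<kappa> s ** h = h ** opg R \<kappa> s"
    using minimal_logarithms_conjugate[OF V W _ norm_eq spread] h0 h1 by auto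
  have "a1 0 ** conj_transpose (a0 0) \<in> G" by (intro SU_mult SU_conj_transpose aG)
  then obtain P q where P: "unitary P" "sum q UNIV = 0" and Pq: "a1 0 ** conj_transpose (a0 0) = opg P q 1"
    using SU_log by blast
  have g1: "opg P q 1 ** a0 0 = a1 0" unfolding Pq[symmetric] by (rule unitary_cancel(4)[OF unitary_G[OF aG(1)]])
  \<comment> \<open>Bounds the t-derivative at unit pace: the generator of A enters once, that of B
    twice because B acts by conjugation.\<close>
  define K where "K = norm (gen P q) + 2 * norm (gen R \<kappa>)"
  note zero = bounded_bilinear.zero_left[OF bounded_bilinear_matrix_mult] bounded_bilinear.zero_right[OF bounded_bilinear_matrix_mult]
  have bound: "d_synh N \<gamma>\<^sub>0 \<gamma>\<^sub>1 \<le> ereal (pi * c * K\<^sup>2 / T)" if T: "T > 0" for T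
  proof -
    define r where "r = 1 / T"
    have r: "r > 0" "r * T = 1" using T by (simp_all add: r_def)
    have lin: "bounded_linear (\<lambda>z::real \<times> real. r * snd z)" "bounded_linear (\<lambda>z::real \<times> real. (- r) * snd z)"
      by (intro bounded_linear_const_mult bounded_linear_snd)+
    define A where "A z = opg P q (r * snd z)" for z :: "real \<times> real"
    define B where "B z = opg R \<kappa> (r * snd z)" for z :: "real \<times> real"
    define E where "E z = opg V x (fst z)" for z :: "real \<times> real"
    define B' where "B' z = opg R \<kappa> ((- r) * snd z)" for z :: "real \<times> real"
    define m where "m z = A z ** (a0 0 ** (B z ** (E z ** B' z)))" for z
    have B': "B' z = conj_transpose (B z)" for z by (simp add: B_def B'_def conj_transpose_opg)
    have un: "unitary (A z)" "unitary (B z)" "unitary (E z)" "unitary (B' z)" "unitary (a0 0)" for z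
      unfolding A_def B_def E_def B'_def by (intro unitary_opg P R V unitary_G aG)+
    have mG: "m z \<in> G" for z
    proof -
      have "B z ** E z ** conj_transpose (B z) \<in> G"
        unfolding E_def by (intro conjugate_SU opg_SU V un)
      from SU_mult[OF opg_SU[OF P] SU_mult[OF aG(1) this]] show ?thesis
        unfolding m_def B' A_def by (simp add: matrix_mul_assoc)
    qed
    define EB where "EB z h = E z ** ((- r * snd h) *\<^sub>R (gen R \<kappa> ** B' z)) + (fst h *\<^sub>R (gen V x ** E z)) ** B' z" for z h
    define BEB where "BEB z h = B z ** EB z h + ((r * snd h) *\<^sub>R (gen R \<kappa> ** B z)) ** (E z ** B' z)" for z h
    define Dm where "Dm z h = A z ** (a0 0 ** BEB z h) + ((r * snd h) *\<^sub>R (gen P q ** A z)) ** (a0 0 ** (B z ** (E z ** B' z)))" for z h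
    note FD = bounded_bilinear.FDERIV[OF bounded_bilinear_matrix_mult]
    have dA: "(A has_derivative (\<lambda>h. (r * snd h) *\<^sub>R (gen P q ** A z))) (at z)" for z
      unfolding A_def[abs_def] by (rule has_derivative_opg_compose[OF P(1) lin(1)])
    have dB: "(B has_derivative (\<lambda>h. (r * snd h) *\<^sub>R (gen R \<kappa> ** B z))) (at z)" for z
      unfolding B_def[abs_def] by (rule has_derivative_opg_compose[OF R lin(1)])
    have dB': "(B' has_derivative (\<lambda>h. (- r * snd h) *\<^sub>R (gen R \<kappa> ** B' z))) (at z)" for z
      unfolding B'_def[abs_def] by (rule has_derivative_opg_compose[OF R lin(2)])
    have dE: "(E has_derivative (\<lambda>h. fst h *\<^sub>R (gen V x ** E z))) (at z)" for z
      unfolding E_def[abs_def] by (rule has_derivative_opg_compose[OF V(1) bounded_linear_fst])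
    have dEB: "((\<lambda>z. E z ** B' z) has_derivative EB z) (at z)" for z
      unfolding EB_def[abs_def] by (rule FD[OF dE dB'])
    have dBEB: "((\<lambda>z. B z ** (E z ** B' z)) has_derivative BEB z) (at z)" for z
      unfolding BEB_def[abs_def] by (rule FD[OF dB dEB])
    have "((\<lambda>z. a0 0 ** (B z ** (E z ** B' z))) has_derivative (\<lambda>h. a0 0 ** BEB z h)) (at z)" for z
      by (rule bounded_linear.has_derivative[OF bounded_bilinear.bounded_linear_right[OF bounded_bilinear_matrix_mult] dBEB])
    from FD[OF dA this] have dm: "(m has_derivative Dm z) (at z)" for z
      unfolding Dm_def[abs_def] m_def[abs_def] .
    have cont: "continuous_on UNIV A" "continuous_on UNIV B" "continuous_on UNIV E" "continuous_on UNIV B'"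
      unfolding A_def[abs_def] B_def[abs_def] E_def[abs_def] B'_def[abs_def] by (intro continuous_intros)+
    have cDm: "continuous_on UNIV (\<lambda>z. Dm z v)" for v
      unfolding Dm_def BEB_def EB_def by (intro continuous_intros cont)
    have cm: "continuous_on UNIV m" unfolding m_def[abs_def] by (intro continuous_intros cont)
    have norm\<theta>: "norm (Dm z (1, 0)) = norm (gen V x)" for z
      by (simp add: Dm_def BEB_def EB_def zero un)
    have normt: "norm (Dm z (0, 1)) \<le> r * K" for z
    proof -
      have "Dm z (0, 1) = A z ** (a0 0 ** (B z ** (E z ** ((- r) *\<^sub>R (gen R \<kappa> ** B' z)))))
          + A z ** (a0 0 ** ((r *\<^sub>R (gen R \<kappa> ** B z)) ** (E z ** B' z)))
          + (r *\<^sub>R (gen P q ** A z)) ** (a0 0 ** (B z ** (E z ** B' z)))"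
        by (simp add: Dm_def BEB_def EB_def zero matrix_add_ldistrib)
      then have "norm (Dm z (0, 1)) \<le> norm (A z ** (a0 0 ** (B z ** (E z ** ((- r) *\<^sub>R (gen R \<kappa> ** B' z))))))
          + norm (A z ** (a0 0 ** ((r *\<^sub>R (gen R \<kappa> ** B z)) ** (E z ** B' z))))
          + norm ((r *\<^sub>R (gen P q ** A z)) ** (a0 0 ** (B z ** (E z ** B' z))))"
        by (simp only:) (intro order_trans[OF norm_triangle_ineq] add_mono norm_triangle_ineq order_refl)
      also have "\<dots> = r * norm (gen R \<kappa>) + r * norm (gen R \<kappa>) + r * norm (gen P q)"
        using r(1) by (simp add: un unitary_mult)
      finally show ?thesis by (simp add: K_def algebra_simps)
    qed
    define Wf where "Wf z = F (m z)" for z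
    have dW: "(Wf has_derivative (\<lambda>h. DF (m z) (Dm z h))) (at z)" for z
      unfolding Wf_def[abs_def] by (rule has_derivative_compose[OF dm F_has_derivative[OF mG]])
    have cW: "continuous_on UNIV (\<lambda>z. DF (m z) (Dm z v))" for v
      using mG by (intro continuous_on_DF cm cDm) auto
    \<comment> \<open>The commutation with \<open>h\<close> enters here: \<open>h\<close> passes
      through the last factor to the far right, where \<open>F\<close> is invariant under
      it.\<close>
    have m_per: "m (\<theta> + 2*pi, t) = m (\<theta>, t) ** h" for \<theta> t
    proof -
      have "m (\<theta> + 2*pi, t) = A (\<theta>, t) ** (a0 0 ** (B (\<theta>, t) ** (E (\<theta>, t) ** (h ** B' (\<theta>, t)))))"
        by (simp add: m_def A_def B_def E_def B'_def opg_add[OF V(1)] h0 matrix_mul_assoc)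
      also have "h ** B' (\<theta>, t) = B' (\<theta>, t) ** h" by (simp add: B'_def Rh)
      finally show ?thesis by (simp add: m_def matrix_mul_assoc)
    qed
    have Wper: "Wf (\<theta> + 2*pi, t) = Wf (\<theta>, t)" for \<theta> t
      unfolding Wf_def m_per by (rule F_right_H[OF mG h])
    note WC = C1_periodicI[OF dW cW Wper]
    have n\<theta>: "norm (frechet_derivative Wf (at z) (1, 0)) = sqrt c * norm (gen V x)" for z
    proof -
      have "((\<lambda>\<theta>. (\<theta>, snd z)) has_vector_derivative (1, 0)) (at (fst z))"
        by (auto intro!: has_vector_derivative_Pair derivative_eq_intros)
      then have "((\<lambda>\<theta>. m (\<theta>, snd z)) has_vector_derivative Dm z (1, 0)) (at (fst z))"
        using vector_derivative_diff_chain_within[of "\<lambda>\<theta>. (\<theta>, snd z)" "(1, 0)" "fst z" UNIV m "Dm z"]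
          has_derivative_at_withinI[OF dm[of z]] by (simp add: o_def)
      from norm_DF_curve[OF mG this] show ?thesis by (simp add: WC(2) norm\<theta>)
    qed
    have nt: "norm (frechet_derivative Wf (at z) (0, 1)) \<le> sqrt c * (r * K)" for z
    proof -
      have "((\<lambda>t. (fst z, t)) has_vector_derivative (0, 1)) (at (snd z))"
        by (auto intro!: has_vector_derivative_Pair derivative_eq_intros)
      then have "((\<lambda>t. m (fst z, t)) has_vector_derivative Dm z (0, 1)) (at (snd z))"
        using vector_derivative_diff_chain_within[of "\<lambda>t. (fst z, t)" "(0, 1)" "snd z" UNIV m "Dm z"]
          has_derivative_at_withinI[OF dm[of z]] by (simp add: o_def)
      from norm_DF_curve[OF mG this] show ?thesis using normt[of z] c by (simp add: WC(2))
    qed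
    have "d_synh N \<gamma>\<^sub>0 \<gamma>\<^sub>1 \<le> ereal (LINT z|lebesgue_on (cyl T).
      ((norm (frechet_derivative Wf (at z) (1, 0)))\<^sup>2 + (norm (frechet_derivative Wf (at z) (0, 1)))\<^sup>2) / 2
      - (min_length N \<gamma>\<^sub>0)\<^sup>2 / (8 * pi\<^sup>2))"
    proof (rule d_synh_le_classical[OF WC(1) T])
      show "Wf z \<in> N" for z unfolding Wf_def N by (intro imageI mG)
      show "\<gamma>\<^sub>0 (cis \<theta>) = Wf (\<theta>, 0)" for \<theta>
        by (simp add: Wf_def m_def A_def B_def E_def B'_def opg_0[OF P(1)] opg_0[OF R] a0[of \<theta>, symmetric] Fa(1))
      show "\<gamma>\<^sub>1 (cis \<theta>) = Wf (\<theta>, T)" for \<theta>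
      proof -
        have "m (\<theta>, T) = opg P q 1 ** a0 0 ** (opg R \<kappa> 1 ** opg V x \<theta> ** opg R \<kappa> (- 1))"
          by (simp add: m_def A_def B_def E_def B'_def r(2) matrix_mul_assoc)
        then have "m (\<theta>, T) = a1 \<theta>" unfolding g1 RW[symmetric] a1[of \<theta>, symmetric] .
        then show ?thesis by (simp add: Wf_def Fa(2))
      qed
    qed
    \<comment> \<open>The subtracted constant cancels the angular part of the energy density
      exactly, leaving the t-derivative alone.\<close>
    also have "(\<lambda>z. ((norm (frechet_derivative Wf (at z) (1, 0)))\<^sup>2 + (norm (frechet_derivative Wf (at z) (0, 1)))\<^sup>2) / 2
      - (min_length N \<gamma>\<^sub>0)\<^sup>2 / (8 * pi\<^sup>2)) = (\<lambda>z. (norm (frechet_derivative Wf (at z) (0, 1)))\<^sup>2 / 2)"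
      by (simp add: n\<theta> l0 power_mult_distrib field_simps)
    also have "(LINT z|lebesgue_on (cyl T). (norm (frechet_derivative Wf (at z) (0, 1)))\<^sup>2 / 2) \<le> pi * c * K\<^sup>2 / T"
    proof -
      have cB: "continuous_on UNIV (\<lambda>z. (norm (frechet_derivative Wf (at z) (0, 1)))\<^sup>2 / 2)"
        by (intro continuous_intros C1_periodicD(2)[OF WC(1)]) simp
      have "integral (cyl T) (\<lambda>z. (norm (frechet_derivative Wf (at z) (0, 1)))\<^sup>2 / 2) \<le> integral (cyl T) (\<lambda>z. (sqrt c * (r * K))\<^sup>2 / 2)"
        unfolding cyl_eq_cbox
        by (intro integral_le integrable_continuous continuous_on_subset[OF cB] continuous_on_const divide_right_mono power_mono nt) auto
      also have "\<dots> = 2 * pi * T * ((sqrt c * (r * K))\<^sup>2 / 2)"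
        using T by (simp add: cyl_eq_cbox content_Pair)
      also have "\<dots> = pi * c * K\<^sup>2 / T"
        using T c by (simp add: r_def power_mult_distrib power2_eq_square)
      finally show ?thesis unfolding LINT_cyl(2)[OF cB] .
    qed
    finally show ?thesis by simp
  qed
  show ?thesis
  proof (rule ereal_le_epsilon2)
    fix e :: real assume e: "0 < e"
    define T where "T = (pi * c * K\<^sup>2 + 1) / e"
    have pos: "pi * c * K\<^sup>2 + 1 > 0" using c by (intro add_nonneg_pos mult_nonneg_nonneg) auto
    then have T: "T > 0" using e by (simp add: T_def)
    have "pi * c * K\<^sup>2 / T \<le> e"
      using pos e T by (simp add: divide_le_eq) (simp add: T_def)
    with bound[OF T] show "d_synh N \<gamma>\<^sub>0 \<gamma>\<^sub>1 \<le> 0 + ereal e" by (simp add: order_trans)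
  qed
qed

end

section \<open>Lower bound for the synharmonic distance\<close>

lemma Cauchy_Schwarz_interval:
  fixes g :: "real \<Rightarrow> real"
  assumes g: "continuous_on {a..b} g" and "a \<le> b"
  shows "(integral {a..b} g)\<^sup>2 \<le> (b - a) * integral {a..b} (\<lambda>x. (g x)\<^sup>2)"
proof (cases "a = b")
  case False
  then have ab: "b - a > 0" using assms by simp
  \<comment> \<open>The mean: the inequality is the nonnegativity of the integral of (g -
    m)^2.\<close>
  define m where "m = integral {a..b} g / (b - a)"
  have "((\<lambda>x. (g x)\<^sup>2 - 2 * m * g x + m\<^sup>2) has_integral
      integral {a..b} (\<lambda>x. (g x)\<^sup>2) - 2 * m * integral {a..b} g + (b - a) * m\<^sup>2) {a..b}"
    using has_integral_const_real[of "m\<^sup>2" a b] ab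
    by (intro has_integral_add has_integral_diff has_integral_mult_right integrable_integral
        integrable_continuous_interval continuous_intros g) (simp_all add: content_real)
  moreover have "(g x)\<^sup>2 - 2 * m * g x + m\<^sup>2 = (g x - m)\<^sup>2" for x by (simp add: power2_diff mult_ac)
  ultimately have "((\<lambda>x. (g x - m)\<^sup>2) has_integral
      integral {a..b} (\<lambda>x. (g x)\<^sup>2) - 2 * m * integral {a..b} g + (b - a) * m\<^sup>2) {a..b}"
    by (simp only:)
  then have "0 \<le> integral {a..b} (\<lambda>x. (g x)\<^sup>2) - 2 * m * integral {a..b} g + (b - a) * m\<^sup>2"
    by (rule has_integral_nonneg) simp
  also have "integral {a..b} g = m * (b - a)" using ab by (simp add: m_def)
  finally have "m\<^sup>2 * (b - a) \<le> integral {a..b} (\<lambda>x. (g x)\<^sup>2)" by (simp add: power2_eq_square algebra_simps)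
  then have "(b - a) * (m\<^sup>2 * (b - a)) \<le> (b - a) * integral {a..b} (\<lambda>x. (g x)\<^sup>2)" using ab by (intro mult_left_mono) auto
  moreover have "(integral {a..b} g)\<^sup>2 = (b - a) * (m\<^sup>2 * (b - a))"
    using \<open>integral {a..b} g = m * (b - a)\<close> by (simp add: power2_eq_square)
  ultimately show ?thesis by simp
qed simp

text \<open>On an interval of length \<open>l\<close> around \<open>x\<close>, compare with a point where \<open>u\<^sup>2\<close> is at most its mean.\<close>

lemma sup_bound_interval:
  fixes u g :: "real \<Rightarrow> real"
  assumes u: "continuous_on UNIV u" "\<And>x. 0 \<le> u x" and g: "continuous_on UNIV g" "\<And>x. 0 \<le> g x"
    and lip: "\<And>x y. x \<le> y \<Longrightarrow> \<bar>u x - u y\<bar> \<le> integral {x..y} g"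
    and l: "0 < l" "l \<le> b" and U2: "integral {0..b} (\<lambda>x. (u x)\<^sup>2) \<le> U2" and G2: "integral {0..b} (\<lambda>x. (g x)\<^sup>2) \<le> G2"
    and x: "x \<in> {0..b}"
  shows "u x \<le> sqrt (U2 / l) + sqrt (l * G2)"
proof -
  have cu: "continuous_on S u" and cg: "continuous_on S g" for S
    by (rule continuous_on_subset[OF u(1) subset_UNIV], rule continuous_on_subset[OF g(1) subset_UNIV])
  define x0 where "x0 = min x (b - l)"
  have x0: "0 \<le> x0" "x0 \<le> x" "x \<le> x0 + l" "x0 + l \<le> b" using x l by (auto simp: x0_def)
  have mono: "integral {x0..x0 + l} (\<lambda>x. (f x)\<^sup>2) \<le> integral {0..b} (\<lambda>x. (f x)\<^sup>2)" if "\<And>S. continuous_on S f" for f :: "real \<Rightarrow> real"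
    using x0 by (intro integral_subset_le integrable_continuous_interval continuous_intros that) auto
  obtain y where y: "y \<in> {x0..x0 + l}" "\<And>z. z \<in> {x0..x0 + l} \<Longrightarrow> u y \<le> u z"
    using continuous_attains_inf[of "{x0..x0 + l}" u] cu l by auto
  have "(u y)\<^sup>2 * l = integral {x0..x0 + l} (\<lambda>_. (u y)\<^sup>2)" using l by simp
  also have "\<dots> \<le> integral {x0..x0 + l} (\<lambda>x. (u x)\<^sup>2)"
    using y u(2) by (intro integral_le integrable_continuous_interval continuous_intros cu power_mono) auto
  also have "\<dots> \<le> U2" using mono[OF cu] U2 by simp
  finally have "(u y)\<^sup>2 \<le> U2 / l" using l by (simp add: pos_le_divide_eq)
  then have uy: "u y \<le> sqrt (U2 / l)" by (rule real_le_rsqrt)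
  have "\<bar>u x - u y\<bar> \<le> integral {min x y..max x y} g"
    using lip[of x y] lip[of y x] by (cases "x \<le> y") (simp_all add: abs_minus_commute)
  also have "\<dots> \<le> integral {x0..x0 + l} g"
    using x0 y(1) g(2) by (intro integral_subset_le integrable_continuous_interval cg) auto
  also have "\<dots> \<le> sqrt (l * G2)"
  proof (rule real_le_rsqrt)
    have "(integral {x0..x0 + l} g)\<^sup>2 \<le> (x0 + l - x0) * integral {x0..x0 + l} (\<lambda>x. (g x)\<^sup>2)"
      using l by (intro Cauchy_Schwarz_interval cg) auto
    also have "\<dots> \<le> l * G2" using mono[OF cg] G2 l by (simp add: mult_left_mono)
    finally show "(integral {x0..x0 + l} g)\<^sup>2 \<le> l * G2" .
  qed
  finally show ?thesis using uy by linarith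
qed

lemma norm_diff_le_integral:
  fixes f :: "real \<Rightarrow> 'v::euclidean_space"
  assumes f: "\<And>t. (f has_vector_derivative f' t) (at t)" "continuous_on UNIV f'" and "x \<le> y"
  shows "norm (f x - f y) \<le> integral {x..y} (\<lambda>t. norm (f' t))"
proof -
  have c: "continuous_on {x..y} f'" by (rule continuous_on_subset[OF f(2) subset_UNIV])
  have "(f' has_integral f y - f x) {x..y}"
    by (rule fundamental_theorem_of_calculus[OF assms(3)]) (simp add: has_vector_derivative_at_within f)
  then have "f y - f x = integral {x..y} f'" by (simp add: integral_unique)
  moreover have "norm (integral {x..y} f') \<le> integral {x..y} (\<lambda>t. norm (f' t))"
    by (intro integral_norm_bound_integral integrable_continuous_interval continuous_on_norm c order_refl)
  ultimately show ?thesis unfolding norm_minus_commute[of "f x"] by simp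
qed

lemma continuous_on_slice:
  assumes "continuous_on UNIV (f :: real \<times> real \<Rightarrow> 'a::topological_space)"
  shows "continuous_on S (\<lambda>\<theta>. f (\<theta>, t))" "continuous_on S (\<lambda>t. f (\<theta>, t))"
  by (rule continuous_on_compose2[OF assms]; auto intro!: continuous_intros)+

lemma continuous_on_integral_slice:
  fixes f :: "real \<times> real \<Rightarrow> 'a::euclidean_space"
  assumes "continuous_on UNIV f"
  shows "continuous_on S (\<lambda>t. integral {0..b} (\<lambda>\<theta>. f (\<theta>, t)))"
proof -
  have "continuous_on (UNIV \<times> cbox 0 b) (\<lambda>(t, \<theta>). f (\<theta>, t))"
    unfolding case_prod_unfold by (rule continuous_on_compose2[OF assms]) (auto intro!: continuous_intros)
  from integral_continuous_on_param[OF this] have "continuous_on UNIV (\<lambda>t. integral {0..b} (\<lambda>\<theta>. f (\<theta>, t)))"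
    by simp
  then show ?thesis by (rule continuous_on_subset) simp
qed

section \<open>Slices of maps on the cylinder\<close>

abbreviation d_theta :: "(real \<times> real \<Rightarrow> 'v::euclidean_space) \<Rightarrow> real \<times> real \<Rightarrow> 'v" where
  "d_theta w z \<equiv> frechet_derivative w (at z) (1, 0)"

abbreviation d_t :: "(real \<times> real \<Rightarrow> 'v::euclidean_space) \<Rightarrow> real \<times> real \<Rightarrow> 'v" where
  "d_t w z \<equiv> frechet_derivative w (at z) (0, 1)"

definition slice_energy :: "(real \<times> real \<Rightarrow> 'v::euclidean_space) \<Rightarrow> real \<Rightarrow> real" where
  "slice_energy w t = integral {0..2*pi} (\<lambda>\<theta>. (norm (d_theta w (\<theta>, t)))\<^sup>2)"

text \<open>The t-derivative is included because it controls how far neighbouring slices are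
  apart.\<close>

definition slice_energy2 :: "(real \<times> real \<Rightarrow> 'v::euclidean_space) \<Rightarrow> real \<Rightarrow> real" where
  "slice_energy2 w t = integral {0..2*pi} (\<lambda>\<theta>. (norm (d_theta w (\<theta>, t)))\<^sup>2 + (norm (d_t w (\<theta>, t)))\<^sup>2)"

text \<open>The maps approximating a competitor may leave \<open>N\<close>; this measures by how
  much on one slice.\<close>

definition slice_dist :: "'v::euclidean_space set \<Rightarrow> (real \<times> real \<Rightarrow> 'v) \<Rightarrow> real \<Rightarrow> real" where
  "slice_dist N w t = integral {0..2*pi} (\<lambda>\<theta>. (infdist (w (\<theta>, t)) N)\<^sup>2)"

text \<open>For each angle the difference is an integral of the t-derivative; the Cauchy-Schwarz
  inequality and a change of the order of integration give the factor t' - t.\<close>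

lemma slice_L2_diff:
  assumes w: "C1_periodic w" and t: "t \<le> t'"
  shows "integral {0..2*pi} (\<lambda>\<theta>. (norm (w (\<theta>, t) - w (\<theta>, t')))\<^sup>2) \<le> (t' - t) * integral {t..t'} (slice_energy2 w)"
proof -
  note W = C1_periodicD[OF w]
  have cs: "continuous_on UNIV (\<lambda>z. (norm (d_t w z))\<^sup>2)" "continuous_on UNIV (\<lambda>z. (norm (d_theta w z))\<^sup>2 + (norm (d_t w z))\<^sup>2)"
    by (intro continuous_intros W(2))+
  have pt: "(norm (w (\<theta>, t) - w (\<theta>, t')))\<^sup>2 \<le> (t' - t) * integral {t..t'} (\<lambda>s. (norm (d_t w (\<theta>, s)))\<^sup>2)" for \<theta>
  proof -
    have "norm (w (\<theta>, t) - w (\<theta>, t')) \<le> integral {t..t'} (\<lambda>s. norm (d_t w (\<theta>, s)))"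
      by (rule norm_diff_le_integral[OF W(6) continuous_on_slice(2)[OF W(2)] t])
    then have "(norm (w (\<theta>, t) - w (\<theta>, t')))\<^sup>2 \<le> (integral {t..t'} (\<lambda>s. norm (d_t w (\<theta>, s))))\<^sup>2"
      by (rule power_mono) simp
    also have "\<dots> \<le> (t' - t) * integral {t..t'} (\<lambda>s. (norm (d_t w (\<theta>, s)))\<^sup>2)"
      by (rule Cauchy_Schwarz_interval[OF _ t]) (intro continuous_on_norm continuous_on_slice(2)[OF W(2)])
    finally show ?thesis .
  qed
  have c2: "continuous_on (cbox (0, t) (2*pi, t')) (\<lambda>(\<theta>, s). (norm (d_t w (\<theta>, s)))\<^sup>2)"
    unfolding case_prod_unfold prod.collapse by (rule continuous_on_subset[OF cs(1) subset_UNIV])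
  have ci: "(\<lambda>\<theta>. integral {t..t'} (\<lambda>s. (norm (d_t w (\<theta>, s)))\<^sup>2)) integrable_on {0..2*pi}"
    using integral_integrable_2dim[OF c2] by simp
  have i1: "(\<lambda>\<theta>. (norm (w (\<theta>, t) - w (\<theta>, t')))\<^sup>2) integrable_on {0..2*pi}"
    by (intro integrable_continuous_interval continuous_intros continuous_on_slice W(4))
  have "integral {0..2*pi} (\<lambda>\<theta>. (norm (w (\<theta>, t) - w (\<theta>, t')))\<^sup>2)
      \<le> integral {0..2*pi} (\<lambda>\<theta>. (t' - t) * integral {t..t'} (\<lambda>s. (norm (d_t w (\<theta>, s)))\<^sup>2))"
    by (rule integral_le[OF i1 has_integral_integrable[OF has_integral_mult_right[OF integrable_integral[OF ci]]] pt])
  also have "\<dots> = (t' - t) * integral {t..t'} (\<lambda>s. integral {0..2*pi} (\<lambda>\<theta>. (norm (d_t w (\<theta>, s)))\<^sup>2))"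
    using integral_swap_continuous[OF c2] by simp
  also have "\<dots> \<le> (t' - t) * integral {t..t'} (slice_energy2 w)"
  proof (intro mult_left_mono integral_le)
    show "(\<lambda>s. integral {0..2*pi} (\<lambda>\<theta>. (norm (d_t w (\<theta>, s)))\<^sup>2)) integrable_on {t..t'}"
      by (intro integrable_continuous_interval continuous_on_integral_slice cs)
    show "slice_energy2 w integrable_on {t..t'}" unfolding slice_energy2_def[abs_def]
      by (intro integrable_continuous_interval continuous_on_integral_slice cs)
    show "integral {0..2*pi} (\<lambda>\<theta>. (norm (d_t w (\<theta>, s)))\<^sup>2) \<le> slice_energy2 w s" for s
      unfolding slice_energy2_def
      by (intro integral_le integrable_continuous_interval continuous_on_slice cs) simp
  qed (use t in simp)
  finally show ?thesis .
qed

text \<open>In one variable, closeness in L^2 together with an energy bound gives uniform closeness.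
  The window length l stays free, because the first term improves as l grows and the second as l
  shrinks.\<close>

lemma slice_sup_diff:
  fixes v v' :: "real \<Rightarrow> 'v::euclidean_space"
  assumes v: "\<And>t. (v has_vector_derivative a t) (at t)" "continuous_on UNIV a"
    and v': "\<And>t. (v' has_vector_derivative a' t) (at t)" "continuous_on UNIV a'"
    and l: "0 < l" "l \<le> 2*pi" and U2: "integral {0..2*pi} (\<lambda>\<theta>. (norm (v \<theta> - v' \<theta>))\<^sup>2) \<le> U2"
    and A: "integral {0..2*pi} (\<lambda>\<theta>. (norm (a \<theta>))\<^sup>2) \<le> A2" "integral {0..2*pi} (\<lambda>\<theta>. (norm (a' \<theta>))\<^sup>2) \<le> A2'"
    and x: "x \<in> {0..2*pi}"
  shows "norm (v x - v' x) \<le> sqrt (U2 / l) + sqrt (l * (2 * A2 + 2 * A2'))"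
proof -
  have ca: "continuous_on S a" "continuous_on S a'" for S
    by (rule continuous_on_subset[OF v(2) subset_UNIV], rule continuous_on_subset[OF v'(2) subset_UNIV])
  have cv: "continuous_on UNIV v" "continuous_on UNIV v'"
    by (rule continuous_at_imp_continuous_on; use v(1) v'(1) has_vector_derivative_continuous in blast)+
  have int: "(\<lambda>\<theta>. (norm (a \<theta>))\<^sup>2) integrable_on {0..2*pi}" "(\<lambda>\<theta>. (norm (a' \<theta>))\<^sup>2) integrable_on {0..2*pi}"
    by (intro integrable_continuous_interval continuous_intros ca)+
  show ?thesis
  proof (rule sup_bound_interval[where g = "\<lambda>\<theta>. norm (a \<theta>) + norm (a' \<theta>)", OF _ _ _ _ _ l U2 _ x])
    show "continuous_on UNIV (\<lambda>\<theta>. norm (v \<theta> - v' \<theta>))" by (intro continuous_intros cv)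
    show "continuous_on UNIV (\<lambda>\<theta>. norm (a \<theta>) + norm (a' \<theta>))" by (intro continuous_intros ca)
    fix x y :: real assume xy: "x \<le> y"
    have "\<bar>norm (v x - v' x) - norm (v y - v' y)\<bar> \<le> norm (v x - v y) + norm (v' x - v' y)"
      using norm_triangle_ineq3[of "v x - v' x" "v y - v' y"] norm_triangle_ineq4[of "v x - v y" "v' x - v' y"]
      by (simp add: algebra_simps)
    also have "\<dots> \<le> integral {x..y} (\<lambda>t. norm (a t)) + integral {x..y} (\<lambda>t. norm (a' t))"
      by (intro add_mono norm_diff_le_integral[OF v xy] norm_diff_le_integral[OF v' xy])
    also have "\<dots> = integral {x..y} (\<lambda>\<theta>. norm (a \<theta>) + norm (a' \<theta>))"
      by (intro integral_add[symmetric] integrable_continuous_interval continuous_on_norm ca)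
    finally show "\<bar>norm (v x - v' x) - norm (v y - v' y)\<bar> \<le> integral {x..y} (\<lambda>\<theta>. norm (a \<theta>) + norm (a' \<theta>))" .
  next
    have "integral {0..2*pi} (\<lambda>\<theta>. (norm (a \<theta>) + norm (a' \<theta>))\<^sup>2)
        \<le> integral {0..2*pi} (\<lambda>\<theta>. 2 * (norm (a \<theta>))\<^sup>2 + 2 * (norm (a' \<theta>))\<^sup>2)"
    proof (intro integral_le integrable_continuous_interval continuous_intros ca)
      fix \<theta>
      show "(norm (a \<theta>) + norm (a' \<theta>))\<^sup>2 \<le> 2 * (norm (a \<theta>))\<^sup>2 + 2 * (norm (a' \<theta>))\<^sup>2"
        using sum_squares_bound[of "norm (a \<theta>)" "norm (a' \<theta>)"] by (simp add: power2_sum)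
    qed
    also have "\<dots> = 2 * integral {0..2*pi} (\<lambda>\<theta>. (norm (a \<theta>))\<^sup>2) + 2 * integral {0..2*pi} (\<lambda>\<theta>. (norm (a' \<theta>))\<^sup>2)"
      using int by (simp add: integral_add)
    finally show "integral {0..2*pi} (\<lambda>\<theta>. (norm (a \<theta>) + norm (a' \<theta>))\<^sup>2) \<le> 2 * A2 + 2 * A2'"
      using A by linarith
  qed simp_all
qed

text \<open>The same interpolation for the distance to \<open>N\<close>, which is 1-Lipschitz and so
  varies no faster than v.\<close>

lemma slice_sup_infdist:
  fixes v :: "real \<Rightarrow> 'v::euclidean_space"
  assumes v: "\<And>t. (v has_vector_derivative a t) (at t)" "continuous_on UNIV a"
    and l: "0 < l" "l \<le> 2*pi" and U2: "integral {0..2*pi} (\<lambda>\<theta>. (infdist (v \<theta>) N)\<^sup>2) \<le> U2"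
    and A: "integral {0..2*pi} (\<lambda>\<theta>. (norm (a \<theta>))\<^sup>2) \<le> A2" and x: "x \<in> {0..2*pi}"
  shows "infdist (v x) N \<le> sqrt (U2 / l) + sqrt (l * A2)"
proof (rule sup_bound_interval[where g = "\<lambda>\<theta>. norm (a \<theta>)", OF _ _ _ _ _ l U2 A x])
  have "continuous_on UNIV v"
    by (rule continuous_at_imp_continuous_on; use v(1) has_vector_derivative_continuous in blast)
  then show "continuous_on UNIV (\<lambda>\<theta>. infdist (v \<theta>) N)" by (intro continuous_on_infdist)
  show "continuous_on UNIV (\<lambda>\<theta>. norm (a \<theta>))" by (intro continuous_on_norm v(2))
  fix x y :: real assume xy: "x \<le> y"
  have "\<bar>infdist (v x) N - infdist (v y) N\<bar> \<le> dist (v x) (v y)" by (rule infdist_triangle_abs)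
  also have "\<dots> \<le> integral {x..y} (\<lambda>t. norm (a t))"
    unfolding dist_norm by (rule norm_diff_le_integral[OF v xy])
  finally show "\<bar>infdist (v x) N - infdist (v y) N\<bar> \<le> integral {x..y} (\<lambda>t. norm (a t))" .
qed (simp_all add: infdist_nonneg)

section \<open>Geodesic polygons near a slice\<close>

context SU_quotient
begin

text \<open>The polygon passes through points of \<open>N\<close> near the curve at n equidistant
  angles. Each distance between vertices may exceed the corresponding chord by 2\<delta>, in total
  2n\<delta>, so n has to be fixed before \<delta> wherever the length matters.\<close>

lemma polygon_near_curve:
  assumes \<eta>: "\<eta> > 0"
  shows "\<exists>\<rho>>0. \<forall>v n \<delta> \<omega>. v (2*pi) = v 0 \<and> n > 0 \<and> 0 < \<delta> \<and> 0 \<le> \<omega> \<and> \<omega> + 2 * \<delta> < \<rho> \<and>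
    (\<forall>t\<in>{0..2*pi}. \<exists>p\<in>N. norm (v t - p) < \<delta>) \<and>
    (\<forall>j<n. \<forall>t\<in>{2*pi/real n * real j..2*pi/real n * real (Suc j)}. norm (v t - v (2*pi/real n * real j)) \<le> \<omega>) \<longrightarrow>
    (\<exists>\<beta>. C1_loop N \<beta> \<and> loop_length \<beta> \<le> (1 + \<eta>) * ((\<Sum>j<n. norm (v (2*pi/real n * real (Suc j)) - v (2*pi/real n * real j))) + 2 * real n * \<delta>) \<and>
      (\<forall>t\<in>{0..2*pi}. norm (\<beta> (cis t) - v t) \<le> (1 + \<eta>) * (\<omega> + 2 * \<delta>) + \<delta> + \<omega>))"
proof -
  obtain \<rho> where \<rho>: "\<rho> > 0" and geo: "\<And>p q. p \<in> N \<Longrightarrow> q \<in> N \<Longrightarrow> norm (p - q) < \<rho> \<Longrightarrow>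
    \<exists>g V x. g \<in> G \<and> unitary V \<and> sum x UNIV = 0 \<and> p = F g \<and> q = F (g ** opg V x 1) \<and>
       sqrt c * norm (gen V x) \<le> (1 + \<eta>) * norm (p - q)"
    using short_geodesics[OF \<eta>] by blast
  have main: "\<exists>\<beta>. C1_loop N \<beta> \<and> loop_length \<beta> \<le> (1 + \<eta>) * ((\<Sum>j<n. norm (v (2*pi/real n * real (Suc j)) - v (2*pi/real n * real j))) + 2 * real n * \<delta>) \<and>
      (\<forall>t\<in>{0..2*pi}. norm (\<beta> (cis t) - v t) \<le> (1 + \<eta>) * (\<omega> + 2 * \<delta>) + \<delta> + \<omega>)"
    if v0: "v (2*pi) = v 0" and n: "n > 0" and \<delta>: "0 < \<delta>" and \<omega>: "0 \<le> \<omega>" and small: "\<omega> + 2 * \<delta> < \<rho>"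
      and near: "\<And>t. t \<in> {0..2*pi} \<Longrightarrow> \<exists>p\<in>N. norm (v t - p) < \<delta>"
      and osc: "\<And>j t. j < n \<Longrightarrow> t \<in> {2*pi/real n * real j..2*pi/real n * real (Suc j)} \<Longrightarrow> norm (v t - v (2*pi/real n * real j)) \<le> \<omega>"
    for v :: "real \<Rightarrow> 'v" and n \<delta> \<omega>
  proof -
    define s where "s = 2*pi/real n"
    have s: "s > 0" "s * n = 2*pi" using n by (simp_all add: s_def)
    have "\<exists>p. j \<le> n \<longrightarrow> p \<in> N \<and> norm (v (s * real j) - p) < \<delta>" for j
    proof (cases "j \<le> n")
      case True
      then have "s * real j \<le> s * real n" using s(1) by (intro mult_left_mono) auto
      then have "s * real j \<in> {0..2*pi}" using s by simp
      then show ?thesis using near by blast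
    qed simp
    from choice[OF allI[OF this]] obtain p where p: "\<forall>j. j \<le> n \<longrightarrow> p j \<in> N \<and> norm (v (s * real j) - p j) < \<delta>" by (rule exE)
    \<comment> \<open>The points chosen over the equal values v(0) and v(2 pi) may differ; reusing
      the first one closes the polygon.\<close>
    define q where "q j = (if j = n then p 0 else p j)" for j
    have q: "q j \<in> N" "norm (v (s * real j) - q j) < \<delta>" if "j \<le> n" for j
      using p[rule_format, of j] p[rule_format, of 0] that v0 s(2) by (auto simp: q_def)
    have step: "norm (q j - q (Suc j)) \<le> norm (v (s * real (Suc j)) - v (s * real j)) + 2 * \<delta>" if "j < n" for j
    proof -
      have "q j - q (Suc j) = (v (s * real (Suc j)) - q (Suc j)) - (v (s * real j) - q j) - (v (s * real (Suc j)) - v (s * real j))"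
        by simp
      then have "norm (q j - q (Suc j)) \<le> norm (v (s * real (Suc j)) - q (Suc j)) + norm (v (s * real j) - q j)
          + norm (v (s * real (Suc j)) - v (s * real j))"
        by (simp only:) (rule order_trans[OF norm_triangle_ineq4 add_right_mono[OF norm_triangle_ineq4]])
      then show ?thesis using q(2)[of j] q(2)[of "Suc j"] that by simp
    qed
    have step2: "norm (q j - q (Suc j)) \<le> \<omega> + 2 * \<delta>" if "j < n" for j
      using step[OF that] osc[OF that, of "s * real (Suc j)"] s(1) by (simp add: s_def[symmetric] mult_left_mono)
    define L where "L j = (1 + \<eta>) * norm (q j - q (Suc j))" for j
    define r where "r = (1 + \<eta>) * (\<omega> + 2 * \<delta>)"
    have "\<exists>\<beta>. C1_loop N \<beta> \<and> loop_length \<beta> \<le> (\<Sum>j<n. L j) \<and>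
      (\<forall>j<n. \<forall>t\<in>{2*pi/n * j..2*pi/n * Suc j}. norm (\<beta> (cis t) - q j) \<le> r)"
    proof (rule polygon_loop[OF n])
      show "q n = q 0" by (simp add: q_def)
      show "0 \<le> r" using \<eta> \<delta> \<omega> by (simp add: r_def)
      show "L j \<le> r" if "j < n" for j unfolding L_def r_def using step2[OF that] \<eta> by (intro mult_left_mono) auto
      show "\<exists>g V x. g \<in> G \<and> unitary V \<and> sum x UNIV = 0 \<and> q j = F g \<and> q (Suc j) = F (g ** opg V x 1) \<and>
        sqrt c * norm (gen V x) \<le> L j" if "j < n" for j
        unfolding L_def using step2[OF that] small that by (intro geo q(1)) auto
    qed
    then obtain \<beta> where \<beta>: "C1_loop N \<beta>" "loop_length \<beta> \<le> (\<Sum>j<n. L j)"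
      "\<And>j t. j < n \<Longrightarrow> t \<in> {s * j..s * Suc j} \<Longrightarrow> norm (\<beta> (cis t) - q j) \<le> r" unfolding s_def by blast
    have "(\<Sum>j<n. L j) \<le> (\<Sum>j<n. (1 + \<eta>) * (norm (v (s * real (Suc j)) - v (s * real j)) + 2 * \<delta>))"
      unfolding L_def using step \<eta> by (intro sum_mono mult_left_mono) auto
    also have "\<dots> = (1 + \<eta>) * ((\<Sum>j<n. norm (v (s * real (Suc j)) - v (s * real j))) + 2 * real n * \<delta>)"
      by (simp add: sum_distrib_left [symmetric] sum.distrib)
    finally have len: "loop_length \<beta> \<le> (1 + \<eta>) * ((\<Sum>j<n. norm (v (s * real (Suc j)) - v (s * real j))) + 2 * real n * \<delta>)"
      using \<beta>(2) by simp
    have close: "norm (\<beta> (cis t) - v t) \<le> r + \<delta> + \<omega>" if t: "t \<in> {0..2*pi}" for t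
    proof -
      obtain j where j: "j < n" "t \<in> {s * j..s * Suc j}" using ex_subinterval[OF s n t] by blast
      have "norm (\<beta> (cis t) - v t) \<le> norm (\<beta> (cis t) - q j) + norm (v (s * j) - q j) + norm (v t - v (s * j))"
      proof -
        have "\<beta> (cis t) - v t = (\<beta> (cis t) - q j) - (v (s * j) - q j) - (v t - v (s * j))" by simp
        then show ?thesis by (simp only:) (rule order_trans[OF norm_triangle_ineq4 add_right_mono[OF norm_triangle_ineq4]])
      qed
      then show ?thesis using \<beta>(3)[OF j] q(2)[of j] osc[OF j(1), of t] j unfolding s_def[symmetric] by simp
    qed
    show ?thesis using \<beta>(1) len close unfolding r_def s_def by blast
  qed
  show ?thesis
    by (rule exI[of _ \<rho>], rule conjI[OF \<rho>], intro allI impI, elim conjE, rule main; blast)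
qed

end

lemma sqrt_leI: assumes "x \<le> y\<^sup>2" "0 \<le> y" shows "sqrt x \<le> y"
proof -
  have "sqrt x \<le> sqrt (y\<^sup>2)" using assms(1) by (rule real_sqrt_le_mono)
  also have "\<dots> = y" using assms(2) by simp
  finally show ?thesis .
qed

text \<open>On an arc of length 2 pi / n the Cauchy-Schwarz inequality bounds the squared
  oscillation by 2 pi / n times the energy, and the hypothesis on n makes this at most the square of
  \<omega>.\<close>

lemma arc_oscillation:
  fixes v :: "real \<Rightarrow> 'v::euclidean_space"
  assumes v: "\<And>t. (v has_vector_derivative a t) (at t)" "continuous_on UNIV a"
    and A2: "integral {0..2*pi} (\<lambda>\<theta>. (norm (a \<theta>))\<^sup>2) \<le> A2" "2 * pi * A2 \<le> real n * \<omega>\<^sup>2" and "0 \<le> \<omega>"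
    and j: "j < n" and t: "t \<in> {2*pi/real n * real j..2*pi/real n * real (Suc j)}"
  shows "norm (v t - v (2*pi/real n * real j)) \<le> \<omega>"
proof -
  have ca: "continuous_on S a" for S by (rule continuous_on_subset[OF v(2) subset_UNIV])
  define s where "s = 2*pi/real n * real j"
  have n: "real n > 0" using j by simp
  have s: "0 \<le> s" "s \<le> t" using t by (simp_all add: s_def)
  have "2*pi/real n * real (Suc j) \<le> 2*pi/real n * real n" using j by (intro mult_left_mono) auto
  then have t2: "t \<le> 2*pi" using t n by simp
  have "2*pi/real n * real (Suc j) = s + 2*pi/real n"
    unfolding s_def of_nat_Suc by (simp only: distrib_left mult_1_right add.commute)
  then have ts: "t - s \<le> 2*pi/real n" using t by simp
  have A0: "0 \<le> integral {s..t} (\<lambda>\<theta>. (norm (a \<theta>))\<^sup>2)"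
    by (intro integral_nonneg integrable_continuous_interval continuous_intros ca) simp
  have le: "norm (v s - v t) \<le> integral {s..t} (\<lambda>t. norm (a t))" by (rule norm_diff_le_integral[OF v s(2)])
  have "(norm (v s - v t))\<^sup>2 \<le> (integral {s..t} (\<lambda>t. norm (a t)))\<^sup>2" by (rule power_mono[OF le]) simp
  also have "\<dots> \<le> (t - s) * integral {s..t} (\<lambda>\<theta>. (norm (a \<theta>))\<^sup>2)"
    by (rule Cauchy_Schwarz_interval[OF _ s(2)]) (intro continuous_on_norm ca)
  also have "\<dots> \<le> 2*pi/real n * integral {s..t} (\<lambda>\<theta>. (norm (a \<theta>))\<^sup>2)" by (rule mult_right_mono[OF ts A0])
  also have "\<dots> \<le> 2*pi/real n * A2"
  proof (rule mult_left_mono)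
    have "integral {s..t} (\<lambda>\<theta>. (norm (a \<theta>))\<^sup>2) \<le> integral {0..2*pi} (\<lambda>\<theta>. (norm (a \<theta>))\<^sup>2)"
      using s t2 by (intro integral_subset_le integrable_continuous_interval continuous_intros ca) auto
    then show "integral {s..t} (\<lambda>\<theta>. (norm (a \<theta>))\<^sup>2) \<le> A2" using A2(1) by (rule order_trans)
  qed (use n in simp)
  also have "\<dots> \<le> \<omega>\<^sup>2" using A2(2) n by (simp add: field_simps)
  finally have "norm (v s - v t) \<le> \<omega>" using \<open>0 \<le> \<omega>\<close> by (rule power2_le_imp_le)
  then show ?thesis unfolding s_def norm_minus_commute[of "v t"] .
qed

text \<open>The chords are at most as long as the curve, and the Cauchy-Schwarz inequality compares
  length with energy. The factor 2 pi in the bound of energy by squared length arises here.\<close>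

lemma arc_sum:
  fixes v :: "real \<Rightarrow> 'v::euclidean_space"
  assumes v: "\<And>t. (v has_vector_derivative a t) (at t)" "continuous_on UNIV a" and n: "n > 0"
  shows "(\<Sum>j<n. norm (v (2*pi/real n * real (Suc j)) - v (2*pi/real n * real j)))
    \<le> sqrt (2 * pi * integral {0..2*pi} (\<lambda>\<theta>. (norm (a \<theta>))\<^sup>2))"
proof -
  have ca: "continuous_on S a" for S by (rule continuous_on_subset[OF v(2) subset_UNIV])
  define s where "s = 2*pi/real n"
  have s: "s > 0" "s * real n = 2*pi" using n by (simp_all add: s_def)
  have "(\<Sum>j<k. norm (v (s * real (Suc j)) - v (s * real j))) \<le> integral {0..s * real k} (\<lambda>t. norm (a t))" for k
  proof (induction k)
    case (Suc k)
    have mono: "s * real k \<le> s * real (Suc k)" "0 \<le> s * real k" using s(1) by (simp_all add: mult_left_mono)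
    have "norm (v (s * real (Suc k)) - v (s * real k)) \<le> integral {s * real k..s * real (Suc k)} (\<lambda>t. norm (a t))"
      using norm_diff_le_integral[OF v mono(1)] unfolding norm_minus_commute[of "v (s * real k)"] .
    moreover have "integral {0..s * real k} (\<lambda>t. norm (a t)) + integral {s * real k..s * real (Suc k)} (\<lambda>t. norm (a t))
        = integral {0..s * real (Suc k)} (\<lambda>t. norm (a t))"
      by (rule Henstock_Kurzweil_Integration.integral_combine[OF mono(2,1)])
        (intro integrable_continuous_interval continuous_on_norm ca)
    ultimately show ?case using Suc.IH unfolding sum.lessThan_Suc by linarith
  qed simp
  from this[of n] have 1: "(\<Sum>j<n. norm (v (s * real (Suc j)) - v (s * real j))) \<le> integral {0..2*pi} (\<lambda>t. norm (a t))"
    unfolding s(2) .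
  have "(integral {0..2*pi} (\<lambda>t. norm (a t)))\<^sup>2 \<le> (2*pi - 0) * integral {0..2*pi} (\<lambda>\<theta>. (norm (a \<theta>))\<^sup>2)"
    by (rule Cauchy_Schwarz_interval) (intro continuous_on_norm ca, simp)
  then have "integral {0..2*pi} (\<lambda>t. norm (a t)) \<le> sqrt (2 * pi * integral {0..2*pi} (\<lambda>\<theta>. (norm (a \<theta>))\<^sup>2))"
    by (intro real_le_rsqrt) simp
  then show ?thesis using 1 unfolding s_def by linarith
qed

lemma slice_properties:
  fixes w :: "real \<times> real \<Rightarrow> 'v::euclidean_space"
  assumes w: "C1_periodic w"
  shows "continuous_on S (slice_energy w)" "continuous_on S (slice_energy2 w)" "continuous_on S (slice_dist N w)"
    "0 \<le> slice_energy w t" "0 \<le> slice_dist N w t" "slice_energy w t \<le> slice_energy2 w t"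
    "x \<le> t \<Longrightarrow> t \<le> y \<Longrightarrow> x \<le> t' \<Longrightarrow> t' \<le> y \<Longrightarrow>
      integral {0..2*pi} (\<lambda>\<theta>. (norm (w (\<theta>, t) - w (\<theta>, t')))\<^sup>2) \<le> (y - x) * integral {x..y} (slice_energy2 w)"
proof -
  note W = C1_periodicD[OF w]
  have cs: "continuous_on UNIV (\<lambda>z. (norm (d_theta w z))\<^sup>2)" "continuous_on UNIV (\<lambda>z. (norm (d_theta w z))\<^sup>2 + (norm (d_t w z))\<^sup>2)"
    "continuous_on UNIV (\<lambda>z. (infdist (w z) N)\<^sup>2)"
    by (intro continuous_intros continuous_on_infdist W(2,4))+
  show "continuous_on S (slice_energy w)" "continuous_on S (slice_dist N w)"
    unfolding slice_energy_def[abs_def] slice_dist_def[abs_def] by (intro continuous_on_integral_slice cs)+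
  show c2: "continuous_on S (slice_energy2 w)" for S
    unfolding slice_energy2_def[abs_def] by (intro continuous_on_integral_slice cs)
  show "0 \<le> slice_energy w t" unfolding slice_energy_def
    by (intro integral_nonneg integrable_continuous_interval continuous_on_slice cs) simp
  show "0 \<le> slice_dist N w t" unfolding slice_dist_def
    by (intro integral_nonneg integrable_continuous_interval continuous_on_slice cs) simp
  show "slice_energy w t \<le> slice_energy2 w t" unfolding slice_energy_def slice_energy2_def
    by (intro integral_le integrable_continuous_interval continuous_on_slice cs) simp
  have S0: "0 \<le> slice_energy2 w t" for t unfolding slice_energy2_def
    by (intro integral_nonneg integrable_continuous_interval continuous_on_slice cs) simp
  have ord: "integral {0..2*pi} (\<lambda>\<theta>. (norm (w (\<theta>, t) - w (\<theta>, t')))\<^sup>2) \<le> (y - x) * integral {x..y} (slice_energy2 w)"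
    if "x \<le> t" "t \<le> t'" "t' \<le> y" for t t'
  proof -
    have "integral {0..2*pi} (\<lambda>\<theta>. (norm (w (\<theta>, t) - w (\<theta>, t')))\<^sup>2) \<le> (t' - t) * integral {t..t'} (slice_energy2 w)"
      by (rule slice_L2_diff[OF w that(2)])
    also have "\<dots> \<le> (y - x) * integral {x..y} (slice_energy2 w)"
    proof (rule mult_mono)
      show "integral {t..t'} (slice_energy2 w) \<le> integral {x..y} (slice_energy2 w)"
        using that S0 by (intro integral_subset_le integrable_continuous_interval c2) auto
      show "0 \<le> integral {t..t'} (slice_energy2 w)"
        by (intro integral_nonneg integrable_continuous_interval c2 S0)
    qed (use that in auto)
    finally show ?thesis .
  qed
  assume h: "x \<le> t" "t \<le> y" "x \<le> t'" "t' \<le> y"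
  show "integral {0..2*pi} (\<lambda>\<theta>. (norm (w (\<theta>, t) - w (\<theta>, t')))\<^sup>2) \<le> (y - x) * integral {x..y} (slice_energy2 w)"
  proof (cases "t \<le> t'")
    case True then show ?thesis using ord h by blast
  next
    case False
    then have "t' \<le> t" by simp
    from ord[OF h(3) this h(2)] show ?thesis by (simp only: norm_minus_commute)
  qed
qed

section \<open>Carrying the homotopy class across slices\<close>

context SU_quotient
begin

lemma C1_loop_continuous:
  assumes "C1_loop N \<gamma>"
  shows "homotopic_maps N \<gamma> \<gamma>" "continuous_on (sphere 0 1) \<gamma>" "\<gamma> ` sphere 0 1 \<subseteq> N"
proof -
  show N: "\<gamma> ` sphere 0 1 \<subseteq> N" using assms by (simp add: C1_loop_def)
  have \<gamma>N: "\<gamma> (cis t) \<in> N" for t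
  proof -
    have "\<gamma> (cis t) \<in> \<gamma> ` sphere 0 1" by (rule imageI) simp
    then show ?thesis using N by blast
  qed
  have "continuous_on UNIV (\<lambda>\<theta>. \<gamma> (cis \<theta>))"
    using assms C1_differentiable_imp_continuous_on unfolding C1_loop_def by blast
  then have c: "continuous_on ({0..1::real} \<times> UNIV) (\<lambda>y. \<gamma> (cis (snd y)))"
    by (rule continuous_on_compose2) (auto intro!: continuous_intros)
  show h: "homotopic_maps N \<gamma> \<gamma>"
    by (rule homotopic_maps_periodic[OF c]) (simp_all add: \<gamma>N cis_mult[symmetric])
  show "continuous_on (sphere 0 1) \<gamma>" using homotopic_with_imp_continuous[OF h] by simp
qed

text \<open>A slice need not lie in \<open>N\<close>, so its homotopy class is expressed through a
  nearby loop that does.\<close>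

definition loop_near :: "(complex \<Rightarrow> 'v) \<Rightarrow> real \<Rightarrow> (real \<Rightarrow> 'v) \<Rightarrow> bool" where
  "loop_near \<gamma> r v \<longleftrightarrow> (\<exists>\<beta>. C1_loop N \<beta> \<and> homotopic_maps N \<gamma> \<beta> \<and> (\<forall>t\<in>{0..2*pi}. norm (\<beta> (cis t) - v t) \<le> r))"

text \<open>The polygon for v' is built afresh from v' alone, and v serves only to show that it lies
  in the right class. The tolerance 8\<mu> is therefore the same before and after, and errors do not
  accumulate along a chain.\<close>

lemma loop_near_transfer:
  assumes \<eta>: "0 < \<eta>" "\<eta> \<le> 1"
  shows "\<exists>\<mu>>0. \<forall>\<gamma> v v' n \<delta> \<omega>. loop_near \<gamma> (8*\<mu>) v \<and> v' (2*pi) = v' 0 \<and> (\<forall>t\<in>{0..2*pi}. norm (v t - v' t) \<le> \<mu>) \<and>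
    0 < n \<and> 0 < \<delta> \<and> \<delta> \<le> \<mu> \<and> 0 \<le> \<omega> \<and> \<omega> \<le> \<mu> \<and> (\<forall>t\<in>{0..2*pi}. \<exists>p\<in>N. norm (v' t - p) < \<delta>) \<and>
    (\<forall>j<n. \<forall>t\<in>{2*pi/real n * real j..2*pi/real n * real (Suc j)}. norm (v' t - v' (2*pi/real n * real j)) \<le> \<omega>) \<longrightarrow>
    loop_near \<gamma> (8*\<mu>) v' \<and>
    min_length N \<gamma> \<le> (1 + \<eta>) * ((\<Sum>j<n. norm (v' (2*pi/real n * real (Suc j)) - v' (2*pi/real n * real j))) + 2 * real n * \<delta>)"
  using polygon_near_curve[OF \<eta>(1)]
proof (elim exE conjE, goal_cases)
  case (1 \<rho>)
  obtain r where r: "r > 0" and hom: "\<forall>\<alpha> \<beta>. continuous_on (sphere 0 1) \<alpha> \<and> continuous_on (sphere 0 1) \<beta> \<and> \<alpha> ` sphere 0 1 \<subseteq> N \<and>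
    \<beta> ` sphere 0 1 \<subseteq> N \<and> (\<forall>z\<in>sphere 0 1. norm (\<alpha> z - \<beta> z) < r) \<longrightarrow> homotopic_maps N \<alpha> \<beta>"
    using close_loops_homotopic by (elim exE conjE) (rule that)
  \<comment> \<open>The new polygon is within 2(3\<mu>) + 2\<mu> = 8\<mu> of its slice, and old and
    new loops differ by at most 8\<mu> + 8\<mu> + \<mu> = 17\<mu>. The divisor 40 leaves room in
    both thresholds.\<close>
  define \<mu> where "\<mu> = min \<rho> r / 40"
  have \<mu>: "\<mu> > 0" "40 * \<mu> \<le> \<rho>" "40 * \<mu> \<le> r" using 1(1) r by (auto simp: \<mu>_def)
  show ?case
  proof (rule exI[of _ \<mu>], rule conjI[OF \<mu>(1)], intro allI impI, elim conjE)
    fix \<gamma> v and v' :: "real \<Rightarrow> 'v" and n :: nat and \<delta> \<omega> :: real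
    assume ln: "loop_near \<gamma> (8*\<mu>) v" and per: "v' (2*pi) = v' 0" and close: "\<forall>t\<in>{0..2*pi}. norm (v t - v' t) \<le> \<mu>"
      and n: "0 < n" and \<delta>: "0 < \<delta>" "\<delta> \<le> \<mu>" and \<omega>: "0 \<le> \<omega>" "\<omega> \<le> \<mu>" and near: "\<forall>t\<in>{0..2*pi}. \<exists>p\<in>N. norm (v' t - p) < \<delta>"
      and osc: "\<forall>j<n. \<forall>t\<in>{2*pi/real n * real j..2*pi/real n * real (Suc j)}. norm (v' t - v' (2*pi/real n * real j)) \<le> \<omega>"
    have "\<omega> + 2 * \<delta> < \<rho>" using \<mu> \<delta> \<omega> by linarith
    note pre = conjI[OF per conjI[OF n conjI[OF \<delta>(1) conjI[OF \<omega>(1) conjI[OF this conjI[OF near osc]]]]]]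
    from mp[OF spec[OF spec[OF spec[OF spec[OF 1(2), of v'], of n], of \<delta>], of \<omega>] pre]
    obtain \<beta>' where \<beta>': "C1_loop N \<beta>'"
      "loop_length \<beta>' \<le> (1 + \<eta>) * ((\<Sum>j<n. norm (v' (2*pi/real n * real (Suc j)) - v' (2*pi/real n * real j))) + 2 * real n * \<delta>)"
      "\<forall>t\<in>{0..2*pi}. norm (\<beta>' (cis t) - v' t) \<le> (1 + \<eta>) * (\<omega> + 2 * \<delta>) + \<delta> + \<omega>"
      by (elim exE conjE) (rule that)
    have "(1 + \<eta>) * (\<omega> + 2 * \<delta>) \<le> 2 * (3 * \<mu>)" using \<eta> \<delta> \<omega> by (intro mult_mono) auto
    then have d': "norm (\<beta>' (cis t) - v' t) \<le> 8 * \<mu>" if "t \<in> {0..2*pi}" for t using bspec[OF \<beta>'(3) that] \<delta> \<omega> by linarith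
    from ln[unfolded loop_near_def] obtain \<beta> where \<beta>: "C1_loop N \<beta>" "homotopic_maps N \<gamma> \<beta>"
      "\<forall>t\<in>{0..2*pi}. norm (\<beta> (cis t) - v t) \<le> 8 * \<mu>" by (elim exE conjE) (rule that)
    have "norm (\<beta> z - \<beta>' z) < r" if z: "z \<in> sphere 0 1" for z
    proof -
      define t where "t = Arg2pi z"
      have zt: "z = cis t" using cis_Arg2pi[OF z] by (simp add: t_def)
      have t: "t \<in> {0..2*pi}" using Arg2pi[of z] by (simp add: t_def)
      have "\<beta> z - \<beta>' z = (\<beta> (cis t) - v t) - (\<beta>' (cis t) - v' t) + (v t - v' t)" by (simp add: zt)
      then have "norm (\<beta> z - \<beta>' z) \<le> norm (\<beta> (cis t) - v t) + norm (\<beta>' (cis t) - v' t) + norm (v t - v' t)"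
        by (simp only:) (rule order_trans[OF norm_triangle_ineq add_right_mono[OF norm_triangle_ineq4]])
      then show ?thesis using bspec[OF \<beta>(3) t] d'[OF t] bspec[OF close t] \<mu> by linarith
    qed
    then have "homotopic_maps N \<beta> \<beta>'"
      using C1_loop_continuous[OF \<beta>(1)] C1_loop_continuous[OF \<beta>'(1)] by (intro hom[rule_format] conjI ballI)
    then have h: "homotopic_maps N \<gamma> \<beta>'" by (rule homotopic_with_trans[OF \<beta>(2)])
    show "loop_near \<gamma> (8*\<mu>) v' \<and>
      min_length N \<gamma> \<le> (1 + \<eta>) * ((\<Sum>j<n. norm (v' (2*pi/real n * real (Suc j)) - v' (2*pi/real n * real j))) + 2 * real n * \<delta>)"
    proof
      show "loop_near \<gamma> (8*\<mu>) v'" unfolding loop_near_def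
        by (rule exI[of _ \<beta>'], intro conjI ballI \<beta>'(1) h d')
      show "min_length N \<gamma> \<le> (1 + \<eta>) * ((\<Sum>j<n. norm (v' (2*pi/real n * real (Suc j)) - v' (2*pi/real n * real j))) + 2 * real n * \<delta>)"
        by (rule order_trans[OF min_length_le[OF \<beta>'(1) h] \<beta>'(2)])
    qed
  qed
qed

text \<open>\<kappa> is the energy \<lambda>^2 / (2 pi) of a minimising loop, lowered by the losses
  in \<eta>. A slice of small energy near \<open>N\<close> is compared with a good slice of its
  window, whose class is known from the chain; slices far from \<open>N\<close> are paid for by the
  term with \<open>C\<close>. The constants precede the map, so that they serve a whole
  approximating sequence.\<close>

lemma energy_lower_bound_classical:
  assumes \<gamma>: "C1_loop N \<gamma>" and \<eta>: "0 < \<eta>" "\<eta> \<le> 1"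
    and \<kappa>: "\<kappa> = (max 0 (min_length N \<gamma> / (1 + \<eta>) - \<eta>))\<^sup>2 / (2 * pi)"
  obtains e C \<zeta>\<^sub>0 where "e > 0" "C \<ge> 0" "\<zeta>\<^sub>0 > 0"
    "\<forall>w T Z \<zeta>. C1_periodic w \<and> 0 < Z \<and> 0 < \<zeta> \<and> \<zeta> \<le> \<zeta>\<^sub>0 \<and> \<zeta> * real Z = T \<and>
      (\<forall>i<Z. integral {\<zeta> * real i..\<zeta> * real (Suc i)} (slice_energy2 w) \<le> e) \<and>
      integral {0..T} (slice_dist N w) \<le> e * \<zeta>\<^sup>2 \<and>
      integral {0..2*pi} (\<lambda>\<theta>. (norm (w (\<theta>, 0) - \<gamma> (cis \<theta>)))\<^sup>2) \<le> \<zeta> * e \<longrightarrow>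
      T * \<kappa> \<le> integral {0..T} (slice_energy w) + C * integral {0..T} (slice_dist N w)"
proof -
  obtain D where D: "\<And>t. ((\<lambda>\<theta>. \<gamma> (cis \<theta>)) has_vector_derivative D t) (at t)" "continuous_on UNIV D"
    using \<gamma> unfolding C1_loop_def C1_differentiable_on_def by blast
  have N0: "N \<noteq> {}" using C1_loop_continuous(3)[OF \<gamma>] by (metis empty_iff image_subset_iff norm_one mem_sphere_0)
  have near: "\<exists>p\<in>N. norm (y - p) < d" if "infdist y N < d" for y d
    using infdist_attains_inf[OF compact_imp_closed[OF compact_N] N0, of y] that by (metis dist_norm)
  have \<kappa>0: "\<kappa> \<ge> 0" by (simp add: \<kappa>)
  from loop_near_transfer[OF \<eta>] obtain \<mu> where \<mu>: "\<mu> > 0" and tr: "\<forall>\<gamma> v v' n \<delta> \<omega>. loop_near \<gamma> (8*\<mu>) v \<and> v' (2*pi) = v' 0 \<and> (\<forall>t\<in>{0..2*pi}. norm (v t - v' t) \<le> \<mu>) \<and>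
    0 < n \<and> 0 < \<delta> \<and> \<delta> \<le> \<mu> \<and> 0 \<le> \<omega> \<and> \<omega> \<le> \<mu> \<and> (\<forall>t\<in>{0..2*pi}. \<exists>p\<in>N. norm (v' t - p) < \<delta>) \<and>
    (\<forall>j<n. \<forall>t\<in>{2*pi/real n * real j..2*pi/real n * real (Suc j)}. norm (v' t - v' (2*pi/real n * real j)) \<le> \<omega>) \<longrightarrow>
    loop_near \<gamma> (8*\<mu>) v' \<and>
    min_length N \<gamma> \<le> (1 + \<eta>) * ((\<Sum>j<n. norm (v' (2*pi/real n * real (Suc j)) - v' (2*pi/real n * real j))) + 2 * real n * \<delta>)"
    by (elim exE conjE) (rule that)
  have transfer: "loop_near \<gamma> (8*\<mu>) v' \<and> min_length N \<gamma> \<le> (1 + \<eta>) * (sqrt (2 * pi * integral {0..2*pi} (\<lambda>\<theta>. (norm (a \<theta>))\<^sup>2)) + 2 * real n * \<delta>)"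
    if h: "loop_near \<gamma> (8*\<mu>) v" "v' (2*pi) = v' 0" "\<And>t. t \<in> {0..2*pi} \<Longrightarrow> norm (v t - v' t) \<le> \<mu>" "0 < n" "0 < \<delta>" "\<delta> \<le> \<mu>"
      "\<And>t. t \<in> {0..2*pi} \<Longrightarrow> infdist (v' t) N < \<delta>"
      and a: "\<And>t. (v' has_vector_derivative a t) (at t)" "continuous_on UNIV a"
      and A2: "integral {0..2*pi} (\<lambda>\<theta>. (norm (a \<theta>))\<^sup>2) \<le> A2" "2 * pi * A2 \<le> real n * \<mu>\<^sup>2"
    for v v' a n \<delta> A2
  proof -
    have "loop_near \<gamma> (8*\<mu>) v' \<and>
      min_length N \<gamma> \<le> (1 + \<eta>) * ((\<Sum>j<n. norm (v' (2*pi/real n * real (Suc j)) - v' (2*pi/real n * real j))) + 2 * real n * \<delta>)"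
    proof (rule mp[OF spec[OF spec[OF spec[OF spec[OF spec[OF spec[OF tr, of \<gamma>], of v], of v'], of n], of \<delta>], of \<mu>]], intro conjI h ballI allI impI)
      show "0 \<le> \<mu>" using \<mu> by simp
      show "norm (v' t - v' (2*pi/real n * real j)) \<le> \<mu>" if "j < n" "t \<in> {2*pi/real n * real j..2*pi/real n * real (Suc j)}" for j t
        by (rule arc_oscillation[OF a A2 _ that]) (use \<mu> in simp)
    qed (simp_all add: near h)
    moreover have "(1 + \<eta>) * ((\<Sum>j<n. norm (v' (2*pi/real n * real (Suc j)) - v' (2*pi/real n * real j))) + 2 * real n * \<delta>)
      \<le> (1 + \<eta>) * (sqrt (2 * pi * integral {0..2*pi} (\<lambda>\<theta>. (norm (a \<theta>))\<^sup>2)) + 2 * real n * \<delta>)"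
      using \<eta> by (intro mult_left_mono add_right_mono arc_sum[OF a h(4)]) simp
    ultimately show ?thesis by (auto intro: order_trans)
  qed
  \<comment> \<open>For squared L^2 distance 4e\<zeta>, energies 2e/\<zeta> and interpolation length
    \<zeta>, slices are uniformly within sqrt(4e) + sqrt(8e), and this is at most \<mu>.\<close>
  define e where "e = (\<mu>/5)\<^sup>2"
  have e: "e > 0" using \<mu> by (simp add: e_def)
  have arcs: "\<exists>n::nat. 0 < n \<and> y \<le> real n * \<mu>\<^sup>2" for y
  proof -
    obtain n :: nat where "y / \<mu>\<^sup>2 < real n" using reals_Archimedean2 by blast
    then have "y / \<mu>\<^sup>2 \<le> real (Suc n)" by simp
    then show ?thesis using \<mu> by (intro exI[of _ "Suc n"]) (simp add: pos_divide_le_eq)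
  qed
  \<comment> \<open>Enough arcs for slices of energy at most \<kappa>. As \<open>K\<close> is fixed
    first, \<delta> can be taken so small that the total chord error 2K\<delta> is at most
    \<eta>.\<close>
  obtain K :: nat where K: "0 < K" "2 * pi * \<kappa> \<le> real K * \<mu>\<^sup>2" using arcs by blast
  define \<delta> where "\<delta> = min \<mu> (\<eta> / (2 * real K))"
  have \<delta>: "0 < \<delta>" "\<delta> \<le> \<mu>" using \<mu> \<eta> K by (simp_all add: \<delta>_def)
  have "\<delta> \<le> \<eta> / (2 * real K)" by (simp add: \<delta>_def)
  then have K\<delta>: "2 * real K * \<delta> \<le> \<eta>" using K by (simp add: field_simps)
  \<comment> \<open>\<open>l\<close> and \<open>d\<close> are tuned so that energy at most \<kappa>
    and squared L^2 distance at most \<open>d\<close> put a slice within \<delta>/4 + \<delta>/4 of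
    \<open>N\<close>.\<close>
  define l where "l = min (2*pi) ((\<delta>/4)\<^sup>2 / (\<kappa> + 1))"
  have l: "0 < l" "l \<le> 2*pi" using \<delta> \<kappa>0 by (simp_all add: l_def)
  have "l * \<kappa> \<le> (\<delta>/4)\<^sup>2 / (\<kappa> + 1) * (\<kappa> + 1)" using \<kappa>0 l by (intro mult_mono) (auto simp: l_def)
  then have l\<kappa>: "l * \<kappa> \<le> (\<delta>/4)\<^sup>2" using \<kappa>0 by simp
  define d where "d = l * (\<delta>/4)\<^sup>2"
  have d: "d > 0" using l \<delta> by (simp add: d_def)
  define \<Gamma> where "\<Gamma> = integral {0..2*pi} (\<lambda>\<theta>. (norm (D \<theta>))\<^sup>2)"
  have \<Gamma>0: "0 \<le> \<Gamma>" unfolding \<Gamma>_def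
    by (intro integral_nonneg integrable_continuous_interval continuous_intros continuous_on_subset[OF D(2) subset_UNIV]) simp
  \<comment> \<open>Short windows make 2e/\<zeta> large enough to dominate the energy of \<gamma>
    and the value \<kappa>, so that \<gamma> and any slice of energy below \<kappa> obey the energy
    bound of good slices. The bound 2 pi lets \<zeta> serve as an interpolation length on the
    circle.\<close>
  define \<zeta>\<^sub>0 where "\<zeta>\<^sub>0 = min (2*pi) (2 * e / (\<Gamma> + \<kappa> + 1))"
  have \<zeta>0: "\<zeta>\<^sub>0 > 0" using e \<Gamma>0 \<kappa>0 by (simp add: \<zeta>\<^sub>0_def)
  show ?thesis
  proof (rule that[of e "\<kappa> / d" \<zeta>\<^sub>0])
    show "e > 0" "\<kappa> / d \<ge> 0" "\<zeta>\<^sub>0 > 0" using e \<kappa>0 d \<zeta>0 by simp_all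
    show "\<forall>w T Z \<zeta>. C1_periodic w \<and> 0 < Z \<and> 0 < \<zeta> \<and> \<zeta> \<le> \<zeta>\<^sub>0 \<and> \<zeta> * real Z = T \<and>
      (\<forall>i<Z. integral {\<zeta> * real i..\<zeta> * real (Suc i)} (slice_energy2 w) \<le> e) \<and>
      integral {0..T} (slice_dist N w) \<le> e * \<zeta>\<^sup>2 \<and>
      integral {0..2*pi} (\<lambda>\<theta>. (norm (w (\<theta>, 0) - \<gamma> (cis \<theta>)))\<^sup>2) \<le> \<zeta> * e \<longrightarrow>
      T * \<kappa> \<le> integral {0..T} (slice_energy w) + \<kappa> / d * integral {0..T} (slice_dist N w)"
    proof (intro allI impI, elim conjE)
    fix w :: "real \<times> real \<Rightarrow> 'v" and T \<zeta> :: real and Z :: nat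
    assume w: "C1_periodic w" and Z: "0 < Z" and \<zeta>: "0 < \<zeta>" "\<zeta> \<le> \<zeta>\<^sub>0" and T: "\<zeta> * real Z = T"
      and win': "\<forall>i<Z. integral {\<zeta> * real i..\<zeta> * real (Suc i)} (slice_energy2 w) \<le> e"
      and dst: "integral {0..T} (slice_dist N w) \<le> e * \<zeta>\<^sup>2"
      and ini: "integral {0..2*pi} (\<lambda>\<theta>. (norm (w (\<theta>, 0) - \<gamma> (cis \<theta>)))\<^sup>2) \<le> \<zeta> * e"
    note win = win'[rule_format]
    note W = C1_periodicD[OF w] and sp = slice_properties[OF w]
    have der: "((\<lambda>\<theta>. w (\<theta>, t)) has_vector_derivative d_theta w (\<theta>, t)) (at \<theta>)" "continuous_on UNIV (\<lambda>\<theta>. d_theta w (\<theta>, t))" for \<theta> t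
      by (rule W(5)) (rule continuous_on_slice(1)[OF W(2)])
    have \<zeta>pi: "\<zeta> \<le> 2*pi" using \<zeta> by (simp add: \<zeta>\<^sub>0_def)
    have "\<zeta> * (\<Gamma> + \<kappa> + 1) \<le> 2 * e"
    proof -
      have "\<zeta> \<le> 2 * e / (\<Gamma> + \<kappa> + 1)" using \<zeta> by (simp add: \<zeta>\<^sub>0_def)
      then show ?thesis using \<Gamma>0 \<kappa>0 by (simp add: pos_le_divide_eq)
    qed
    then have *: "\<Gamma> + \<kappa> + 1 \<le> 2 * e / \<zeta>" using \<zeta> by (simp add: pos_le_divide_eq mult.commute)
    then have \<Gamma>e: "\<Gamma> \<le> 2 * e / \<zeta>" and \<kappa>e: "\<kappa> \<le> 2 * e / \<zeta>" using \<Gamma>0 \<kappa>0 by linarith+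
    have close: "norm (v x - v' x) \<le> \<mu>"
      if v: "\<And>t. (v has_vector_derivative a t) (at t)" "continuous_on UNIV a"
        and v': "\<And>t. (v' has_vector_derivative a' t) (at t)" "continuous_on UNIV a'"
        and U2: "integral {0..2*pi} (\<lambda>\<theta>. (norm (v \<theta> - v' \<theta>))\<^sup>2) \<le> 4 * e * \<zeta>"
        and A: "integral {0..2*pi} (\<lambda>\<theta>. (norm (a \<theta>))\<^sup>2) \<le> 2 * e / \<zeta>" "integral {0..2*pi} (\<lambda>\<theta>. (norm (a' \<theta>))\<^sup>2) \<le> 2 * e / \<zeta>"
        and x: "x \<in> {0..2*pi}" for v v' a a' :: "real \<Rightarrow> 'v" and x
    proof -
      have 1: "norm (v x - v' x) \<le> sqrt (4 * e * \<zeta> / \<zeta>) + sqrt (\<zeta> * (2 * (2 * e / \<zeta>) + 2 * (2 * e / \<zeta>)))"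
        by (rule slice_sup_diff[OF v v' \<zeta>(1) \<zeta>pi U2 A x])
      have "sqrt (4 * e * \<zeta> / \<zeta>) \<le> 2 * \<mu> / 5" using \<mu> \<zeta> by (intro sqrt_leI) (simp_all add: e_def power2_eq_square)
      moreover have "\<zeta> * (2 * (2 * e / \<zeta>) + 2 * (2 * e / \<zeta>)) = 8 * e" using \<zeta> by (simp add: field_simps)
      moreover have "sqrt (8 * e) \<le> 3 * \<mu> / 5" using \<mu> by (intro sqrt_leI) (simp_all add: e_def power2_eq_square)
      ultimately show ?thesis using 1 by simp
    qed
    have sub: "0 \<le> \<zeta> * real i" "\<zeta> * real i \<le> \<zeta> * real (Suc i)" "\<zeta> * real (Suc i) \<le> T" if "i < Z" for i
      using \<zeta>(1) that unfolding T[symmetric] by (auto intro!: mult_left_mono)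
    have "\<exists>t. i < Z \<longrightarrow> t \<in> {\<zeta> * real i..\<zeta> * real (Suc i)} \<and> slice_energy w t \<le> 2 * e / \<zeta> \<and> slice_dist N w t \<le> 2 * e * \<zeta>" for i
    proof (cases "i < Z")
      case True
      define I where "I = {\<zeta> * real i..\<zeta> * real (Suc i)}"
      \<comment> \<open>Minimising one weighted sum over the window gives a slice that is good in
        both respects, since the mean of this sum is at most 2e/\<zeta>.\<close>
      define g where "g t = slice_energy w t + slice_dist N w t / \<zeta>\<^sup>2" for t
      have cg: "continuous_on I g" unfolding g_def I_def by (intro continuous_intros sp) (use \<zeta> in simp)
      have "compact I" "I \<noteq> {}" using sub(2)[OF True] by (simp_all add: I_def)
      from continuous_attains_inf[OF this cg] obtain t where t: "t \<in> I" "\<And>y. y \<in> I \<Longrightarrow> g t \<le> g y" by blast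
      have intE: "slice_energy w integrable_on I" "slice_energy2 w integrable_on I" "slice_dist N w integrable_on I"
        "(\<lambda>t. slice_dist N w t / \<zeta>\<^sup>2) integrable_on I"
        unfolding I_def using \<zeta> by (intro integrable_continuous_interval continuous_intros sp; simp)+
      have ic: "(\<lambda>_. g t) integrable_on I" unfolding I_def by (rule integrable_continuous_interval[OF continuous_on_const])
      have ig: "g integrable_on I" using cg unfolding I_def by (rule integrable_continuous_interval)
      have "\<zeta> * g t = integral I (\<lambda>_. g t)" using sub(2)[OF True] by (simp add: I_def algebra_simps)
      also have "\<dots> \<le> integral I g"
        by (rule integral_le[OF ic ig t(2)])
      also have "\<dots> = integral I (slice_energy w) + integral I (\<lambda>t. slice_dist N w t / \<zeta>\<^sup>2)"
        unfolding g_def[abs_def] by (rule integral_add[OF intE(1,4)])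
      also have "integral I (\<lambda>t. slice_dist N w t / \<zeta>\<^sup>2) = integral I (slice_dist N w) / \<zeta>\<^sup>2" by simp
      also have "integral I (slice_energy w) \<le> integral I (slice_energy2 w)" by (rule integral_le[OF intE(1,2) sp(6)])
      also have "integral I (slice_energy2 w) \<le> e" unfolding I_def by (rule win[OF True])
      also have "integral I (slice_dist N w) / \<zeta>\<^sup>2 \<le> e"
      proof -
        have "integral I (slice_dist N w) \<le> integral {0..T} (slice_dist N w)"
          using sub[OF True] by (intro integral_subset_le intE(3) integrable_continuous_interval sp(3,5)) (auto simp: I_def sp(5))
        then show ?thesis using dst \<zeta> by (simp add: pos_divide_le_eq)
      qed
      finally have "\<zeta> * g t \<le> e + e" by simp
      then have gt: "g t \<le> 2 * e / \<zeta>" using \<zeta> by (simp add: pos_le_divide_eq mult.commute)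
      have "slice_energy w t \<le> g t" using sp(5) by (simp add: g_def)
      moreover have "slice_dist N w t / \<zeta>\<^sup>2 \<le> g t" using sp(4) by (simp add: g_def)
      then have "slice_dist N w t / \<zeta>\<^sup>2 \<le> 2 * e / \<zeta>" using gt by linarith
      then have "slice_dist N w t \<le> 2 * e / \<zeta> * \<zeta>\<^sup>2" using \<zeta> by (simp add: pos_divide_le_eq)
      then have "slice_dist N w t \<le> 2 * e * \<zeta>" using \<zeta> by (simp add: power2_eq_square)
      ultimately show ?thesis using gt t(1) unfolding I_def by (intro exI[of _ t]) simp
    qed simp
    from choice[OF allI[OF this]] obtain \<tau> where \<tau>: "\<forall>i. i < Z \<longrightarrow> \<tau> i \<in> {\<zeta> * real i..\<zeta> * real (Suc i)} \<and>
      slice_energy w (\<tau> i) \<le> 2 * e / \<zeta> \<and> slice_dist N w (\<tau> i) \<le> 2 * e * \<zeta>" by (rule exE)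
    have \<tau>I: "\<tau> i \<in> {\<zeta> * real i..\<zeta> * real (Suc i)}" and \<tau>E: "slice_energy w (\<tau> i) \<le> 2 * e / \<zeta>"
      and \<tau>D: "slice_dist N w (\<tau> i) \<le> 2 * e * \<zeta>" if "i < Z" for i using \<tau> that by auto
    have \<tau>near: "infdist (w (x, \<tau> i)) N < \<mu>" if i: "i < Z" and x: "x \<in> {0..2*pi}" for i x
    proof -
      have 1: "infdist (w (x, \<tau> i)) N \<le> sqrt (2 * e * \<zeta> / \<zeta>) + sqrt (\<zeta> * (2 * e / \<zeta>))"
        by (rule slice_sup_infdist[OF der \<zeta>(1) \<zeta>pi \<tau>D[OF i, unfolded slice_dist_def] \<tau>E[OF i, unfolded slice_energy_def] x])
      have "2 * e * \<zeta> / \<zeta> = 2 * e" "\<zeta> * (2 * e / \<zeta>) = 2 * e" using \<zeta> by simp_all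
      moreover have "sqrt (2 * e) \<le> 2 * \<mu> / 5" using \<mu> by (intro sqrt_leI) (simp_all add: e_def power2_eq_square)
      ultimately show ?thesis using 1 \<mu> by simp
    qed
    \<comment> \<open>This number of arcs grows as \<zeta> shrinks. That does no harm, because the
      chain passes on only the homotopy class; the length bound is drawn later with \<open>K\<close>
      arcs.\<close>
    obtain n :: nat where n: "0 < n" "2 * pi * (2 * e / \<zeta>) \<le> real n * \<mu>\<^sup>2" using arcs by blast
    have per: "w (2*pi, t) = w (0, t)" for t using W(3)[of 0 t] by simp
    have chain: "loop_near \<gamma> (8*\<mu>) (\<lambda>\<theta>. w (\<theta>, \<tau> i))" if "i < Z" for i
      using that
    proof (induction i)
      case 0
      have "loop_near \<gamma> (8*\<mu>) (\<lambda>\<theta>. \<gamma> (cis \<theta>))" unfolding loop_near_def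
        using \<mu> by (intro exI[of _ \<gamma>] conjI \<gamma> C1_loop_continuous(1)[OF \<gamma>]) simp
      moreover have "norm (\<gamma> (cis x) - w (x, \<tau> 0)) \<le> \<mu>" if x: "x \<in> {0..2*pi}" for x
      proof (rule close[OF D der _ \<Gamma>e[unfolded \<Gamma>_def] \<tau>E[OF 0, unfolded slice_energy_def] x])
        have 1: "integral {0..2*pi} (\<lambda>\<theta>. (norm (w (\<theta>, 0) - w (\<theta>, \<tau> 0)))\<^sup>2) \<le> (\<zeta> * real (Suc 0) - \<zeta> * real 0) * integral {\<zeta> * real 0..\<zeta> * real (Suc 0)} (slice_energy2 w)"
          using \<tau>I[OF 0] \<zeta> by (intro sp(7)) auto
        also have "\<dots> \<le> \<zeta> * e" using win[OF 0] \<zeta> by (simp add: mult_left_mono)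
        finally have 2: "integral {0..2*pi} (\<lambda>\<theta>. (norm (w (\<theta>, 0) - w (\<theta>, \<tau> 0)))\<^sup>2) \<le> \<zeta> * e" .
        have cc: "continuous_on {0..2*pi} (\<lambda>\<theta>. \<gamma> (cis \<theta>))" "continuous_on {0..2*pi} (\<lambda>\<theta>. w (\<theta>, t))" for t
          by (rule continuous_at_imp_continuous_on, use D(1) has_vector_derivative_continuous in blast,
              rule continuous_on_slice(1)[OF W(4)])
        have i1: "(\<lambda>\<theta>. 2 * (norm (w (\<theta>, 0) - \<gamma> (cis \<theta>)))\<^sup>2) integrable_on {0..2*pi}"
          and i2: "(\<lambda>\<theta>. 2 * (norm (w (\<theta>, 0) - w (\<theta>, \<tau> 0)))\<^sup>2) integrable_on {0..2*pi}"
          and i3: "(\<lambda>\<theta>. (norm (\<gamma> (cis \<theta>) - w (\<theta>, \<tau> 0)))\<^sup>2) integrable_on {0..2*pi}"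
          by (intro integrable_continuous_interval continuous_intros cc)+
        have "integral {0..2*pi} (\<lambda>\<theta>. (norm (\<gamma> (cis \<theta>) - w (\<theta>, \<tau> 0)))\<^sup>2)
          \<le> integral {0..2*pi} (\<lambda>\<theta>. 2 * (norm (w (\<theta>, 0) - \<gamma> (cis \<theta>)))\<^sup>2 + 2 * (norm (w (\<theta>, 0) - w (\<theta>, \<tau> 0)))\<^sup>2)"
        proof (rule integral_le[OF i3 integrable_add[OF i1 i2]])
          fix \<theta>
          have "norm (\<gamma> (cis \<theta>) - w (\<theta>, \<tau> 0)) \<le> norm (w (\<theta>, 0) - \<gamma> (cis \<theta>)) + norm (w (\<theta>, 0) - w (\<theta>, \<tau> 0))"
            using norm_triangle_ineq4[of "w (\<theta>, 0) - w (\<theta>, \<tau> 0)" "w (\<theta>, 0) - \<gamma> (cis \<theta>)"] by simp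
          then have "(norm (\<gamma> (cis \<theta>) - w (\<theta>, \<tau> 0)))\<^sup>2 \<le> (norm (w (\<theta>, 0) - \<gamma> (cis \<theta>)) + norm (w (\<theta>, 0) - w (\<theta>, \<tau> 0)))\<^sup>2"
            by (rule power_mono) simp
          also have "\<dots> \<le> 2 * (norm (w (\<theta>, 0) - \<gamma> (cis \<theta>)))\<^sup>2 + 2 * (norm (w (\<theta>, 0) - w (\<theta>, \<tau> 0)))\<^sup>2"
            using sum_squares_bound[of "norm (w (\<theta>, 0) - \<gamma> (cis \<theta>))" "norm (w (\<theta>, 0) - w (\<theta>, \<tau> 0))"] by (simp add: power2_sum)
          finally show "(norm (\<gamma> (cis \<theta>) - w (\<theta>, \<tau> 0)))\<^sup>2 \<le> 2 * (norm (w (\<theta>, 0) - \<gamma> (cis \<theta>)))\<^sup>2 + 2 * (norm (w (\<theta>, 0) - w (\<theta>, \<tau> 0)))\<^sup>2" .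
        qed
        also have "\<dots> = 2 * integral {0..2*pi} (\<lambda>\<theta>. (norm (w (\<theta>, 0) - \<gamma> (cis \<theta>)))\<^sup>2) + 2 * integral {0..2*pi} (\<lambda>\<theta>. (norm (w (\<theta>, 0) - w (\<theta>, \<tau> 0)))\<^sup>2)"
          unfolding integral_add[OF i1 i2] by simp
        finally show "integral {0..2*pi} (\<lambda>\<theta>. (norm (\<gamma> (cis \<theta>) - w (\<theta>, \<tau> 0)))\<^sup>2) \<le> 4 * e * \<zeta>"
          using ini 2 by (simp add: mult.commute)
      qed
      ultimately show ?case
        using transfer[OF _ per _ n(1) \<mu> order_refl \<tau>near[OF 0] der \<tau>E[OF 0, unfolded slice_energy_def] n(2)] by blast
    next
      case (Suc i)
      then have i: "i < Z" by simp
      have "norm (w (x, \<tau> i) - w (x, \<tau> (Suc i))) \<le> \<mu>" if x: "x \<in> {0..2*pi}" for x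
      proof (rule close[OF der der _ \<tau>E[OF i, unfolded slice_energy_def] \<tau>E[OF Suc.prems, unfolded slice_energy_def] x])
        have "integral {0..2*pi} (\<lambda>\<theta>. (norm (w (\<theta>, \<tau> i) - w (\<theta>, \<tau> (Suc i))))\<^sup>2)
          \<le> (\<zeta> * real (Suc (Suc i)) - \<zeta> * real i) * integral {\<zeta> * real i..\<zeta> * real (Suc (Suc i))} (slice_energy2 w)"
          using \<tau>I[OF i] \<tau>I[OF Suc.prems] sub(2)[OF i] sub(2)[OF Suc.prems] by (intro sp(7)) auto
        also have "integral {\<zeta> * real i..\<zeta> * real (Suc (Suc i))} (slice_energy2 w)
          = integral {\<zeta> * real i..\<zeta> * real (Suc i)} (slice_energy2 w) + integral {\<zeta> * real (Suc i)..\<zeta> * real (Suc (Suc i))} (slice_energy2 w)"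
          by (rule Henstock_Kurzweil_Integration.integral_combine[symmetric, OF sub(2)[OF i] sub(2)[OF Suc.prems]])
            (intro integrable_continuous_interval sp(2))
        also have "\<zeta> * real (Suc (Suc i)) - \<zeta> * real i = 2 * \<zeta>" by (simp add: algebra_simps)
        also have "2 * \<zeta> * (integral {\<zeta> * real i..\<zeta> * real (Suc i)} (slice_energy2 w) + integral {\<zeta> * real (Suc i)..\<zeta> * real (Suc (Suc i))} (slice_energy2 w))
          \<le> 2 * \<zeta> * (e + e)" using \<zeta> by (intro mult_left_mono add_mono win i Suc.prems) simp
        finally show "integral {0..2*pi} (\<lambda>\<theta>. (norm (w (\<theta>, \<tau> i) - w (\<theta>, \<tau> (Suc i))))\<^sup>2) \<le> 4 * e * \<zeta>" by (simp add: algebra_simps)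
      qed
      then show ?case
        using transfer[OF Suc.IH[OF i] per _ n(1) \<mu> order_refl \<tau>near[OF Suc.prems] der \<tau>E[OF Suc.prems, unfolded slice_energy_def] n(2)] by blast
    qed
    \<comment> \<open>A slice of energy at least \<kappa> satisfies this at once, and one of
      distance at least \<open>d\<close> by the second term. Any other slice is uniformly close to
      the good slice of its window and so inherits its homotopy class.\<close>
    have pt: "\<kappa> \<le> slice_energy w t + \<kappa> / d * slice_dist N w t" if t: "t \<in> {0..T}" for t
    proof (cases "slice_energy w t < \<kappa> \<and> slice_dist N w t < d")
      case True
      then have Et: "slice_energy w t \<le> \<kappa>" "slice_dist N w t \<le> d" by simp_all
      obtain i where i: "i < Z" "t \<in> {\<zeta> * real i..\<zeta> * real (Suc i)}" using ex_subinterval[OF \<zeta>(1) T Z t] by blast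
      have cl: "norm (w (x, \<tau> i) - w (x, t)) \<le> \<mu>" if x: "x \<in> {0..2*pi}" for x
      proof (rule close[OF der der _ \<tau>E[OF i(1), unfolded slice_energy_def] order_trans[OF Et(1) \<kappa>e, unfolded slice_energy_def] x])
        have "integral {0..2*pi} (\<lambda>\<theta>. (norm (w (\<theta>, \<tau> i) - w (\<theta>, t)))\<^sup>2)
          \<le> (\<zeta> * real (Suc i) - \<zeta> * real i) * integral {\<zeta> * real i..\<zeta> * real (Suc i)} (slice_energy2 w)"
          using \<tau>I[OF i(1)] i(2) by (intro sp(7)) auto
        also have "\<zeta> * real (Suc i) - \<zeta> * real i = \<zeta>" by (simp add: algebra_simps)
        also have "\<zeta> * integral {\<zeta> * real i..\<zeta> * real (Suc i)} (slice_energy2 w) \<le> \<zeta> * e"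
          using \<zeta> by (intro mult_left_mono win i(1)) simp
        also have "\<dots> \<le> 4 * e * \<zeta>" using \<zeta> e by simp
        finally show "integral {0..2*pi} (\<lambda>\<theta>. (norm (w (\<theta>, \<tau> i) - w (\<theta>, t)))\<^sup>2) \<le> 4 * e * \<zeta>" .
      qed
      have nr: "infdist (w (x, t)) N < \<delta>" if x: "x \<in> {0..2*pi}" for x
      proof -
        have 1: "infdist (w (x, t)) N \<le> sqrt (d / l) + sqrt (l * \<kappa>)"
          by (rule slice_sup_infdist[OF der l Et(2)[unfolded slice_dist_def] Et(1)[unfolded slice_energy_def] x])
        have "sqrt (d / l) \<le> \<delta>/4" using l \<delta> by (intro sqrt_leI) (simp_all add: d_def)
        moreover have "sqrt (l * \<kappa>) \<le> \<delta>/4" using l\<kappa> \<delta> by (intro sqrt_leI) simp_all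
        ultimately show ?thesis using 1 \<delta> by linarith
      qed
      have "min_length N \<gamma> \<le> (1 + \<eta>) * (sqrt (2 * pi * slice_energy w t) + 2 * real K * \<delta>)"
        using transfer[OF chain[OF i(1)] per cl K(1) \<delta> nr der Et(1)[unfolded slice_energy_def] K(2)] unfolding slice_energy_def by blast
      also have "\<dots> \<le> (1 + \<eta>) * (sqrt (2 * pi * slice_energy w t) + \<eta>)" using K\<delta> \<eta> by (intro mult_left_mono) auto
      finally have "min_length N \<gamma> / (1 + \<eta>) \<le> sqrt (2 * pi * slice_energy w t) + \<eta>" using \<eta> by (simp add: pos_divide_le_eq mult.commute)
      then have "max 0 (min_length N \<gamma> / (1 + \<eta>) - \<eta>) \<le> sqrt (2 * pi * slice_energy w t)" using sp(4) by simp
      then have "(max 0 (min_length N \<gamma> / (1 + \<eta>) - \<eta>))\<^sup>2 \<le> (sqrt (2 * pi * slice_energy w t))\<^sup>2" by (rule power_mono) simp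
      also have "\<dots> = 2 * pi * slice_energy w t" using sp(4) by simp
      finally have "\<kappa> \<le> slice_energy w t" unfolding \<kappa> by (simp add: pos_divide_le_eq mult.commute)
      then show ?thesis using True by simp
    next
      case False
      have k: "0 \<le> \<kappa> / d" using \<kappa>0 d by simp
      show ?thesis
      proof (cases "slice_energy w t < \<kappa>")
        case True
        then have "d \<le> slice_dist N w t" using False by simp
        then have "\<kappa> / d * d \<le> \<kappa> / d * slice_dist N w t" using k by (rule mult_left_mono)
        then show ?thesis using sp(4)[of t] d by simp
      next
        case False
        then show ?thesis using mult_nonneg_nonneg[OF k sp(5)[of N t]] by simp
      qed
    qed
    have T0: "0 \<le> T" using T \<zeta> by auto
    have "T * \<kappa> = integral {0..T} (\<lambda>_. \<kappa>)" using T0 by simp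
    also have "\<dots> \<le> integral {0..T} (\<lambda>t. slice_energy w t + \<kappa> / d * slice_dist N w t)"
    proof (rule integral_le[OF _ _ pt])
      show "(\<lambda>_. \<kappa>) integrable_on {0..T}" by (rule integrable_continuous_interval[OF continuous_on_const])
      show "(\<lambda>t. slice_energy w t + \<kappa> / d * slice_dist N w t) integrable_on {0..T}"
        by (intro integrable_continuous_interval continuous_on_add continuous_on_mult_left sp(1,3))
    qed
    also have "\<dots> = integral {0..T} (slice_energy w) + integral {0..T} (\<lambda>t. \<kappa> / d * slice_dist N w t)"
      by (intro integral_add integrable_continuous_interval continuous_intros sp)
    also have "integral {0..T} (\<lambda>t. \<kappa> / d * slice_dist N w t) = \<kappa> / d * integral {0..T} (slice_dist N w)" by simp
    finally show "T * \<kappa> \<le> integral {0..T} (slice_energy w) + \<kappa> / d * integral {0..T} (slice_dist N w)" .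
    qed
  qed
qed

end

section \<open>From Sobolev competitors to classical maps\<close>

lemma norm_add_square_le:
  fixes a b :: "'a::real_normed_vector"
  assumes "\<tau> > 0"
  shows "(norm (a + b))\<^sup>2 \<le> (1 + \<tau>) * (norm a)\<^sup>2 + (1 + 1/\<tau>) * (norm b)\<^sup>2"
proof -
  have 1: "(norm (a + b))\<^sup>2 \<le> (norm a + norm b)\<^sup>2" by (rule power_mono[OF norm_triangle_ineq]) simp
  have 2: "(norm a + norm b)\<^sup>2 = (norm a)\<^sup>2 + (norm b)\<^sup>2 + 2 * norm a * norm b" by (rule power2_sum)
  \<comment> \<open>The weighted form keeps the coefficient of the first square near 1 for small
    \<tau>, so that energies compare sharply in the limit.\<close>
  have "0 \<le> (\<tau> * norm a - norm b)\<^sup>2 / \<tau>" using assms by simp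
  also have "\<dots> = \<tau> * (norm a)\<^sup>2 - 2 * norm a * norm b + (norm b)\<^sup>2 / \<tau>"
    using assms by (simp add: power2_eq_square field_simps)
  finally have 3: "2 * norm a * norm b \<le> \<tau> * (norm a)\<^sup>2 + (norm b)\<^sup>2 / \<tau>" by simp
  have "(1 + \<tau>) * (norm a)\<^sup>2 + (1 + 1/\<tau>) * (norm b)\<^sup>2 = (norm a)\<^sup>2 + (norm b)\<^sup>2 + (\<tau> * (norm a)\<^sup>2 + (norm b)\<^sup>2 / \<tau>)"
    by (simp add: distrib_right)
  then show ?thesis using 1 2 3 by linarith
qed

lemma integrable_L2_diff:
  fixes f g :: "'a::euclidean_space \<Rightarrow> 'v::euclidean_space"
  assumes f: "L2_on D f" and g: "L2_on D g"
  shows "integrable (lebesgue_on D) (\<lambda>z. (norm (f z - g z))\<^sup>2)"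
proof (rule Bochner_Integration.integrable_bound)
  show "integrable (lebesgue_on D) (\<lambda>z. 2 * (norm (f z))\<^sup>2 + 2 * (norm (g z))\<^sup>2)"
    using f g by (simp add: L2_on_def)
  show "(\<lambda>z. (norm (f z - g z))\<^sup>2) \<in> borel_measurable (lebesgue_on D)"
    using f g unfolding L2_on_def by (intro borel_measurable_power borel_measurable_norm borel_measurable_diff) auto
  show "AE z in lebesgue_on D. norm ((norm (f z - g z))\<^sup>2) \<le> norm (2 * (norm (f z))\<^sup>2 + 2 * (norm (g z))\<^sup>2)"
  proof (rule AE_I2)
    fix z
    have "norm ((norm (f z - g z))\<^sup>2) = (norm (f z - g z))\<^sup>2" by simp
    also have "\<dots> \<le> 2 * (norm (f z))\<^sup>2 + 2 * (norm (g z))\<^sup>2" using norm_add_square_le[of 1 "f z" "- g z"] by simp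
    also have "\<dots> \<le> norm (2 * (norm (f z))\<^sup>2 + 2 * (norm (g z))\<^sup>2)" by simp
    finally show "norm ((norm (f z - g z))\<^sup>2) \<le> norm (2 * (norm (f z))\<^sup>2 + 2 * (norm (g z))\<^sup>2)" .
  qed
qed

lemma SU_inverse:
  assumes "h \<in> carrier SU" shows "inv\<^bsub>SU\<^esub> h = conj_transpose h"
proof -
  have u: "unitary h" using assms by (simp add: carrier_SU)
  show ?thesis unfolding m_inv_def
  proof (rule the_equality)
    show "conj_transpose h \<in> carrier SU \<and> h \<otimes>\<^bsub>SU\<^esub> conj_transpose h = \<one>\<^bsub>SU\<^esub> \<and> conj_transpose h \<otimes>\<^bsub>SU\<^esub> h = \<one>\<^bsub>SU\<^esub>"
      using SU_conj_transpose[OF assms] unitaryD[OF u] by simp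
    fix y assume "y \<in> carrier SU \<and> h \<otimes>\<^bsub>SU\<^esub> y = \<one>\<^bsub>SU\<^esub> \<and> y \<otimes>\<^bsub>SU\<^esub> h = \<one>\<^bsub>SU\<^esub>"
    then have "conj_transpose h ** (h ** y) = conj_transpose h ** mat 1" by simp
    then show "y = conj_transpose h" by (simp add: unitary_cancel[OF u])
  qed
qed

context SU_quotient
begin

text \<open>The classical estimate is applied to the approximations w_n, whose distance to
  \<open>N\<close> is at most their distance to the competitor, because the latter lies in
  \<open>N\<close> almost everywhere. Then n tends to infinity, \<tau> to 0 and \<eta> to 0, in this
  order.\<close>

lemma competitor_energy:
  assumes \<gamma>: "C1_loop N \<gamma>" and comp: "synh_competitor N \<gamma> \<beta> T u A B"
  shows "T * ((min_length N \<gamma>)\<^sup>2 / (2*pi)) \<le> (LINT z|lebesgue_on (cyl T). (norm (A z))\<^sup>2)"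
proof -
  define f where "f = (\<lambda>(\<theta>, t). u (cis \<theta>, t))"
  let ?M = "lebesgue_on (cyl T)"
  from comp have T: "0 < T" and L2: "L2_on (cyl T) f" "L2_on (cyl T) A" "L2_on (cyl T) B"
    and fN: "AE z in ?M. f z \<in> N" and tr: "has_traces T f A B \<gamma> \<beta>"
    unfolding synh_competitor_def Let_def f_def[symmetric] sobolev_cyl_def by blast+
  from tr[unfolded has_traces_def] obtain w where w: "\<forall>n::nat. C1_periodic (w n)"
    and I0': "(\<lambda>n. LINT z|?M. (norm (w n z - f z))\<^sup>2 + (norm (frechet_derivative (w n) (at z) (1,0) - A z))\<^sup>2
            + (norm (frechet_derivative (w n) (at z) (0,1) - B z))\<^sup>2) \<longlonglongrightarrow> 0"
    and J0': "(\<lambda>n. LINT \<theta>|lebesgue_on {0..2*pi}. (norm (w n (\<theta>, 0) - \<gamma> (cis \<theta>)))\<^sup>2) \<longlonglongrightarrow> 0"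
    by (elim exE conjE) (rule that)
  note w = w[rule_format]
  note W = C1_periodicD[OF w]
  define I where "I n = (LINT z|?M. (norm (w n z - f z))\<^sup>2 + (norm (d_theta (w n) z - A z))\<^sup>2
            + (norm (d_t (w n) z - B z))\<^sup>2)" for n
  have I0: "I \<longlonglongrightarrow> 0" using I0' unfolding I_def[abs_def] .
  have wL: "L2_on (cyl T) (w n)" "L2_on (cyl T) (d_theta (w n))" "L2_on (cyl T) (d_t (w n))" for n
    unfolding cyl_eq_cbox by (intro L2_on_continuous W(2,4))+
  have P: "integrable ?M (\<lambda>z. (norm (w n z - f z))\<^sup>2)" and Q: "integrable ?M (\<lambda>z. (norm (d_theta (w n) z - A z))\<^sup>2)"
    and R: "integrable ?M (\<lambda>z. (norm (d_t (w n) z - B z))\<^sup>2)" for n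
    by (intro integrable_L2_diff wL L2)+
  have PQR: "integrable ?M (\<lambda>z. (norm (w n z - f z))\<^sup>2 + (norm (d_theta (w n) z - A z))\<^sup>2 + (norm (d_t (w n) z - B z))\<^sup>2)" for n
    by (intro Bochner_Integration.integrable_add P Q R)
  have PI: "(LINT z|?M. (norm (w n z - f z))\<^sup>2) \<le> I n" for n
    unfolding I_def by (rule Bochner_Integration.integral_mono[OF P PQR]) simp
  have QI: "(LINT z|?M. (norm (d_theta (w n) z - A z))\<^sup>2) \<le> I n" for n
    unfolding I_def by (rule Bochner_Integration.integral_mono[OF Q PQR]) simp
  have QRI: "(LINT z|?M. (norm (d_theta (w n) z - A z))\<^sup>2 + (norm (d_t (w n) z - B z))\<^sup>2) \<le> I n" for n
    unfolding I_def by (rule Bochner_Integration.integral_mono[OF Bochner_Integration.integrable_add[OF Q R] PQR]) simp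
  have distI: "integral {0..T} (slice_dist N (w n)) \<le> I n" for n
  proof -
    have c: "continuous_on UNIV (\<lambda>z. (infdist (w n z) N)\<^sup>2)"
      by (intro continuous_intros continuous_on_infdist W(4))
    have "integral {0..T} (slice_dist N (w n)) = (LINT z|?M. (infdist (w n z) N)\<^sup>2)"
      unfolding LINT_cyl(2)[OF c] integral_cyl(2)[OF c] slice_dist_def[abs_def] by (rule refl)
    also have "\<dots> \<le> (LINT z|?M. (norm (w n z - f z))\<^sup>2)"
    proof (rule integral_mono_AE[OF LINT_cyl(1)[OF c] P])
      show "AE z in ?M. (infdist (w n z) N)\<^sup>2 \<le> (norm (w n z - f z))\<^sup>2"
        using fN
      proof eventually_elim
        case (elim z)
        show ?case using infdist_le[OF elim, of "w n z"] by (intro power_mono infdist_nonneg) (simp add: dist_norm)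
      qed
    qed
    finally show ?thesis using PI[of n] by linarith
  qed
  define PA where "PA = (LINT z|?M. (norm (A z))\<^sup>2)"
  have iA: "integrable ?M (\<lambda>z. (norm (A z))\<^sup>2)" using L2(2) by (simp add: L2_on_def)
  have EI: "integral {0..T} (slice_energy (w n)) \<le> (1 + \<tau>) * PA + (1 + 1/\<tau>) * I n" if \<tau>: "\<tau> > 0" for \<tau> n
  proof -
    have c: "continuous_on UNIV (\<lambda>z. (norm (d_theta (w n) z))\<^sup>2)" by (intro continuous_intros W(2))
    have "integral {0..T} (slice_energy (w n)) = (LINT z|?M. (norm (d_theta (w n) z))\<^sup>2)"
      unfolding LINT_cyl(2)[OF c] integral_cyl(2)[OF c] slice_energy_def[abs_def] by (rule refl)
    also have "\<dots> \<le> (LINT z|?M. (1 + \<tau>) * (norm (A z))\<^sup>2 + (1 + 1/\<tau>) * (norm (d_theta (w n) z - A z))\<^sup>2)"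
    proof (rule Bochner_Integration.integral_mono[OF LINT_cyl(1)[OF c]])
      show "integrable ?M (\<lambda>z. (1 + \<tau>) * (norm (A z))\<^sup>2 + (1 + 1/\<tau>) * (norm (d_theta (w n) z - A z))\<^sup>2)"
        by (intro Bochner_Integration.integrable_add integrable_mult_right iA Q)
      show "(norm (d_theta (w n) z))\<^sup>2 \<le> (1 + \<tau>) * (norm (A z))\<^sup>2 + (1 + 1/\<tau>) * (norm (d_theta (w n) z - A z))\<^sup>2" for z
        using norm_add_square_le[OF \<tau>, of "A z" "d_theta (w n) z - A z"] by simp
    qed
    also have "\<dots> = (1 + \<tau>) * PA + (1 + 1/\<tau>) * (LINT z|?M. (norm (d_theta (w n) z - A z))\<^sup>2)"
      unfolding PA_def
      by (simp only: Bochner_Integration.integral_add[OF integrable_mult_right[OF iA] integrable_mult_right[OF Q]] integral_mult_right_zero)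
    also have "\<dots> \<le> (1 + \<tau>) * PA + (1 + 1/\<tau>) * I n" using \<tau> QI[of n] by (intro add_left_mono mult_left_mono) auto
    finally show ?thesis .
  qed
  \<comment> \<open>Uniform smallness of the energy over short windows: from n0 on all w_n are close
    to w_n0 in energy, and w_n0 alone has bounded slice energy M.\<close>
  have windows: "\<exists>n0 \<zeta>1. \<zeta>1 > 0 \<and> (\<forall>n\<ge>n0. \<forall>x y. 0 \<le> x \<and> x \<le> y \<and> y \<le> T \<and> y - x \<le> \<zeta>1 \<longrightarrow> integral {x..y} (slice_energy2 (w n)) \<le> e)"
    if e: "e > 0" for e :: real
  proof -
    \<comment> \<open>The difference from w_n0 has energy at most 2 (e/16 + e/16) = e/4, which is
      doubled when the energy is split, giving e/2. The other e/2 is 2M times the window length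
      e/(4M).\<close>
    have "\<forall>\<^sub>F n in sequentially. I n < e/16" using order_tendstoD(2)[OF I0, of "e/16"] e by simp
    then obtain n0 where n0: "\<And>n. n \<ge> n0 \<Longrightarrow> I n < e/16" unfolding eventually_sequentially by blast
    have "compact {0..T}" "{0..T} \<noteq> {}" using T by simp_all
    from continuous_attains_sup[OF this slice_properties(2)[OF w[of n0]]] obtain t0 where
      t0: "\<And>t. t \<in> {0..T} \<Longrightarrow> slice_energy2 (w n0) t \<le> slice_energy2 (w n0) t0" by blast
    define M where "M = \<bar>slice_energy2 (w n0) t0\<bar> + 1"
    have M: "M > 0" "\<And>t. t \<in> {0..T} \<Longrightarrow> slice_energy2 (w n0) t \<le> M" using t0 by (fastforce simp: M_def)+
    have main: "integral {x..y} (slice_energy2 (w n)) \<le> e"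
      if n: "n \<ge> n0" and xy: "0 \<le> x" "x \<le> y" "y \<le> T" "y - x \<le> e / (4 * M)" for n x y
    proof -
      define X where "X z = (norm (d_theta (w n) z - d_theta (w n0) z))\<^sup>2 + (norm (d_t (w n) z - d_t (w n0) z))\<^sup>2" for z
      define Xs where "Xs t = integral {0..2*pi} (\<lambda>\<theta>. X (\<theta>, t))" for t
      have cX: "continuous_on UNIV X" unfolding X_def[abs_def] by (intro continuous_intros W(2))
      have cXs: "continuous_on S Xs" for S unfolding Xs_def[abs_def] by (rule continuous_on_integral_slice[OF cX])
      have Xs0: "0 \<le> Xs t" for t unfolding Xs_def
        by (intro integral_nonneg integrable_continuous_interval continuous_on_slice cX) (simp add: X_def)
      have "integral {0..T} Xs = (LINT z|?M. X z)"
        unfolding LINT_cyl(2)[OF cX] integral_cyl(2)[OF cX] Xs_def[abs_def] by (rule refl)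
      also have "\<dots> \<le> (LINT z|?M. 2 * ((norm (d_theta (w n) z - A z))\<^sup>2 + (norm (d_t (w n) z - B z))\<^sup>2)
          + 2 * ((norm (d_theta (w n0) z - A z))\<^sup>2 + (norm (d_t (w n0) z - B z))\<^sup>2))"
      proof (rule Bochner_Integration.integral_mono[OF LINT_cyl(1)[OF cX]])
        show "integrable ?M (\<lambda>z. 2 * ((norm (d_theta (w n) z - A z))\<^sup>2 + (norm (d_t (w n) z - B z))\<^sup>2)
          + 2 * ((norm (d_theta (w n0) z - A z))\<^sup>2 + (norm (d_t (w n0) z - B z))\<^sup>2))"
          by (intro Bochner_Integration.integrable_add integrable_mult_right Q R)
        show "X z \<le> 2 * ((norm (d_theta (w n) z - A z))\<^sup>2 + (norm (d_t (w n) z - B z))\<^sup>2)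
          + 2 * ((norm (d_theta (w n0) z - A z))\<^sup>2 + (norm (d_t (w n0) z - B z))\<^sup>2)" for z
          using norm_add_square_le[of 1 "d_theta (w n) z - A z" "A z - d_theta (w n0) z"]
            norm_add_square_le[of 1 "d_t (w n) z - B z" "B z - d_t (w n0) z"]
          unfolding X_def by (simp add: norm_minus_commute)
      qed
      also have "\<dots> = 2 * (LINT z|?M. (norm (d_theta (w n) z - A z))\<^sup>2 + (norm (d_t (w n) z - B z))\<^sup>2)
          + 2 * (LINT z|?M. (norm (d_theta (w n0) z - A z))\<^sup>2 + (norm (d_t (w n0) z - B z))\<^sup>2)"
        by (subst Bochner_Integration.integral_add)
          (intro Bochner_Integration.integrable_add integrable_mult_right Q R, intro Bochner_Integration.integrable_add integrable_mult_right Q R,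
            simp only: integral_mult_right_zero)
      also have "\<dots> \<le> e / 4" using QRI[of n] QRI[of n0] n0[OF n] n0[OF order_refl] by linarith
      finally have XT: "integral {0..T} Xs \<le> e / 4" .
      have Sle: "slice_energy2 (w n) t \<le> 2 * slice_energy2 (w n0) t + 2 * Xs t" for t
      proof -
        let ?s = "\<lambda>n \<theta>. (norm (d_theta (w n) (\<theta>, t)))\<^sup>2 + (norm (d_t (w n) (\<theta>, t)))\<^sup>2"
        have i1: "?s n integrable_on {0..2*pi}" for n
          by (intro integrable_continuous_interval continuous_intros continuous_on_slice W(2))
        have i2: "(\<lambda>\<theta>. X (\<theta>, t)) integrable_on {0..2*pi}"
          by (intro integrable_continuous_interval continuous_on_slice cX)
        have h: "((\<lambda>\<theta>. 2 * ?s n0 \<theta> + 2 * X (\<theta>, t)) has_integral 2 * slice_energy2 (w n0) t + 2 * Xs t) {0..2*pi}"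
          unfolding slice_energy2_def Xs_def
          by (rule has_integral_add[OF has_integral_mult_right[OF integrable_integral[OF i1]] has_integral_mult_right[OF integrable_integral[OF i2]]])
        have "(?s n has_integral slice_energy2 (w n) t) {0..2*pi}"
          unfolding slice_energy2_def by (rule integrable_integral[OF i1])
        from this h show ?thesis
        proof (rule has_integral_le)
          show "?s n \<theta> \<le> 2 * ?s n0 \<theta> + 2 * X (\<theta>, t)" for \<theta>
            using norm_add_square_le[of 1 "d_theta (w n0) (\<theta>, t)" "d_theta (w n) (\<theta>, t) - d_theta (w n0) (\<theta>, t)"]
              norm_add_square_le[of 1 "d_t (w n0) (\<theta>, t)" "d_t (w n) (\<theta>, t) - d_t (w n0) (\<theta>, t)"]
            unfolding X_def by simp
        qed
      qed
      have "integral {x..y} (slice_energy2 (w n)) \<le> integral {x..y} (\<lambda>t. 2 * M + 2 * Xs t)"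
      proof (rule integral_le)
        show "slice_energy2 (w n) integrable_on {x..y}" by (intro integrable_continuous_interval slice_properties w)
        show "(\<lambda>t. 2 * M + 2 * Xs t) integrable_on {x..y}" by (intro integrable_continuous_interval continuous_intros cXs)
        show "slice_energy2 (w n) t \<le> 2 * M + 2 * Xs t" if "t \<in> {x..y}" for t
          using Sle[of t] M(2)[of t] that xy by auto
      qed
      also have "\<dots> = integral {x..y} (\<lambda>_. 2 * M) + integral {x..y} (\<lambda>t. 2 * Xs t)"
        by (intro integral_add integrable_continuous_interval continuous_intros cXs)
      also have "integral {x..y} (\<lambda>_. 2 * M) = (y - x) * (2 * M)" using xy by simp
      also have "(y - x) * (2 * M) \<le> e / (4 * M) * (2 * M)" using xy M by (intro mult_right_mono) auto
      also have "e / (4 * M) * (2 * M) = e / 2" using M by simp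
      also have "integral {x..y} (\<lambda>t. 2 * Xs t) = 2 * integral {x..y} Xs" by simp
      also have "integral {x..y} Xs \<le> integral {0..T} Xs"
        using xy Xs0 by (intro integral_subset_le integrable_continuous_interval cXs) auto
      also have "\<dots> \<le> e / 4" by (rule XT)
      finally show ?thesis by simp
    qed
    show ?thesis
      by (rule exI[of _ n0], rule exI[of _ "e / (4 * M)"]) (use e M main in auto)
  qed
  have c\<gamma>: "continuous_on {0..2*pi} (\<lambda>\<theta>. \<gamma> (cis \<theta>))"
    by (rule continuous_on_compose2[OF C1_loop_continuous(2)[OF \<gamma>]]) (auto intro!: continuous_intros)
  have J: "(LINT \<theta>|lebesgue_on {0..2*pi}. (norm (w n (\<theta>, 0) - \<gamma> (cis \<theta>)))\<^sup>2) = integral {0..2*pi} (\<lambda>\<theta>. (norm (w n (\<theta>, 0) - \<gamma> (cis \<theta>)))\<^sup>2)" for n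
  proof -
    have "continuous_on (cbox 0 (2*pi)) (\<lambda>\<theta>. (norm (w n (\<theta>, 0) - \<gamma> (cis \<theta>)))\<^sup>2)"
      unfolding cbox_interval by (intro continuous_intros c\<gamma> continuous_on_slice W(4))
    from lebesgue_integral_eq_integral[OF continuous_imp_integrable[OF this]] show ?thesis by simp
  qed
  have J0: "(\<lambda>n. integral {0..2*pi} (\<lambda>\<theta>. (norm (w n (\<theta>, 0) - \<gamma> (cis \<theta>)))\<^sup>2)) \<longlonglongrightarrow> 0" using J0' unfolding J .
  have main: "T * ((max 0 (min_length N \<gamma> / (1 + \<eta>) - \<eta>))\<^sup>2 / (2 * pi)) \<le> (1 + \<tau>) * PA"
    if \<eta>: "0 < \<eta>" "\<eta> \<le> 1" and \<tau>: "\<tau> > 0" for \<eta> \<tau>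
  proof -
    define \<kappa> where "\<kappa> = (max 0 (min_length N \<gamma> / (1 + \<eta>) - \<eta>))\<^sup>2 / (2 * pi)"
    obtain e C \<zeta>\<^sub>0 where e: "e > 0" and C: "C \<ge> 0" and \<zeta>0: "\<zeta>\<^sub>0 > 0"
      and lb: "\<forall>w T Z \<zeta>. C1_periodic w \<and> 0 < Z \<and> 0 < \<zeta> \<and> \<zeta> \<le> \<zeta>\<^sub>0 \<and> \<zeta> * real Z = T \<and>
      (\<forall>i<Z. integral {\<zeta> * real i..\<zeta> * real (Suc i)} (slice_energy2 w) \<le> e) \<and>
      integral {0..T} (slice_dist N w) \<le> e * \<zeta>\<^sup>2 \<and>
      integral {0..2*pi} (\<lambda>\<theta>. (norm (w (\<theta>, 0) - \<gamma> (cis \<theta>)))\<^sup>2) \<le> \<zeta> * e \<longrightarrow>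
      T * \<kappa> \<le> integral {0..T} (slice_energy w) + C * integral {0..T} (slice_dist N w)"
      by (rule energy_lower_bound_classical[OF \<gamma> \<eta> \<kappa>_def]) (rule that, assumption, assumption, assumption, assumption)
    from windows[OF e] obtain n0 \<zeta>1 where \<zeta>1: "\<zeta>1 > 0"
      and win: "\<And>n x y. n \<ge> n0 \<Longrightarrow> 0 \<le> x \<Longrightarrow> x \<le> y \<Longrightarrow> y \<le> T \<Longrightarrow> y - x \<le> \<zeta>1 \<Longrightarrow> integral {x..y} (slice_energy2 (w n)) \<le> e" by blast
    obtain Z' :: nat where Z': "T / min \<zeta>\<^sub>0 \<zeta>1 < real Z'" using reals_Archimedean2 by blast
    define Z where "Z = Suc Z'"
    \<comment> \<open>Equal windows filling [0, T] exactly, with enough of them to satisfy both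
      length thresholds.\<close>
    define \<zeta> where "\<zeta> = T / real Z"
    have Z: "0 < Z" "T / min \<zeta>\<^sub>0 \<zeta>1 \<le> real Z" using Z' by (simp_all add: Z_def)
    have TZ: "T \<le> real Z * min \<zeta>\<^sub>0 \<zeta>1" using Z(2) \<zeta>0 \<zeta>1 by (simp add: pos_divide_le_eq)
    have Zr: "0 < real Z" using Z(1) by simp
    have "\<zeta> \<le> min \<zeta>\<^sub>0 \<zeta>1" unfolding \<zeta>_def pos_divide_le_eq[OF Zr] by (subst mult.commute) (rule TZ)
    then have \<zeta>: "0 < \<zeta>" "\<zeta> \<le> \<zeta>\<^sub>0" "\<zeta> \<le> \<zeta>1" "\<zeta> * real Z = T" using T Z(1) by (simp_all add: \<zeta>_def)
    have "0 < e * \<zeta>\<^sup>2" "0 < \<zeta> * e" using e \<zeta> by simp_all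
    note evs = eventually_ge_at_top[of n0] order_tendstoD(2)[OF I0 this(1)] order_tendstoD(2)[OF J0 this(2)]
    have ev: "\<forall>\<^sub>F n in sequentially. T * \<kappa> \<le> (1 + \<tau>) * PA + (1 + 1/\<tau>) * I n + C * I n"
      using evs
    proof eventually_elim
      case (elim n)
      have "T * \<kappa> \<le> integral {0..T} (slice_energy (w n)) + C * integral {0..T} (slice_dist N (w n))"
      proof (rule mp[OF spec[OF spec[OF spec[OF spec[OF lb, of "w n"], of T], of Z], of \<zeta>]], intro conjI allI impI w Z(1) \<zeta>(1,2,4))
        show "integral {\<zeta> * real i..\<zeta> * real (Suc i)} (slice_energy2 (w n)) \<le> e" if "i < Z" for i
        proof (rule win[OF elim(1)])
          show "0 \<le> \<zeta> * real i" "\<zeta> * real i \<le> \<zeta> * real (Suc i)" using \<zeta> by (simp_all add: mult_left_mono)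
          show "\<zeta> * real (Suc i) \<le> T" unfolding \<zeta>(4)[symmetric] using \<zeta>(1) that by (intro mult_left_mono) auto
          show "\<zeta> * real (Suc i) - \<zeta> * real i \<le> \<zeta>1" using \<zeta>(3) by (simp add: algebra_simps)
        qed
        show "integral {0..T} (slice_dist N (w n)) \<le> e * \<zeta>\<^sup>2" using distI[of n] elim(2) by linarith
        show "integral {0..2*pi} (\<lambda>\<theta>. (norm (w n (\<theta>, 0) - \<gamma> (cis \<theta>)))\<^sup>2) \<le> \<zeta> * e" using elim(3) by simp
      qed
      moreover have "C * integral {0..T} (slice_dist N (w n)) \<le> C * I n" by (rule mult_left_mono[OF distI C])
      ultimately show ?case using EI[OF \<tau>, of n] by linarith
    qed
    have lim: "(\<lambda>n. (1 + \<tau>) * PA + (1 + 1/\<tau>) * I n + C * I n) \<longlonglongrightarrow> (1 + \<tau>) * PA + (1 + 1/\<tau>) * 0 + C * 0"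
      by (intro tendsto_intros I0)
    have "T * \<kappa> \<le> (1 + \<tau>) * PA + (1 + 1/\<tau>) * 0 + C * 0" by (rule tendsto_lowerbound[OF lim ev]) simp
    then show ?thesis unfolding \<kappa>_def by simp
  qed
  have main2: "T * ((max 0 (min_length N \<gamma> / (1 + \<eta>) - \<eta>))\<^sup>2 / (2 * pi)) \<le> PA" if \<eta>: "0 < \<eta>" "\<eta> \<le> 1" for \<eta>
  proof -
    have lim: "((\<lambda>\<tau>. (1 + \<tau>) * PA) \<longlongrightarrow> (1 + 0) * PA) (at_right 0)" by (intro tendsto_intros)
    have "\<forall>\<^sub>F \<tau> in at_right 0. T * ((max 0 (min_length N \<gamma> / (1 + \<eta>) - \<eta>))\<^sup>2 / (2 * pi)) \<le> (1 + \<tau>) * PA"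
      using eventually_at_right_less by (rule eventually_mono) (rule main[OF \<eta>])
    from tendsto_lowerbound[OF lim this] show ?thesis by simp
  qed
  have lim: "((\<lambda>\<eta>. T * ((max 0 (min_length N \<gamma> / (1 + \<eta>) - \<eta>))\<^sup>2 / (2 * pi)))
    \<longlongrightarrow> T * ((max 0 (min_length N \<gamma> / (1 + 0) - 0))\<^sup>2 / (2 * pi))) (at_right 0)"
    by (intro tendsto_intros tendsto_max) simp_all
  have "\<forall>\<^sub>F \<eta> in at_right (0::real). \<eta> \<in> {0<..<1}" by (rule eventually_at_right_real) simp
  then have "\<forall>\<^sub>F \<eta> in at_right 0. T * ((max 0 (min_length N \<gamma> / (1 + \<eta>) - \<eta>))\<^sup>2 / (2 * pi)) \<le> PA"
    by (rule eventually_mono) (rule main2, simp_all)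
  from tendsto_upperbound[OF lim this]
  have "T * ((max 0 (min_length N \<gamma>))\<^sup>2 / (2 * pi)) \<le> PA" by simp
  moreover have "0 \<le> min_length N \<gamma>" unfolding min_length_def
    by (rule cINF_greatest) (use \<gamma> C1_loop_continuous(1)[OF \<gamma>] loop_length_nonneg in auto)
  ultimately show ?thesis unfolding PA_def by (simp add: max_def)
qed

text \<open>The subtracted constant integrates over the cylinder to T \<lambda>^2 / (4 pi), which is
  half of the lower bound for the angular term; the t-derivative adds something nonnegative.\<close>

lemma d_synh_ge_0:
  assumes \<gamma>: "C1_loop N \<gamma>"
  shows "0 \<le> d_synh N \<gamma> \<beta>"
  unfolding d_synh_def
proof (rule INF_greatest, clarify)
  fix T u A B assume comp: "synh_competitor N \<gamma> \<beta> T u A B"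
  let ?M = "lebesgue_on (cyl T)"
  define k where "k = (min_length N \<gamma>)\<^sup>2 / (8 * pi\<^sup>2)"
  have T: "0 < T" and iA: "integrable ?M (\<lambda>z. (norm (A z))\<^sup>2)" and iB: "integrable ?M (\<lambda>z. (norm (B z))\<^sup>2)"
    using comp unfolding synh_competitor_def Let_def sobolev_cyl_def L2_on_def by blast+
  note ck = continuous_on_const[of "UNIV :: (real \<times> real) set" k]
  have K: "(LINT z|?M. k) = T * (2 * pi * k)"
    unfolding LINT_cyl(2)[OF ck] integral_cyl(2)[OF ck] using T by simp
  have "(LINT z|?M. ((norm (A z))\<^sup>2 + (norm (B z))\<^sup>2) / 2 - k) = (LINT z|?M. ((norm (A z))\<^sup>2 + (norm (B z))\<^sup>2) / 2) - (LINT z|?M. k)"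
    by (rule Bochner_Integration.integral_diff[OF integrable_divide_zero[OF Bochner_Integration.integrable_add[OF iA iB]] LINT_cyl(1)[OF ck]])
  also have "(LINT z|?M. ((norm (A z))\<^sup>2 + (norm (B z))\<^sup>2) / 2) = ((LINT z|?M. (norm (A z))\<^sup>2) + (LINT z|?M. (norm (B z))\<^sup>2)) / 2"
    by (simp only: integral_divide_zero Bochner_Integration.integral_add[OF iA iB])
  finally have eq: "(LINT z|?M. ((norm (A z))\<^sup>2 + (norm (B z))\<^sup>2) / 2 - k)
    = ((LINT z|?M. (norm (A z))\<^sup>2) + (LINT z|?M. (norm (B z))\<^sup>2)) / 2 - T * (2 * pi * k)" unfolding K .
  have k2: "T * (2 * pi * k) = T * ((min_length N \<gamma>)\<^sup>2 / (2*pi)) / 2"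
    by (simp add: k_def power2_eq_square)
  have TA: "T * (2 * pi * k) \<le> (LINT z|?M. (norm (A z))\<^sup>2) / 2"
    unfolding k2 by (rule divide_right_mono[OF competitor_energy[OF \<gamma> comp]]) simp
  have B0: "0 \<le> (LINT z|?M. (norm (B z))\<^sup>2)" by simp
  have "0 \<le> (a + b) / 2 - x" if "x \<le> a / 2" "0 \<le> b" for a b x :: real
  proof -
    have "a / 2 \<le> (a + b) / 2" by (rule divide_right_mono) (use that in simp_all)
    then have "x \<le> (a + b) / 2" by (rule order_trans[OF that(1)])
    then show ?thesis by simp
  qed
  from this[OF TA B0] have "0 \<le> (LINT z|?M. ((norm (A z))\<^sup>2 + (norm (B z))\<^sup>2) / 2 - k)" unfolding eq .
  then show "0 \<le> ereal (LINT z|?M. ((norm (A z))\<^sup>2 + (norm (B z))\<^sup>2) / 2 - (min_length N \<gamma>)\<^sup>2 / (8 * pi\<^sup>2))"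
    unfolding k_def by simp
qed

end

section \<open>From cosets to the matrix description of the quotient\<close>

lemma SU_quotientI:
  fixes H :: "(complex^'d^'d) set" and \<iota> :: "(complex^'d^'d) set \<Rightarrow> 'v::euclidean_space"
  assumes "subgroup H SU" and "discrete H" and "c > 0" and "isometric_embedding c H \<iota>"
  obtains F U where "SU_quotient c H (\<iota> ` (lcosets\<^bsub>SU\<^esub> H)) F U"
proof -
  interpret H: subgroup H SU by (rule assms(1))
  from assms(4)[unfolded isometric_embedding_def] obtain U F where inj: "inj_on \<iota> (lcosets\<^bsub>SU\<^esub> H)"
    and U: "open U" "carrier SU \<subseteq> U" and smooth: "smooth_on F U" and F: "\<forall>g\<in>carrier SU. F g = \<iota> (g <#\<^bsub>SU\<^esub> H)"
    and iso: "\<forall>g\<in>carrier SU. \<forall>X\<in>su. \<forall>Y\<in>su.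
           frechet_derivative F (at g) (g ** X) \<bullet> frechet_derivative F (at g) (g ** Y) = su_inner c X Y"
    by (elim exE conjE) (rule that)
  have Ck: "Ck_on 1 F U" using smooth unfolding smooth_on_def by blast
  have one: "mat 1 \<in> H" using H.one_closed by simp
  have mult: "h ** k \<in> H" if "h \<in> H" "k \<in> H" for h k using H.m_closed[OF that] by simp
  have inv: "conj_transpose h \<in> H" if "h \<in> H" for h
    using H.m_inv_closed[OF that] SU_inverse[of h] H.subset that by auto
  have coset: "g <#\<^bsub>SU\<^esub> H = {g ** h | h. h \<in> H}" for g by (auto simp: l_coset_def)
  have "SU_quotient c H (\<iota> ` (lcosets\<^bsub>SU\<^esub> H)) F U"
  proof
    show "c > 0" by (rule assms(3))
    show "H \<subseteq> carrier SU" by (rule H.subset)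
    show "h ** k \<in> H" if "h \<in> H" "k \<in> H" for h k by (rule mult[OF that])
    show "conj_transpose h \<in> H" if "h \<in> H" for h by (rule inv[OF that])
    show "mat 1 \<in> H" by (rule one)
    have "mat 1 isolated_in H" using assms(2) one by (simp add: discrete_def)
    then obtain r where "r > 0" "\<forall>y\<in>H. dist (mat 1) y < r \<longrightarrow> y = mat 1" unfolding isolated_in_dist_Ex_iff by blast
    then show "\<exists>r>0. \<forall>h\<in>H. h \<noteq> mat 1 \<longrightarrow> r \<le> norm (h - mat 1)"
      by (intro exI[of _ r]) (metis dist_commute dist_norm not_less)
    show "\<iota> ` (lcosets\<^bsub>SU\<^esub> H) = F ` carrier SU" using F by (auto simp: LCOSETS_def image_iff)
    show "F g = F g' \<longleftrightarrow> (\<exists>h\<in>H. g' = g ** h)" if g: "g \<in> carrier SU" "g' \<in> carrier SU" for g g'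
    proof -
      have "g <#\<^bsub>SU\<^esub> H \<in> lcosets\<^bsub>SU\<^esub> H" "g' <#\<^bsub>SU\<^esub> H \<in> lcosets\<^bsub>SU\<^esub> H" using g by (auto simp: LCOSETS_def)
      \<comment> \<open>Injectivity of \<iota> on cosets turns equal values of \<open>F\<close> into
        equal cosets.\<close>
      then have "F g = F g' \<longleftrightarrow> g <#\<^bsub>SU\<^esub> H = g' <#\<^bsub>SU\<^esub> H" using F g inj_on_eq_iff[OF inj] by simp
      also have "\<dots> \<longleftrightarrow> (\<exists>h\<in>H. g' = g ** h)"
      proof
        assume eq: "g <#\<^bsub>SU\<^esub> H = g' <#\<^bsub>SU\<^esub> H"
        have "g' ** mat 1 \<in> g' <#\<^bsub>SU\<^esub> H" unfolding coset using one by blast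
        then have "g' \<in> g <#\<^bsub>SU\<^esub> H" unfolding eq by simp
        then show "\<exists>h\<in>H. g' = g ** h" unfolding coset by blast
      next
        assume "\<exists>h\<in>H. g' = g ** h"
        then obtain h where h: "h \<in> H" "g' = g ** h" by blast
        have uh: "unitary h" using h(1) H.subset by (auto simp: carrier_SU)
        show "g <#\<^bsub>SU\<^esub> H = g' <#\<^bsub>SU\<^esub> H"
        proof (rule subset_antisym; rule subsetI)
          fix x assume "x \<in> g <#\<^bsub>SU\<^esub> H"
          then obtain k where k: "k \<in> H" "x = g ** k" unfolding coset by blast
          have "x = g' ** (conj_transpose h ** k)" unfolding k(2) h(2)
            by (metis matrix_mul_assoc unitary_cancel(2)[OF uh])
          then show "x \<in> g' <#\<^bsub>SU\<^esub> H" unfolding coset using mult[OF inv[OF h(1)] k(1)] by blast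
        next
          fix x assume "x \<in> g' <#\<^bsub>SU\<^esub> H"
          then obtain k where k: "k \<in> H" "x = g' ** k" unfolding coset by blast
          have "x = g ** (h ** k)" unfolding k(2) h(2) by (simp only: matrix_mul_assoc)
          then show "x \<in> g <#\<^bsub>SU\<^esub> H" unfolding coset using mult[OF h(1) k(1)] by blast
        qed
      qed
      finally show ?thesis .
    qed
    show "open U" "carrier SU \<subseteq> U" by (rule U)+
    show "F differentiable_on U" "continuous_on U (\<lambda>x. frechet_derivative F (at x) v)" for v
      using Ck by (simp_all del: split_paired_All)
    show "frechet_derivative F (at g) (g ** X) \<bullet> frechet_derivative F (at g) (g ** Y) = c * (X \<bullet> Y)"
      if "g \<in> carrier SU" "X \<in> su" "Y \<in> su" for g X Y
      using iso that by (simp add: su_inner_eq)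
  qed
  then show ?thesis by (rule that)
qed

theorem corollary9p6:
  fixes H :: "(complex^'d^'d) set"
    and c :: real
    and \<iota> :: "(complex^'d^'d) set \<Rightarrow> 'v::euclidean_space"
    and N :: "'v set"
    and \<gamma>\<^sub>0 \<gamma>\<^sub>1 :: "complex \<Rightarrow> 'v"
  assumes "CARD('d) \<ge> 2"
    and "subgroup H SU" and "discrete H"
    and "c > 0" and "isometric_embedding c H \<iota>"
    and "N = \<iota> ` (lcosets\<^bsub>SU\<^esub> H)"
    and "minimising_geodesic N \<gamma>\<^sub>0" and "minimising_geodesic N \<gamma>\<^sub>1"
    and "homotopic_maps N \<gamma>\<^sub>0 \<gamma>\<^sub>1"
  shows "synharmonic N \<gamma>\<^sub>0 \<gamma>\<^sub>1"
proof -
  obtain F U where "SU_quotient c H N F U"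
    using SU_quotientI[OF assms(2-5)] unfolding assms(6) by blast
  then interpret SU_quotient c H N F U .
  have "C1_loop N \<gamma>\<^sub>0" using assms(7) by (simp add: minimising_geodesic_def closed_geodesic_def)
  then show ?thesis
    unfolding synharmonic_def using d_synh_le_0[OF assms(7-9)] d_synh_ge_0 by (intro antisym)
qed

end
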